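(* Let $n\in\mathbb N$. There exist indecomposable $F\mathfrak S_n$-modules $Y(\lambda|p\mu)$, one for each pair of partitions $(\lambda,\mu)$ with $|\lambda|+p|\mu|=n$, with the following properties: (i) for every $(\alpha|\beta)\in\mathscr P^2(n)$, the module $M(\alpha|\beta)$ is isomorphic to a direct sum of modules $Y(\lambda|p\mu)$ with $(\lambda|p\mu)\trianglerighteq(\alpha|\beta)$; (ii) $[M(\lambda|p\mu):Y(\lambda|p\mu)]=1$; (iii) if $\lambda=\sum_{i=0}^r p^i\lambda(i)$ and $\mu=\sum_{i=0}^{r-1}p^i\mu(i)$ are the $p$-adic expansions, then $Y(\lambda|p\mu)$ has as a vertex a Sylow $p$-subgroup of the Young subgroup $\mathfrak S_\rho$, where $\rho$ is the partition of $n$ having exactly $|\lambda(i)|+|\mu(i-1)|$ parts equal to $p^i$ for each $i\in\{0,\dots,r\}$ (with $\mu(-1)=\varnothing$).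
   Context: $F$ is a field of odd prime characteristic $p$; $\mathfrak S_n$ is the symmetric group on $\{1,\dots,n\}$. A composition of $n$ is a finite sequence $\alpha=(\alpha_1,\dots,\alpha_r)$ of non-negative integers with $\alpha_r\ne0$ and $\sum_i\alpha_i=n$ ($\varnothing$ is the unique composition of $0$); a partition is a non-increasing composition; by convention $\alpha_i=0$ for $i>r$. For a partition $\mu$, $p\mu=(p\mu_1,p\mu_2,\dots)$. $\mathscr P^2(n)$ is the set of pairs $(\alpha|\beta)$ of partitions with $|\alpha|+|\beta|=n$. The Young subgroup of a composition $\alpha$ is $\mathfrak S_\alpha=\mathfrak S_{\alpha_1}\times\cdots\times\mathfrak S_{\alpha_r}$, the $i$-th factor acting on $\{\alpha_1+\dots+\alpha_{i-1}+1,\dots,\alpha_1+\dots+\alpha_i\}$. For $(\alpha|\beta)$ a pair of compositions with $|\alpha|+|\beta|=n$, the signed Young permutation module is $M(\alpha|\beta)=\mathrm{Ind}_{\mathfrak S_\alpha\times\mathfrak S_\beta}^{\mathfrak S_n}(F\boxtimes\mathrm{sgn})$, where $\mathfrak S_\alpha$ permutes $\{1,\dots,|\alpha|\}$ and acts trivially, and $\mathfrak S_\beta$ permutes $\{|\alpha|+1,\dots,n\}$ (as a Young subgroup of that set) and acts by the sign character. For an indecomposable module $N$, $[M:N]$ denotes the number of summands isomorphic to $N$ in a Krull–Schmidt decomposition of $M$. Dominance order on $\mathscr P^2(n)$: $(\lambda|\nu)\trianglerighteq(\alpha|\beta)$ iff for all $k\ge1$, $\sum_{i=1}^k\lambda_i\ge\sum_{i=1}^k\alpha_i$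 and $|\lambda|+\sum_{i=1}^k\nu_i\ge|\alpha|+\sum_{i=1}^k\beta_i$. A partition is $p$-restricted if $\lambda_i-\lambda_{i+1}<p$ for all $i$; every partition $\lambda$ has a unique $p$-adic expansion $\lambda=\sum_{i\ge0}p^i\lambda(i)$ (componentwise sum) with each $\lambda(i)$ a $p$-restricted partition. *)

theory Defs
  imports "Jordan_Normal_Form.Matrix" "HOL-Combinatorics.Permutations"
begin

definition is_composition :: "nat list \<Rightarrow> bool" where
  "is_composition a \<longleftrightarrow> a = [] \<or> last a \<noteq> 0"

definition is_partition :: "nat list \<Rightarrow> bool" where
  "is_partition a \<longleftrightarrow> is_composition a \<and> sorted_wrt (\<lambda>x y. y \<le> x) a"

definition entry :: "nat list \<Rightarrow> nat \<Rightarrow> nat" where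
  "entry a i = (if 1 \<le> i \<and> i \<le> length a then a ! (i - 1) else 0)"

definition p_restricted :: "nat \<Rightarrow> nat list \<Rightarrow> bool" where
  "p_restricted p a \<longleftrightarrow> is_partition a \<and> (\<forall>i\<ge>1. entry a i - entry a (i + 1) < p)"

definition scale :: "nat \<Rightarrow> nat list \<Rightarrow> nat list" where
  "scale p a = map (\<lambda>x. p * x) a"

definition dominates :: "nat list \<times> nat list \<Rightarrow> nat list \<times> nat list \<Rightarrow> bool" where
  "dominates L A \<longleftrightarrow> (\<forall>k\<ge>1.
      (\<Sum>i=1..k. entry (fst L) i) \<ge> (\<Sum>i=1..k. entry (fst A) i) \<and>
      sum_list (fst L) + (\<Sum>i=1..k. entry (snd L) i) \<ge> sum_list (fst A) + (\<Sum>i=1..k. entry (snd A) i))"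

definition padic_exp :: "nat \<Rightarrow> nat list \<Rightarrow> nat \<Rightarrow> (nat \<Rightarrow> nat list) \<Rightarrow> bool" where
  "padic_exp p lam r l \<longleftrightarrow> (\<forall>i<r. p_restricted p (l i)) \<and>
     (\<forall>j. entry lam j = (\<Sum>i<r. p ^ i * entry (l i) j))"

definition Sym :: "nat \<Rightarrow> (nat \<Rightarrow> nat) set" where
  "Sym n = {\<sigma>. \<sigma> permutes {1..n}}"

definition young :: "nat list \<Rightarrow> (nat \<Rightarrow> nat) set" where
  "young a = {\<sigma>. \<sigma> permutes {1..sum_list a} \<and>
     (\<forall>k<length a. \<forall>x. sum_list (take k a) < x \<and> x \<le> sum_list (take (Suc k) a) \<longrightarrow>
         sum_list (take k a) < \<sigma> x \<and> \<sigma> x \<le> sum_list (take (Suc k) a))}"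

definition perm_subgroup :: "(nat \<Rightarrow> nat) set \<Rightarrow> (nat \<Rightarrow> nat) set \<Rightarrow> bool" where
  "perm_subgroup H G \<longleftrightarrow> H \<subseteq> G \<and> id \<in> H \<and> (\<forall>a\<in>H. \<forall>b\<in>H. a \<circ> b \<in> H) \<and> (\<forall>a\<in>H. inv_into UNIV a \<in> H)"

definition sylow :: "nat \<Rightarrow> (nat \<Rightarrow> nat) set \<Rightarrow> (nat \<Rightarrow> nat) set \<Rightarrow> bool" where
  "sylow p P H \<longleftrightarrow> perm_subgroup P H \<and> (\<exists>k. card P = p ^ k) \<and> \<not> p dvd (card H div card P)"

section \<open>Matrix representations (= finite-dimensional modules over the group algebra)\<close>

text \<open>A module: its dimension d and the action g \<mapsto> d x d matrix (left action, product g \<circ> h).\<close>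
type_synonym 'a rep = "nat \<times> ((nat \<Rightarrow> nat) \<Rightarrow> 'a mat)"

definition is_rep :: "(nat \<Rightarrow> nat) set \<Rightarrow> 'a::field rep \<Rightarrow> bool" where
  "is_rep G M \<longleftrightarrow> (\<forall>g\<in>G. snd M g \<in> carrier_mat (fst M) (fst M)) \<and>
     (\<forall>g\<in>G. \<forall>h\<in>G. snd M (g \<circ> h) = snd M g * snd M h) \<and> snd M id = 1\<^sub>m (fst M)"

definition rep_iso :: "(nat \<Rightarrow> nat) set \<Rightarrow> 'a::field rep \<Rightarrow> 'a rep \<Rightarrow> bool" where
  "rep_iso G M N \<longleftrightarrow> fst M = fst N \<and> (\<exists>P \<in> carrier_mat (fst M) (fst M). invertible_mat P \<and>
     (\<forall>g\<in>G. P * snd M g = snd N g * P))"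

definition dsum :: "'a::field rep \<Rightarrow> 'a rep \<Rightarrow> 'a rep" where
  "dsum M N = (fst M + fst N, \<lambda>g. four_block_mat (snd M g) (0\<^sub>m (fst M) (fst N))
                                     (0\<^sub>m (fst N) (fst M)) (snd N g))"

definition zero_rep :: "'a::field rep" where
  "zero_rep = (0, \<lambda>g. 1\<^sub>m 0)"

definition dsum_list :: "'a::field rep list \<Rightarrow> 'a rep" where
  "dsum_list Ns = foldr dsum Ns zero_rep"

definition indecomposable :: "(nat \<Rightarrow> nat) set \<Rightarrow> 'a::field rep \<Rightarrow> bool" where
  "indecomposable G M \<longleftrightarrow> is_rep G M \<and> fst M > 0 \<and>
     \<not> (\<exists>A B. is_rep G A \<and> is_rep G B \<and> fst A > 0 \<and> fst B > 0 \<and> rep_iso G M (dsum A B))"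

text \<open>[M:N]: number of summands isomorphic to N in a Krull-Schmidt decomposition of M
  (well defined by the Krull-Schmidt theorem).\<close>
definition mult :: "(nat \<Rightarrow> nat) set \<Rightarrow> 'a::field rep \<Rightarrow> 'a rep \<Rightarrow> nat" where
  "mult G M N = (SOME k. \<exists>Ns. (\<forall>X\<in>set Ns. indecomposable G X) \<and> rep_iso G M (dsum_list Ns) \<and>
       k = length (filter (\<lambda>X. rep_iso G X N) Ns))"

text \<open>Induced module via a left transversal t_1..t_m of H in G:
  block (i,j) of Ind(g) is rho(t_i^-1 g t_j) if this lies in H, and 0 otherwise.\<close>
definition left_transversal :: "(nat \<Rightarrow> nat) set \<Rightarrow> (nat \<Rightarrow> nat) set \<Rightarrow> (nat \<Rightarrow> nat) list \<Rightarrow> bool" where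
  "left_transversal G H ts \<longleftrightarrow> set ts \<subseteq> G \<and>
     (\<forall>g\<in>G. \<exists>!i. i < length ts \<and> inv_into UNIV (ts ! i) \<circ> g \<in> H)"

definition Ind :: "(nat \<Rightarrow> nat) set \<Rightarrow> (nat \<Rightarrow> nat) set \<Rightarrow> 'a::field rep \<Rightarrow> 'a rep" where
  "Ind G H M = (let ts = (SOME ts. left_transversal G H ts); d = fst M; m = length ts in
     (m * d, \<lambda>g. mat (m * d) (m * d) (\<lambda>(a, b).
        let x = inv_into UNIV (ts ! (a div d)) \<circ> g \<circ> ts ! (b div d) in
        if x \<in> H then snd M x $$ (a mod d, b mod d) else 0)))"

definition summand :: "(nat \<Rightarrow> nat) set \<Rightarrow> 'a::field rep \<Rightarrow> 'a rep \<Rightarrow> bool" where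
  "summand G M N \<longleftrightarrow> (\<exists>C. is_rep G C \<and> rep_iso G N (dsum M C))"

text \<open>M is relatively Q-projective: M is a summand of Ind_Q^G Res_Q M.\<close>
definition rel_proj :: "(nat \<Rightarrow> nat) set \<Rightarrow> (nat \<Rightarrow> nat) set \<Rightarrow> 'a::field rep \<Rightarrow> bool" where
  "rel_proj G Q M \<longleftrightarrow> summand G M (Ind G Q M)"

definition vertex :: "(nat \<Rightarrow> nat) set \<Rightarrow> 'a::field rep \<Rightarrow> (nat \<Rightarrow> nat) set \<Rightarrow> bool" where
  "vertex G M Q \<longleftrightarrow> perm_subgroup Q G \<and> rel_proj G Q M \<and>
     (\<forall>R. perm_subgroup R Q \<and> R \<subset> Q \<longrightarrow> \<not> rel_proj G R M)"

text \<open>Signed Young permutation module M(alpha|beta) = Ind from S_alpha x S_beta of F boxtimes sgn.\<close>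
definition signed_perm_module :: "nat \<Rightarrow> nat list \<Rightarrow> nat list \<Rightarrow> 'a::field rep" where
  "signed_perm_module n \<alpha> \<beta> = Ind (Sym n) (young (\<alpha> @ \<beta>))
     (1, \<lambda>\<sigma>. mat 1 1 (\<lambda>_. of_int (sign (\<lambda>x. if sum_list \<alpha> < x then \<sigma> x else x))))"

end

theory Submission
  imports Defs "HOL-Algebra.Sylow" "Jordan_Normal_Form.Determinant"
begin

text \<open>
  \<open>M(\<alpha>|\<beta>)\<close> is realised as a monomial module on words in even and odd letters of prescribed
  content, so that homomorphisms are kernels \<open>K U T\<close> that are equivariant up to sign. Taking the
  pointwise minimum of two words shows that every endomorphism is a scalar plus a sum \<open>J\<close> of maps
  factoring through modules of larger content; if some \<open>\<beta>\<^sub>j\<close> is prime to \<open>p\<close>, the identity itself lies in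
  \<open>J\<close>. Hence everything reduces to the pairs \<open>(\<lambda>|p\<mu>)\<close>, for which a character \<open>\<phi>\<close> of the endomorphism
  ring killing \<open>J\<close> is needed: \<open>Y(\<lambda>|p\<mu>)\<close> is then the unique summand on which \<open>\<phi>\<close> does not vanish.

  To construct \<open>\<phi>\<close>, let a \<open>p\<close>-group \<open>Q\<close> have blocks of \<open>p\<close>-power size as orbits, one block for each box of
  the Young diagrams of \<open>\<lambda>(i)\<close> and \<open>\<mu>(i-1)\<close>. Modulo \<open>p\<close> only the words fixed by \<open>Q\<close> contribute to a
  product of kernels (a Brauer quotient), and there an antisymmetriser over the columns is a common
  eigenvector of all endomorphisms; \<open>\<phi>\<close> is its eigenvalue. Traces from proper subgroups of \<open>Q\<close> have
  \<open>\<phi> = 0\<close>, so a vertex is not smaller than \<open>Q\<close>; if the \<open>\<lambda>(i)\<close> and \<open>\<mu>(i)\<close> are \<open>p\<close>-restricted, \<open>\<phi>\<close> is non-zero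
  on an endomorphism factoring through the module induced from \<open>S\<^sub>\<rho>\<close>, so \<open>Y(\<lambda>|p\<mu>)\<close> is projective relative
  to a Sylow \<open>p\<close>-subgroup of it.
\<close>

text \<open>Partial sums of a content over all letters, the even ones first, form one chain that
  encodes the dominance order on pairs; making letters smaller moves up. Hence the passage to larger
  contents terminates and yields (i). All that a quotient by \<open>J\<close> would give is drawn
  from \<open>\<phi>\<close>: 1 is not in \<open>J\<close>, and one summand is singled out. Signs
  shape the construction. Exchanging two blocks with equal letters in one column must cost -1: for
  even letters a sign on blocks provides it, for odd letters the module itself, as blocks have odd
  size. Odd blocks have at least \<open>p\<close> points, and a kernel cannot change the parity of
  the letter on a block with more than one point, so odd columns stay odd. The endomorphism on which
  \<open>\<phi>\<close> is non-zero pairs the filling with the one in which each column is reversed,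
  as one pairs polytabloids. Without reversal the value would be the order of a row stabiliser,
  which \<open>p\<close> may divide; with reversal it is, up to sign, a product of factorials of
  differences of consecutive parts of the \<open>\<lambda>(i)\<close> and \<open>\<mu>(i)\<close>,
  and these differences are below \<open>p\<close>.\<close>

abbreviation pinv :: "('x \<Rightarrow> 'x) \<Rightarrow> 'x \<Rightarrow> 'x" where "pinv \<equiv> inv_into UNIV"
abbreviation swp :: "'x \<Rightarrow> 'x \<Rightarrow> 'x \<Rightarrow> 'x" where "swp \<equiv> Transposition.transpose"

section \<open>Matrix representations, idempotents and direct sums\<close>

text \<open>The side conditions are equations between dimensions instead of
  \<open>carrier_mat\<close> premises with free sizes, so that the simplifier can discharge them and
  long products are reassociated by rewriting.\<close>

lemma mult_assoc_dim:
  fixes A B C :: "'a::field mat"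
  assumes "dim_col A = dim_row B" "dim_col B = dim_row C"
  shows "A * B * C = A * (B * C)"
  using assms by (intro assoc_mult_mat[of _ "dim_row A" "dim_col A" _ "dim_col B" _ "dim_col C"]) auto

lemma mult_add_dim:
  fixes A B C :: "'a::field mat"
  assumes "dim_col A = dim_row B" "dim_row B = dim_row C" "dim_col B = dim_col C"
  shows "A * (B + C) = A * B + A * C"
  using assms by (intro mult_add_distrib_mat[of _ "dim_row A" "dim_col A" _ "dim_col B"]) auto

lemma add_mult_dim:
  fixes A B C :: "'a::field mat"
  assumes "dim_col A = dim_row C" "dim_row A = dim_row B" "dim_col A = dim_col B"
  shows "(A + B) * C = A * C + B * C"
  using assms by (intro add_mult_distrib_mat[of _ "dim_row A" "dim_col A" _ _ "dim_col C"]) auto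

lemma mult_minus_dim:
  fixes A B C :: "'a::field mat"
  assumes "dim_col A = dim_row B" "dim_row B = dim_row C" "dim_col B = dim_col C"
  shows "A * (B - C) = A * B - A * C"
  using assms by (intro mult_minus_distrib_mat[of _ "dim_row A" "dim_col A" _ "dim_col B"]) auto

lemma minus_mult_dim:
  fixes A B C :: "'a::field mat"
  assumes "dim_col A = dim_row C" "dim_row A = dim_row B" "dim_col A = dim_col B"
  shows "(A - B) * C = A * C - B * C"
  using assms by (intro minus_mult_distrib_mat[of _ "dim_row A" "dim_col A" _ _ "dim_col C"]) auto

lemma smult_mult_dim:
  fixes A B :: "'a::field mat"
  assumes "dim_col A = dim_row B"
  shows "(k \<cdot>\<^sub>m A) * B = k \<cdot>\<^sub>m (A * B)" "A * (k \<cdot>\<^sub>m B) = k \<cdot>\<^sub>m (A * B)"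
proof -
  show "(k \<cdot>\<^sub>m A) * B = k \<cdot>\<^sub>m (A * B)"
    by (rule mult_smult_assoc_mat[of A "dim_row A" "dim_col A" B "dim_col B"]) (use assms in auto)
  show "A * (k \<cdot>\<^sub>m B) = k \<cdot>\<^sub>m (A * B)"
    by (rule mult_smult_distrib[of A "dim_row A" "dim_col A" B "dim_col B"]) (use assms in auto)
qed

lemma one_mult_dim:
  fixes A :: "'a::field mat"
  shows "n = dim_row A \<Longrightarrow> 1\<^sub>m n * A = A" "n = dim_col A \<Longrightarrow> A * 1\<^sub>m n = A"
  by (auto intro: left_mult_one_mat right_mult_one_mat)

lemma zero_mult_dim:
  fixes A :: "'a::field mat"
  shows "k = dim_row A \<Longrightarrow> 0\<^sub>m n k * A = 0\<^sub>m n (dim_col A)" "k = dim_col A \<Longrightarrow> A * 0\<^sub>m k n = 0\<^sub>m (dim_row A) n"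
  by (auto intro: left_mult_zero_mat right_mult_zero_mat)

lemma add_zero_dim:
  fixes A :: "'a::field mat"
  shows "n = dim_row A \<Longrightarrow> k = dim_col A \<Longrightarrow> 0\<^sub>m n k + A = A" "n = dim_row A \<Longrightarrow> k = dim_col A \<Longrightarrow> A + 0\<^sub>m n k = A"
  by auto

lemmas dim_algebra = mult_assoc_dim mult_add_dim add_mult_dim mult_minus_dim minus_mult_dim smult_mult_dim
  one_mult_dim zero_mult_dim add_zero_dim

text \<open>If \<open>d < k\<close>, zero padding turns \<open>P\<close> and \<open>I\<close> into
  square matrices with product 1, although the last column of the first one is zero; its determinant
  would have to be both zero and invertible.\<close>

lemma section_dim_le:
  fixes P I :: "'a::field mat"
  assumes P: "P \<in> carrier_mat k d" and I: "I \<in> carrier_mat d k" and PI: "P * I = 1\<^sub>m k"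
  shows "k \<le> d"
proof (rule ccontr)
  assume "\<not> k \<le> d" then have dk: "d < k" by simp
  define A where "A = mat k k (\<lambda>(a,b). if b < d then P $$ (a,b) else 0)"
  define B where "B = mat k k (\<lambda>(a,b). if a < d then I $$ (a,b) else 0)"
  have A: "A \<in> carrier_mat k k" and B: "B \<in> carrier_mat k k" by (auto simp: A_def B_def)
  have "A * B = P * I"
  proof (rule eq_matI)
    fix i j assume "i < dim_row (P * I)" "j < dim_col (P * I)"
    then have ij: "i < k" "j < k" using P I by auto
    have "(A * B) $$ (i,j) = (\<Sum>l<k. A $$ (i,l) * B $$ (l,j))"
      using ij A B by (simp add: scalar_prod_def lessThan_atLeast0)
    also have "\<dots> = (\<Sum>l<d. P $$ (i,l) * I $$ (l,j))"
      using dk ij by (intro sum.mono_neutral_cong_right) (auto simp: A_def B_def)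
    also have "\<dots> = (P * I) $$ (i,j)"
      using ij P I by (simp add: scalar_prod_def lessThan_atLeast0)
    finally show "(A * B) $$ (i,j) = (P * I) $$ (i,j)" .
  qed (use A B P I in auto)
  then have "det A * det B = 1" using det_mult[OF A B] PI by simp
  then have "det A \<noteq> 0" by auto
  moreover have "A *\<^sub>v unit_vec k (k-1) = 0\<^sub>v k"
    using dk by (intro eq_vecI) (auto simp: A_def scalar_prod_def intro!: sum.neutral)
  moreover have "unit_vec k (k-1) \<noteq> (0\<^sub>v k :: 'a vec)" 
    using dk by (simp add: unit_vec_nonzero)
  ultimately show False using det_0_iff_vec_prod_zero_field[OF A] by (metis unit_vec_carrier)
qed

text \<open>No basis of the image is chosen. Among all identity matrices that factor through
  \<open>e\<close>, a largest one is taken; if the remaining idempotent \<open>f\<close> were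
  nonzero, one column and one row of \<open>f\<close> would enlarge the factorisation by
  one.\<close>

lemma idempotent_matrix_splits:
  fixes e :: "'a::field mat"
  assumes e: "e \<in> carrier_mat d d" and ee: "e * e = e"
  obtains k I P where "I \<in> carrier_mat d k" "P \<in> carrier_mat k d" "P * I = 1\<^sub>m k" "I * P = e"
proof -
  define S where "S k \<longleftrightarrow> (\<exists>I P. I \<in> carrier_mat d k \<and> P \<in> carrier_mat k d \<and> P * I = 1\<^sub>m k \<and> e * I = I \<and> P * e = P)" for k
  have "S 0" unfolding S_def
    by (rule exI[of _ "0\<^sub>m d 0"], rule exI[of _ "0\<^sub>m 0 d"]) (use e in auto)
  have bd: "S k \<Longrightarrow> k \<le> d" for k unfolding S_def using section_dim_le by blast
  define k where "k = (GREATEST k. S k)"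
  have Sk: "S k" unfolding k_def by (rule GreatestI_nat[of S 0 d]) (use \<open>S 0\<close> bd in auto)
  have nS: "\<not> S (Suc k)"
  proof
    assume "S (Suc k)"
    then have "Suc k \<le> (GREATEST k. S k)" by (rule Greatest_le_nat[where b=d]) (use bd in auto)
    then show False by (simp add: k_def)
  qed
  from Sk obtain I P where I: "I \<in> carrier_mat d k" and P: "P \<in> carrier_mat k d" and PI: "P * I = 1\<^sub>m k"
    and eI: "e * I = I" and Pe: "P * e = P" unfolding S_def by blast
  define f where "f = e - I * P"
  have dims[simp]: "dim_row e = d" "dim_col e = d" "dim_row I = d" "dim_col I = k" "dim_row P = k" "dim_col P = d"
    "dim_row f = d" "dim_col f = d" using e I P by (auto simp: f_def)
  have ePI: "e * (I * P) = I * P" by (metis eI mult_assoc_dim dims)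
  have IPe: "I * P * e = I * P" by (simp add: dim_algebra Pe)
  have IPIP: "I * P * (I * P) = I * P"
    by (simp add: dim_algebra) (metis PI mult_assoc_dim dims one_mult_dim(1))
  have ef: "e * f = f" by (simp add: f_def dim_algebra ee ePI)
  have fe: "f * e = f" by (simp add: f_def minus_mult_dim ee IPe)
  have fI: "f * I = 0\<^sub>m d k" by (simp add: f_def minus_mult_dim eI) (simp add: mult_assoc_dim PI one_mult_dim minus_r_inv_mat[OF I])
  have Pf: "P * f = 0\<^sub>m k d" by (simp add: f_def mult_minus_dim Pe mult_assoc_dim[symmetric] PI one_mult_dim minus_r_inv_mat[OF P])
  have ff: "f * f = f"
  proof -
    have "f * f = f * e - f * I * P" by (subst (2) f_def) (simp add: mult_minus_dim mult_assoc_dim)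
    also have "\<dots> = f" unfolding fe fI by (rule eq_matI) (auto simp: scalar_prod_def)
    finally show ?thesis .
  qed
  have "f = 0\<^sub>m d d"
  proof (rule ccontr)
    assume "f \<noteq> 0\<^sub>m d d"
    then obtain i j where ij: "i < d" "j < d" "f $$ (i,j) \<noteq> 0"
      by (metis dims(7,8) eq_matI index_zero_mat)
    \<comment> \<open>The new row is divided by the pivot \<open>f $$ (i,j)\<close>, because row
      \<open>i\<close> times column \<open>j\<close> of \<open>f\<close> is the entry of
      \<open>f * f = f\<close> at that place.\<close>
    define I' where "I' = mat d (Suc k) (\<lambda>(a,b). if b < k then I $$ (a,b) else f $$ (a,j))"
    define P' where "P' = mat (Suc k) d (\<lambda>(a,b). if a < k then P $$ (a,b) else f $$ (i,b) / f $$ (i,j))"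
    have car: "I' \<in> carrier_mat d (Suc k)" "P' \<in> carrier_mat (Suc k) d" by (auto simp: I'_def P'_def)
    have ent: "(\<Sum>l<d. A $$ (a,l) * B $$ (l,b)) = (A * B) $$ (a,b)" 
      if "a < dim_row A" "b < dim_col B" "dim_row B = d" "dim_col A = d" for A B :: "'a mat" and a b
      using that by (simp add: scalar_prod_def lessThan_atLeast0)
    have 1: "P' * I' = 1\<^sub>m (Suc k)"
    proof (rule eq_matI)
      fix a b assume "a < dim_row (1\<^sub>m (Suc k))" "b < dim_col (1\<^sub>m (Suc k))"
      then have ab: "a < Suc k" "b < Suc k" by auto
      have "(P' * I') $$ (a,b) = (\<Sum>l<d. P' $$ (a,l) * I' $$ (l,b))"
        using ab car by (simp add: scalar_prod_def lessThan_atLeast0)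
      also have "\<dots> = (if a < k then if b < k then (P*I) $$ (a,b) else (P * f) $$ (a,j)
             else if b < k then (f * I) $$ (i,b) / f $$ (i,j) else (f * f) $$ (i,j) / f $$ (i,j))"
        using ab ij by (auto simp: I'_def P'_def sum_divide_distrib ent[symmetric] simp del: index_mult_mat)
      also have "\<dots> = 1\<^sub>m (Suc k) $$ (a,b)" unfolding PI Pf fI ff using ab ij by auto
      finally show "(P' * I') $$ (a,b) = 1\<^sub>m (Suc k) $$ (a,b)" .
    qed (use car in auto)
    have 2: "e * I' = I'"
    proof (rule eq_matI)
      fix a b assume "a < dim_row I'" "b < dim_col I'"
      then have ab: "a < d" "b < Suc k" using car by auto
      have "(e * I') $$ (a,b) = (\<Sum>l<d. e $$ (a,l) * I' $$ (l,b))"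
        using ab car by (simp add: scalar_prod_def lessThan_atLeast0)
      also have "\<dots> = (if b < k then (e*I) $$ (a,b) else (e * f) $$ (a,j))"
        using ab ij by (auto simp: I'_def ent[symmetric] simp del: index_mult_mat)
      finally show "(e * I') $$ (a,b) = I' $$ (a,b)" unfolding eI ef using ab by (simp add: I'_def)
    qed (use car in auto)
    have 3: "P' * e = P'"
    proof (rule eq_matI)
      fix a b assume "a < dim_row P'" "b < dim_col P'"
      then have ab: "a < Suc k" "b < d" using car by auto
      have "(P' * e) $$ (a,b) = (\<Sum>l<d. P' $$ (a,l) * e $$ (l,b))"
        using ab car by (simp add: scalar_prod_def lessThan_atLeast0)
      also have "\<dots> = (if a < k then (P*e) $$ (a,b) else (f * e) $$ (i,b) / f $$ (i,j))"
        using ab ij by (auto simp: P'_def sum_divide_distrib ent[symmetric] simp del: index_mult_mat)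
      finally show "(P' * e) $$ (a,b) = P' $$ (a,b)" unfolding Pe fe using ab by (simp add: P'_def)
    qed (use car in auto)
    from 1 2 3 car have "S (Suc k)" unfolding S_def by blast
    with nS show False by simp
  qed
  then have "I * P = e"
  proof -
    have "I * P = e - f" unfolding f_def by (rule eq_matI) auto
    then show ?thesis using \<open>f = 0\<^sub>m d d\<close> by (auto intro!: eq_matI)
  qed
  then show ?thesis using that I P PI by blast
qed


section \<open>Homomorphisms, isomorphisms and biproducts of representations\<close>

definition rep_hom :: "(nat \<Rightarrow> nat) set \<Rightarrow> 'a::field rep \<Rightarrow> 'a rep \<Rightarrow> 'a mat set" where
  "rep_hom G M N = {A. dim_row A = fst N \<and> dim_col A = fst M \<and> (\<forall>g\<in>G. A * snd M g = snd N g * A)}"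

lemma rep_homD:
  assumes "A \<in> rep_hom G M N"
  shows "dim_row A = fst N" "dim_col A = fst M" "g \<in> G \<Longrightarrow> A * snd M g = snd N g * A"
  using assms by (auto simp: rep_hom_def)

lemma is_repD:
  assumes "is_rep G M"
  shows "g \<in> G \<Longrightarrow> dim_row (snd M g) = fst M" "g \<in> G \<Longrightarrow> dim_col (snd M g) = fst M"
    "g \<in> G \<Longrightarrow> h \<in> G \<Longrightarrow> snd M (g \<circ> h) = snd M g * snd M h" "snd M id = 1\<^sub>m (fst M)"
  using assms by (auto simp: is_rep_def)

lemma rep_hom_mult:
  assumes "is_rep G M" "is_rep G N" "is_rep G K" and A: "A \<in> rep_hom G M N" and B: "B \<in> rep_hom G N K"
  shows "B * A \<in> rep_hom G M K"
proof -
  note d = rep_homD(1,2)[OF A] rep_homD(1,2)[OF B] is_repD(1,2)[OF assms(1)] is_repD(1,2)[OF assms(2)] is_repD(1,2)[OF assms(3)]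
  have "B * A * snd M g = snd K g * (B * A)" if g: "g \<in> G" for g
  proof -
    have "B * A * snd M g = B * (snd N g * A)" using g by (simp add: mult_assoc_dim d rep_homD(3)[OF A])
    also have "\<dots> = snd K g * (B * A)" using g by (simp add: mult_assoc_dim[symmetric] d rep_homD(3)[OF B])
    finally show ?thesis .
  qed
  then show ?thesis using d by (auto simp: rep_hom_def)
qed

lemma rep_hom_one: "is_rep G M \<Longrightarrow> 1\<^sub>m (fst M) \<in> rep_hom G M M"
  by (auto simp: rep_hom_def dim_algebra is_repD)

lemma rep_hom_zero: "is_rep G M \<Longrightarrow> is_rep G N \<Longrightarrow> 0\<^sub>m (fst N) (fst M) \<in> rep_hom G M N"
  by (auto simp: rep_hom_def dim_algebra is_repD)

lemma rep_hom_add: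
  assumes "is_rep G M" "is_rep G N" "A \<in> rep_hom G M N" "B \<in> rep_hom G M N"
  shows "A + B \<in> rep_hom G M N"
  using assms by (auto simp: rep_hom_def dim_algebra is_repD)

lemma rep_hom_smult:
  assumes "is_rep G M" "is_rep G N" "A \<in> rep_hom G M N"
  shows "k \<cdot>\<^sub>m A \<in> rep_hom G M N"
  using assms by (auto simp: rep_hom_def dim_algebra is_repD)

lemma rep_hom_minus:
  assumes "is_rep G M" "is_rep G N" "A \<in> rep_hom G M N" "B \<in> rep_hom G M N"
  shows "A - B \<in> rep_hom G M N"
  using assms by (auto simp: rep_hom_def dim_algebra is_repD)

lemma rep_hom_pow:
  assumes "is_rep G M" "A \<in> rep_hom G M M"
  shows "A ^\<^sub>m k \<in> rep_hom G M M"
proof (induction k)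
  case 0
  then show ?case using rep_hom_one[OF assms(1)] rep_homD(1)[OF assms(2)] by simp
next
  case (Suc k)
  then show ?case using rep_hom_mult[OF assms(1,1,1) assms(2)] by simp
qed

definition rep_unit :: "(nat \<Rightarrow> nat) set \<Rightarrow> 'a::field rep \<Rightarrow> 'a mat \<Rightarrow> bool" where
  "rep_unit G X f \<longleftrightarrow> f \<in> rep_hom G X X \<and> (\<exists>h\<in>rep_hom G X X. h * f = 1\<^sub>m (fst X) \<and> f * h = 1\<^sub>m (fst X))"

text \<open>The equality of dimensions demanded by \<open>rep_iso\<close> follows by applying
  \<open>section_dim_le\<close> to both composites.\<close>

lemma rep_isoI:
  assumes "is_rep G M" "is_rep G N" and f: "f \<in> rep_hom G M N" and h: "h \<in> rep_hom G N M"
    and hf: "h * f = 1\<^sub>m (fst M)" and fh: "f * h = 1\<^sub>m (fst N)"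
  shows "rep_iso G M N"
proof -
  note d = rep_homD(1,2)[OF f] rep_homD(1,2)[OF h]
  have "fst M \<le> fst N" by (rule section_dim_le[OF _ _ hf]) (use d in auto)
  moreover have "fst N \<le> fst M" by (rule section_dim_le[OF _ _ fh]) (use d in auto)
  ultimately have eq: "fst M = fst N" by simp
  have "invertible_mat f" unfolding invertible_mat_def inverts_mat_def
    using d eq hf fh by auto
  then show ?thesis unfolding rep_iso_def using d eq rep_homD(3)[OF f] by (auto intro!: bexI[of _ f])
qed

lemma rep_isoE:
  assumes iso: "rep_iso G M N" and M: "is_rep G M" and N: "is_rep G N"
  obtains f h where "f \<in> rep_hom G M N" "h \<in> rep_hom G N M" "h * f = 1\<^sub>m (fst M)" "f * h = 1\<^sub>m (fst N)"
proof -
  from iso obtain P where eq: "fst M = fst N" and P: "P \<in> carrier_mat (fst M) (fst M)" and inv: "invertible_mat P"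
    and com: "\<And>g. g \<in> G \<Longrightarrow> P * snd M g = snd N g * P" unfolding rep_iso_def by auto
  from inv obtain Q where "inverts_mat P Q" "inverts_mat Q P" unfolding invertible_mat_def by auto
  then have PQ: "P * Q = 1\<^sub>m (fst M)" and QP': "Q * P = 1\<^sub>m (dim_row Q)" using P by (auto simp: inverts_mat_def)
  have cQ: "dim_col Q = fst M" using PQ by (metis index_mult_mat(3) index_one_mat(3))
  have rQ: "dim_row Q = fst M" using QP' P by (metis carrier_matD(2) index_mult_mat(3) index_one_mat(3))
  note QP = QP'[unfolded rQ]
  note d = P[THEN carrier_matD(1)] P[THEN carrier_matD(2)] cQ rQ eq is_repD(1,2)[OF M] is_repD(1,2)[OF N]
  have "Q * snd N g = snd M g * Q" if g: "g \<in> G" for g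
  proof -
    have "Q * snd N g = Q * snd N g * (P * Q)" using g d by (simp add: PQ dim_algebra)
    also have "\<dots> = Q * (snd N g * P) * Q" using g d by (simp add: mult_assoc_dim)
    also have "\<dots> = (Q * P) * snd M g * Q" using g d by (simp add: com[symmetric] mult_assoc_dim)
    also have "\<dots> = snd M g * Q" using g d by (simp add: QP dim_algebra)
    finally show ?thesis .
  qed
  then have "Q \<in> rep_hom G N M" using d by (auto simp: rep_hom_def)
  moreover have "P \<in> rep_hom G M N" using d com by (auto simp: rep_hom_def)
  ultimately show ?thesis using that QP PQ eq by auto
qed

lemma rep_iso_refl: "is_rep G M \<Longrightarrow> rep_iso G M M"
  by (rule rep_isoI[of _ _ _ "1\<^sub>m (fst M)" "1\<^sub>m (fst M)"]) (auto simp: rep_hom_one)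

lemma rep_iso_sym: "rep_iso G M N \<Longrightarrow> is_rep G M \<Longrightarrow> is_rep G N \<Longrightarrow> rep_iso G N M"
  by (erule rep_isoE, assumption, assumption) (rule rep_isoI)

lemma rep_iso_trans:
  assumes "rep_iso G M N" "rep_iso G N K" and M: "is_rep G M" and N: "is_rep G N" and K: "is_rep G K"
  shows "rep_iso G M K"
proof -
  obtain f h where f: "f \<in> rep_hom G M N" and h: "h \<in> rep_hom G N M" and 1: "h * f = 1\<^sub>m (fst M)" "f * h = 1\<^sub>m (fst N)"
    using rep_isoE[OF assms(1) M N] by blast
  obtain f' h' where f': "f' \<in> rep_hom G N K" and h': "h' \<in> rep_hom G K N" and 2: "h' * f' = 1\<^sub>m (fst N)" "f' * h' = 1\<^sub>m (fst K)"
    using rep_isoE[OF assms(2) N K] by blast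
  note d = rep_homD(1,2)[OF f] rep_homD(1,2)[OF h] rep_homD(1,2)[OF f'] rep_homD(1,2)[OF h']
  have "(h * h') * (f' * f) = h * (h' * f') * f" by (simp add: mult_assoc_dim d)
  then have a: "(h * h') * (f' * f) = 1\<^sub>m (fst M)" by (simp add: 1 2 d dim_algebra)
  have "(f' * f) * (h * h') = f' * (f * h) * h'" by (simp add: mult_assoc_dim d)
  then have b: "(f' * f) * (h * h') = 1\<^sub>m (fst K)" by (simp add: 1 2 d dim_algebra)
  show ?thesis
    by (rule rep_isoI[OF M K rep_hom_mult[OF M N K f f'] rep_hom_mult[OF K N M h' h] a b])
qed

text \<open>The injections and projections are written with empty blocks so that every product with
  a direct sum is computed by the one rule for four-block matrices.\<close>

definition inl_mat :: "nat \<Rightarrow> nat \<Rightarrow> 'a::field mat" where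
  "inl_mat a b = four_block_mat (1\<^sub>m a) (0\<^sub>m a 0) (0\<^sub>m b a) (0\<^sub>m b 0)"
definition inr_mat :: "nat \<Rightarrow> nat \<Rightarrow> 'a::field mat" where
  "inr_mat a b = four_block_mat (0\<^sub>m a b) (0\<^sub>m a 0) (1\<^sub>m b) (0\<^sub>m b 0)"
definition prl_mat :: "nat \<Rightarrow> nat \<Rightarrow> 'a::field mat" where
  "prl_mat a b = four_block_mat (1\<^sub>m a) (0\<^sub>m a b) (0\<^sub>m 0 a) (0\<^sub>m 0 b)"
definition prr_mat :: "nat \<Rightarrow> nat \<Rightarrow> 'a::field mat" where
  "prr_mat a b = four_block_mat (0\<^sub>m b a) (1\<^sub>m b) (0\<^sub>m 0 a) (0\<^sub>m 0 b)"

lemma four_block_empty: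
  fixes A :: "'a::field mat"
  assumes "dim_row A = n" "dim_col A = m"
  shows "four_block_mat A (0\<^sub>m n 0) (0\<^sub>m 0 m) (0\<^sub>m 0 0) = A"
  using assms by (intro eq_matI) auto

lemma mult_four_block_dim:
  fixes A1 :: "'a::field mat"
  assumes "dim_row B1 = dim_row A1" "dim_row D1 = dim_row C1" "dim_col C1 = dim_col A1" "dim_col D1 = dim_col B1"
    "dim_row A2 = dim_col A1" "dim_row B2 = dim_col A1" "dim_row C2 = dim_col B1" "dim_row D2 = dim_col B1"
    "dim_col C2 = dim_col A2" "dim_col D2 = dim_col B2"
  shows "four_block_mat A1 B1 C1 D1 * four_block_mat A2 B2 C2 D2
    = four_block_mat (A1 * A2 + B1 * C2) (A1 * B2 + B1 * D2) (C1 * A2 + D1 * C2) (C1 * B2 + D1 * D2)"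
  by (rule mult_four_block_mat[where ?nr1.0="dim_row A1" and ?n1.0="dim_col A1" and ?n2.0="dim_col B1" and ?nr2.0="dim_row C1" and ?nc1.0="dim_col A2" and ?nc2.0="dim_col B2"])
    (use assms in auto)

lemma biproduct_dims [simp]:
  "dim_row (inl_mat a b) = a + b" "dim_col (inl_mat a b) = a"
  "dim_row (inr_mat a b) = a + b" "dim_col (inr_mat a b) = b"
  "dim_row (prl_mat a b) = a" "dim_col (prl_mat a b) = a + b"
  "dim_row (prr_mat a b) = b" "dim_col (prr_mat a b) = a + b"
  by (simp_all add: inl_mat_def inr_mat_def prl_mat_def prr_mat_def)

lemma biproduct_mats:
  shows "prl_mat a b * inl_mat a b = (1\<^sub>m a :: 'a::field mat)" "prr_mat a b * inr_mat a b = (1\<^sub>m b :: 'a mat)"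
    "prl_mat a b * inr_mat a b = (0\<^sub>m a b :: 'a mat)" "prr_mat a b * inl_mat a b = (0\<^sub>m b a :: 'a mat)"
    "inl_mat a b * prl_mat a b + inr_mat a b * prr_mat a b = (1\<^sub>m (a + b) :: 'a mat)"
  by (simp_all add: inl_mat_def inr_mat_def prl_mat_def prr_mat_def mult_four_block_dim dim_algebra four_block_empty)
   (rule eq_matI, auto)

lemma is_rep_dsum:
  assumes X: "is_rep G X" and Z: "is_rep G Z"
  shows "is_rep G (dsum X Z)"
proof -
  note d = is_repD(1,2)[OF X] is_repD(1,2)[OF Z]
  have "snd (dsum X Z) (g \<circ> h) = snd (dsum X Z) g * snd (dsum X Z) h" if "g \<in> G" "h \<in> G" for g h
    unfolding dsum_def snd_conv using that
    by (simp add: mult_four_block_dim d is_repD(3)[OF X] is_repD(3)[OF Z] dim_algebra)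
  then show ?thesis unfolding is_rep_def
    by (auto simp: dsum_def d is_repD(4)[OF X] is_repD(4)[OF Z])
qed

lemma biproduct_homs:
  assumes X: "is_rep G X" and Z: "is_rep G Z"
  shows "inl_mat (fst X) (fst Z) \<in> rep_hom G X (dsum X Z)" "inr_mat (fst X) (fst Z) \<in> rep_hom G Z (dsum X Z)"
    "prl_mat (fst X) (fst Z) \<in> rep_hom G (dsum X Z) X" "prr_mat (fst X) (fst Z) \<in> rep_hom G (dsum X Z) Z"
proof -
  note d = is_repD(1,2)[OF X] is_repD(1,2)[OF Z]
  have f: "A = four_block_mat A (0\<^sub>m (dim_row A) 0) (0\<^sub>m 0 (dim_col A)) (0\<^sub>m 0 0)" for A :: "'a mat"
    by (rule four_block_empty[symmetric]) auto
  let ?a = "fst X" and ?b = "fst Z"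
  have 1: "inl_mat ?a ?b * snd X g = snd (dsum X Z) g * inl_mat ?a ?b" if "g \<in> G" for g
    using that by (subst f[of "snd X g"]) (simp add: inl_mat_def dsum_def mult_four_block_dim d dim_algebra)
  have 2: "inr_mat ?a ?b * snd Z g = snd (dsum X Z) g * inr_mat ?a ?b" if "g \<in> G" for g
    using that by (subst f[of "snd Z g"]) (simp add: inr_mat_def dsum_def mult_four_block_dim d dim_algebra)
  have 3: "prl_mat ?a ?b * snd (dsum X Z) g = snd X g * prl_mat ?a ?b" if "g \<in> G" for g
    using that by (subst f[of "snd X g"]) (simp add: prl_mat_def dsum_def mult_four_block_dim d dim_algebra)
  have 4: "prr_mat ?a ?b * snd (dsum X Z) g = snd Z g * prr_mat ?a ?b" if "g \<in> G" for g
    using that by (subst f[of "snd Z g"]) (simp add: prr_mat_def dsum_def mult_four_block_dim d dim_algebra)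
  show "inl_mat ?a ?b \<in> rep_hom G X (dsum X Z)" "inr_mat ?a ?b \<in> rep_hom G Z (dsum X Z)"
    "prl_mat ?a ?b \<in> rep_hom G (dsum X Z) X" "prr_mat ?a ?b \<in> rep_hom G (dsum X Z) Z"
    using 1 2 3 4 by (auto simp: rep_hom_def) (auto simp: dsum_def)
qed

lemma biproduct_iso:
  assumes M: "is_rep G M" and X: "is_rep G X" and Z: "is_rep G Z"
    and i: "i \<in> rep_hom G X M" and p: "p \<in> rep_hom G M X" and i': "i' \<in> rep_hom G Z M" and p': "p' \<in> rep_hom G M Z"
    and pi: "p * i = 1\<^sub>m (fst X)" and pi': "p' * i' = 1\<^sub>m (fst Z)"
    and o1: "p * i' = 0\<^sub>m (fst X) (fst Z)" and o2: "p' * i = 0\<^sub>m (fst Z) (fst X)"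
    and s: "i * p + i' * p' = 1\<^sub>m (fst M)"
  shows "rep_iso G M (dsum X Z)"
proof -
  let ?a = "fst X" and ?b = "fst Z"
  note D = is_rep_dsum[OF X Z] and H = biproduct_homs[OF X Z]
  note d[simp] = rep_homD(1,2)[OF i] rep_homD(1,2)[OF p] rep_homD(1,2)[OF i'] rep_homD(1,2)[OF p']
  have dd: "fst (dsum X Z) = ?a + ?b" by (simp add: dsum_def)
  define f where "f = inl_mat ?a ?b * p + inr_mat ?a ?b * p'"
  define h where "h = i * prl_mat ?a ?b + i' * prr_mat ?a ?b"
  have f: "f \<in> rep_hom G M (dsum X Z)" unfolding f_def
    by (intro rep_hom_add[OF M D] rep_hom_mult[OF M X D p H(1)] rep_hom_mult[OF M Z D p' H(2)])
  have h: "h \<in> rep_hom G (dsum X Z) M" unfolding h_def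
    by (intro rep_hom_add[OF D M] rep_hom_mult[OF D X M H(3) i] rep_hom_mult[OF D Z M H(4) i'])
  let ?il = "inl_mat ?a ?b :: 'a mat" and ?ir = "inr_mat ?a ?b :: 'a mat" and ?pl = "prl_mat ?a ?b :: 'a mat" and ?pr = "prr_mat ?a ?b :: 'a mat"
  have "i * ?pl * (?il * p) = i * (?pl * ?il) * p" "i * ?pl * (?ir * p') = i * (?pl * ?ir) * p'"
     "i' * ?pr * (?il * p) = i' * (?pr * ?il) * p" "i' * ?pr * (?ir * p') = i' * (?pr * ?ir) * p'"
    by (simp_all add: mult_assoc_dim)
  then have "h * f = i * p + i' * p'"
    unfolding h_def f_def by (simp add: mult_add_dim add_mult_dim biproduct_mats one_mult_dim zero_mult_dim add_zero_dim)
  then have hf: "h * f = 1\<^sub>m (fst M)" using s by simp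
  have "?il * p * (i * ?pl) = ?il * (p * i) * ?pl" "?il * p * (i' * ?pr) = ?il * (p * i') * ?pr"
     "?ir * p' * (i * ?pl) = ?ir * (p' * i) * ?pl" "?ir * p' * (i' * ?pr) = ?ir * (p' * i') * ?pr"
    by (simp_all add: mult_assoc_dim)
  then have "f * h = ?il * ?pl + ?ir * ?pr"
    unfolding h_def f_def by (simp add: mult_add_dim add_mult_dim pi pi' o1 o2 one_mult_dim zero_mult_dim add_zero_dim)
  then have fh: "f * h = 1\<^sub>m (fst (dsum X Z))" by (simp add: biproduct_mats dd)
  show ?thesis by (rule rep_isoI[OF M D f h hf fh])
qed

lemma biproductE:
  assumes iso: "rep_iso G M (dsum X Z)" and M: "is_rep G M" and X: "is_rep G X" and Z: "is_rep G Z"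
  obtains i p i' p' where "i \<in> rep_hom G X M" "p \<in> rep_hom G M X" "i' \<in> rep_hom G Z M" "p' \<in> rep_hom G M Z"
    "p * i = 1\<^sub>m (fst X)" "p' * i' = 1\<^sub>m (fst Z)" "p * i' = 0\<^sub>m (fst X) (fst Z)" "p' * i = 0\<^sub>m (fst Z) (fst X)"
    "i * p + i' * p' = 1\<^sub>m (fst M)"
proof -
  let ?a = "fst X" and ?b = "fst Z"
  note D = is_rep_dsum[OF X Z] and H = biproduct_homs[OF X Z]
  have dd: "fst (dsum X Z) = ?a + ?b" by (simp add: dsum_def)
  obtain f h where f: "f \<in> rep_hom G M (dsum X Z)" and h: "h \<in> rep_hom G (dsum X Z) M"
    and hf: "h * f = 1\<^sub>m (fst M)" and fh: "f * h = 1\<^sub>m (fst (dsum X Z))"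
    using rep_isoE[OF iso M D] by blast
  note d[simp] = rep_homD(1,2)[OF f, unfolded dd] rep_homD(1,2)[OF h, unfolded dd]
  let ?il = "inl_mat ?a ?b :: 'a mat" and ?ir = "inr_mat ?a ?b :: 'a mat" and ?pl = "prl_mat ?a ?b :: 'a mat" and ?pr = "prr_mat ?a ?b :: 'a mat"
  have mid: "A * f * (h * B) = A * B" if "dim_col A = ?a + ?b" "dim_row B = ?a + ?b" for A B :: "'a mat"
  proof -
    have "A * f * (h * B) = A * (f * h) * B" using that by (simp add: mult_assoc_dim)
    then show ?thesis using that by (simp add: fh dd one_mult_dim)
  qed
  have "h * ?il * (?pl * f) + h * ?ir * (?pr * f) = h * (?il * ?pl + ?ir * ?pr) * f"
    by (simp add: mult_add_dim add_mult_dim mult_assoc_dim)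
  also have "\<dots> = 1\<^sub>m (fst M)" by (simp add: biproduct_mats one_mult_dim hf)
  finally have s: "h * ?il * (?pl * f) + h * ?ir * (?pr * f) = 1\<^sub>m (fst M)" .
  show ?thesis
    by (rule that[of "h * ?il" "?pl * f" "h * ?ir" "?pr * f"])
      (use s in \<open>simp_all add: mid biproduct_mats rep_hom_mult[OF X D M H(1) h] rep_hom_mult[OF Z D M H(2) h]
         rep_hom_mult[OF M D X f H(3)] rep_hom_mult[OF M D Z f H(4)]\<close>)
qed

text \<open>The action on the image of \<open>e\<close> is the compression
  \<open>p * snd M g * i\<close>; it is multiplicative because \<open>e = i * p\<close> commutes
  with the action.\<close>

lemma idempotent_splits:
  assumes M: "is_rep G M" and e: "e \<in> rep_hom G M M" and ee: "e * e = e"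
  obtains X i p where "is_rep G X" "i \<in> rep_hom G X M" "p \<in> rep_hom G M X" "p * i = 1\<^sub>m (fst X)" "i * p = e"
proof -
  have "e \<in> carrier_mat (fst M) (fst M)" using rep_homD(1,2)[OF e] by auto
  then obtain k i p where
    i: "i \<in> carrier_mat (fst M) k" and p: "p \<in> carrier_mat k (fst M)" and pi: "p * i = 1\<^sub>m k" and ip: "i * p = e"
    by (rule idempotent_matrix_splits[OF _ ee])
  define X where "X = (k, \<lambda>g. p * snd M g * i)"
  note d[simp] = rep_homD(1,2)[OF e] is_repD(1,2)[OF M] i[THEN carrier_matD(1)] i[THEN carrier_matD(2)]
    p[THEN carrier_matD(1)] p[THEN carrier_matD(2)]
  have fX: "fst X = k" by (simp add: X_def)
  have pe: "p * e = p" unfolding ip[symmetric] by (simp add: mult_assoc_dim[symmetric] pi one_mult_dim)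
  have ei: "e * i = i" unfolding ip[symmetric] by (simp add: mult_assoc_dim pi one_mult_dim)
  have com: "e * snd M g = snd M g * e" if "g \<in> G" for g using rep_homD(3)[OF e that] .
  have 1: "p * snd M g = snd X g * p" if g: "g \<in> G" for g
  proof -
    have "snd X g * p = p * (snd M g * e)" using g by (simp add: X_def mult_assoc_dim ip)
    also have "\<dots> = p * e * snd M g" using g by (simp add: com[symmetric] mult_assoc_dim)
    finally show ?thesis by (simp add: pe)
  qed
  have 2: "i * snd X g = snd M g * i" if g: "g \<in> G" for g
  proof -
    have "i * snd X g = e * snd M g * i" using g by (simp add: X_def mult_assoc_dim ip[symmetric])
    also have "\<dots> = snd M g * (e * i)" using g by (simp add: com mult_assoc_dim)
    finally show ?thesis by (simp add: ei)
  qed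
  have "is_rep G X" unfolding is_rep_def
  proof (intro conjI ballI)
    fix g h assume g: "g \<in> G" and h: "h \<in> G"
    have "snd X g * snd X h = (p * snd M g) * (i * snd X h)" using g h by (simp add: X_def mult_assoc_dim)
    also have "\<dots> = p * snd M g * (snd M h * i)" using h by (simp add: 2)
    also have "\<dots> = snd X (g \<circ> h)" using g h by (simp add: X_def is_repD(3)[OF M] mult_assoc_dim)
    finally show "snd X (g \<circ> h) = snd X g * snd X h" ..
  next
    show "snd X id = 1\<^sub>m (fst X)" by (simp add: X_def is_repD(4)[OF M] one_mult_dim pi)
  qed (auto simp: X_def)
  moreover have "i \<in> rep_hom G X M" "p \<in> rep_hom G M X" using 1 2 by (auto simp: rep_hom_def fX)
  ultimately show ?thesis using that[of X i p] pi ip fX by simp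
qed

lemma mat_inner_zero:
  fixes A B :: "'a::field mat"
  shows "dim_col A = 0 \<Longrightarrow> dim_row B = 0 \<Longrightarrow> A * B = 0\<^sub>m (dim_row A) (dim_col B)"
  by (rule eq_matI) (auto simp: scalar_prod_def)

text \<open>\<open>Z\<close> splits the complementary idempotent \<open>1 - i * p\<close>. The last
  clause serves to recognise trivial decompositions: a complement of dimension 0 leaves
  \<open>i * p\<close> as the identity.\<close>

lemma idempotent_complement:
  assumes M: "is_rep G M" and X: "is_rep G X" and i: "i \<in> rep_hom G X M" and p: "p \<in> rep_hom G M X"
    and pi: "p * i = 1\<^sub>m (fst X)"
  obtains Z where "is_rep G Z" "rep_iso G M (dsum X Z)" "fst Z = 0 \<longrightarrow> i * p = 1\<^sub>m (fst M)"
proof -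
  note d[simp] = rep_homD(1,2)[OF i] rep_homD(1,2)[OF p]
  let ?f = "1\<^sub>m (fst M) - i * p"
  have ip: "i * p \<in> rep_hom G M M" by (rule rep_hom_mult[OF M X M p i])
  have f: "?f \<in> rep_hom G M M" by (intro rep_hom_minus M ip rep_hom_one)
  have fi: "?f * i = 0\<^sub>m (fst M) (fst X)"
    by (simp add: minus_mult_dim one_mult_dim mult_assoc_dim pi minus_r_inv_mat[of i "fst M" "fst X"] carrier_matI)
  have pf: "p * ?f = 0\<^sub>m (fst X) (fst M)"
    by (simp add: mult_minus_dim one_mult_dim mult_assoc_dim[symmetric] pi minus_r_inv_mat[of p "fst X" "fst M"] carrier_matI)
  have ff: "?f * ?f = ?f"
  proof -
    have "?f * ?f = ?f - ?f * i * p" by (subst mult_minus_dim) (simp_all add: one_mult_dim mult_assoc_dim)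
    also have "\<dots> = ?f" unfolding fi by (rule eq_matI) (auto simp: scalar_prod_def)
    finally show ?thesis .
  qed
  obtain Z i' p' where Z: "is_rep G Z" and i': "i' \<in> rep_hom G Z M" and p': "p' \<in> rep_hom G M Z"
    and pi': "p' * i' = 1\<^sub>m (fst Z)" and ip': "i' * p' = ?f" by (rule idempotent_splits[OF M f ff])
  note d'[simp] = rep_homD(1,2)[OF i'] rep_homD(1,2)[OF p']
  have p'f: "p' * ?f = p'" unfolding ip'[symmetric] by (simp add: mult_assoc_dim[symmetric] pi' one_mult_dim)
  have fi': "?f * i' = i'" unfolding ip'[symmetric] by (simp add: mult_assoc_dim pi' one_mult_dim)
  have "p' * i = p' * ?f * i" unfolding p'f ..
  also have "\<dots> = p' * (?f * i)" by (rule mult_assoc_dim) simp_all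
  also have "\<dots> = 0\<^sub>m (fst Z) (fst X)" unfolding fi by (simp add: zero_mult_dim)
  finally have o2: "p' * i = 0\<^sub>m (fst Z) (fst X)" .
  have "p * i' = p * (?f * i')" unfolding fi' ..
  also have "\<dots> = p * ?f * i'" by (rule mult_assoc_dim[symmetric]) simp_all
  also have "\<dots> = 0\<^sub>m (fst X) (fst Z)" unfolding pf by (simp add: zero_mult_dim)
  finally have o1: "p * i' = 0\<^sub>m (fst X) (fst Z)" .
  have s: "i * p + i' * p' = 1\<^sub>m (fst M)" unfolding ip' by (rule eq_matI) auto
  have z0: "fst Z = 0 \<longrightarrow> i * p = 1\<^sub>m (fst M)"
  proof
    assume that: "fst Z = 0"
    have "i' * p' = 0\<^sub>m (fst M) (fst M)" using that by (subst mat_inner_zero) auto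
    then show "i * p = 1\<^sub>m (fst M)" using s by (metis add_zero_dim(2) d(1) d(4) index_mult_mat(2,3))
  qed
  show ?thesis by (rule that[OF Z biproduct_iso[OF M X Z i p i' p' pi pi' o1 o2 s] z0])
qed

lemma indecomposable_idempotent:
  assumes M: "indecomposable G M" and e: "e \<in> rep_hom G M M" and ee: "e * e = e"
  shows "e = 0\<^sub>m (fst M) (fst M) \<or> e = 1\<^sub>m (fst M)"
proof -
  have rM: "is_rep G M" using M by (simp add: indecomposable_def)
  obtain X i p where X: "is_rep G X" and i: "i \<in> rep_hom G X M" and p: "p \<in> rep_hom G M X" and pi: "p * i = 1\<^sub>m (fst X)" and ip: "i * p = e"
    by (rule idempotent_splits[OF rM e ee])
  obtain Z where Z: "is_rep G Z" "rep_iso G M (dsum X Z)" "fst Z = 0 \<longrightarrow> i * p = 1\<^sub>m (fst M)"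
    by (rule idempotent_complement[OF rM X i p pi])
  have "fst X = 0 \<or> fst Z = 0"
  proof (rule ccontr)
    assume "\<not> (fst X = 0 \<or> fst Z = 0)"
    then have "\<exists>A B. is_rep G A \<and> is_rep G B \<and> fst A > 0 \<and> fst B > 0 \<and> rep_iso G M (dsum A B)"
      using X Z(1,2) by (intro exI[of _ X] exI[of _ Z]) simp
    then show False using M by (simp add: indecomposable_def)
  qed
  then show ?thesis
  proof
    assume "fst X = 0"
    then have "i * p = 0\<^sub>m (fst M) (fst M)" using rep_homD(1,2)[OF i] rep_homD(1,2)[OF p] by (subst mat_inner_zero) auto
    then show ?thesis using ip by simp
  qed (use Z ip in simp)
qed

section \<open>Fitting's lemma\<close>

primrec mat_poly :: "'a::field mat \<Rightarrow> 'a list \<Rightarrow> 'a mat" where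
  "mat_poly f [] = 0\<^sub>m (dim_row f) (dim_row f)"
| "mat_poly f (a # as) = a \<cdot>\<^sub>m 1\<^sub>m (dim_row f) + f * mat_poly f as"

lemma mat_poly_dim: "dim_row f = d \<Longrightarrow> dim_col f = d \<Longrightarrow> dim_row (mat_poly f as) = d \<and> dim_col (mat_poly f as) = d"
  by (induction as) auto

lemma mat_poly_hom:
  assumes "is_rep G X" "f \<in> rep_hom G X X"
  shows "mat_poly f as \<in> rep_hom G X X"
  using assms by (induction as) (simp_all add: rep_homD(1)[OF assms(2)] rep_hom_zero rep_hom_add rep_hom_smult rep_hom_one rep_hom_mult)

lemma mat_poly_comm:
  fixes f :: "'a::field mat"
  assumes [simp]: "dim_row f = d" "dim_col f = d"
  shows "f * mat_poly f as = mat_poly f as * f"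
proof (induction as)
  case (Cons a as)
  have [simp]: "dim_row (mat_poly f as) = d" "dim_col (mat_poly f as) = d" using mat_poly_dim[of f d as] by auto
  show ?case by (simp add: dim_algebra Cons[symmetric])
qed (simp add: dim_algebra)

lemma pow_mat_Suc_left:
  fixes f :: "'a::field mat"
  assumes "dim_row f = d" "dim_col f = d"
  shows "f ^\<^sub>m (Suc k) = f * f ^\<^sub>m k"
  using assms by (induction k) (auto simp: one_mult_dim mult_assoc_dim)

lemma mat_poly_index:
  fixes f :: "'a::field mat"
  assumes [simp]: "dim_row f = d" "dim_col f = d" and ij: "i < d" "j < d"
  shows "mat_poly f as $$ (i,j) = (\<Sum>k<length as. as ! k * (f ^\<^sub>m k) $$ (i,j))"
  using ij
proof (induction as arbitrary: i j)
  case (Cons a as)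
  have [simp]: "dim_row (mat_poly f as) = d" "dim_col (mat_poly f as) = d" using mat_poly_dim[of f d as] by auto
  have "(f * mat_poly f as) $$ (i,j) = (\<Sum>l<d. f $$ (i,l) * mat_poly f as $$ (l,j))"
    using Cons.prems by (simp add: scalar_prod_def lessThan_atLeast0)
  also have "\<dots> = (\<Sum>l<d. \<Sum>k<length as. as ! k * (f $$ (i,l) * (f ^\<^sub>m k) $$ (l,j)))"
    using Cons by (simp add: sum_distrib_left mult.left_commute)
  also have "\<dots> = (\<Sum>k<length as. as ! k * (\<Sum>l<d. f $$ (i,l) * (f ^\<^sub>m k) $$ (l,j)))"
    by (subst sum.swap) (simp add: sum_distrib_left)
  also have "\<dots> = (\<Sum>k<length as. as ! k * (f * f ^\<^sub>m k) $$ (i,j))"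
    using Cons.prems by (simp add: scalar_prod_def lessThan_atLeast0)
  also have "\<dots> = (\<Sum>k<length as. as ! k * (f ^\<^sub>m (Suc k)) $$ (i,j))" 
    by (simp only: pow_mat_Suc_left[OF assms(1,2)])
  finally have "(f * mat_poly f as) $$ (i,j) = (\<Sum>k<length as. as ! k * (f ^\<^sub>m (Suc k)) $$ (i,j))" .
  moreover have "mat_poly f (a # as) $$ (i,j) = a * (f ^\<^sub>m 0) $$ (i,j) + (f * mat_poly f as) $$ (i,j)"
    using Cons.prems by simp
  ultimately show ?case
    by (simp only: length_Cons sum.lessThan_Suc_shift nth_Cons_0 nth_Cons_Suc)
qed simp

text \<open>The powers of \<open>f\<close> up to exponent \<open>d * d\<close>, flattened to columns
  of length \<open>d * d\<close>, are linearly dependent. A zero row is added to make the matrix of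
  columns square, so that its singularity can be read off the determinant.\<close>

lemma mat_poly_annihilates:
  fixes f :: "'a::field mat"
  assumes [simp]: "dim_row f = d" "dim_col f = d"
  obtains as where "mat_poly f as = 0\<^sub>m d d" "\<exists>a\<in>set as. a \<noteq> 0"
proof -
  define N where "N = Suc (d * d)"
  define A where "A = mat N N (\<lambda>(r,k). if r < d * d then (f ^\<^sub>m k) $$ (r div d, r mod d) else 0)"
  have A: "A \<in> carrier_mat N N" by (simp add: A_def)
  have "transpose_mat A *\<^sub>v unit_vec N (d*d) = 0\<^sub>v N"
    by (intro eq_vecI) (auto simp: A_def N_def scalar_prod_def intro!: sum.neutral)
  moreover have "unit_vec N (d*d) \<noteq> (0\<^sub>v N :: 'a vec)" by (simp add: N_def)
  ultimately have "det (transpose_mat A) = 0"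
    using det_0_iff_vec_prod_zero_field[of "transpose_mat A" N] A by (metis transpose_carrier_mat unit_vec_carrier)
  then have "det A = 0" using det_transpose[OF A] by simp
  then obtain v where v: "v \<in> carrier_vec N" "v \<noteq> 0\<^sub>v N" "A *\<^sub>v v = 0\<^sub>v N"
    using det_0_iff_vec_prod_zero_field[OF A] by blast
  define as where "as = map (\<lambda>k. v $ k) [0..<N]"
  have "mat_poly f as = 0\<^sub>m d d"
  proof (rule eq_matI)
    fix i j assume "i < dim_row (0\<^sub>m d d)" "j < dim_col (0\<^sub>m d d)"
    then have ij: "i < d" "j < d" by auto
    have "i * d + j < Suc i * d" using ij by simp
    also have "\<dots> \<le> d * d" using ij by (intro mult_le_mono1) simp
    finally have r: "i * d + j < d * d" .
    have dm: "(i * d + j) div d = i" "(i * d + j) mod d = j" using ij by auto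
    have "mat_poly f as $$ (i,j) = (\<Sum>k<N. v $ k * (f ^\<^sub>m k) $$ (i,j))"
      using mat_poly_index[OF assms ij, of as] by (simp add: as_def)
    also have "\<dots> = (A *\<^sub>v v) $ (i * d + j)"
      using r v(1) dm by (simp add: A_def scalar_prod_def lessThan_atLeast0 N_def mult.commute)
    also have "\<dots> = 0" unfolding v(3) using r by (simp add: N_def)
    finally show "mat_poly f as $$ (i,j) = 0\<^sub>m d d $$ (i,j)" using ij by simp
  qed (use mat_poly_dim[OF assms] in auto)
  moreover obtain k where "k < N" "v $ k \<noteq> 0" using v(1,2) by (metis carrier_vecD eq_vecI index_zero_vec)
  then have "\<exists>a\<in>set as. a \<noteq> 0" by (auto simp: as_def)
  ultimately show ?thesis using that[of as] by auto
qed

lemma mat_poly_replicate: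
  fixes f :: "'a::field mat"
  assumes [simp]: "dim_row f = d" "dim_col f = d"
  shows "mat_poly f (replicate k 0 @ as) = f ^\<^sub>m k * mat_poly f as"
proof (induction k)
  case 0 then show ?case using mat_poly_dim[OF assms, of as] by (simp add: one_mult_dim)
next
  case (Suc k)
  have [simp]: "dim_row (mat_poly f as) = d" "dim_col (mat_poly f as) = d" using mat_poly_dim[OF assms, of as] by auto
  have "mat_poly f (replicate (Suc k) 0 @ as) = 0 \<cdot>\<^sub>m 1\<^sub>m d + f * (f ^\<^sub>m k * mat_poly f as)" by (simp add: Suc)
  also have "\<dots> = f * (f ^\<^sub>m k * mat_poly f as)" by (rule eq_matI) auto
  also have "\<dots> = f ^\<^sub>m (Suc k) * mat_poly f as" 
    unfolding pow_mat_Suc_left[OF assms] by (simp add: mult_assoc_dim)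
  finally show ?case .
qed

text \<open>A linear relation between the powers of \<open>f\<close>, divided by its lowest coefficient, gives \<open>f\<^sup>k = f\<^sup>k\<^sup>+\<^sup>1 h\<close>.
  Then \<open>(f h)\<^sup>k\<close> is an idempotent, which is 0 or 1.\<close>
lemma fitting:
  assumes X: "indecomposable G X" and f: "f \<in> rep_hom G X X"
  shows "rep_unit G X f \<or> (\<exists>k. f ^\<^sub>m k = 0\<^sub>m (fst X) (fst X))"
proof -
  have rX: "is_rep G X" using X by (simp add: indecomposable_def)
  let ?d = "fst X"
  note d[simp] = rep_homD(1,2)[OF f]
  obtain as where as: "mat_poly f as = 0\<^sub>m ?d ?d" "\<exists>a\<in>set as. a \<noteq> 0" using mat_poly_annihilates[OF d] by blast
  from split_list_first_prop[OF as(2)] obtain us a bs where us: "as = us @ a # bs" "a \<noteq> 0" "\<forall>x\<in>set us. \<not> x \<noteq> 0" by blast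
  define k where "k = length us"
  have "us = replicate k 0" using us(3) by (simp add: k_def replicate_eqI)
  then have as': "as = replicate k 0 @ a # bs" using us by simp
  define h where "h = (- inverse a) \<cdot>\<^sub>m mat_poly f bs"
  have h: "h \<in> rep_hom G X X" unfolding h_def by (intro rep_hom_smult rX mat_poly_hom f)
  note dh[simp] = rep_homD(1,2)[OF h]
  have [simp]: "dim_row (mat_poly f bs) = ?d" "dim_col (mat_poly f bs) = ?d" using mat_poly_dim[OF d, of bs] by auto
  have com: "f * h = h * f" unfolding h_def by (simp add: dim_algebra mat_poly_comm[OF d])
  define u where "u = f * h"
  have u: "u \<in> rep_hom G X X" unfolding u_def by (rule rep_hom_mult[OF rX rX rX h f])
  note du[simp] = rep_homD(1,2)[OF u]
  have "f ^\<^sub>m k * (a \<cdot>\<^sub>m 1\<^sub>m ?d + f * mat_poly f bs) = 0\<^sub>m ?d ?d"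
    using as(1) mat_poly_replicate[OF d, of k "a # bs"] unfolding as' by simp
  then have "a \<cdot>\<^sub>m (f ^\<^sub>m k) + f ^\<^sub>m k * (f * mat_poly f bs) = 0\<^sub>m ?d ?d"
    by (simp add: mult_add_dim smult_mult_dim one_mult_dim)
  then have z: "a * (f ^\<^sub>m k) $$ (i,j) + (f ^\<^sub>m k * (f * mat_poly f bs)) $$ (i,j) = 0" if "i < ?d" "j < ?d" for i j
    using that by (metis (no_types, lifting) d index_add_mat(1) index_mult_mat(2,3) index_smult_mat(1,2,3) index_zero_mat(1) pow_mat_dim(1,2) \<open>dim_col (mat_poly f bs) = fst X\<close>)
  have fu: "f ^\<^sub>m k * u = f ^\<^sub>m k"
  proof (rule eq_matI)
    fix i j assume "i < dim_row (f ^\<^sub>m k)" "j < dim_col (f ^\<^sub>m k)"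
    then have ij: "i < ?d" "j < ?d" by (auto split: if_splits)
    have "f ^\<^sub>m k * u = (- inverse a) \<cdot>\<^sub>m (f ^\<^sub>m k * (f * mat_poly f bs))"
      by (simp add: u_def h_def smult_mult_dim)
    then have "(f ^\<^sub>m k * u) $$ (i,j) = - inverse a * (f ^\<^sub>m k * (f * mat_poly f bs)) $$ (i,j)"
      using ij by simp
    also have "\<dots> = (f ^\<^sub>m k) $$ (i,j)" using z[OF ij] us(2)
      by (simp add: field_simps add_eq_0_iff)
    finally show "(f ^\<^sub>m k * u) $$ (i,j) = (f ^\<^sub>m k) $$ (i,j)" .
  qed auto
  have fum: "f ^\<^sub>m k * u ^\<^sub>m m = f ^\<^sub>m k" for m
    by (induction m) (simp_all add: one_mult_dim mult_assoc_dim[symmetric] fu)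
  have hfm: "\<exists>w. dim_row w = ?d \<and> dim_col w = ?d \<and> u ^\<^sub>m m = w * f ^\<^sub>m m" for m
  proof (induction m)
    case 0
    then show ?case by (intro exI[of _ "1\<^sub>m ?d"]) (simp add: one_mult_dim)
  next
    case (Suc m)
    then obtain w where w: "dim_row w = ?d" "dim_col w = ?d" "u ^\<^sub>m m = w * f ^\<^sub>m m" by blast
    have "u * f ^\<^sub>m m = h * f ^\<^sub>m (Suc m)"
      unfolding u_def com pow_mat_Suc_left[OF d] by (simp add: mult_assoc_dim)
    moreover have fmh: "f ^\<^sub>m l * h = h * f ^\<^sub>m l" for l
    proof (induction l)
      case (Suc l)
      have "f ^\<^sub>m Suc l * h = f ^\<^sub>m l * (f * h)" by (simp add: mult_assoc_dim)
      also have "\<dots> = (f ^\<^sub>m l * h) * f" unfolding com by (simp add: mult_assoc_dim)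
      finally show ?case unfolding Suc by (simp add: mult_assoc_dim)
    qed (simp add: one_mult_dim)
    moreover have "f ^\<^sub>m m * u = h * f ^\<^sub>m (Suc m)"
    proof -
      have "f ^\<^sub>m m * u = f ^\<^sub>m (Suc m) * h" by (simp add: u_def mult_assoc_dim)
      then show ?thesis by (simp only: fmh)
    qed
    ultimately have "u ^\<^sub>m Suc m = w * (h * f ^\<^sub>m (Suc m))" using w by (simp add: mult_assoc_dim)
    then show ?case using w by (intro exI[of _ "w * h"]) (simp add: mult_assoc_dim)
  qed
  let ?e = "u ^\<^sub>m k"
  \<comment> \<open>Rewriting the left factor as a multiple \<open>w * f ^\<^sub>m k\<close> lets
    \<open>f ^\<^sub>m k\<close> absorb the right factor by \<open>fum\<close>, which leaves the
    left factor again.\<close>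
  have ee: "?e * ?e = ?e"
  proof -
    obtain w where w: "dim_row w = ?d" "dim_col w = ?d" "?e = w * f ^\<^sub>m k" using hfm by blast
    have "?e * ?e = w * (f ^\<^sub>m k * u ^\<^sub>m k)" by (subst (1) w(3)) (simp add: mult_assoc_dim w(1,2))
    then show ?thesis by (simp add: fum w(3)[symmetric])
  qed
  from indecomposable_idempotent[OF X rep_hom_pow[OF rX u] ee] show ?thesis
  proof
    assume "?e = 0\<^sub>m ?d ?d"
    then have "f ^\<^sub>m k = 0\<^sub>m ?d ?d" using fum[of k] by (simp add: zero_mult_dim)
    then show ?thesis by blast
  next
    assume e1: "?e = 1\<^sub>m ?d"
    \<comment> \<open>The inverse of \<open>u\<close> is a power of \<open>u\<close>: the exponent
      is \<open>k - 1\<close>, or 0 when \<open>k = 0\<close>, where \<open>fu\<close> reads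
      \<open>u = 1\<close>.\<close>
    obtain l where l: "u ^\<^sub>m l * u = 1\<^sub>m ?d" "u * u ^\<^sub>m l = 1\<^sub>m ?d"
    proof (cases k)
      case 0
      then have "u = 1\<^sub>m ?d" using fu by (simp add: one_mult_dim)
      then show ?thesis using that[of 0] by (simp add: one_mult_dim)
    next
      case (Suc l)
      then show ?thesis using e1 that[of l] pow_mat_Suc_left[OF du, of l] by simp
    qed
    define w where "w = h * u ^\<^sub>m l" 
    have w: "w \<in> rep_hom G X X" unfolding w_def by (intro rep_hom_mult[OF rX rX rX] rep_hom_pow rX u h)
    have fw: "f * w = 1\<^sub>m ?d" using l(2) by (simp add: w_def u_def mult_assoc_dim)
    define w' where "w' = u ^\<^sub>m l * h"
    have w'f: "w' * f = 1\<^sub>m ?d" using l(1) by (simp add: w'_def u_def com mult_assoc_dim)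
    have "w' = w' * (f * w)" by (simp add: fw one_mult_dim w'_def)
    also have "\<dots> = (w' * f) * w" by (simp add: mult_assoc_dim w_def w'_def)
    also have "\<dots> = w" by (simp add: w'f one_mult_dim rep_homD[OF w])
    finally have "w * f = 1\<^sub>m ?d" using w'f by simp
    then show ?thesis using f w fw unfolding rep_unit_def by blast
  qed
qed

section \<open>Local endomorphism rings and Krull-Schmidt decompositions\<close>

lemma indecomposable_rep: "indecomposable G X \<Longrightarrow> is_rep G X" "indecomposable G X \<Longrightarrow> fst X > 0"
  by (auto simp: indecomposable_def)

lemma zero_neq_one_mat: "d > 0 \<Longrightarrow> (0\<^sub>m d d :: 'a::field mat) \<noteq> 1\<^sub>m d"
  by (metis index_one_mat(1) index_zero_mat(1) zero_neq_one)

text \<open>Let \<open>z\<close> be the last nonzero power of \<open>x\<close>. Then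
  \<open>x * z = 0\<close>, so \<open>x + y = 1\<close> gives \<open>y * z = z\<close>, and no power
  of \<open>y\<close> kills \<open>z\<close>.\<close>

lemma not_both_nilpotent:
  fixes x y :: "'a::field mat"
  assumes [simp]: "dim_row x = d" "dim_col x = d" "dim_row y = d" "dim_col y = d" and "d > 0"
    and xy: "x + y = 1\<^sub>m d" and x: "x ^\<^sub>m k = 0\<^sub>m d d" and y: "y ^\<^sub>m l = 0\<^sub>m d d"
  shows False
proof -
  have one: "x ^\<^sub>m 0 \<noteq> 0\<^sub>m d d" using zero_neq_one_mat[OF \<open>d > 0\<close>] by (metis assms(1) pow_mat.simps(1))
  define m where "m = (LEAST m. x ^\<^sub>m m = 0\<^sub>m d d)"
  have m: "x ^\<^sub>m m = 0\<^sub>m d d" unfolding m_def by (rule LeastI) (rule x)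
  obtain m' where m': "m = Suc m'" using m one by (cases m) auto
  have z: "x ^\<^sub>m m' \<noteq> 0\<^sub>m d d" using not_less_Least[of m' "\<lambda>m. x ^\<^sub>m m = 0\<^sub>m d d"] m' m_def by auto
  have xm: "x * x ^\<^sub>m m' = 0\<^sub>m d d" using m m' pow_mat_Suc_left[of x d m'] by simp
  have "x ^\<^sub>m m' = (x + y) * x ^\<^sub>m m'" by (simp add: xy one_mult_dim)
  also have "\<dots> = y * x ^\<^sub>m m'" by (subst add_mult_dim) (simp_all add: xm add_zero_dim)
  finally have st: "y * x ^\<^sub>m m' = x ^\<^sub>m m'" ..
  have "y ^\<^sub>m j * x ^\<^sub>m m' = x ^\<^sub>m m'" for j
    by (induction j) (simp_all add: one_mult_dim mult_assoc_dim st)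
  from this[of l] have "0\<^sub>m d d * x ^\<^sub>m m' = x ^\<^sub>m m'" unfolding y .
  then have "x ^\<^sub>m m' = 0\<^sub>m d d" by (metis assms(1,2) pow_mat_dim zero_mult_dim(1))
  with z show False by simp
qed

lemma rep_unitE:
  assumes "rep_unit G X f"
  obtains h where "f \<in> rep_hom G X X" "h \<in> rep_hom G X X" "h * f = 1\<^sub>m (fst X)" "f * h = 1\<^sub>m (fst X)"
  using assms unfolding rep_unit_def by auto

text \<open>Locality of the endomorphism ring: after multiplication by the inverse of the sum, the
  two terms add up to 1, and by \<open>fitting\<close> each is a unit or nilpotent; they cannot both
  be nilpotent.\<close>

lemma rep_unit_add:
  assumes X: "indecomposable G X" and a: "a \<in> rep_hom G X X" and b: "b \<in> rep_hom G X X" and u: "rep_unit G X (a + b)"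
  shows "rep_unit G X a \<or> rep_unit G X b"
proof -
  have rX: "is_rep G X" and dX: "fst X > 0" using X by (auto simp: indecomposable_rep)
  from u obtain w where w: "w \<in> rep_hom G X X" "w * (a + b) = 1\<^sub>m (fst X)" "(a + b) * w = 1\<^sub>m (fst X)" by (rule rep_unitE)
  note d[simp] = rep_homD(1,2)[OF a] rep_homD(1,2)[OF b] rep_homD(1,2)[OF w(1)]
  have unit: "rep_unit G X c" if c: "c \<in> rep_hom G X X" and wc: "rep_unit G X (w * c)" for c
  proof -
    from wc obtain x where x: "x \<in> rep_hom G X X" "x * (w * c) = 1\<^sub>m (fst X)" "(w * c) * x = 1\<^sub>m (fst X)" by (rule rep_unitE)
    note dx[simp] = rep_homD(1,2)[OF c] rep_homD(1,2)[OF x(1)]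
    have "c * (x * w) = (a + b) * w * (c * (x * w))" by (simp add: w(3) one_mult_dim)
    also have "\<dots> = (a + b) * ((w * c) * x) * w" by (simp add: mult_assoc_dim)
    also have "\<dots> = 1\<^sub>m (fst X)" using w(3) by (simp add: x(3) one_mult_dim)
    finally have "c * (x * w) = 1\<^sub>m (fst X)" .
    moreover have "(x * w) * c = 1\<^sub>m (fst X)" using x(2) by (simp add: mult_assoc_dim)
    ultimately show ?thesis using c rep_hom_mult[OF rX rX rX w(1) x(1)] unfolding rep_unit_def by (intro conjI bexI[of _ "x * w"])
  qed
  have wa: "w * a \<in> rep_hom G X X" and wb: "w * b \<in> rep_hom G X X" using rep_hom_mult[OF rX rX rX] a b w(1) by blast+
  have s: "w * a + w * b = 1\<^sub>m (fst X)" using w(2) by (simp add: mult_add_dim)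
  show ?thesis
  proof (rule ccontr)
    assume "\<not> ?thesis"
    then obtain k l where "(w * a) ^\<^sub>m k = 0\<^sub>m (fst X) (fst X)" "(w * b) ^\<^sub>m l = 0\<^sub>m (fst X) (fst X)"
      using fitting[OF X wa] fitting[OF X wb] unit[OF a] unit[OF b] by auto
    then show False using not_both_nilpotent[OF _ _ _ _ dX s] by simp
  qed
qed

text \<open>The version of \<open>summand\<close> that carries no complement;
  \<open>idempotent_complement\<close> supplies one when it is asked for. It composes, and it can be
  tested by a unit (\<open>retract_unit\<close>).\<close>

definition retract :: "(nat \<Rightarrow> nat) set \<Rightarrow> 'a::field rep \<Rightarrow> 'a rep \<Rightarrow> bool" where
  "retract G X M \<longleftrightarrow> (\<exists>i\<in>rep_hom G X M. \<exists>p\<in>rep_hom G M X. p * i = 1\<^sub>m (fst X))"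

lemma retractE:
  assumes "retract G X M"
  obtains i p where "i \<in> rep_hom G X M" "p \<in> rep_hom G M X" "p * i = 1\<^sub>m (fst X)"
  using assms unfolding retract_def by auto

lemma retractI: "i \<in> rep_hom G X M \<Longrightarrow> p \<in> rep_hom G M X \<Longrightarrow> p * i = 1\<^sub>m (fst X) \<Longrightarrow> retract G X M"
  unfolding retract_def by auto

lemma retract_refl: "is_rep G X \<Longrightarrow> retract G X X"
  by (rule retractI[of "1\<^sub>m (fst X)" _ _ _ "1\<^sub>m (fst X)"]) (auto simp: rep_hom_one)

lemma retract_trans:
  assumes XM: "retract G X M" and MN: "retract G M N" and X: "is_rep G X" and M: "is_rep G M" and N: "is_rep G N"
  shows "retract G X N"
proof -
  obtain i p where i: "i \<in> rep_hom G X M" and p: "p \<in> rep_hom G M X" and pi: "p * i = 1\<^sub>m (fst X)" using XM by (rule retractE)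
  obtain i' p' where i': "i' \<in> rep_hom G M N" and p': "p' \<in> rep_hom G N M" and pi': "p' * i' = 1\<^sub>m (fst M)" using MN by (rule retractE)
  note d = rep_homD(1,2)[OF i] rep_homD(1,2)[OF p] rep_homD(1,2)[OF i'] rep_homD(1,2)[OF p']
  have "(p * p') * (i' * i) = p * (p' * i') * i" by (simp add: d mult_assoc_dim)
  then have "(p * p') * (i' * i) = 1\<^sub>m (fst X)" by (simp add: pi' pi one_mult_dim d)
  then show ?thesis by (intro retractI[OF rep_hom_mult[OF X M N i i'] rep_hom_mult[OF N M X p' p]])
qed

lemma retract_iso: "rep_iso G X M \<Longrightarrow> is_rep G X \<Longrightarrow> is_rep G M \<Longrightarrow> retract G X M"
  by (erule rep_isoE, assumption, assumption) (rule retractI)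

lemma retract_unit:
  assumes X: "is_rep G X" and M: "is_rep G M" and a: "a \<in> rep_hom G X M" and b: "b \<in> rep_hom G M X" and u: "rep_unit G X (b * a)"
  shows "retract G X M"
proof -
  from u obtain h where h: "h \<in> rep_hom G X X" "h * (b * a) = 1\<^sub>m (fst X)" by (rule rep_unitE)
  have "h * b * a = 1\<^sub>m (fst X)" using h by (simp add: mult_assoc_dim rep_homD(1,2)[OF a] rep_homD(1,2)[OF b] rep_homD(1,2)[OF h(1)])
  then show ?thesis by (intro retractI[OF a rep_hom_mult[OF M X X b h(1)]])
qed

text \<open>\<open>i * p\<close> is an idempotent of \<open>N\<close>, and it is nonzero because
  \<open>p * i = 1\<close> with \<open>X\<close> nonzero; so it is the identity.\<close>

lemma retract_indecomposable_iso:
  assumes X: "indecomposable G X" and N: "indecomposable G N" and r: "retract G X N"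
  shows "rep_iso G X N"
proof -
  have rX: "is_rep G X" and rN: "is_rep G N" using X N by (auto simp: indecomposable_rep)
  obtain i p where i: "i \<in> rep_hom G X N" and p: "p \<in> rep_hom G N X" and pi: "p * i = 1\<^sub>m (fst X)" using r by (rule retractE)
  note d[simp] = rep_homD(1,2)[OF i] rep_homD(1,2)[OF p]
  have "(i * p) * (i * p) = i * (p * i) * p" by (simp add: mult_assoc_dim)
  then have ee: "(i * p) * (i * p) = i * p" by (simp add: pi one_mult_dim)
  have "i * p \<noteq> 0\<^sub>m (fst N) (fst N)"
  proof
    assume z: "i * p = 0\<^sub>m (fst N) (fst N)"
    have "p * i * (p * i) = p * (i * p) * i" by (simp add: mult_assoc_dim)
    then have "1\<^sub>m (fst X) = (0\<^sub>m (fst X) (fst X) :: 'a mat)" by (simp add: z pi zero_mult_dim)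
    then show False using zero_neq_one_mat[of "fst X"] X by (metis indecomposable_rep(2))
  qed
  then have "i * p = 1\<^sub>m (fst N)" using indecomposable_idempotent[OF N rep_hom_mult[OF rN rX rN p i] ee] by blast
  then show ?thesis by (rule rep_isoI[OF rX rN i p pi])
qed

lemma retract_dsum_left: "is_rep G A \<Longrightarrow> is_rep G B \<Longrightarrow> retract G A (dsum A B)"
  by (rule retractI[OF biproduct_homs(1,3)]) (auto simp: biproduct_mats)

text \<open>The identity of \<open>X\<close> is the sum of two endomorphisms, one through
  \<open>A\<close> and one through \<open>B\<close>; by locality one of them is a unit.\<close>

lemma retract_of_dsum:
  assumes X: "indecomposable G X" and M: "is_rep G M" and A: "is_rep G A" and B: "is_rep G B"
    and r: "retract G X M" and iso: "rep_iso G M (dsum A B)"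
  shows "retract G X A \<or> retract G X B"
proof -
  have rX: "is_rep G X" using X by (simp add: indecomposable_rep)
  obtain i p where i: "i \<in> rep_hom G X M" and p: "p \<in> rep_hom G M X" and pi: "p * i = 1\<^sub>m (fst X)" using r by (rule retractE)
  obtain iA pA iB pB where h: "iA \<in> rep_hom G A M" "pA \<in> rep_hom G M A" "iB \<in> rep_hom G B M" "pB \<in> rep_hom G M B"
    and s: "iA * pA + iB * pB = 1\<^sub>m (fst M)" by (rule biproductE[OF iso M A B])
  note d[simp] = rep_homD(1,2)[OF i] rep_homD(1,2)[OF p] rep_homD(1,2)[OF h(1)] rep_homD(1,2)[OF h(2)] rep_homD(1,2)[OF h(3)] rep_homD(1,2)[OF h(4)]
  let ?a = "(p * iA) * (pA * i)" and ?b = "(p * iB) * (pB * i)"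
  note hh = rep_hom_mult[OF A M rX h(1) p] rep_hom_mult[OF rX M A i h(2)] rep_hom_mult[OF B M rX h(3) p] rep_hom_mult[OF rX M B i h(4)]
  have "?a + ?b = p * (iA * pA + iB * pB) * i" by (simp add: mult_add_dim add_mult_dim mult_assoc_dim)
  also have "\<dots> = 1\<^sub>m (fst X)" by (simp add: s one_mult_dim pi)
  finally have ab: "?a + ?b = 1\<^sub>m (fst X)" .
  then have "rep_unit G X (?a + ?b)" unfolding rep_unit_def using rep_hom_one[OF rX] by (auto intro!: bexI[of _ "1\<^sub>m (fst X)"])
  from rep_unit_add[OF X rep_hom_mult[OF rX A rX hh(2,1)] rep_hom_mult[OF rX B rX hh(4,3)] this]
  show ?thesis using retract_unit[OF rX A hh(2,1)] retract_unit[OF rX B hh(4,3)] by blast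
qed

lemma is_rep_zero_rep: "is_rep G zero_rep"
  by (auto simp: is_rep_def zero_rep_def)

lemma dsum_list_simps [simp]: "dsum_list [] = zero_rep" "dsum_list (N # Ns) = dsum N (dsum_list Ns)"
  by (auto simp: dsum_list_def)

lemma is_rep_dsum_list: "\<forall>N\<in>set Ns. is_rep G N \<Longrightarrow> is_rep G (dsum_list Ns)"
  by (induction Ns) (auto simp: is_rep_zero_rep is_rep_dsum)

lemma retract_zero_dim: "retract G X M \<Longrightarrow> fst M = 0 \<Longrightarrow> fst X = 0"
  by (erule retractE) (metis carrier_matI le_zero_eq rep_homD(1,2) section_dim_le)

lemma retract_of_dsum_list:
  assumes X: "indecomposable G X" and r: "retract G X (dsum_list Ns)" and Ns: "\<forall>N\<in>set Ns. is_rep G N"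
  shows "\<exists>N\<in>set Ns. retract G X N"
  using r Ns
proof (induction Ns)
  case Nil
  then have "fst X = 0" using retract_zero_dim by (fastforce simp: zero_rep_def)
  then show ?case using X by (simp add: indecomposable_def)
next
  case (Cons N Ns)
  have N: "is_rep G N" "is_rep G (dsum_list Ns)" using Cons.prems is_rep_dsum_list[of Ns G] by auto
  have "retract G X N \<or> retract G X (dsum_list Ns)"
    by (rule retract_of_dsum[OF X is_rep_dsum[OF N] N]) (use Cons.prems rep_iso_refl[OF is_rep_dsum[OF N]] in auto)
  then show ?case using Cons by auto
qed

lemma dsum_cong:
  assumes "rep_iso G A A'" "rep_iso G B B'" and A: "is_rep G A" and A': "is_rep G A'" and B: "is_rep G B" and B': "is_rep G B'"
  shows "rep_iso G (dsum A B) (dsum A' B')"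
proof -
  obtain f h where f: "f \<in> rep_hom G A A'" "h \<in> rep_hom G A' A" "h * f = 1\<^sub>m (fst A)" "f * h = 1\<^sub>m (fst A')"
    by (rule rep_isoE[OF assms(1) A A'])
  obtain f' h' where f': "f' \<in> rep_hom G B B'" "h' \<in> rep_hom G B' B" "h' * f' = 1\<^sub>m (fst B)" "f' * h' = 1\<^sub>m (fst B')"
    by (rule rep_isoE[OF assms(2) B B'])
  note d[simp] = rep_homD(1,2)[OF f(1)] rep_homD(1,2)[OF f(2)] rep_homD(1,2)[OF f'(1)] rep_homD(1,2)[OF f'(2)]
  note D = is_rep_dsum[OF A B] and H = biproduct_homs[OF A B]
  let ?il = "inl_mat (fst A) (fst B) :: 'a mat" and ?ir = "inr_mat (fst A) (fst B) :: 'a mat"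
  let ?pl = "prl_mat (fst A) (fst B) :: 'a mat" and ?pr = "prr_mat (fst A) (fst B) :: 'a mat"
  have m: "(f * ?pl) * (?il * h) = f * (?pl * ?il) * h" "(f' * ?pr) * (?ir * h') = f' * (?pr * ?ir) * h'"
    "(f * ?pl) * (?ir * h') = f * (?pl * ?ir) * h'" "(f' * ?pr) * (?il * h) = f' * (?pr * ?il) * h"
    "(?il * h) * (f * ?pl) = ?il * (h * f) * ?pl" "(?ir * h') * (f' * ?pr) = ?ir * (h' * f') * ?pr"
    by (simp_all add: mult_assoc_dim)
  show ?thesis
  proof (rule biproduct_iso[OF D A' B'])
    show "?il * h \<in> rep_hom G A' (dsum A B)" by (rule rep_hom_mult[OF A' A D f(2) H(1)])
    show "f * ?pl \<in> rep_hom G (dsum A B) A'" by (rule rep_hom_mult[OF D A A' H(3) f(1)])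
    show "?ir * h' \<in> rep_hom G B' (dsum A B)" by (rule rep_hom_mult[OF B' B D f'(2) H(2)])
    show "f' * ?pr \<in> rep_hom G (dsum A B) B'" by (rule rep_hom_mult[OF D B B' H(4) f'(1)])
  qed (simp_all add: m biproduct_mats f(3,4) f'(3,4) one_mult_dim zero_mult_dim, simp add: dsum_def)
qed

lemma dsum_list_cong:
  assumes "list_all2 (rep_iso G) Ns Ns'" "\<forall>N\<in>set Ns. is_rep G N" "\<forall>N\<in>set Ns'. is_rep G N"
  shows "rep_iso G (dsum_list Ns) (dsum_list Ns')"
  using assms
  by (induction rule: list_all2_induct) (auto simp: rep_iso_refl is_rep_zero_rep is_rep_dsum_list intro!: dsum_cong)

text \<open>A nonzero retract of least dimension is indecomposable, since a proper summand of it
  would be a smaller retract. Splitting it off leaves a module of smaller dimension.\<close>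

lemma decomposition_exists:
  assumes "is_rep G M"
  shows "\<exists>Ns. (\<forall>N\<in>set Ns. indecomposable G N) \<and> rep_iso G M (dsum_list Ns)"
  using assms
proof (induction "fst M" arbitrary: M rule: less_induct)
  case less
  note M = less.prems
  show ?case
  proof (cases "fst M = 0")
    case True
    have "rep_iso G M zero_rep"
      by (rule rep_isoI[OF M is_rep_zero_rep, of "0\<^sub>m 0 0" "0\<^sub>m 0 0"])
        (use True is_repD(1,2)[OF M] in \<open>auto simp: rep_hom_def zero_rep_def intro!: eq_matI\<close>)
    then show ?thesis by (intro exI[of _ "[]"]) simp
  next
    case False
    define Q where "Q d \<longleftrightarrow> (\<exists>A. is_rep G A \<and> fst A = d \<and> d > 0 \<and> retract G A M)" for d
    have "Q (fst M)" unfolding Q_def using M False retract_refl[OF M] by blast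
    then have "Q (LEAST d. Q d)" by (rule LeastI)
    then obtain A where A: "is_rep G A" "fst A = (LEAST d. Q d)" "fst A > 0" "retract G A M" unfolding Q_def by auto
    have ind: "indecomposable G A"
    proof (rule ccontr)
      assume "\<not> indecomposable G A"
      then obtain A1 A2 where A12: "is_rep G A1" "is_rep G A2" "fst A1 > 0" "fst A2 > 0" "rep_iso G A (dsum A1 A2)"
        unfolding indecomposable_def using A by auto
      have "retract G A1 A"
        by (rule retract_trans[OF retract_dsum_left[OF A12(1,2)]])
          (auto intro!: retract_iso rep_iso_sym A A12 is_rep_dsum)
      then have "retract G A1 M" by (rule retract_trans[OF _ A(4) A12(1) A(1) M])
      then have "Q (fst A1)" unfolding Q_def using A12 by blast
      then have "fst A \<le> fst A1" unfolding A(2) by (rule Least_le)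
      moreover have "fst A = fst A1 + fst A2" using A12(5) by (simp add: rep_iso_def dsum_def)
      ultimately show False using A12 by simp
    qed
    obtain i p where "i \<in> rep_hom G A M" "p \<in> rep_hom G M A" "p * i = 1\<^sub>m (fst A)" using A(4) by (rule retractE)
    then obtain Z where Z: "is_rep G Z" "rep_iso G M (dsum A Z)" by (rule idempotent_complement[OF M A(1)])
    have "fst M = fst A + fst Z" using Z(2) by (simp add: rep_iso_def dsum_def)
    then have "fst Z < fst M" using A by simp
    from less.hyps[OF this Z(1)] obtain Ns where Ns: "\<forall>N\<in>set Ns. indecomposable G N" "rep_iso G Z (dsum_list Ns)" by blast
    have rN: "is_rep G (dsum_list Ns)" using Ns(1) by (intro is_rep_dsum_list) (auto simp: indecomposable_rep)
    have "rep_iso G M (dsum A (dsum_list Ns))"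
      by (rule rep_iso_trans[OF Z(2) dsum_cong[OF rep_iso_refl[OF A(1)] Ns(2) A(1) A(1) Z(1) rN] M is_rep_dsum[OF A(1) Z(1)] is_rep_dsum[OF A(1) rN]])
    then show ?thesis using ind Ns(1) by (intro exI[of _ "A # Ns"]) auto
  qed
qed

definition msum :: "nat \<Rightarrow> 'a::field mat list \<Rightarrow> 'a mat" where
  "msum d xs = foldr (+) xs (0\<^sub>m d d)"

lemma msum_simps [simp]: "msum d [] = 0\<^sub>m d d" "msum d (x # xs) = x + msum d xs"
  by (auto simp: msum_def)

lemma msum_dim: "dim_row (msum d xs) = d \<and> dim_col (msum d xs) = d"
  by (induction xs) auto

lemma msum_sandwich:
  fixes A B :: "'a::field mat"
  assumes "\<forall>x\<in>set xs. dim_row x = d \<and> dim_col x = d" "dim_col A = d" "dim_row B = d" "dim_row A = e" "dim_col B = e"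
  shows "A * msum d xs * B = msum e (map (\<lambda>x. A * x * B) xs)"
  using assms(1) by (induction xs) (auto simp: assms(2-) zero_mult_dim mult_add_dim add_mult_dim msum_dim)

text \<open>The coordinate maps are indexed by positions in the list, because the same module may
  occur several times.\<close>

lemma dsum_list_maps:
  assumes "rep_iso G M (dsum_list Ns)" "is_rep G M" "\<forall>N\<in>set Ns. is_rep G N"
  shows "\<exists>I P. (\<forall>k<length Ns. I k \<in> rep_hom G (Ns ! k) M \<and> P k \<in> rep_hom G M (Ns ! k) \<and> P k * I k = 1\<^sub>m (fst (Ns ! k))
        \<and> (\<forall>l<length Ns. l \<noteq> k \<longrightarrow> P k * I l = 0\<^sub>m (fst (Ns ! k)) (fst (Ns ! l))))
     \<and> msum (fst M) (map (\<lambda>k. I k * P k) [0..<length Ns]) = 1\<^sub>m (fst M)"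
  using assms
proof (induction Ns arbitrary: M)
  case Nil
  then have "fst M = 0" by (simp add: rep_iso_def zero_rep_def)
  then show ?case by (auto intro!: eq_matI)
next
  case (Cons N Ns)
  note M = Cons.prems(2)
  have N: "is_rep G N" and R: "is_rep G (dsum_list Ns)" using Cons.prems is_rep_dsum_list[of Ns G] by auto
  obtain i p i' p' where h: "i \<in> rep_hom G N M" "p \<in> rep_hom G M N" "i' \<in> rep_hom G (dsum_list Ns) M" "p' \<in> rep_hom G M (dsum_list Ns)"
    "p * i = 1\<^sub>m (fst N)" "p' * i' = 1\<^sub>m (fst (dsum_list Ns))" "p * i' = 0\<^sub>m (fst N) (fst (dsum_list Ns))"
    "p' * i = 0\<^sub>m (fst (dsum_list Ns)) (fst N)" "i * p + i' * p' = 1\<^sub>m (fst M)"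
    by (rule biproductE[OF Cons.prems(1)[unfolded dsum_list_simps] M N R])
  note d[simp] = rep_homD(1,2)[OF h(1)] rep_homD(1,2)[OF h(2)] rep_homD(1,2)[OF h(3)] rep_homD(1,2)[OF h(4)]
  obtain I P where IP: "\<forall>k<length Ns. I k \<in> rep_hom G (Ns ! k) (dsum_list Ns) \<and> P k \<in> rep_hom G (dsum_list Ns) (Ns ! k) \<and> P k * I k = 1\<^sub>m (fst (Ns ! k))
        \<and> (\<forall>l<length Ns. l \<noteq> k \<longrightarrow> P k * I l = 0\<^sub>m (fst (Ns ! k)) (fst (Ns ! l)))"
     and s: "msum (fst (dsum_list Ns)) (map (\<lambda>k. I k * P k) [0..<length Ns]) = 1\<^sub>m (fst (dsum_list Ns))"
    using Cons.IH[OF rep_iso_refl[OF R] R] Cons.prems(3) by auto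
  have dI: "dim_row (I k) = fst (dsum_list Ns)" "dim_col (I k) = fst (Ns ! k)" "dim_row (P k) = fst (Ns ! k)" "dim_col (P k) = fst (dsum_list Ns)"
    if "k < length Ns" for k using IP that rep_homD(1,2) by blast+
  define I' where "I' k = (case k of 0 \<Rightarrow> i | Suc k \<Rightarrow> i' * I k)" for k
  define P' where "P' k = (case k of 0 \<Rightarrow> p | Suc k \<Rightarrow> P k * p')" for k
  have hm: "i' * I k \<in> rep_hom G (Ns ! k) M" "P k * p' \<in> rep_hom G M (Ns ! k)" if "k < length Ns" for k
    using that IP Cons.prems(3) by (auto intro!: rep_hom_mult[OF _ R M _ h(3)] rep_hom_mult[OF M R _ h(4)])
  have mm: "P k * p' * (i' * I l) = P k * I l" if "k < length Ns" "l < length Ns" for k l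
  proof -
    have "P k * p' * (i' * I l) = P k * (p' * i') * I l" using dI that by (simp add: mult_assoc_dim)
    then show ?thesis using dI that by (simp add: h(6) one_mult_dim)
  qed
  have m0: "p * (i' * I l) = 0\<^sub>m (fst N) (fst (Ns ! l))" "P l * p' * i = 0\<^sub>m (fst (Ns ! l)) (fst N)" if "l < length Ns" for l
  proof -
    have "p * (i' * I l) = (p * i') * I l" "P l * p' * i = P l * (p' * i)" using dI that by (simp_all add: mult_assoc_dim)
    then show "p * (i' * I l) = 0\<^sub>m (fst N) (fst (Ns ! l))" "P l * p' * i = 0\<^sub>m (fst (Ns ! l)) (fst N)"
      using dI that by (simp_all add: h(7,8) zero_mult_dim)
  qed
  have c1: "\<forall>k<length (N # Ns). I' k \<in> rep_hom G ((N # Ns) ! k) M \<and> P' k \<in> rep_hom G M ((N # Ns) ! k) \<and> P' k * I' k = 1\<^sub>m (fst ((N # Ns) ! k))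
        \<and> (\<forall>l<length (N # Ns). l \<noteq> k \<longrightarrow> P' k * I' l = 0\<^sub>m (fst ((N # Ns) ! k)) (fst ((N # Ns) ! l)))"
    using IP by (auto simp: I'_def P'_def h hm mm m0 less_Suc_eq_0_disj split: nat.splits)
  have "map (\<lambda>k. I' k * P' k) [0..<length (N # Ns)] = i * p # map (\<lambda>k. i' * I k * (P k * p')) [0..<length Ns]"
    by (simp add: I'_def P'_def upt_conv_Cons map_Suc_upt[symmetric] del: upt_Suc)
  also have "map (\<lambda>k. i' * I k * (P k * p')) [0..<length Ns] = map (\<lambda>x. i' * x * p') (map (\<lambda>k. I k * P k) [0..<length Ns])"
    using dI by (simp add: mult_assoc_dim)
  finally have "msum (fst M) (map (\<lambda>k. I' k * P' k) [0..<length (N # Ns)])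
     = i * p + i' * msum (fst (dsum_list Ns)) (map (\<lambda>k. I k * P k) [0..<length Ns]) * p'"
    using dI by (subst msum_sandwich[where e="fst M"]) auto
  also have "\<dots> = 1\<^sub>m (fst M)" unfolding s by (simp add: one_mult_dim h(9))
  finally show ?case using c1 by blast
qed

section \<open>Characters of endomorphism rings and the summands they detect\<close>

definition rep_character :: "(nat \<Rightarrow> nat) set \<Rightarrow> 'a::field rep \<Rightarrow> ('a mat \<Rightarrow> 'a) \<Rightarrow> bool" where
  "rep_character G M \<phi> \<longleftrightarrow> \<phi> (1\<^sub>m (fst M)) = 1 \<and>
    (\<forall>A\<in>rep_hom G M M. \<forall>B\<in>rep_hom G M M. \<phi> (A + B) = \<phi> A + \<phi> B \<and> \<phi> (A * B) = \<phi> A * \<phi> B)"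

lemma character_zero:
  assumes M: "is_rep G M" and \<phi>: "rep_character G M \<phi>"
  shows "\<phi> (0\<^sub>m (fst M) (fst M)) = 0"
proof -
  have z: "0\<^sub>m (fst M) (fst M) \<in> rep_hom G M M" by (rule rep_hom_zero[OF M M])
  have "\<phi> (0\<^sub>m (fst M) (fst M) + 0\<^sub>m (fst M) (fst M)) = \<phi> (0\<^sub>m (fst M) (fst M)) + \<phi> (0\<^sub>m (fst M) (fst M))"
    using \<phi> z unfolding rep_character_def by blast
  moreover have "0\<^sub>m (fst M) (fst M) + 0\<^sub>m (fst M) (fst M) = (0\<^sub>m (fst M) (fst M) :: 'a mat)" by simp
  ultimately show ?thesis by (metis add_cancel_right_right)
qed

lemma character_msum:
  assumes M: "is_rep G M" and \<phi>: "rep_character G M \<phi>" and "\<forall>x\<in>set xs. x \<in> rep_hom G M M"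
  shows "msum (fst M) xs \<in> rep_hom G M M \<and> \<phi> (msum (fst M) xs) = (\<Sum>x\<leftarrow>xs. \<phi> x)"
  using assms(3)
proof (induction xs)
  case Nil
  then show ?case using rep_hom_zero[OF M M] character_zero[OF M \<phi>] by simp
next
  case (Cons x xs)
  then show ?case using \<phi> rep_hom_add[OF M M, of x "msum (fst M) xs"] unfolding rep_character_def by auto
qed

text \<open>Carried back to \<open>M\<close>, the \<open>k\<close>-th power of
  \<open>p * f * i\<close> has the value \<open>\<phi> (i * p)\<close> times the \<open>k\<close>-th
  power of \<open>\<phi> f * \<phi> (i * p)\<close>, which is nonzero. So the endomorphism of
  \<open>X\<close> is not nilpotent, and \<open>fitting\<close> makes it a unit.\<close>

lemma character_unit:
  assumes M: "is_rep G M" and \<phi>: "rep_character G M \<phi>" and X: "indecomposable G X"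
    and i: "i \<in> rep_hom G X M" and p: "p \<in> rep_hom G M X" and f: "f \<in> rep_hom G M M"
    and pi: "p * i = 1\<^sub>m (fst X)" and ne: "\<phi> (i * p) \<noteq> 0" "\<phi> f \<noteq> 0"
  shows "rep_unit G X (p * f * i)"
proof -
  have rX: "is_rep G X" using X by (simp add: indecomposable_rep)
  note d[simp] = rep_homD(1,2)[OF i] rep_homD(1,2)[OF p] rep_homD(1,2)[OF f]
  let ?g = "p * f * i"
  have g: "?g \<in> rep_hom G X X" by (intro rep_hom_mult[OF rX M rX i] rep_hom_mult[OF M M rX f] p)
  note dg = rep_homD(1,2)[OF g]
  have ip: "i * p \<in> rep_hom G M M" by (rule rep_hom_mult[OF M rX M p i])
  have mul: "\<phi> (A * B) = \<phi> A * \<phi> B" if "A \<in> rep_hom G M M" "B \<in> rep_hom G M M" for A B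
    using that \<phi> unfolding rep_character_def by blast
  have pw: "i * ?g ^\<^sub>m k * p \<in> rep_hom G M M \<and> \<phi> (i * ?g ^\<^sub>m k * p) \<noteq> 0" for k
  proof (induction k)
    case 0
    then show ?case using ip ne by (simp add: one_mult_dim dg)
  next
    case (Suc k)
    have "i * ?g ^\<^sub>m Suc k * p = (i * ?g ^\<^sub>m k * p) * (f * (i * p))"
      using dg by (simp add: mult_assoc_dim)
    then show ?case using Suc ne mul[OF f ip] mul[OF _ rep_hom_mult[OF M M M ip f]] rep_hom_mult[OF M M M rep_hom_mult[OF M M M ip f]]
      by auto
  qed
  have "?g ^\<^sub>m k \<noteq> 0\<^sub>m (fst X) (fst X)" for k
  proof
    assume "?g ^\<^sub>m k = 0\<^sub>m (fst X) (fst X)"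
    then have "i * ?g ^\<^sub>m k * p = 0\<^sub>m (fst M) (fst M)" by (simp add: zero_mult_dim)
    then show False using pw[of k] character_zero[OF M \<phi>] by simp
  qed
  then show ?thesis using fitting[OF X g] by blast
qed

lemma sum_01_unique:
  fixes c :: "nat \<Rightarrow> 'a::field"
  assumes "\<And>k. k < n \<Longrightarrow> c k * c k = c k" "\<And>k l. k < n \<Longrightarrow> l < n \<Longrightarrow> k \<noteq> l \<Longrightarrow> c k * c l = 0"
    and s: "(\<Sum>k<n. c k) = 1"
  shows "\<exists>k0<n. \<forall>k<n. c k = (if k = k0 then 1 else 0)"
proof -
  obtain k0 where k0: "k0 < n" "c k0 \<noteq> 0" using s by (metis lessThan_iff sum.neutral zero_neq_one)
  then have "c k0 = 1" using assms(1)[of k0] by simp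
  moreover have "c k = 0" if "k < n" "k \<noteq> k0" for k using assms(2)[of k0 k] that k0 by auto
  ultimately show ?thesis using k0 by auto
qed

text \<open>The projections to the summands are orthogonal idempotents with sum 1, and
  \<open>\<phi>\<close> maps them to such a family in a field, where exactly one member is
  1.\<close>

lemma character_component:
  assumes M: "is_rep G M" and \<phi>: "rep_character G M \<phi>" and iso: "rep_iso G M (dsum_list Ns)" and Ns: "\<forall>N\<in>set Ns. indecomposable G N"
  obtains I P k0 where "k0 < length Ns"
    "\<forall>k<length Ns. I k \<in> rep_hom G (Ns ! k) M \<and> P k \<in> rep_hom G M (Ns ! k) \<and> P k * I k = 1\<^sub>m (fst (Ns ! k))
      \<and> \<phi> (I k * P k) = (if k = k0 then 1 else 0)"
proof -
  have rN: "\<forall>N\<in>set Ns. is_rep G N" using Ns by (auto simp: indecomposable_rep)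
  obtain I P where IP: "\<forall>k<length Ns. I k \<in> rep_hom G (Ns ! k) M \<and> P k \<in> rep_hom G M (Ns ! k) \<and> P k * I k = 1\<^sub>m (fst (Ns ! k))
        \<and> (\<forall>l<length Ns. l \<noteq> k \<longrightarrow> P k * I l = 0\<^sub>m (fst (Ns ! k)) (fst (Ns ! l)))"
     and s: "msum (fst M) (map (\<lambda>k. I k * P k) [0..<length Ns]) = 1\<^sub>m (fst M)"
    using dsum_list_maps[OF iso M rN] by auto
  have h: "I k \<in> rep_hom G (Ns ! k) M" "P k \<in> rep_hom G M (Ns ! k)" "P k * I k = 1\<^sub>m (fst (Ns ! k))" "is_rep G (Ns ! k)" if "k < length Ns" for k
    using IP that rN by auto
  have dI: "dim_row (I k) = fst M" "dim_col (I k) = fst (Ns ! k)" "dim_row (P k) = fst (Ns ! k)" "dim_col (P k) = fst M"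
    if "k < length Ns" for k using h that rep_homD(1,2) by blast+
  have e: "I k * P k \<in> rep_hom G M M" if "k < length Ns" for k by (rule rep_hom_mult[OF M h(4) M h(2) h(1)]) (use that in auto)
  have mul: "\<phi> (A * B) = \<phi> A * \<phi> B" if "A \<in> rep_hom G M M" "B \<in> rep_hom G M M" for A B
    using that \<phi> unfolding rep_character_def by blast
  have ee: "I k * P k * (I l * P l) = I k * (P k * I l) * P l" if "k < length Ns" "l < length Ns" for k l
    using dI that by (simp add: mult_assoc_dim)
  have 1: "\<phi> (I k * P k) * \<phi> (I k * P k) = \<phi> (I k * P k)" if "k < length Ns" for k
    unfolding mul[OF e[OF that] e[OF that], symmetric] ee[OF that that] using dI that h(3) by (simp add: one_mult_dim)
  have 2: "\<phi> (I k * P k) * \<phi> (I l * P l) = 0" if "k < length Ns" "l < length Ns" "k \<noteq> l" for k l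
    unfolding mul[OF e[OF that(1)] e[OF that(2)], symmetric] ee[OF that(1,2)] using dI that IP character_zero[OF M \<phi>] by (auto simp: zero_mult_dim)
  have "(\<Sum>k<length Ns. \<phi> (I k * P k)) = (\<Sum>x\<leftarrow>map (\<lambda>k. I k * P k) [0..<length Ns]. \<phi> x)"
    by (simp add: sum_list_sum_nth lessThan_atLeast0)
  also have "\<dots> = \<phi> (1\<^sub>m (fst M))" using character_msum[OF M \<phi>, of "map (\<lambda>k. I k * P k) [0..<length Ns]"] e s by auto
  finally have "(\<Sum>k<length Ns. \<phi> (I k * P k)) = 1" using \<phi> by (simp add: rep_character_def)
  from sum_01_unique[of "length Ns" "\<lambda>k. \<phi> (I k * P k)", OF 1 2 this] obtain k0 where
    "k0 < length Ns" "\<And>k. k < length Ns \<Longrightarrow> \<phi> (I k * P k) = (if k = k0 then 1 else 0)" by auto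
  then show ?thesis using that[of k0 I P] h by simp
qed

text \<open>\<open>\<phi> (a b) = \<phi> (b a)\<close> makes the value of \<open>\<phi>\<close> on the projection to a summand depend on its
  isomorphism type only.\<close>
lemma character_mult_one:
  assumes M: "is_rep G M" and \<phi>: "rep_character G M \<phi>" and Y: "indecomposable G Y"
    and i: "i \<in> rep_hom G Y M" and p: "p \<in> rep_hom G M Y" and pi: "p * i = 1\<^sub>m (fst Y)" and ne: "\<phi> (i * p) \<noteq> 0"
  shows "mult G M Y = 1"
proof -
  have rY: "is_rep G Y" using Y by (simp add: indecomposable_rep)
  note d[simp] = rep_homD(1,2)[OF i] rep_homD(1,2)[OF p]
  have mul: "\<phi> (A * B) = \<phi> A * \<phi> B" if "A \<in> rep_hom G M M" "B \<in> rep_hom G M M" for A B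
    using that \<phi> unfolding rep_character_def by blast
  \<comment> \<open>\<open>mult\<close> picks some count by \<open>SOME\<close>; the count is
    therefore determined for every decomposition at once.\<close>
  have one: "length (filter (\<lambda>X. rep_iso G X Y) Ns) = 1"
    if Ns: "\<forall>X\<in>set Ns. indecomposable G X" and iso: "rep_iso G M (dsum_list Ns)" for Ns
  proof -
    obtain I P k0 where k0: "k0 < length Ns" and
      IP: "\<forall>k<length Ns. I k \<in> rep_hom G (Ns ! k) M \<and> P k \<in> rep_hom G M (Ns ! k) \<and> P k * I k = 1\<^sub>m (fst (Ns ! k))
      \<and> \<phi> (I k * P k) = (if k = k0 then 1 else 0)"
      by (rule character_component[OF M \<phi> iso Ns])
    have h: "I k \<in> rep_hom G (Ns ! k) M" "P k \<in> rep_hom G M (Ns ! k)" and PI: "P k * I k = 1\<^sub>m (fst (Ns ! k))"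
      and v: "\<phi> (I k * P k) = (if k = k0 then 1 else 0)" if "k < length Ns" for k using IP that by auto
    have iff: "rep_iso G (Ns ! k) Y \<longleftrightarrow> k = k0" if k: "k < length Ns" for k
    proof
      have N: "indecomposable G (Ns ! k)" and rN: "is_rep G (Ns ! k)" using Ns k by (auto simp: indecomposable_rep)
      note dk[simp] = rep_homD(1,2)[OF h(1)[OF k]] rep_homD(1,2)[OF h(2)[OF k]]
      {
        assume "rep_iso G (Ns ! k) Y"
        then obtain f g where f: "f \<in> rep_hom G (Ns ! k) Y" and g: "g \<in> rep_hom G Y (Ns ! k)" and gf: "g * f = 1\<^sub>m (fst (Ns ! k))" "f * g = 1\<^sub>m (fst Y)"
          by (rule rep_isoE[OF _ rN rY])
        note df[simp] = rep_homD(1,2)[OF f] rep_homD(1,2)[OF g]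
        let ?a = "(i * f) * P k" and ?b = "(I k * g) * p"
        have a: "?a \<in> rep_hom G M M" by (rule rep_hom_mult[OF M rN M h(2)[OF k] rep_hom_mult[OF rN rY M f i]])
        have b: "?b \<in> rep_hom G M M" by (rule rep_hom_mult[OF M rY M p rep_hom_mult[OF rY rN M g h(1)[OF k]]])
        have "?a * ?b = i * (f * (P k * I k) * g) * p" by (simp add: mult_assoc_dim)
        then have ab: "?a * ?b = i * p" by (simp add: PI[OF k] one_mult_dim gf)
        have "?b * ?a = I k * (g * (p * i) * f) * P k" by (simp add: mult_assoc_dim)
        then have ba: "?b * ?a = I k * P k" by (simp add: pi one_mult_dim gf)
        have "\<phi> (I k * P k) = \<phi> (i * p)" unfolding ab[symmetric] ba[symmetric] mul[OF a b] mul[OF b a] by (rule mult.commute)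
        then show "k = k0" using v[OF k] ne by (auto split: if_splits)
      }
      {
        \<comment> \<open>\<open>\<phi>\<close> is nonzero on the projections to \<open>Y\<close>
          and to the \<open>k0\<close>-th summand, so passing from \<open>Y\<close> to that summand
          and back is a unit.\<close>
        assume kk: "k = k0"
        have e: "I k * P k \<in> rep_hom G M M" by (rule rep_hom_mult[OF M rN M h(2)[OF k] h(1)[OF k]])
        have "rep_unit G Y (p * (I k * P k) * i)"
          by (rule character_unit[OF M \<phi> Y i p e pi ne]) (use v[OF k] kk in simp)
        then have "rep_unit G Y ((p * I k) * (P k * i))" by (simp add: mult_assoc_dim)
        from retract_unit[OF rY rN rep_hom_mult[OF rY M rN i h(2)[OF k]] rep_hom_mult[OF rN M rY h(1)[OF k] p] this]
        have "retract G Y (Ns ! k)" .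
        from retract_indecomposable_iso[OF Y N this] show "rep_iso G (Ns ! k) Y" by (rule rep_iso_sym[OF _ rY rN])
      }
    qed
    have "length (filter (\<lambda>X. rep_iso G X Y) Ns) = card {k. k < length Ns \<and> rep_iso G (Ns ! k) Y}"
      by (rule length_filter_conv_card)
    also have "{k. k < length Ns \<and> rep_iso G (Ns ! k) Y} = {k0}" using iff k0 by auto
    finally show ?thesis by simp
  qed
  obtain Ns where "\<forall>N\<in>set Ns. indecomposable G N" "rep_iso G M (dsum_list Ns)" using decomposition_exists[OF M] by blast
  then have "\<exists>Ns. (\<forall>X\<in>set Ns. indecomposable G X) \<and> rep_iso G M (dsum_list Ns) \<and> 1 = length (filter (\<lambda>X. rep_iso G X Y) Ns)"
    using one by auto
  then have "\<exists>Ns. (\<forall>X\<in>set Ns. indecomposable G X) \<and> rep_iso G M (dsum_list Ns) \<and> mult G M Y = length (filter (\<lambda>X. rep_iso G X Y) Ns)"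
    unfolding mult_def by (rule someI)
  then show ?thesis using one by auto
qed

section \<open>Signed words and equivariant kernels\<close>

declare One_nat_def [simp del]

section \<open>Signs of bijections between finite sets of numbers\<close>

definition ordered_pairs :: "nat set \<Rightarrow> (nat \<times> nat) set" where
  "ordered_pairs S = {(x,y). x \<in> S \<and> y \<in> S \<and> x < y}"

text \<open>The sign of \<open>g\<close> as a bijection from \<open>S\<close> to \<open>g ` S\<close>, both in their natural order, so that \<open>g ` S = S\<close> is not required.\<close>
definition osgn :: "nat set \<Rightarrow> (nat \<Rightarrow> nat) \<Rightarrow> int" where
  "osgn S g = (\<Prod>(x,y)\<in>ordered_pairs S. if g x < g y then 1 else - 1)"

lemma finite_ordered_pairs: "finite S \<Longrightarrow> finite (ordered_pairs S)"
  by (rule finite_subset[of _ "S \<times> S"]) (auto simp: ordered_pairs_def)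

text \<open>\<open>F\<close> sends a pair to its image under \<open>h\<close> put in increasing
  order. It is a bijection of pairs, and under it the signs multiply pair by pair: sorting the image
  costs exactly the factor of \<open>h\<close>.\<close>

lemma osgn_comp:
  assumes h: "inj_on h S" and g: "inj_on g (h ` S)"
  shows "osgn S (g \<circ> h) = osgn (h ` S) g * osgn S h"
proof -
  define F where "F = (\<lambda>(x,y). (min (h x) (h y), max (h x) (h y)))"
  have bij: "bij_betw F (ordered_pairs S) (ordered_pairs (h ` S))"
  proof (rule bij_betw_imageI)
    show "inj_on F (ordered_pairs S)"
    proof (rule inj_onI, clarify)
      fix a b c d assume ab: "(a,b) \<in> ordered_pairs S" "(c,d) \<in> ordered_pairs S" "F (a,b) = F (c,d)"
      then have "{h a, h b} = {h c, h d}" by (auto simp: F_def min_def max_def split: if_splits)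
      then have "h ` {a,b} = h ` {c,d}" by simp
      then have "{a,b} = {c,d}" using h ab by (subst (asm) inj_on_image_eq_iff[of h S]) (auto simp: ordered_pairs_def)
      then show "a = c \<and> b = d" using ab by (auto simp: ordered_pairs_def doubleton_eq_iff)
    qed
    show "F ` ordered_pairs S = ordered_pairs (h ` S)"
    proof
      show "F ` ordered_pairs S \<subseteq> ordered_pairs (h ` S)"
      proof
        fix z assume "z \<in> F ` ordered_pairs S"
        then obtain x y where xy: "x \<in> S" "y \<in> S" "x < y" "z = F (x,y)" by (auto simp: ordered_pairs_def)
        then have "h x \<noteq> h y" using h by (auto dest: inj_onD)
        then show "z \<in> ordered_pairs (h ` S)" using xy by (auto simp: F_def ordered_pairs_def min_def max_def)
      qed
      show "ordered_pairs (h ` S) \<subseteq> F ` ordered_pairs S"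
      proof
        fix z assume "z \<in> ordered_pairs (h ` S)"
        then obtain x y where xy: "x \<in> S" "y \<in> S" "h x < h y" "z = (h x, h y)" by (auto simp: ordered_pairs_def)
        then have "x \<noteq> y" by auto
        then have "(x < y \<and> z = F (x,y)) \<or> (y < x \<and> z = F (y,x))" using xy by (auto simp: F_def min_def max_def)
        then show "z \<in> F ` ordered_pairs S" using xy by (auto simp: ordered_pairs_def)
      qed
    qed
  qed
  have "osgn (h ` S) g = (\<Prod>p\<in>ordered_pairs S. (\<lambda>(x,y). if g x < g y then 1 else - 1) (F p))"
    unfolding osgn_def by (rule prod.reindex_bij_betw[OF bij, symmetric])
  then have "osgn (h ` S) g * osgn S h = (\<Prod>p\<in>ordered_pairs S. (\<lambda>(x,y). if g x < g y then 1 else - 1) (F p) * (\<lambda>(x,y). if h x < h y then 1 else - 1) p)"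
    unfolding osgn_def by (simp add: prod.distrib)
  also have "\<dots> = osgn S (g \<circ> h)" unfolding osgn_def
  proof (rule prod.cong[OF refl], clarify)
    fix x y assume xy: "(x,y) \<in> ordered_pairs S"
    then have S: "x \<in> S" "y \<in> S" "x \<noteq> y" by (auto simp: ordered_pairs_def)
    then have hn: "h x \<noteq> h y" using h by (auto dest: inj_onD)
    then have "g (h x) \<noteq> g (h y)" using g S by (auto dest: inj_onD)
    then show "(case F (x, y) of (x, y) \<Rightarrow> if g x < g y then 1 else - 1) * (if h x < h y then 1 else - 1) = (if (g \<circ> h) x < (g \<circ> h) y then 1 else (- 1::int))"
      using hn by (auto simp: F_def min_def max_def)
  qed
  finally show ?thesis ..
qed

lemma osgn_cases: "osgn S g = 1 \<or> osgn S g = - 1"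
proof (cases "finite (ordered_pairs S)")
  case True
  then show ?thesis unfolding osgn_def by (induction rule: finite_induct) (auto split: if_splits)
qed (simp add: osgn_def)

lemma osgn_square: "osgn S g * osgn S g = 1"
  using osgn_cases[of S g] by auto

lemma osgn_cong: "(\<And>x. x \<in> S \<Longrightarrow> g x = h x) \<Longrightarrow> osgn S g = osgn S h"
  unfolding osgn_def by (rule prod.cong) (auto simp: ordered_pairs_def)

lemma osgn_id: "(\<And>x. x \<in> S \<Longrightarrow> g x = x) \<Longrightarrow> osgn S g = 1"
  unfolding osgn_def by (rule prod.neutral) (auto simp: ordered_pairs_def)

text \<open>The inverted pairs are \<open>(a,b)\<close> and, for each point between \<open>a\<close>
  and \<open>b\<close>, one pair with \<open>a\<close> and one with \<open>b\<close>: an odd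
  number.\<close>

lemma osgn_transpose:
  assumes S: "finite S" "a \<in> S" "b \<in> S" "a \<noteq> b"
  shows "osgn S (swp a b) = - 1"
proof -
  have main: "osgn S (swp a b) = - 1" if ab: "a \<in> S" "b \<in> S" "a < b" for a b
  proof -
    let ?M = "{x\<in>S. a < x \<and> x < b}"
    let ?N = "(\<lambda>y. (a,y)) ` ?M \<union> (\<lambda>x. (x,b)) ` ?M \<union> {(a,b)}"
    let ?s = "\<lambda>(x,y). if swp a b x < swp a b y then 1 else (- 1 :: int)"
    have sub: "?N \<subseteq> ordered_pairs S" using ab by (auto simp: ordered_pairs_def)
    have "osgn S (swp a b) = prod ?s ?N"
      unfolding osgn_def using ab sub
      by (intro prod.mono_neutral_right finite_ordered_pairs S(1))
         (auto simp: ordered_pairs_def Transposition.transpose_def split: if_splits)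
    also have "\<dots> = prod (\<lambda>_. - 1) ?N"
      by (rule prod.cong) (use ab in \<open>auto simp: Transposition.transpose_def\<close>)
    also have "\<dots> = (- 1) ^ card ?N" by simp
    also have "card ?N = Suc (card ((\<lambda>y. (a,y)) ` ?M \<union> (\<lambda>x. (x,b)) ` ?M))"
      using S(1) by (subst Un_insert_right, subst card_insert_disjoint) (auto simp: Un_commute)
    also have "card ((\<lambda>y. (a,y)) ` ?M \<union> (\<lambda>x. (x,b)) ` ?M) = card ((\<lambda>y. (a,y)) ` ?M) + card ((\<lambda>x. (x,b)) ` ?M)"
      using S(1) by (intro card_Un_disjoint) auto
    also have "\<dots> = card ?M + card ?M" by (simp add: card_image inj_on_def)
    finally show ?thesis by simp
  qed
  show ?thesis using main[of a b] main[of b a] S by (cases "a < b") (auto simp: Transposition.transpose_commute)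
qed

lemma osgn_sign:
  assumes "finite S" "r permutes S"
  shows "osgn S r = sign r"
proof (rule permutes_induct[where P="\<lambda>r. osgn S r = sign r", OF assms(2,1)])
  show "osgn S id = sign id" by (simp add: osgn_id sign_id)
next
  fix a b p assume ab: "a \<in> S" "b \<in> S" "a \<noteq> b" and IH: "osgn S p = sign p" and p: "p permutes S"
  have im: "p ` S = S" using p by (rule permutes_image)
  have "osgn S (swp a b \<circ> p) = osgn S (swp a b) * osgn S p"
    using osgn_comp[of p S "swp a b", OF permutes_inj_on[OF p]] unfolding im
    by (metis inj_on_def transpose_involutory)
  also have "osgn S (swp a b) = sign (swp a b)"
    using ab assms(1) by (simp add: osgn_transpose sign_swap_id)
  also have "\<dots> * osgn S p = sign (swp a b \<circ> p)"
    unfolding IH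
  proof (rule sign_compose[symmetric, OF permutation_swap_id])
    show "permutation p" using p assms(1) permutation_permutes by blast
  qed
  finally show "osgn S (swp a b \<circ> p) = sign (swp a b \<circ> p)" .
qed

definition restr :: "nat set \<Rightarrow> (nat \<Rightarrow> nat) \<Rightarrow> nat \<Rightarrow> nat" where
  "restr S g = (\<lambda>x. if x \<in> S then g x else x)"

lemma restr_permutes:
  assumes "inj_on g S" "g ` S = S"
  shows "restr S g permutes S"
proof (rule bij_imp_permutes)
  show "bij_betw (restr S g) S S"
    using assms by (auto simp: bij_betw_def restr_def inj_on_def image_def)
qed (simp add: restr_def)

lemma osgn_restr:
  assumes "finite S" "inj_on g S" "g ` S = S"
  shows "osgn S g = sign (restr S g)"
  using osgn_sign[OF assms(1) restr_permutes[OF assms(2,3)]] osgn_cong[of S "restr S g" g] by (simp add: restr_def)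

text \<open>On invariant sets \<open>osgn\<close> is the sign of the restricted permutation, which
  does not see how \<open>A\<close> and \<open>B\<close> interleave; the restrictions to
  \<open>A\<close> and \<open>B\<close> compose to that on the union.\<close>

lemma osgn_union:
  assumes fin: "finite A" "finite B" and dis: "A \<inter> B = {}" and inj: "inj_on g A" "inj_on g B" and im: "g ` A = A" "g ` B = B"
  shows "osgn (A \<union> B) g = osgn A g * osgn B g"
proof -
  have "inj_on g (A \<union> B)" unfolding inj_on_Un using inj dis im by (simp add: Diff_triv Int_commute)
  then have "osgn (A \<union> B) g = sign (restr (A \<union> B) g)" using fin im by (intro osgn_restr) (auto simp: image_Un)
  also have "restr (A \<union> B) g = restr A g \<circ> restr B g"
    using dis im by (auto simp: restr_def fun_eq_iff)
  also have "sign \<dots> = sign (restr A g) * sign (restr B g)"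
    by (rule sign_compose) (use fin restr_permutes[OF inj(1) im(1)] restr_permutes[OF inj(2) im(2)] in \<open>auto simp: permutation_permutes\<close>)
  finally show ?thesis using osgn_restr fin inj im by metis
qed

text \<open>Letters below \<open>n\<close> are even, the letters from \<open>n\<close> to \<open>2 n - 1\<close> are odd. Words of a fixed content correspond to
  the cosets of a Young subgroup, and \<open>eps\<close> is the sign by which a permutation acts on the positions of
  odd letters.\<close>
definition words :: "nat \<Rightarrow> (nat \<Rightarrow> nat) set" where
  "words n = {T. (\<forall>x. x \<notin> {1..n} \<longrightarrow> T x = 0) \<and> (\<forall>x\<in>{1..n}. T x < 2 * n)}"

definition act :: "(nat \<Rightarrow> nat) \<Rightarrow> (nat \<Rightarrow> nat) \<Rightarrow> nat \<Rightarrow> nat" where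
  "act g T = T \<circ> pinv g"

definition wcont :: "nat \<Rightarrow> (nat \<Rightarrow> nat) \<Rightarrow> (nat \<Rightarrow> nat) set" where
  "wcont n c = {T\<in>words n. \<forall>k<2*n. card {x\<in>{1..n}. T x = k} = c k}"

definition odds :: "nat \<Rightarrow> (nat \<Rightarrow> nat) \<Rightarrow> nat set" where
  "odds n T = {x\<in>{1..n}. n \<le> T x}"

definition eps :: "nat \<Rightarrow> (nat \<Rightarrow> nat) \<Rightarrow> (nat \<Rightarrow> nat) \<Rightarrow> int" where
  "eps n g T = osgn (odds n T) g"

lemma finite_words: "finite (words n)"
proof -
  have "words n \<subseteq> {f. \<forall>x. (x \<in> {1..n} \<longrightarrow> f x \<in> {..<2*n}) \<and> (x \<notin> {1..n} \<longrightarrow> f x = 0)}" by (auto simp: words_def)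
  then show ?thesis by (rule finite_subset) (rule finite_set_of_finite_funs, auto)
qed

lemma finite_wcont: "finite (wcont n c)"
  using finite_words by (auto simp: wcont_def)

lemma SymD: "g \<in> Sym n \<Longrightarrow> g permutes {1..n}" "g \<in> Sym n \<Longrightarrow> bij g" "g \<in> Sym n \<Longrightarrow> inj g" "g \<in> Sym n \<Longrightarrow> surj g"
  by (auto simp: Sym_def permutes_bij permutes_inj permutes_surj)

lemma Sym_closed: "g \<in> Sym n \<Longrightarrow> h \<in> Sym n \<Longrightarrow> g \<circ> h \<in> Sym n" "g \<in> Sym n \<Longrightarrow> pinv g \<in> Sym n" "id \<in> Sym n"
  by (auto simp: Sym_def permutes_compose permutes_inv permutes_id)

lemma finite_Sym: "finite (Sym n)"
  unfolding Sym_def by (rule finite_permutations) simp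

lemma Sym_inv: "g \<in> Sym n \<Longrightarrow> g \<circ> pinv g = id" "g \<in> Sym n \<Longrightarrow> pinv g \<circ> g = id"
  "g \<in> Sym n \<Longrightarrow> pinv (pinv g) = g"
  using permutes_inv_o[OF SymD(1), of g n] inv_inv_eq[OF SymD(2), of g n] by auto

lemma act_id [simp]: "act id T = T" by (simp add: act_def)

lemma act_comp: "g \<in> Sym n \<Longrightarrow> h \<in> Sym n \<Longrightarrow> act (g \<circ> h) T = act g (act h T)"
  by (simp add: act_def o_inv_distrib SymD comp_assoc)

lemma act_inv: "g \<in> Sym n \<Longrightarrow> act (pinv g) (act g T) = T" "g \<in> Sym n \<Longrightarrow> act g (act (pinv g) T) = T"
  by (metis act_comp act_id Sym_closed(2) Sym_inv)+

lemma act_eq_iff: "g \<in> Sym n \<Longrightarrow> act g T = act g T' \<longleftrightarrow> T = T'"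
  by (metis act_inv(1))

lemma act_apply: "g \<in> Sym n \<Longrightarrow> act g T (g x) = T x"
  by (simp add: act_def SymD inv_f_f)

lemma act_words:
  assumes g: "g \<in> Sym n" and T: "T \<in> words n"
  shows "act g T \<in> words n"
proof -
  have "pinv g x \<in> {1..n} \<longleftrightarrow> x \<in> {1..n}" for x
    by (rule permutes_in_image[OF permutes_inv[OF SymD(1)[OF g]]])
  then show ?thesis using T unfolding words_def act_def by (simp del: atLeastAtMost_iff)
qed

lemma act_level:
  assumes g: "g \<in> Sym n"
  shows "{x\<in>{1..n}. P (act g T x)} = g ` {x\<in>{1..n}. P (T x)}"
proof -
  have mem: "g x \<in> {1..n} \<longleftrightarrow> x \<in> {1..n}" for x using SymD(1)[OF g] by (rule permutes_in_image)
  show ?thesis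
  proof (rule Set.set_eqI, rule iffI)
    fix y assume y: "y \<in> {x\<in>{1..n}. P (act g T x)}"
    obtain x where "y = g x" using SymD(4)[OF g] by (metis surjD)
    then show "y \<in> g ` {x\<in>{1..n}. P (T x)}" using y mem by (auto simp: act_apply[OF g] simp del: atLeastAtMost_iff)
  qed (use mem in \<open>auto simp: act_apply[OF g] simp del: atLeastAtMost_iff\<close>)
qed

lemma act_wcont:
  assumes g: "g \<in> Sym n" and T: "T \<in> wcont n c"
  shows "act g T \<in> wcont n c"
proof -
  have "card {x\<in>{1..n}. act g T x = k} = card {x\<in>{1..n}. T x = k}" for k
    using act_level[OF g, of "\<lambda>z. z = k" T] SymD(3)[OF g] by (simp add: card_image inj_on_subset[OF _ subset_UNIV])
  then show ?thesis using T act_words[OF g] by (auto simp: wcont_def)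
qed

lemma odds_act: "g \<in> Sym n \<Longrightarrow> odds n (act g T) = g ` odds n T"
  unfolding odds_def by (rule act_level)

lemma finite_odds: "finite (odds n T)" by (simp add: odds_def)

text \<open>The cocycle identity behind the signed action of \<open>is_rep_mono\<close>.\<close>

lemma eps_comp: "g \<in> Sym n \<Longrightarrow> h \<in> Sym n \<Longrightarrow> eps n (g \<circ> h) T = eps n g (act h T) * eps n h T"
  unfolding eps_def odds_act by (rule osgn_comp) (auto intro: inj_on_subset[OF SymD(3)])

lemma eps_cases: "eps n g T = 1 \<or> eps n g T = - 1"
  by (simp add: eps_def osgn_cases)

lemma eps_square: "eps n g T * eps n g T = 1" 
  by (simp add: eps_def osgn_square)

lemma eps_square_field: "of_int (eps n g T) * of_int (eps n g T) = (1::'a::field)"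
  by (metis eps_square of_int_1 of_int_mult)

lemma eps_id [simp]: "eps n id T = 1"
  by (simp add: eps_def osgn_id)

section \<open>Equivariant kernels as matrices of homomorphisms\<close>

definition kinv :: "nat \<Rightarrow> (nat \<Rightarrow> nat) \<Rightarrow> (nat \<Rightarrow> nat) \<Rightarrow> ((nat \<Rightarrow> nat) \<Rightarrow> (nat \<Rightarrow> nat) \<Rightarrow> 'a::field) \<Rightarrow> bool" where
  "kinv n c c' K \<longleftrightarrow> (\<forall>g\<in>Sym n. \<forall>U\<in>wcont n c. \<forall>T\<in>wcont n c'.
     K (act g U) (act g T) = of_int (eps n g U * eps n g T) * K U T)"

definition kmul :: "nat \<Rightarrow> (nat \<Rightarrow> nat) \<Rightarrow> ((nat \<Rightarrow> nat) \<Rightarrow> (nat \<Rightarrow> nat) \<Rightarrow> 'a::field)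
    \<Rightarrow> ((nat \<Rightarrow> nat) \<Rightarrow> (nat \<Rightarrow> nat) \<Rightarrow> 'a) \<Rightarrow> (nat \<Rightarrow> nat) \<Rightarrow> (nat \<Rightarrow> nat) \<Rightarrow> 'a" where
  "kmul n c K L = (\<lambda>U T. \<Sum>S\<in>wcont n c. K U S * L S T)"

definition wenum :: "nat \<Rightarrow> (nat \<Rightarrow> nat) \<Rightarrow> nat \<Rightarrow> nat \<Rightarrow> nat" where
  "wenum n c = (SOME w. bij_betw w {0..<card (wcont n c)} (wcont n c))"

definition kmat :: "nat \<Rightarrow> (nat \<Rightarrow> nat) \<Rightarrow> (nat \<Rightarrow> nat) \<Rightarrow> ((nat \<Rightarrow> nat) \<Rightarrow> (nat \<Rightarrow> nat) \<Rightarrow> 'a::field) \<Rightarrow> 'a mat" where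
  "kmat n c c' K = mat (card (wcont n c)) (card (wcont n c')) (\<lambda>(a,b). K (wenum n c a) (wenum n c' b))"

text \<open>The matrix coefficients of the signed action, which sends the word \<open>T\<close> to
  \<open>eps n g T\<close> times \<open>act g T\<close>, as if odd letters anticommuted.\<close>

definition mono_kernel :: "nat \<Rightarrow> (nat \<Rightarrow> nat) \<Rightarrow> (nat \<Rightarrow> nat) \<Rightarrow> (nat \<Rightarrow> nat) \<Rightarrow> 'a::field" where
  "mono_kernel n g = (\<lambda>U T. if act g T = U then of_int (eps n g T) else 0)"

definition mono_rep :: "nat \<Rightarrow> (nat \<Rightarrow> nat) \<Rightarrow> 'a::field rep" where
  "mono_rep n c = (card (wcont n c), \<lambda>g. kmat n c c (mono_kernel n g))"

lemma wenum_bij: "bij_betw (wenum n c) {0..<card (wcont n c)} (wcont n c)"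
  unfolding wenum_def by (rule someI_ex[OF ex_bij_betw_nat_finite[OF finite_wcont]])

lemma wenum_mem: "a < card (wcont n c) \<Longrightarrow> wenum n c a \<in> wcont n c"
  using wenum_bij[of n c] by (auto simp: bij_betw_def)

lemma wenum_surj: "T \<in> wcont n c \<Longrightarrow> \<exists>a<card (wcont n c). wenum n c a = T"
  using wenum_bij[of n c] unfolding bij_betw_def by (metis atLeastLessThan_iff image_iff)

lemma kmat_dim [simp]: "dim_row (kmat n c c' K) = card (wcont n c)" "dim_col (kmat n c c' K) = card (wcont n c')"
  by (auto simp: kmat_def)

lemma kmat_mult: "kmat n c c' K * kmat n c' c'' L = kmat n c c'' (kmul n c' K L)"
proof (rule eq_matI)
  fix a b assume "a < dim_row (kmat n c c'' (kmul n c' K L))" "b < dim_col (kmat n c c'' (kmul n c' K L))"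
  then have ab: "a < card (wcont n c)" "b < card (wcont n c'')" by auto
  have "(kmat n c c' K * kmat n c' c'' L) $$ (a,b) = (\<Sum>l\<in>{0..<card (wcont n c')}. K (wenum n c a) (wenum n c' l) * L (wenum n c' l) (wenum n c'' b))"
    using ab by (simp add: kmat_def scalar_prod_def)
  also have "\<dots> = (\<Sum>S\<in>wcont n c'. K (wenum n c a) S * L S (wenum n c'' b))"
    by (rule sum.reindex_bij_betw[OF wenum_bij])
  finally show "(kmat n c c' K * kmat n c' c'' L) $$ (a,b) = kmat n c c'' (kmul n c' K L) $$ (a,b)"
    using ab by (simp add: kmat_def kmul_def)
qed auto

lemma kmat_eq_iff: "kmat n c c' K = kmat n c c' L \<longleftrightarrow> (\<forall>U\<in>wcont n c. \<forall>T\<in>wcont n c'. K U T = L U T)"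
proof
  assume eq: "kmat n c c' K = kmat n c c' L"
  show "\<forall>U\<in>wcont n c. \<forall>T\<in>wcont n c'. K U T = L U T"
  proof (intro ballI)
    fix U T assume "U \<in> wcont n c" "T \<in> wcont n c'"
    then obtain a b where ab: "a < card (wcont n c)" "wenum n c a = U" "b < card (wcont n c')" "wenum n c' b = T" using wenum_surj by metis
    then show "K U T = L U T" using arg_cong[OF eq, of "\<lambda>M. M $$ (a,b)"] by (simp add: kmat_def)
  qed
next
  assume "\<forall>U\<in>wcont n c. \<forall>T\<in>wcont n c'. K U T = L U T"
  then show "kmat n c c' K = kmat n c c' L" by (intro eq_matI) (auto simp: kmat_def wenum_mem)
qed

lemma kmat_surj:
  assumes "dim_row A = card (wcont n c)" "dim_col A = card (wcont n c')"
  obtains K where "A = kmat n c c' K"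
proof -
  let ?i = "the_inv_into {0..<card (wcont n c)} (wenum n c)" and ?j = "the_inv_into {0..<card (wcont n c')} (wenum n c')"
  have "the_inv_into {0..<card (wcont n d)} (wenum n d) (wenum n d a) = a" if "a < card (wcont n d)" for a d
    by (rule the_inv_into_f_f) (use that wenum_bij[of n d] in \<open>auto simp: bij_betw_def\<close>)
  then have "A = kmat n c c' (\<lambda>U T. A $$ (?i U, ?j T))" using assms by (intro eq_matI) (auto simp: kmat_def)
  then show ?thesis by (rule that)
qed

lemma kmat_add: "kmat n c c' K + kmat n c c' L = kmat n c c' (\<lambda>U T. K U T + L U T)"
  by (rule eq_matI) (auto simp: kmat_def)

lemma kmat_smult: "a \<cdot>\<^sub>m kmat n c c' K = kmat n c c' (\<lambda>U T. a * K U T)"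
  by (rule eq_matI) (auto simp: kmat_def)

lemma kmat_one: "1\<^sub>m (card (wcont n c)) = kmat n c c (\<lambda>U T. if U = T then 1 else 0)"
proof (rule eq_matI)
  fix i j assume "i < dim_row (kmat n c c (\<lambda>U T. if U = T then 1 else 0) :: 'a mat)" "j < dim_col (kmat n c c (\<lambda>U T. if U = T then 1 else 0) :: 'a mat)"
  then have ij: "i < card (wcont n c)" "j < card (wcont n c)" by auto
  then have "wenum n c i = wenum n c j \<longleftrightarrow> i = j" using wenum_bij[of n c] by (auto simp: bij_betw_def dest: inj_onD)
  then show "1\<^sub>m (card (wcont n c)) $$ (i,j) = kmat n c c (\<lambda>U T. if U = T then 1 else (0::'a)) $$ (i,j)" using ij by (simp add: kmat_def)
qed auto

lemma fst_mono_rep [simp]: "fst (mono_rep n c) = card (wcont n c)"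
  by (simp add: mono_rep_def)

lemma is_rep_mono: "is_rep (Sym n) (mono_rep n c)"
  unfolding is_rep_def
proof (intro conjI ballI)
  fix g h assume g: "g \<in> Sym n" and h: "h \<in> Sym n"
  have "(mono_kernel n (g \<circ> h) U T :: 'a) = kmul n c (mono_kernel n g) (mono_kernel n h) U T" if "T \<in> wcont n c" for U T
  proof -
    have "kmul n c (mono_kernel n g) (mono_kernel n h) U T = (\<Sum>S\<in>wcont n c. if S = act h T then (if act g S = U then of_int (eps n g S * eps n h T) else 0) else (0::'a))"
      unfolding kmul_def mono_kernel_def by (rule sum.cong) auto
    also have "\<dots> = (if act g (act h T) = U then of_int (eps n g (act h T) * eps n h T) else 0)"
      using act_wcont[OF h that] finite_wcont by (simp add: sum.delta)
    finally show ?thesis unfolding act_comp[OF g h, symmetric] eps_comp[OF g h, symmetric] unfolding mono_kernel_def by (rule sym)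
  qed
  then show "snd (mono_rep n c :: 'a rep) (g \<circ> h) = snd (mono_rep n c) g * snd (mono_rep n c) h"
    by (simp add: mono_rep_def kmat_mult kmat_eq_iff)
next
  show "snd (mono_rep n c :: 'a rep) id = 1\<^sub>m (fst (mono_rep n c :: 'a rep))"
    by (auto simp: mono_rep_def kmat_one kmat_eq_iff mono_kernel_def)
qed (auto simp: mono_rep_def)

text \<open>Commutation with \<open>g\<close> is evaluated at \<open>(act g U, T)\<close>, where
  both products have one term; the sign is moved across because it is its own inverse.\<close>

lemma kmat_hom_iff: "kmat n c c' K \<in> rep_hom (Sym n) (mono_rep n c') (mono_rep n c) \<longleftrightarrow> kinv n c c' K"
proof -
  have 1: "kmul n c' K (mono_kernel n g) U T = of_int (eps n g T) * K U (act g T)" if g: "g \<in> Sym n" and T: "T \<in> wcont n c'" for g U T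
  proof -
    have "kmul n c' K (mono_kernel n g) U T = (\<Sum>S\<in>wcont n c'. if S = act g T then of_int (eps n g T) * K U S else 0)"
      unfolding kmul_def mono_kernel_def by (rule sum.cong) auto
    then show ?thesis using act_wcont[OF g T] finite_wcont by (simp add: sum.delta)
  qed
  have 2: "kmul n c (mono_kernel n g) K (act g U) T = of_int (eps n g U) * K U T" if g: "g \<in> Sym n" and U: "U \<in> wcont n c" for g U T
  proof -
    have "kmul n c (mono_kernel n g) K (act g U) T = (\<Sum>S\<in>wcont n c. if S = U then of_int (eps n g U) * K U T else 0)"
      unfolding kmul_def mono_kernel_def by (rule sum.cong) (auto simp: act_eq_iff[OF g])
    then show ?thesis using U finite_wcont by (simp add: sum.delta)
  qed
  have "kmat n c c' K \<in> rep_hom (Sym n) (mono_rep n c') (mono_rep n c) \<longleftrightarrow>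
     (\<forall>g\<in>Sym n. \<forall>U\<in>wcont n c. \<forall>T\<in>wcont n c'. kmul n c' K (mono_kernel n g) U T = kmul n c (mono_kernel n g) K U T)"
    by (simp add: rep_hom_def mono_rep_def kmat_mult kmat_eq_iff)
  also have "\<dots> \<longleftrightarrow> (\<forall>g\<in>Sym n. \<forall>U\<in>wcont n c. \<forall>T\<in>wcont n c'. kmul n c' K (mono_kernel n g) (act g U) T = kmul n c (mono_kernel n g) K (act g U) T)"
    by (metis act_inv(2) act_wcont Sym_closed(2))
  also have "\<dots> \<longleftrightarrow> (\<forall>g\<in>Sym n. \<forall>U\<in>wcont n c. \<forall>T\<in>wcont n c'. of_int (eps n g T) * K (act g U) (act g T) = of_int (eps n g U) * K U T)"
    by (simp add: 1 2)
  also have "\<dots> \<longleftrightarrow> kinv n c c' K"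
  proof -
    have "of_int (eps n g T) * x = of_int (eps n g U) * y \<longleftrightarrow> x = of_int (eps n g U * eps n g T) * y" for g U T and x y :: 'a
      using eps_cases[of n g T] eps_cases[of n g U] by auto
    then show ?thesis unfolding kinv_def by simp
  qed
  finally show ?thesis .
qed

lemma kinv_kmul:
  assumes "kinv n c c' K" "kinv n c' c'' L"
  shows "kinv n c c'' (kmul n c' K L)"
  using rep_hom_mult[OF is_rep_mono is_rep_mono is_rep_mono] assms
  by (simp add: kmat_hom_iff[symmetric] kmat_mult[symmetric])

lemma act_transpose:
  assumes "x \<in> {1..n}" "y \<in> {1..n}" "T x = T y"
  shows "swp x y \<in> Sym n" "act (swp x y) T = T"
  using assms by (auto simp: Sym_def permutes_swap_id act_def fun_eq_iff Transposition.transpose_def inv_swap_id)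

lemma eps_transpose:
  assumes "x \<in> {1..n}" "y \<in> {1..n}" "T x = T y" "x \<noteq> y"
  shows "eps n (swp x y) T = (if n \<le> T x then - 1 else 1)"
proof (cases "n \<le> T x")
  case True
  then show ?thesis using assms unfolding eps_def by (subst osgn_transpose) (auto simp: odds_def)
next
  case False
  then have "x \<notin> odds n T" "y \<notin> odds n T" using assms by (auto simp: odds_def)
  then show ?thesis using False unfolding eps_def by (subst osgn_id) (auto simp: Transposition.transpose_def)
qed

text \<open>Two positions with the same pair of letters of different parity can be transposed at the
  cost of a sign -1, so an equivariant kernel vanishes at such pairs of words
  (\<open>kinv_not_admissible\<close>). On the remaining orbits nonzero kernels do exist
  (\<open>korb\<close>).\<close>

definition admissible :: "nat \<Rightarrow> (nat \<Rightarrow> nat) \<Rightarrow> (nat \<Rightarrow> nat) \<Rightarrow> bool" where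
  "admissible n U T \<longleftrightarrow> (\<forall>x\<in>{1..n}. \<forall>y\<in>{1..n}. x \<noteq> y \<and> U x = U y \<and> T x = T y \<longrightarrow> (n \<le> U x \<longleftrightarrow> n \<le> T x))"

lemma kinv_not_admissible:
  fixes K :: "_ \<Rightarrow> _ \<Rightarrow> 'a::field"
  assumes K: "kinv n c c' K" and U: "U \<in> wcont n c" and T: "T \<in> wcont n c'" and na: "\<not> admissible n U T" and two: "(2::'a) \<noteq> 0"
  shows "K U T = 0"
proof -
  from na obtain x y where xy: "x \<in> {1..n}" "y \<in> {1..n}" "x \<noteq> y" "U x = U y" "T x = T y" "(n \<le> U x) \<noteq> (n \<le> T x)"
    unfolding admissible_def by blast
  let ?g = "swp x y"
  have "K (act ?g U) (act ?g T) = of_int (eps n ?g U * eps n ?g T) * K U T"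
    using K U T act_transpose(1)[OF xy(1,2,4)] unfolding kinv_def by blast
  moreover have "eps n ?g U * eps n ?g T = - 1" using xy by (auto simp: eps_transpose)
  ultimately have "K U T + K U T = 0" by (simp add: act_transpose(2)[OF xy(1,2,4)] act_transpose(2)[OF xy(1,2,5)])
  then have "2 * K U T = 0" by (simp only: mult_2)
  then show ?thesis using two by simp
qed

lemma act_fix: "g \<in> Sym n \<Longrightarrow> act g T = T \<Longrightarrow> T (g x) = T x"
  by (metis act_apply)

text \<open>At a position where the parities differ, the pair of letters occurs only once, so
  \<open>g\<close> fixes that position. The odd positions of \<open>U\<close> and of
  \<open>T\<close> therefore differ by fixed points only, and \<open>g\<close> has the same sign on
  both.\<close>

lemma admissible_fix:
  assumes ad: "admissible n U T" and g: "g \<in> Sym n" and gU: "act g U = U" and gT: "act g T = T"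
  shows "eps n g U * eps n g T = 1"
proof -
  let ?A = "odds n U" and ?B = "odds n T"
  have inj: "inj_on g X" for X using SymD(3)[OF g] inj_on_subset by blast
  have A: "g ` ?A = ?A" "g ` ?B = ?B" using odds_act[OF g] gU gT by metis+
  have im: "g ` (?A \<inter> ?B) = ?A \<inter> ?B" "g ` (?A - ?B) = ?A - ?B" "g ` (?B - ?A) = ?B - ?A"
    using A SymD(3)[OF g] by (simp_all add: image_Int image_set_diff)
  have fx: "g x = x" if x: "x \<in> {1..n}" "(n \<le> U x) \<noteq> (n \<le> T x)" for x
  proof (rule ccontr)
    assume "g x \<noteq> x"
    moreover have "g x \<in> {1..n}" using x permutes_in_image[OF SymD(1)[OF g]] by blast
    moreover have "U (g x) = U x" "T (g x) = T x" using act_fix[OF g] gU gT by auto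
    ultimately show False using ad x unfolding admissible_def by metis
  qed
  have "osgn (?A - ?B) g = 1" "osgn (?B - ?A) g = 1" by (auto intro!: osgn_id fx simp: odds_def)
  moreover have "osgn (?A \<inter> ?B \<union> (?A - ?B)) g = osgn (?A \<inter> ?B) g * osgn (?A - ?B) g"
    by (rule osgn_union) (use im inj finite_odds in auto)
  moreover have "?A \<inter> ?B \<union> (?A - ?B) = ?A" by blast
  moreover have "osgn (?A \<inter> ?B \<union> (?B - ?A)) g = osgn (?A \<inter> ?B) g * osgn (?B - ?A) g"
    by (rule osgn_union) (use im inj finite_odds in auto)
  moreover have "?A \<inter> ?B \<union> (?B - ?A) = ?B" by blast
  ultimately show ?thesis unfolding eps_def by (metis mult.right_neutral osgn_square)
qed

text \<open>The kernel supported on the orbit of one pair of words and normalised to 1 at that pair.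
  For an admissible pair the choice of \<open>g\<close> does not affect the sign, by
  \<open>korb_value\<close>.\<close>

definition korb :: "nat \<Rightarrow> (nat \<Rightarrow> nat) \<Rightarrow> (nat \<Rightarrow> nat) \<Rightarrow> (nat \<Rightarrow> nat) \<Rightarrow> (nat \<Rightarrow> nat) \<Rightarrow> 'a::field" where
  "korb n U0 T0 = (\<lambda>U T. if \<exists>g\<in>Sym n. act g U0 = U \<and> act g T0 = T then
      (let g = (SOME g. g \<in> Sym n \<and> act g U0 = U \<and> act g T0 = T) in of_int (eps n g U0 * eps n g T0)) else 0)"

lemma korb_nonzero: "korb n U0 T0 U T \<noteq> 0 \<Longrightarrow> \<exists>g\<in>Sym n. act g U0 = U \<and> act g T0 = T"
  by (auto simp: korb_def split: if_splits)

lemma korb_value: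
  assumes ad: "admissible n U0 T0" and g: "g \<in> Sym n"
  shows "korb n U0 T0 (act g U0) (act g T0) = of_int (eps n g U0 * eps n g T0)"
proof -
  define h where "h = (SOME h. h \<in> Sym n \<and> act h U0 = act g U0 \<and> act h T0 = act g T0)"
  have h: "h \<in> Sym n \<and> act h U0 = act g U0 \<and> act h T0 = act g T0" unfolding h_def by (rule someI[of _ g]) (use g in simp)
  let ?k = "pinv g \<circ> h"
  have k: "?k \<in> Sym n" using g h by (simp add: Sym_closed)
  have fx: "act ?k U0 = U0" "act ?k T0 = T0" using g h act_comp[OF Sym_closed(2)[OF g], of h] by (simp_all add: act_inv)
  have "h = g \<circ> ?k" using Sym_inv(1)[OF g] by (metis comp_assoc id_comp)
  then have "eps n h U0 = eps n g U0 * eps n ?k U0" "eps n h T0 = eps n g T0 * eps n ?k T0"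
    using eps_comp[OF g k, of U0] eps_comp[OF g k, of T0] fx by simp_all
  then have "eps n h U0 * eps n h T0 = eps n g U0 * eps n g T0 * (eps n ?k U0 * eps n ?k T0)" by simp
  also have "\<dots> = eps n g U0 * eps n g T0" using admissible_fix[OF ad k fx] by simp
  finally show ?thesis using g unfolding korb_def h_def[symmetric] Let_def by auto
qed

lemma korb_kinv:
  assumes ad: "admissible n U0 T0"
  shows "kinv n c c' (korb n U0 T0)"
  unfolding kinv_def
proof (intro ballI)
  fix g U T assume g: "g \<in> Sym n"
  show "korb n U0 T0 (act g U) (act g T) = (of_int (eps n g U * eps n g T) * korb n U0 T0 U T :: 'a)"
  proof (cases "\<exists>h\<in>Sym n. act h U0 = U \<and> act h T0 = T")
    case True
    then obtain h where h: "h \<in> Sym n" "U = act h U0" "T = act h T0" by auto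
    have "korb n U0 T0 (act (g \<circ> h) U0) (act (g \<circ> h) T0) = (of_int (eps n (g \<circ> h) U0 * eps n (g \<circ> h) T0) :: 'a)"
      by (rule korb_value[OF ad Sym_closed(1)[OF g h(1)]])
    then show ?thesis unfolding h(2,3) korb_value[OF ad h(1)] by (simp add: act_comp[OF g h(1)] eps_comp[OF g h(1)])
  next
    case False
    have "\<not> (\<exists>h\<in>Sym n. act h U0 = act g U \<and> act h T0 = act g T)"
    proof
      assume "\<exists>h\<in>Sym n. act h U0 = act g U \<and> act h T0 = act g T"
      then obtain h where h: "h \<in> Sym n" "act h U0 = act g U" "act h T0 = act g T" by auto
      then have "act (pinv g \<circ> h) U0 = U" "act (pinv g \<circ> h) T0 = T"
        using g by (simp_all add: act_comp[OF Sym_closed(2)[OF g]] act_inv)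
      then show False using False Sym_closed(1)[OF Sym_closed(2)[OF g] h(1)] by blast
    qed
    then have "korb n U0 T0 (act g U) (act g T) = (0::'a)" unfolding korb_def by (rule if_not_P)
    moreover have "korb n U0 T0 U T = (0::'a)" unfolding korb_def using False by (rule if_not_P)
    ultimately show ?thesis by simp
  qed
qed

section \<open>Endomorphisms modulo maps through larger contents\<close>

definition psum :: "(nat \<Rightarrow> nat) \<Rightarrow> nat \<Rightarrow> nat" where
  "psum c k = (\<Sum>i<k. c i)"

text \<open>Strict dominance for contents, with even letters before odd ones. For pairs of
  partitions the sums up to \<open>k\<close> and up to \<open>n + k\<close> are the two families of
  sums in \<open>dominates\<close>, see \<open>dominates_psum\<close>.\<close>

definition above :: "nat \<Rightarrow> (nat \<Rightarrow> nat) \<Rightarrow> (nat \<Rightarrow> nat) \<Rightarrow> bool" where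
  "above n c c' \<longleftrightarrow> (\<forall>k\<le>2*n. psum c k \<le> psum c' k) \<and> (\<exists>k\<le>2*n. psum c k < psum c' k)"

definition content :: "nat \<Rightarrow> (nat \<Rightarrow> nat) \<Rightarrow> nat \<Rightarrow> nat" where
  "content n T = (\<lambda>k. card {x\<in>{1..n}. T x = k})"

lemma wcont_content: "T \<in> words n \<Longrightarrow> T \<in> wcont n (content n T)"
  by (auto simp: wcont_def content_def)

lemma wcont_words: "T \<in> wcont n c \<Longrightarrow> T \<in> words n"
  by (simp add: wcont_def)

lemma words_out: "T \<in> words n \<Longrightarrow> x \<notin> {1..n} \<Longrightarrow> T x = 0"
  unfolding words_def by blast

lemma words_lt: "T \<in> words n \<Longrightarrow> x \<in> {1..n} \<Longrightarrow> T x < 2 * n"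
  unfolding words_def by blast

lemma psum_card:
  assumes "T \<in> wcont n c" "k \<le> 2 * n"
  shows "psum c k = card {x\<in>{1..n}. T x < k}"
proof -
  have "{x\<in>{1..n}. T x < k} = (\<Union>i<k. {x\<in>{1..n}. T x = i})" by auto
  moreover have "card (\<Union>i<k. {x\<in>{1..n}. T x = i}) = (\<Sum>i<k. card {x\<in>{1..n}. T x = i})"
    by (rule card_UN_disjoint) auto
  ultimately have "card {x\<in>{1..n}. T x < k} = (\<Sum>i<k. card {x\<in>{1..n}. T x = i})" by (simp only:)
  also have "\<dots> = psum c k" unfolding psum_def using assms by (intro sum.cong) (auto simp: wcont_def)
  finally show ?thesis ..
qed

text \<open>Lowering letters enlarges every set of positions with letter below \<open>k\<close>, and
  strictly so for \<open>k = T x\<close> at a position \<open>x\<close> whose letter drops.\<close>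

lemma above_pointwise:
  assumes T: "T \<in> wcont n c" and S: "S \<in> wcont n c'" and le: "\<And>x. x \<in> {1..n} \<Longrightarrow> S x \<le> T x" and ne: "S \<noteq> T"
  shows "above n c c'"
proof -
  obtain x where x: "S x \<noteq> T x" using ne by blast
  then have x': "x \<in> {1..n}" using words_out wcont_words S T by metis
  have lt: "S x < T x" using x le[OF x'] by simp
  have T2: "T x < 2 * n" using words_lt[OF wcont_words[OF T] x'] .
  have sub: "{x\<in>{1..n}. T x < k} \<subseteq> {x\<in>{1..n}. S x < k}" for k using le by fastforce
  then have "psum c k \<le> psum c' k" if "k \<le> 2*n" for k
    unfolding psum_card[OF T that] psum_card[OF S that] by (intro card_mono) auto
  moreover have "{y\<in>{1..n}. T y < T x} \<subset> {y\<in>{1..n}. S y < T x}" using sub[of "T x"] x' lt by blast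
  then have "psum c (T x) < psum c' (T x)" using T2 psum_card[OF T, of "T x"] psum_card[OF S, of "T x"]
    by (simp add: psubset_card_mono)
  ultimately show ?thesis unfolding above_def using T2 less_imp_le by blast
qed

lemma bij_of_fibre_cards:
  assumes fin: "finite A" "finite B" and eq: "\<And>t. card {a\<in>A. f a = t} = card {b\<in>B. g b = t}"
  shows "\<exists>h. bij_betw h A B \<and> (\<forall>a\<in>A. g (h a) = f a)"
proof -
  have "\<exists>h. bij_betw h {a\<in>A. f a = t} {b\<in>B. g b = t}" for t
    by (rule finite_same_card_bij) (use fin eq in auto)
  then obtain h where h: "\<And>t. bij_betw (h t) {a\<in>A. f a = t} {b\<in>B. g b = t}" by metis
  have mem: "h (f a) a \<in> B \<and> g (h (f a) a) = f a" if "a \<in> A" for a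
    using bij_betwE[OF h[of "f a"]] that by blast
  have "bij_betw (\<lambda>a. h (f a) a) A B"
    unfolding bij_betw_def
  proof
    show "inj_on (\<lambda>a. h (f a) a) A"
    proof (rule inj_onI)
      fix a a' assume a: "a \<in> A" "a' \<in> A" and e: "h (f a) a = h (f a') a'"
      then have f: "f a = f a'" using mem by metis
      have "inj_on (h (f a)) {x\<in>A. f x = f a}" by (rule bij_betw_imp_inj_on[OF h])
      then show "a = a'" using a e f by (auto dest!: inj_onD)
    qed
    show "(\<lambda>a. h (f a) a) ` A = B"
    proof
      show "(\<lambda>a. h (f a) a) ` A \<subseteq> B" using mem by blast
      show "B \<subseteq> (\<lambda>a. h (f a) a) ` A"
      proof
        fix b assume "b \<in> B"
        then have "b \<in> h (g b) ` {a\<in>A. f a = g b}" using bij_betw_imp_surj_on[OF h[of "g b"]] by blast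
        then obtain a where "a \<in> A" "f a = g b" "b = h (g b) a" by blast
        then show "b \<in> (\<lambda>a. h (f a) a) ` A" by (intro image_eqI[of _ _ a]) simp_all
      qed
    qed
  qed
  then show ?thesis using mem by blast
qed

lemma permutes_of_cards:
  fixes f f' :: "'x \<Rightarrow> 'b"
  assumes fin: "finite A" and "\<And>y. card {x\<in>A. f x = y} = card {x\<in>A. f' x = y}"
  shows "\<exists>g. g permutes A \<and> (\<forall>x\<in>A. f (g x) = f' x)"
proof -
  obtain h where h: "bij_betw h A A" "\<forall>x\<in>A. f (h x) = f' x" using bij_of_fibre_cards[OF fin fin, of f' f] assms(2) by auto
  let ?g = "\<lambda>x. if x \<in> A then h x else x"
  have "bij_betw ?g A A" using bij_betw_cong[of A h ?g A] h(1) by simp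
  then have "?g permutes A" by (rule bij_imp_permutes) simp
  then show ?thesis using h(2) by (intro exI[of _ ?g]) simp
qed

lemma perm_of_cards:
  fixes f f' :: "nat \<Rightarrow> 'b"
  assumes "\<And>y. card {x\<in>{1..n}. f x = y} = card {x\<in>{1..n}. f' x = y}"
  shows "\<exists>g\<in>Sym n. \<forall>x\<in>{1..n}. f (g x) = f' x"
  using permutes_of_cards[of "{1..n}" f f'] assms unfolding Sym_def by blast

lemma act_eqI:
  assumes g: "g \<in> Sym n" and "U \<in> words n" "V \<in> words n" and eq: "\<And>x. x \<in> {1..n} \<Longrightarrow> V (g x) = U x"
  shows "act g U = V"
proof
  fix y
  obtain x where y: "y = g x" using SymD(4)[OF g] by (metis surjD)
  have mem: "g x \<in> {1..n} \<longleftrightarrow> x \<in> {1..n}" using SymD(1)[OF g] by (rule permutes_in_image)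
  show "act g U y = V y"
  proof (cases "x \<in> {1..n}")
    case False
    then have "U x = 0" "V (g x) = 0" using assms(2,3) mem unfolding words_def by blast+
    then show ?thesis unfolding y act_apply[OF g] by simp
  qed (simp add: y act_apply[OF g] eq)
qed

lemma wcont_orbit:
  assumes "T \<in> wcont n c" "T' \<in> wcont n c"
  shows "\<exists>g\<in>Sym n. act g T = T'"
proof -
  have "card {x\<in>{1..n}. T' x = y} = card {x\<in>{1..n}. T x = y}" for y
  proof (cases "y < 2 * n")
    case False
    then have "{x\<in>{1..n}. T' x = y} = {}" "{x\<in>{1..n}. T x = y} = {}" using assms by (auto simp: wcont_def words_def)
    then show ?thesis by metis
  qed (use assms in \<open>auto simp: wcont_def\<close>)
  from perm_of_cards[of n T' T, OF this] show ?thesis using act_eqI assms wcont_words by metis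
qed

lemma card_act2:
  assumes g: "g \<in> Sym n"
  shows "card {x\<in>{1..n}. P (act g U x) (act g T x)} = card {x\<in>{1..n}. P (U x) (T x)}"
proof -
  have mem: "g x \<in> {1..n} \<longleftrightarrow> x \<in> {1..n}" for x using SymD(1)[OF g] by (rule permutes_in_image)
  have "{x\<in>{1..n}. P (act g U x) (act g T x)} = g ` {x\<in>{1..n}. P (U x) (T x)}"
  proof (rule Set.set_eqI, rule iffI)
    fix y assume y: "y \<in> {x\<in>{1..n}. P (act g U x) (act g T x)}"
    obtain x where "y = g x" using SymD(4)[OF g] by (metis surjD)
    then show "y \<in> g ` {x\<in>{1..n}. P (U x) (T x)}" using y mem by (auto simp: act_apply[OF g] simp del: atLeastAtMost_iff)
  qed (use mem in \<open>auto simp: act_apply[OF g] simp del: atLeastAtMost_iff\<close>)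
  then show ?thesis using SymD(3)[OF g] by (simp add: card_image inj_on_subset[OF _ subset_UNIV])
qed

lemma sum_act:
  assumes g: "g \<in> Sym n"
  shows "(\<Sum>x\<in>{1..n}. act g T x) = (\<Sum>x\<in>{1..n}. T x)"
  using sum.permute[OF SymD(1)[OF g], of "act g T"] by (simp add: comp_def act_apply[OF g])

lemma pointwise_act:
  assumes g: "g \<in> Sym n" and "\<And>x. x \<in> {1..n} \<Longrightarrow> S x \<le> (T x :: nat)" and x: "x \<in> {1..n}"
  shows "act g S x \<le> act g T x"
proof -
  obtain y where y: "x = g y" using SymD(4)[OF g] by (metis surjD)
  have "y \<in> {1..n}" using x permutes_in_image[OF SymD(1)[OF g]] unfolding y by blast
  then show ?thesis unfolding y act_apply[OF g] by (rule assms(2))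
qed

text \<open>The clause that \<open>wcont n c'\<close> is inhabited makes the partial sums of
  \<open>c'\<close> end in \<open>n\<close> (\<open>psum_total\<close>), so that \<open>c'\<close>
  can be replaced by a pair of partitions of total size \<open>n\<close> in the final
  induction.\<close>

inductive Jmat :: "nat \<Rightarrow> (nat \<Rightarrow> nat) \<Rightarrow> 'a::field mat \<Rightarrow> bool" for n c where
  Jmat_zero: "Jmat n c (0\<^sub>m (card (wcont n c)) (card (wcont n c)))"
| Jmat_step: "above n c c' \<Longrightarrow> wcont n c' \<noteq> {} \<Longrightarrow> A \<in> rep_hom (Sym n) (mono_rep n c) (mono_rep n c') \<Longrightarrow>
     B \<in> rep_hom (Sym n) (mono_rep n c') (mono_rep n c) \<Longrightarrow> Jmat n c M \<Longrightarrow> Jmat n c (B * A + M)"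

lemma Jmat_hom: "Jmat n c M \<Longrightarrow> M \<in> rep_hom (Sym n) (mono_rep n c) (mono_rep n c)"
proof (induction rule: Jmat.induct)
  case Jmat_zero
  then show ?case using rep_hom_zero[OF is_rep_mono[of n c] is_rep_mono[of n c]] by simp
next
  case (Jmat_step c' A B M)
  then show ?case by (intro rep_hom_add is_rep_mono rep_hom_mult[OF is_rep_mono is_rep_mono is_rep_mono])
qed

lemma Jmat_dim: "Jmat n c M \<Longrightarrow> dim_row M = card (wcont n c) \<and> dim_col M = card (wcont n c)"
  using rep_homD(1,2)[OF Jmat_hom] by fastforce

lemma Jmat_add:
  assumes "Jmat n c M" "Jmat n c M'"
  shows "Jmat n c (M + M')"
  using assms(1)
proof (induction rule: Jmat.induct)
  case Jmat_zero
  then show ?case using assms(2) Jmat_dim[OF assms(2)] by (simp add: add_zero_dim)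
next
  case (Jmat_step c' A B M)
  have "B * A + M + M' = B * A + (M + M')"
    using Jmat_dim[OF assms(2)] Jmat_dim[OF Jmat_step(5)] rep_homD(1,2)[OF Jmat_step(3)] rep_homD(1,2)[OF Jmat_step(4)]
    by (intro eq_matI) auto
  then show ?case using Jmat.Jmat_step[OF Jmat_step(1-4) Jmat_step(6)] by simp
qed

lemma Jmat_smult:
  assumes "Jmat n c M"
  shows "Jmat n c (k \<cdot>\<^sub>m M)"
  using assms
proof (induction rule: Jmat.induct)
  case Jmat_zero
  have "k \<cdot>\<^sub>m 0\<^sub>m (card (wcont n c)) (card (wcont n c)) = 0\<^sub>m (card (wcont n c)) (card (wcont n c))" by (intro eq_matI) auto
  then show ?case using Jmat.Jmat_zero by metis
next
  case (Jmat_step c' A B M)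
  have "k \<cdot>\<^sub>m (B * A + M) = (k \<cdot>\<^sub>m B) * A + k \<cdot>\<^sub>m M"
    using Jmat_dim[OF Jmat_step(5)] rep_homD(1,2)[OF Jmat_step(3)] rep_homD(1,2)[OF Jmat_step(4)]
    by (intro eq_matI) (auto simp: smult_mult_dim distrib_left)
  then show ?case using Jmat.Jmat_step[OF Jmat_step(1-3) rep_hom_smult[OF is_rep_mono is_rep_mono Jmat_step(4)] Jmat_step(6)] by simp
qed

lemma Jmat_prod:
  assumes "above n c c'" "wcont n c' \<noteq> {}" "kinv n c' c L" "kinv n c c' K"
  shows "Jmat n c (kmat n c c (kmul n c' K L))"
proof -
  have "Jmat n c (kmat n c c' K * kmat n c' c L + 0\<^sub>m (card (wcont n c)) (card (wcont n c)))"
    by (rule Jmat_step[OF assms(1,2) _ _ Jmat_zero]) (use assms in \<open>simp_all add: kmat_hom_iff\<close>)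
  then show ?thesis by (simp add: kmat_mult add_zero_dim)
qed

section \<open>Every endomorphism is a scalar modulo J\<close>

definition spanned :: "nat \<Rightarrow> (nat \<Rightarrow> nat) \<Rightarrow> 'a::field mat \<Rightarrow> bool" where
  "spanned n c A \<longleftrightarrow> (\<exists>a M. Jmat n c M \<and> A = a \<cdot>\<^sub>m 1\<^sub>m (card (wcont n c)) + M)"

lemma spanned_add:
  assumes "spanned n c A" "spanned n c B"
  shows "spanned n c (A + B)"
proof -
  obtain a M b N where *: "Jmat n c M" "A = a \<cdot>\<^sub>m 1\<^sub>m (card (wcont n c)) + M" "Jmat n c N" "B = b \<cdot>\<^sub>m 1\<^sub>m (card (wcont n c)) + N"
    using assms unfolding spanned_def by auto
  have "A + B = (a + b) \<cdot>\<^sub>m 1\<^sub>m (card (wcont n c)) + (M + N)"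
    unfolding * using Jmat_dim[OF *(1)] Jmat_dim[OF *(3)] by (intro eq_matI) auto
  then show ?thesis unfolding spanned_def using Jmat_add[OF *(1,3)] by blast
qed

lemma spanned_smult:
  assumes "spanned n c A"
  shows "spanned n c (k \<cdot>\<^sub>m A)"
proof -
  obtain a M where *: "Jmat n c M" "A = a \<cdot>\<^sub>m 1\<^sub>m (card (wcont n c)) + M"
    using assms unfolding spanned_def by auto
  have "k \<cdot>\<^sub>m A = (k * a) \<cdot>\<^sub>m 1\<^sub>m (card (wcont n c)) + k \<cdot>\<^sub>m M"
    unfolding * using Jmat_dim[OF *(1)] by (intro eq_matI) (auto simp: distrib_left)
  then show ?thesis unfolding spanned_def using Jmat_smult[OF *(1)] by blast
qed

lemma spanned_Jmat: "Jmat n c M \<Longrightarrow> spanned n c M"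
  unfolding spanned_def using Jmat_dim[of n c M] by (intro exI[of _ 0] exI[of _ M]) (auto intro!: eq_matI)

lemma spanned_one: "spanned n c (1\<^sub>m (card (wcont n c)))"
  unfolding spanned_def by (intro exI[of _ 1] exI[of _ "0\<^sub>m (card (wcont n c)) (card (wcont n c))"])
    (auto intro!: eq_matI Jmat_zero)

text \<open>The total of the largest word below both \<open>U\<close> and \<open>T\<close>. Every
  word below both has at most this total, which makes \<open>wt\<close> the grading for the
  reduction of kernels.\<close>

definition wt :: "nat \<Rightarrow> (nat \<Rightarrow> nat) \<Rightarrow> (nat \<Rightarrow> nat) \<Rightarrow> nat" where
  "wt n U T = (\<Sum>x\<in>{1..n}. min (U x) (T x))"

lemma min_unique:
  assumes "\<And>x. x \<in> {1..n} \<Longrightarrow> S x \<le> U x" "\<And>x. x \<in> {1..n} \<Longrightarrow> S x \<le> T x"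
  shows "(\<Sum>x\<in>{1..n}. S x) \<le> wt n U T" "(\<Sum>x\<in>{1..n}. S x) = wt n U T \<Longrightarrow> x \<in> {1..n} \<Longrightarrow> S x = min (U x) (T x)"
proof -
  have le: "S x \<le> min (U x) (T x)" if "x \<in> {1..n}" for x using assms that by simp
  then show "(\<Sum>x\<in>{1..n}. S x) \<le> wt n U T" unfolding wt_def by (rule sum_mono)
  assume "(\<Sum>x\<in>{1..n}. S x) = wt n U T" "x \<in> {1..n}"
  then show "S x = min (U x) (T x)" unfolding wt_def using sum_mono_inv[of S "{1..n}" "\<lambda>x. min (U x) (T x)" x] le by auto
qed

text \<open>If \<open>S\<close> is the minimum, a pair \<open>i < j\<close> of letters of
  \<open>(U, T)\<close> is the same pair for \<open>(S, T)\<close>, and dually for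
  \<open>j < i\<close>; the diagonal is what remains of the letter \<open>i\<close> of
  \<open>S\<close>. Hence the orbits of \<open>(U, S)\<close> and \<open>(S, T)\<close> determine
  that of \<open>(U, T)\<close>.\<close>

lemma joint_content_min:
  fixes S U T :: "nat \<Rightarrow> nat"
  assumes S: "\<And>x. x \<in> {1..n} \<Longrightarrow> S x = min (U x) (T x)"
  shows "card {x\<in>{1..n}. (U x, T x) = (i,j)} = (if i < j then card {x\<in>{1..n}. S x = i \<and> T x = j}
     else if j < i then card {x\<in>{1..n}. U x = i \<and> S x = j}
     else card {x\<in>{1..n}. S x = i \<and> S x = i} - card {x\<in>{1..n}. S x = i \<and> T x \<noteq> i} - card {x\<in>{1..n}. U x \<noteq> i \<and> S x = i})"
proof -
  consider "i < j" | "j < i" | "i = j" by linarith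
  then show ?thesis
  proof cases
    case 1
    then have "{x\<in>{1..n}. (U x, T x) = (i,j)} = {x\<in>{1..n}. S x = i \<and> T x = j}" using S by (fastforce simp: min_def split: if_splits)
    then show ?thesis using 1 by metis
  next
    case 2
    then have "{x\<in>{1..n}. (U x, T x) = (i,j)} = {x\<in>{1..n}. U x = i \<and> S x = j}" using S by (fastforce simp: min_def split: if_splits)
    then show ?thesis using 2 by (metis not_less_iff_gr_or_eq)
  next
    case 3
    let ?A = "{x\<in>{1..n}. (U x, T x) = (i,j)}" and ?B = "{x\<in>{1..n}. S x = i \<and> T x \<noteq> i}" and ?C = "{x\<in>{1..n}. U x \<noteq> i \<and> S x = i}"
    have u: "{x\<in>{1..n}. S x = i \<and> S x = i} = ?A \<union> ?B \<union> ?C" using S 3 by (auto simp: min_def split: if_splits)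
    have "?A \<inter> ?B = {}" "(?A \<union> ?B) \<inter> ?C = {}" using S 3 by (auto simp: min_def split: if_splits)
    then have "card (?A \<union> ?B \<union> ?C) = card ?A + card ?B + card ?C" by (simp add: card_Un_disjoint)
    then show ?thesis using 3 u by simp
  qed
qed

text \<open>The middle word in a nonzero term lies below \<open>U\<close> and \<open>T\<close> and
  has the total \<open>wt n U0 T0\<close>, so \<open>wt\<close> can only grow; if it stays, the
  middle word is the minimum and the orbit is that of \<open>(U0, T0)\<close>. For
  \<open>U0 = T0\<close> the minimum has content \<open>c\<close> itself, and the identity takes the
  place of the product.\<close>

lemma leading_product:
  fixes c :: "nat \<Rightarrow> nat"
  assumes U0: "U0 \<in> wcont n c" and T0: "T0 \<in> wcont n c" and ad: "admissible n U0 T0"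
  shows "\<exists>P :: _ \<Rightarrow> _ \<Rightarrow> 'a::field. kinv n c c P \<and> spanned n c (kmat n c c P) \<and> P U0 T0 = 1 \<and>
    (\<forall>U\<in>wcont n c. \<forall>T\<in>wcont n c. P U T \<noteq> 0 \<longrightarrow> wt n U0 T0 \<le> wt n U T \<and>
       (wt n U T = wt n U0 T0 \<longrightarrow> (\<exists>g\<in>Sym n. act g U0 = U \<and> act g T0 = T)))"
proof (cases "U0 = T0")
  case True
  let ?P = "\<lambda>U T. if U = T then 1 else 0 :: 'a"
  have "kinv n c c ?P" unfolding kinv_def using eps_square_field by (auto simp: act_eq_iff)
  moreover have "wt n T T = wt n U0 T0 \<and> (\<exists>g\<in>Sym n. act g U0 = T \<and> act g T0 = T)" if T: "T \<in> wcont n c" for T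
  proof -
    obtain g where g: "g \<in> Sym n" "act g T0 = T" using wcont_orbit[OF T0 T] by blast
    then show ?thesis using True sum_act[OF g(1), of T0] by (auto simp: wt_def)
  qed
  ultimately show ?thesis using True spanned_one[of n c] unfolding kmat_one by (intro exI[of _ ?P]) auto
next
  case False
  define S0 where "S0 x = min (U0 x) (T0 x)" for x
  define c' where "c' = content n S0"
  have "S0 \<in> words n" using wcont_words[OF U0] wcont_words[OF T0] by (auto simp: words_def S0_def min_def)
  then have S0: "S0 \<in> wcont n c'" unfolding c'_def by (rule wcont_content)
  have le: "S0 x \<le> U0 x" "S0 x \<le> T0 x" for x by (simp_all add: S0_def)
  have ab: "above n c c'"
  proof (cases "S0 = U0")
    case True
    then have "S0 \<noteq> T0" using False by simp
    then show ?thesis by (intro above_pointwise[OF T0 S0]) (auto simp: le)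
  qed (intro above_pointwise[OF U0 S0], auto simp: le)
  \<comment> \<open>Where the minimum differs from the letter of \<open>U0\<close>, it is the letter
    of \<open>T0\<close>, and the condition for \<open>(U0, T0)\<close> applies.\<close>
  have ad1: "admissible n U0 S0" using ad unfolding admissible_def S0_def
    by (auto simp: min_def split: if_splits)
  have ad2: "admissible n S0 T0" using ad unfolding admissible_def S0_def
    by (auto simp: min_def split: if_splits)
  let ?B = "korb n U0 S0 :: _ \<Rightarrow> _ \<Rightarrow> 'a" and ?C = "korb n S0 T0 :: _ \<Rightarrow> _ \<Rightarrow> 'a"
  let ?P = "kmul n c' ?B ?C"
  have Bp: "(\<forall>x\<in>{1..n}. S x \<le> U x) \<and> (\<Sum>x\<in>{1..n}. S x) = wt n U0 T0" if "?B U S \<noteq> 0" for U S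
  proof -
    from korb_nonzero[OF that] obtain g where g: "g \<in> Sym n" "act g U0 = U" "act g S0 = S" by auto
    then show ?thesis using pointwise_act[OF g(1), of S0 U0] le sum_act[OF g(1), of S0] by (auto simp: wt_def S0_def)
  qed
  have Cp: "\<forall>x\<in>{1..n}. S x \<le> T x" if "?C S T \<noteq> 0" for S T
  proof -
    from korb_nonzero[OF that] obtain g where g: "g \<in> Sym n" "act g S0 = S" "act g T0 = T" by auto
    then show ?thesis using pointwise_act[OF g(1), of S0 T0] le by auto
  qed
  have "kinv n c c ?P" by (intro kinv_kmul korb_kinv ad1 ad2)
  moreover have "spanned n c (kmat n c c ?P)"
    by (intro spanned_Jmat Jmat_prod[OF ab] korb_kinv ad1 ad2) (use S0 in auto)
  \<comment> \<open>Only \<open>S0\<close> contributes: another middle word would lie below both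
    words and have the same total as their minimum.\<close>
  moreover have "?P U0 T0 = 1"
  proof -
    have "?B U0 S * ?C S T0 = 0" if S: "S \<in> wcont n c'" "S \<noteq> S0" for S
    proof (rule ccontr)
      assume "?B U0 S * ?C S T0 \<noteq> 0"
      then have *: "?B U0 S \<noteq> 0" "?C S T0 \<noteq> 0" by auto
      have "S x = S0 x" if "x \<in> {1..n}" for x
        using min_unique(2)[of n S U0 T0 x] Bp[OF *(1)] Cp[OF *(2)] that unfolding S0_def by auto
      moreover have "S x = S0 x" if "x \<notin> {1..n}" for x
        using that wcont_words[OF S(1)] wcont_words[OF S0] unfolding words_def by auto
      ultimately show False using S(2) by blast
    qed
    then have "?P U0 T0 = (\<Sum>S\<in>wcont n c'. if S = S0 then ?B U0 S0 * ?C S0 T0 else 0)"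
      unfolding kmul_def by (intro sum.cong) auto
    also have "\<dots> = ?B U0 S0 * ?C S0 T0" using S0 finite_wcont by simp
    also have "\<dots> = 1" using korb_value[OF ad1 Sym_closed(3), where 'a='a] korb_value[OF ad2 Sym_closed(3), where 'a='a] by simp
    finally show ?thesis .
  qed
  moreover have "wt n U0 T0 \<le> wt n U T \<and> (wt n U T = wt n U0 T0 \<longrightarrow> (\<exists>g\<in>Sym n. act g U0 = U \<and> act g T0 = T))"
    if UT: "U \<in> wcont n c" "T \<in> wcont n c" "?P U T \<noteq> 0" for U T
  proof -
    obtain S where S: "S \<in> wcont n c'" "?B U S * ?C S T \<noteq> 0" using UT(3) unfolding kmul_def by (rule sum.not_neutral_contains_not_neutral)
    then have *: "?B U S \<noteq> 0" "?C S T \<noteq> 0" by auto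
    note b = Bp[OF *(1)] and c = Cp[OF *(2)]
    have 1: "wt n U0 T0 \<le> wt n U T" using min_unique(1)[of n S U T] b c by auto
    have "\<exists>g\<in>Sym n. act g U0 = U \<and> act g T0 = T" if w: "wt n U T = wt n U0 T0"
    proof -
      have Sm: "S x = min (U x) (T x)" if "x \<in> {1..n}" for x using min_unique(2)[of n S U T x] b c w that by auto
      obtain g where g: "g \<in> Sym n" "act g U0 = U" "act g S0 = S" using korb_nonzero[OF *(1)] by auto
      obtain h where h: "h \<in> Sym n" "act h S0 = S" "act h T0 = T" using korb_nonzero[OF *(2)] by auto
      have "card {x\<in>{1..n}. (U x, T x) = y} = card {x\<in>{1..n}. (U0 x, T0 x) = y}" for y
      proof -
        obtain i j where y: "y = (i,j)" by (cases y)
        have g2: "card {x\<in>{1..n}. P (U x) (S x)} = card {x\<in>{1..n}. P (U0 x) (S0 x)}" for P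
          using card_act2[OF g(1), of P U0 S0] g by simp
        have h2: "card {x\<in>{1..n}. P (S x) (T x)} = card {x\<in>{1..n}. P (S0 x) (T0 x)}" for P
          using card_act2[OF h(1), of P S0 T0] h by simp
        have a: "card {x\<in>{1..n}. (U x, T x) = (i,j)} = (if i < j then card {x\<in>{1..n}. S x = i \<and> T x = j}
            else if j < i then card {x\<in>{1..n}. U x = i \<and> S x = j}
            else card {x\<in>{1..n}. S x = i \<and> S x = i} - card {x\<in>{1..n}. S x = i \<and> T x \<noteq> i} - card {x\<in>{1..n}. U x \<noteq> i \<and> S x = i})"
          by (rule joint_content_min[OF Sm])
        have b: "card {x\<in>{1..n}. (U0 x, T0 x) = (i,j)} = (if i < j then card {x\<in>{1..n}. S0 x = i \<and> T0 x = j}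
            else if j < i then card {x\<in>{1..n}. U0 x = i \<and> S0 x = j}
            else card {x\<in>{1..n}. S0 x = i \<and> S0 x = i} - card {x\<in>{1..n}. S0 x = i \<and> T0 x \<noteq> i} - card {x\<in>{1..n}. U0 x \<noteq> i \<and> S0 x = i})"
          by (rule joint_content_min) (rule S0_def)
        show ?thesis unfolding y a b h2[of "\<lambda>s t. s = i \<and> t = j"] g2[of "\<lambda>u s. u = i \<and> s = j"] g2[of "\<lambda>u s. s = i \<and> s = i"]
            h2[of "\<lambda>s t. s = i \<and> t \<noteq> i"] g2[of "\<lambda>u s. u \<noteq> i \<and> s = i"] by (rule refl)
      qed
      from perm_of_cards[of n "\<lambda>x. (U x, T x)" "\<lambda>x. (U0 x, T0 x)", OF this]
      obtain k where k: "k \<in> Sym n" "\<And>x. x \<in> {1..n} \<Longrightarrow> U (k x) = U0 x" "\<And>x. x \<in> {1..n} \<Longrightarrow> T (k x) = T0 x" by auto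
      then show ?thesis using act_eqI[OF k(1) wcont_words[OF U0] wcont_words[OF UT(1)]] act_eqI[OF k(1) wcont_words[OF T0] wcont_words[OF UT(2)]] by auto
    qed
    then show ?thesis using 1 by blast
  qed
  ultimately show ?thesis by blast
qed

text \<open>A kernel is reduced modulo products along increasing \<open>wt\<close>.\<close>
lemma kernel_spanned_aux:
  fixes K :: "_ \<Rightarrow> _ \<Rightarrow> 'a::field"
  assumes two: "(2::'a) \<noteq> 0"
  shows "kinv n c c K \<Longrightarrow> (\<forall>U\<in>wcont n c. \<forall>T\<in>wcont n c. K U T \<noteq> 0 \<longrightarrow> N \<le> wt n U T) \<Longrightarrow> 2*n*n < N + m \<Longrightarrow> spanned n c (kmat n c c K)"
proof (induction m arbitrary: N K)
  case 0
  \<comment> \<open>No pair of words has a weight above \<open>2 * n * n\<close>: there are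
    \<open>n\<close> positions, and letters are below \<open>2 * n\<close>.\<close>
  have "K U T = 0" if UT: "U \<in> wcont n c" "T \<in> wcont n c" for U T
  proof (rule ccontr)
    assume "K U T \<noteq> 0"
    then have "N \<le> wt n U T" using 0 UT by blast
    also have "\<dots> \<le> (\<Sum>x\<in>{1..n}. 2 * n)" unfolding wt_def
      by (intro sum_mono min.coboundedI1 less_imp_le words_lt[OF wcont_words[OF UT(1)]])
    finally show False using 0 by (simp add: mult.commute)
  qed
  then have "kmat n c c K = 0\<^sub>m (card (wcont n c)) (card (wcont n c))" by (intro eq_matI) (auto simp: kmat_def wenum_mem)
  then show ?case by (simp add: spanned_Jmat Jmat_zero)
next
  case (Suc m)
  let ?s = "\<lambda>K. {(U,T)\<in>wcont n c \<times> wcont n c. K U T \<noteq> 0 \<and> wt n U T = N}"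
  have fin: "finite (?s K)" for K :: "_ \<Rightarrow> _ \<Rightarrow> 'a"
    by (rule finite_subset[of _ "wcont n c \<times> wcont n c"]) (auto simp: finite_wcont)
  show ?case using Suc.prems(1,2)
  proof (induction "card (?s K)" arbitrary: K rule: less_induct)
    case less
    show ?case
    proof (cases "?s K = {}")
      case True
      have "\<forall>U\<in>wcont n c. \<forall>T\<in>wcont n c. K U T \<noteq> 0 \<longrightarrow> Suc N \<le> wt n U T"
      proof (intro ballI impI)
        fix U T assume UT: "U \<in> wcont n c" "T \<in> wcont n c" "K U T \<noteq> 0"
        then have "N \<le> wt n U T" using less.prems(2) by blast
        moreover have "wt n U T \<noteq> N" using True UT by blast
        ultimately show "Suc N \<le> wt n U T" by simp
      qed
      then show ?thesis using Suc.IH[OF less.prems(1)] Suc.prems(3) by simp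
    next
      case False
      then obtain U0 T0 where 0: "U0 \<in> wcont n c" "T0 \<in> wcont n c" "K U0 T0 \<noteq> 0" "wt n U0 T0 = N" by auto
      have ad: "admissible n U0 T0" using kinv_not_admissible[OF less.prems(1) 0(1,2) _ two] 0(3) by blast
      from leading_product[OF 0(1,2) ad, where 'a='a] obtain P :: "_ \<Rightarrow> _ \<Rightarrow> 'a" where P: "kinv n c c P" "spanned n c (kmat n c c P)" "P U0 T0 = 1"
        "\<forall>U\<in>wcont n c. \<forall>T\<in>wcont n c. P U T \<noteq> 0 \<longrightarrow> wt n U0 T0 \<le> wt n U T \<and>
           (wt n U T = wt n U0 T0 \<longrightarrow> (\<exists>g\<in>Sym n. act g U0 = U \<and> act g T0 = T))" by blast
      \<comment> \<open>The multiple of \<open>P\<close> is chosen to cancel \<open>K\<close> at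
        \<open>(U0, T0)\<close>, hence on the whole orbit; outside that orbit \<open>P\<close> has
        no support of weight \<open>N\<close>, so no new pair of weight \<open>N\<close>
        appears.\<close>
      define K' where "K' U T = K U T + (- K U0 T0) * P U T" for U T
      have K': "kinv n c c K'" using less.prems(1) P(1) unfolding kinv_def K'_def by (simp add: algebra_simps)
      have z0: "K' U0 T0 = 0" by (simp add: K'_def P)
      have zorb: "K' U T = 0" if "g \<in> Sym n" "act g U0 = U" "act g T0 = T" for g U T
        using K' z0 0 that unfolding kinv_def by auto
      have sup: "N \<le> wt n U T" if "U \<in> wcont n c" "T \<in> wcont n c" "K' U T \<noteq> 0" for U T
        using that less.prems(2) P(4) 0(4) unfolding K'_def by (metis add.right_neutral mult_zero_right)
      have sub: "?s K' \<subset> ?s K"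
      proof (rule psubsetI)
        have "K U T \<noteq> 0" if UT: "U \<in> wcont n c" "T \<in> wcont n c" "K' U T \<noteq> 0" "wt n U T = N" for U T
        proof -
          have "P U T = 0" using P(4) UT 0(4) zorb by metis
          then show ?thesis using UT by (simp add: K'_def)
        qed
        then show "?s K' \<subseteq> ?s K" by blast
        have "(U0,T0) \<in> ?s K" "(U0,T0) \<notin> ?s K'" using 0 z0 by auto
        then show "?s K' \<noteq> ?s K" by blast
      qed
      have "spanned n c (kmat n c c K')"
        by (rule less.hyps[OF psubset_card_mono[OF fin sub] K']) (use sup in blast)
      moreover have "kmat n c c K = kmat n c c K' + K U0 T0 \<cdot>\<^sub>m kmat n c c P"
        by (simp add: kmat_smult kmat_add kmat_eq_iff K'_def)
      ultimately show ?thesis using spanned_add spanned_smult P(2) by metis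
    qed
  qed
qed

lemma endomorphism_spanned:
  assumes "(2::'a::field) \<noteq> 0" and A: "A \<in> rep_hom (Sym n) (mono_rep n c) (mono_rep n c)"
  shows "\<exists>a M. Jmat n c M \<and> A = (a::'a) \<cdot>\<^sub>m 1\<^sub>m (card (wcont n c)) + M"
proof -
  obtain K where K: "A = kmat n c c K" using rep_homD(1,2)[OF A] kmat_surj[of A n c c] by auto
  then have "kinv n c c K" using A kmat_hom_iff by blast
  then have "spanned n c (kmat n c c K)" by (rule kernel_spanned_aux[OF assms(1), where N=0 and m="Suc (2*n*n)"]) auto
  then show ?thesis unfolding K spanned_def .
qed

lemma identity_Jmat:
  fixes c :: "nat \<Rightarrow> nat"
  assumes ne: "wcont n c \<noteq> {}" and a: "a < n" "c a = 0" and j: "n \<le> j" "j < 2 * n" and cj: "of_nat (c j) \<noteq> (0::'a::field)"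
  shows "Jmat n c (1\<^sub>m (card (wcont n c)) :: 'a mat)"
proof -
  obtain T0 where T0: "T0 \<in> wcont n c" using ne by blast
  have cardj: "card {x\<in>{1..n}. T x = j} = c j" if "T \<in> wcont n c" for T using that j by (auto simp: wcont_def)
  have noa: "T x \<noteq> a" if "T \<in> wcont n c" "x \<in> {1..n}" for T x
  proof
    assume "T x = a"
    moreover have "card {x\<in>{1..n}. T x = a} = 0" using that a j by (auto simp: wcont_def)
    then have "{x\<in>{1..n}. T x = a} = {}" by (simp only: card_eq_0_iff) simp
    ultimately show False using that by blast
  qed
  have "card {x\<in>{1..n}. T0 x = j} \<noteq> 0" using cj unfolding cardj[OF T0] by (intro notI) simp
  then have "{x\<in>{1..n}. T0 x = j} \<noteq> {}" by (metis card.empty)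
  then obtain x0 where x0: "x0 \<in> {1..n}" "T0 x0 = j" by blast
  define S0 where "S0 = T0(x0 := a)"
  define c' where "c' = content n S0"
  have "S0 \<in> words n" using wcont_words[OF T0] x0 a unfolding words_def S0_def by auto
  then have S0: "S0 \<in> wcont n c'" unfolding c'_def by (rule wcont_content)
  have ab: "above n c c'"
    by (rule above_pointwise[OF T0 S0]) (use x0 a j in \<open>auto simp: S0_def fun_eq_iff\<close>)
  \<comment> \<open>\<open>a\<close> occurs only once in \<open>S0\<close>, so two positions with
    equal letters of \<open>S0\<close> are both unchanged.\<close>
  have adm: "admissible n T0 S0" "admissible n S0 T0"
  proof -
    have "n \<le> T0 x \<longleftrightarrow> n \<le> S0 x" if "x \<in> {1..n}" "y \<in> {1..n}" "x \<noteq> y" "S0 x = S0 y" for x y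
      using that noa[OF T0, of x] noa[OF T0, of y] by (auto simp: S0_def split: if_splits)
    then show "admissible n T0 S0" "admissible n S0 T0" unfolding admissible_def by blast+
  qed
  let ?B = "korb n T0 S0 :: _ \<Rightarrow> _ \<Rightarrow> 'a" and ?C = "korb n S0 T0 :: _ \<Rightarrow> _ \<Rightarrow> 'a"
  have act_upd: "act g S0 = (act g T0)(g x0 := a)" if g: "g \<in> Sym n" for g
  proof
    fix y
    obtain x where y: "y = g x" using SymD(4)[OF g] by (metis surjD)
    show "act g S0 y = ((act g T0)(g x0 := a)) y" unfolding y using SymD(3)[OF g]
      by (auto simp: act_apply[OF g] S0_def dest: injD)
  qed
  have form: "\<exists>x\<in>{1..n}. T x = j \<and> S = T(x := a)" if "act g T0 = T" "act g S0 = S" "g \<in> Sym n" for g S T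
    using act_upd[OF that(3)] that x0 act_apply[OF that(3), of T0 x0] permutes_in_image[OF SymD(1)[OF that(3)], of x0] by metis
  \<comment> \<open>Some \<open>g\<close> carries \<open>T0\<close> to \<open>T\<close>; a
    transposition within the letter \<open>j\<close> of \<open>T\<close> then moves the marked
    position to \<open>x\<close>.\<close>
  have exg: "\<exists>g\<in>Sym n. act g T0 = T \<and> act g S0 = T(x := a)" if T: "T \<in> wcont n c" and x: "x \<in> {1..n}" "T x = j" for T x
  proof -
    obtain g where g: "g \<in> Sym n" "act g T0 = T" using wcont_orbit[OF T0 T] by blast
    have gx: "g x0 \<in> {1..n}" using permutes_in_image[OF SymD(1)[OF g(1)]] x0 by blast
    have Tgx: "T (g x0) = T x" using act_apply[OF g(1), of T0 x0] g(2) x0 x by simp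
    let ?t = "swp (g x0) x"
    have t: "?t \<in> Sym n" "act ?t T = T" using act_transpose[OF gx x(1) Tgx] by auto
    have h: "?t \<circ> g \<in> Sym n" by (rule Sym_closed(1)[OF t(1) g(1)])
    have T': "act (?t \<circ> g) T0 = T" by (simp add: act_comp[OF t(1) g(1)] g(2) t(2))
    moreover have "act (?t \<circ> g) S0 = T(x := a)" using act_upd[OF h] T' by simp
    ultimately show ?thesis using h by blast
  qed
  have P: "kmul n c' ?B ?C U T = of_nat (c j) * (if U = T then 1 else 0)" if U: "U \<in> wcont n c" and T: "T \<in> wcont n c" for U T
  proof (cases "U = T")
    case False
    have "?B U S * ?C S T = 0" for S
    proof (rule ccontr)
      assume "?B U S * ?C S T \<noteq> 0"
      then have *: "?B U S \<noteq> 0" "?C S T \<noteq> 0" by auto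
      obtain x where x: "x \<in> {1..n}" "U x = j" "S = U(x := a)" using korb_nonzero[OF *(1)] form by blast
      obtain y where y: "y \<in> {1..n}" "T y = j" "S = T(y := a)" using korb_nonzero[OF *(2)] form by blast
      have "x = y" using x y noa[OF T x(1)] by (metis fun_upd_other fun_upd_same)
      then have "U = T" using x y by (metis fun_upd_triv fun_upd_upd)
      then show False using False by simp
    qed
    then have "kmul n c' ?B ?C U T = 0" unfolding kmul_def by (intro sum.neutral) blast
    then show ?thesis using False by simp
  next
    case True
    let ?F = "(\<lambda>x. T(x := a)) ` {x\<in>{1..n}. T x = j}"
    have val: "?B T S * ?C S T = (if S \<in> ?F then 1 else 0)" for S
    proof (cases "S \<in> ?F")
      case True
      then obtain x where x: "x \<in> {1..n}" "T x = j" "S = T(x := a)" by blast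
      obtain g where g: "g \<in> Sym n" "act g T0 = T" "act g S0 = S" using exg[OF T x(1,2)] x(3) by blast
      have "?B T S = of_int (eps n g T0 * eps n g S0)" "?C S T = of_int (eps n g S0 * eps n g T0)"
        using korb_value[OF adm(1) g(1), where 'a='a] korb_value[OF adm(2) g(1), where 'a='a] g(2,3) by simp_all
      then have "?B T S * ?C S T = of_int ((eps n g T0 * eps n g T0) * (eps n g S0 * eps n g S0))" by (simp add: ac_simps)
      then show ?thesis using True by (simp only: eps_square) simp
    next
      case False
      have "?B T S = 0"
      proof (rule ccontr)
        assume "?B T S \<noteq> 0"
        then obtain x where "x \<in> {1..n}" "T x = j" "S = T(x := a)" using korb_nonzero[of n T0 S0 T S] form by blast
        then show False using False by blast
      qed
      then show ?thesis using False by simp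
    qed
    have F: "?F \<subseteq> wcont n c'"
    proof
      fix S assume "S \<in> ?F"
      then obtain x where x: "x \<in> {1..n}" "T x = j" "S = T(x := a)" by blast
      obtain g where g: "g \<in> Sym n" "act g T0 = T" "act g S0 = S" using exg[OF T x(1,2)] x(3) by blast
      then show "S \<in> wcont n c'" using act_wcont[OF g(1) S0] by simp
    qed
    have inj: "inj_on (\<lambda>x. T(x := a)) {x\<in>{1..n}. T x = j}"
      by (rule inj_onI) (metis (mono_tags, lifting) T fun_upd_other fun_upd_same mem_Collect_eq noa)
    have "kmul n c' ?B ?C T T = (\<Sum>S\<in>wcont n c'. if S \<in> ?F then 1 else 0)" unfolding kmul_def by (simp only: val)
    also have "\<dots> = of_nat (card (wcont n c' \<inter> ?F))" by (simp add: sum.If_cases[OF finite_wcont])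
    also have "wcont n c' \<inter> ?F = ?F" using F by blast
    also have "card ?F = c j" using card_image[OF inj] cardj[OF T] by simp
    finally show ?thesis using True by simp
  qed
  have "Jmat n c (kmat n c c (kmul n c' ?B ?C))"
    by (rule Jmat_prod[OF ab]) (use S0 adm in \<open>auto intro: korb_kinv\<close>)
  then have "Jmat n c (inverse (of_nat (c j)) \<cdot>\<^sub>m kmat n c c (kmul n c' ?B ?C))" by (rule Jmat_smult)
  moreover have "inverse (of_nat (c j)) \<cdot>\<^sub>m kmat n c c (kmul n c' ?B ?C) = 1\<^sub>m (card (wcont n c))"
    unfolding kmat_smult kmat_one kmat_eq_iff using P cj by simp
  ultimately show ?thesis by simp
qed

section \<open>Renaming letters within their parity\<close>

definition relabel :: "nat \<Rightarrow> (nat \<Rightarrow> nat) \<Rightarrow> (nat \<Rightarrow> nat) \<Rightarrow> nat \<Rightarrow> nat" where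
  "relabel n f T = (\<lambda>x. if x \<in> {1..n} then f (T x) else 0)"

text \<open>A renaming that respects parity commutes with permutations of positions and leaves the
  odd positions, hence all signs, unchanged.\<close>

lemma relabel_iso:
  fixes c c' :: "nat \<Rightarrow> nat"
  assumes f: "bij_betw f {..<2*n} {..<2*n}" and par: "\<And>k. k < 2*n \<Longrightarrow> f k < n \<longleftrightarrow> k < n"
    and c: "\<And>k. k < 2*n \<Longrightarrow> c' (f k) = c k"
  shows "rep_iso (Sym n) (mono_rep n c :: 'a::field rep) (mono_rep n c')"
proof -
  let ?f' = "the_inv_into {..<2*n} f"
  have inj: "inj_on f {..<2*n}" using f by (rule bij_betw_imp_inj_on)
  have f': "?f' (f k) = k" if "k < 2*n" for k using that by (intro the_inv_into_f_f[OF inj]) simp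
  have f'': "f (?f' k) = k" "?f' k < 2*n" if "k < 2*n" for k
    using that f f_the_inv_into_f_bij_betw[OF f, of k] the_inv_into_into[OF inj, of k "{..<2*n}"] by (auto simp: bij_betw_def)
  have fk: "f k < 2*n" if "k < 2*n" for k using that f by (auto simp: bij_betw_def)
  have w: "relabel n h T \<in> words n" if "T \<in> words n" "\<And>k. k < 2*n \<Longrightarrow> h k < 2*n" for h T
    using that unfolding words_def relabel_def by auto
  have m1: "relabel n f T \<in> wcont n c'" if T: "T \<in> wcont n c" for T
  proof -
    have "card {x\<in>{1..n}. relabel n f T x = k} = c' k" if k: "k < 2*n" for k
    proof -
      have "relabel n f T x = k \<longleftrightarrow> T x = ?f' k" if x: "x \<in> {1..n}" for x
        unfolding relabel_def if_P[OF x] using f'[OF words_lt[OF wcont_words[OF T] x]] f''(1)[OF k] by metis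
      then have "{x\<in>{1..n}. relabel n f T x = k} = {x\<in>{1..n}. T x = ?f' k}" by blast
      moreover have "card {x\<in>{1..n}. T x = ?f' k} = c (?f' k)" using T f''(2)[OF k] by (auto simp: wcont_def)
      ultimately show ?thesis using c[OF f''(2)[OF k]] f''(1)[OF k] by simp
    qed
    then show ?thesis using w[OF wcont_words[OF T] fk] by (simp add: wcont_def)
  qed
  have m2: "relabel n ?f' T \<in> wcont n c" if T: "T \<in> wcont n c'" for T
  proof -
    have "card {x\<in>{1..n}. relabel n ?f' T x = k} = c k" if k: "k < 2*n" for k
    proof -
      have "relabel n ?f' T x = k \<longleftrightarrow> T x = f k" if x: "x \<in> {1..n}" for x
        unfolding relabel_def if_P[OF x] using f''(1)[OF words_lt[OF wcont_words[OF T] x]] f'[OF k] by metis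
      then have "{x\<in>{1..n}. relabel n ?f' T x = k} = {x\<in>{1..n}. T x = f k}" by blast
      moreover have "card {x\<in>{1..n}. T x = f k} = c' (f k)" using T fk[OF k] by (auto simp: wcont_def)
      ultimately show ?thesis using c[OF k] by simp
    qed
    then show ?thesis using w[OF wcont_words[OF T] f''(2)] by (simp add: wcont_def)
  qed
  have r1: "relabel n ?f' (relabel n f T) = T" if "T \<in> words n" for T
  proof
    fix x show "relabel n ?f' (relabel n f T) x = T x"
      using f'[OF words_lt[OF that, of x]] words_out[OF that, of x] by (cases "x \<in> {1..n}") (simp_all add: relabel_def del: atLeastAtMost_iff)
  qed
  have r2: "relabel n f (relabel n ?f' T) = T" if "T \<in> words n" for T
  proof
    fix x show "relabel n f (relabel n ?f' T) x = T x"
      using f''(1)[OF words_lt[OF that, of x]] words_out[OF that, of x] by (cases "x \<in> {1..n}") (simp_all add: relabel_def del: atLeastAtMost_iff)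
  qed
  have rel_iff: "U = relabel n f T \<longleftrightarrow> T = relabel n ?f' U" if "T \<in> words n" "U \<in> words n" for U T using r1 r2 that by metis
  have actr: "act g (relabel n f T) = relabel n f (act g T)" if g: "g \<in> Sym n" for g T
    using permutes_in_image[OF permutes_inv[OF SymD(1)[OF g]]] by (simp add: act_def relabel_def fun_eq_iff del: atLeastAtMost_iff)
  have od: "odds n (relabel n f T) = odds n T" if "T \<in> words n" for T
  proof -
    have "n \<le> relabel n f T x \<longleftrightarrow> n \<le> T x" if x: "x \<in> {1..n}" for x
      unfolding relabel_def if_P[OF x] using par[OF words_lt[OF \<open>T \<in> words n\<close> x]] by linarith
    then show ?thesis unfolding odds_def by blast
  qed
  have ep: "eps n g (relabel n f T) = eps n g T" if "T \<in> words n" for g T using od[OF that] by (simp add: eps_def)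
  let ?R = "\<lambda>U T. if U = relabel n f T then 1 else (0::'a)" and ?R' = "\<lambda>T U. if U = relabel n f T then 1 else (0::'a)"
  have i1: "kinv n c' c ?R" unfolding kinv_def
  proof (intro ballI)
    fix g U T assume g: "g \<in> Sym n" and U: "U \<in> wcont n c'" and T: "T \<in> wcont n c"
    show "?R (act g U) (act g T) = of_int (eps n g U * eps n g T) * ?R U T"
      using ep[OF wcont_words[OF T]] by (simp add: actr[OF g, symmetric] act_eq_iff[OF g] eps_square_field)
  qed
  then have i2: "kinv n c c' ?R'" unfolding kinv_def by (metis mult.commute)
  have k1: "kmul n c' ?R' ?R U T = (if U = T then 1 else 0)" if "U \<in> wcont n c" "T \<in> wcont n c" for U T
  proof -
    have "kmul n c' ?R' ?R U T = (\<Sum>S\<in>wcont n c'. if S = relabel n f T then (if U = T then 1 else 0) else 0)"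
      unfolding kmul_def
    proof (rule sum.cong[OF refl])
      fix S
      have "relabel n f U = relabel n f T \<longleftrightarrow> U = T" using r1[OF wcont_words[OF that(1)]] r1[OF wcont_words[OF that(2)]] by metis
      then show "?R' U S * ?R S T = (if S = relabel n f T then if U = T then 1 else 0 else 0)" by auto
    qed
    then show ?thesis using m1[OF that(2)] finite_wcont by simp
  qed
  have k2: "kmul n c ?R ?R' U T = (if U = T then 1 else 0)" if "U \<in> wcont n c'" "T \<in> wcont n c'" for U T
  proof -
    have "kmul n c ?R ?R' U T = (\<Sum>S\<in>wcont n c. if S = relabel n ?f' T then (if U = T then 1 else 0) else 0)"
      unfolding kmul_def
    proof (rule sum.cong[OF refl])
      fix S assume S: "S \<in> wcont n c"
      show "?R U S * ?R' S T = (if S = relabel n ?f' T then if U = T then 1 else 0 else 0)"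
        using rel_iff[OF wcont_words[OF S] wcont_words[OF that(2)]] by auto
    qed
    then show ?thesis using m2[OF that(2)] finite_wcont by simp
  qed
  show ?thesis
    by (rule rep_isoI[OF is_rep_mono is_rep_mono, of "kmat n c' c ?R" n c c' "kmat n c c' ?R'"])
      (use i1 i2 k1 k2 in \<open>simp_all add: kmat_hom_iff kmat_mult kmat_one kmat_eq_iff\<close>)
qed

section \<open>Contents and pairs of partitions\<close>

declare One_nat_def [simp]

definition cont :: "nat \<Rightarrow> nat list \<Rightarrow> nat list \<Rightarrow> nat \<Rightarrow> nat" where
  "cont n \<alpha> \<beta> = (\<lambda>k. if k < n then entry \<alpha> (Suc k) else entry \<beta> (Suc (k - n)))"

lemma entry_Suc: "entry a (Suc i) = (if i < length a then a ! i else 0)"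
  by (simp add: entry_def)

lemma sum_list_entry: "length a \<le> m \<Longrightarrow> sum_list a = (\<Sum>i<m. entry a (Suc i))"
proof -
  assume "length a \<le> m"
  then have "(\<Sum>i<m. entry a (Suc i)) = (\<Sum>i<length a. a ! i)"
    unfolding entry_Suc by (intro sum.mono_neutral_cong_right) auto
  then show ?thesis by (simp add: sum_list_sum_nth lessThan_atLeast0)
qed

lemma sorted_desc_nth_mono: "sorted_wrt (\<lambda>x y. y \<le> x) (a::nat list) \<Longrightarrow> i \<le> j \<Longrightarrow> j < length a \<Longrightarrow> a ! j \<le> a ! i"
  using sorted_wrt_nth_less[of "\<lambda>x y. y \<le> x" a i j] by (cases "i = j") auto

lemma entry_antimono: "is_partition a \<Longrightarrow> i \<le> j \<Longrightarrow> entry a (Suc j) \<le> entry a (Suc i)"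
  unfolding entry_Suc is_partition_def using sorted_desc_nth_mono[of a i j] by auto

lemma partition_pos: "is_partition a \<Longrightarrow> i < length a \<Longrightarrow> a ! i > 0"
proof -
  assume a: "is_partition a" "i < length a"
  then have "a \<noteq> []" by auto
  then have "last a \<noteq> 0" using a by (auto simp: is_partition_def is_composition_def)
  moreover have "i \<le> length a - 1" "length a - 1 < length a" using a(2) by linarith+
  then have "a ! (length a - 1) \<le> a ! i" using a(1) sorted_desc_nth_mono unfolding is_partition_def by blast
  then have "last a \<le> a ! i" unfolding last_conv_nth[OF \<open>a \<noteq> []\<close>] .
  ultimately show ?thesis by simp
qed

lemma partition_length: "is_partition a \<Longrightarrow> length a \<le> sum_list a"
proof -
  assume a: "is_partition a"
  have "length a = (\<Sum>i<length a. 1)" by simp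
  also have "\<dots> \<le> (\<Sum>i<length a. a ! i)" by (rule sum_mono) (use partition_pos[OF a] in \<open>simp add: Suc_le_eq\<close>)
  finally show ?thesis by (simp add: sum_list_sum_nth lessThan_atLeast0)
qed

text \<open>The largest index in \<open>A\<close> is at least \<open>card A - 1\<close>, so its
  value is at most the last one on the right-hand side.\<close>

lemma sum_top:
  fixes f :: "nat \<Rightarrow> nat"
  assumes anti: "\<And>i j. i \<le> j \<Longrightarrow> f j \<le> f i" and "finite A"
  shows "sum f A \<le> (\<Sum>i<card A. f i)"
  using assms(2)
proof (induction "card A" arbitrary: A)
  case (Suc m)
  note c = Suc.hyps(2)
  let ?M = "Max A"
  have ne: "A \<noteq> {}" using c by auto
  have M: "?M \<in> A" using Max_in[OF Suc.prems ne] .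
  have "A \<subseteq> {..?M}" using Max_ge[OF Suc.prems] by auto
  then have "card A \<le> card {..?M}" by (rule card_mono[rotated]) simp
  then have m: "m \<le> ?M" unfolding c[symmetric] by simp
  have c': "card (A - {?M}) = m" unfolding card_Diff_singleton[OF M] c[symmetric] by simp
  have "sum f A = f ?M + sum f (A - {?M})" by (rule sum.remove[OF Suc.prems M])
  also have "\<dots> \<le> f m + (\<Sum>i<m. f i)"
  proof (rule add_mono[OF anti[OF m]])
    have "finite (A - {?M})" using Suc.prems by simp
    from Suc.hyps(1)[OF c'[symmetric] this] show "sum f (A - {?M}) \<le> (\<Sum>i<m. f i)" unfolding c' .
  qed
  also have "\<dots> = (\<Sum>i<card A. f i)" unfolding c[symmetric] by simp
  finally show ?case .
qed simp

text \<open>Sorting into decreasing order can only raise the initial sums, by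
  \<open>sum_top\<close>. Zeros are dropped because a partition must end in a nonzero part.\<close>

lemma sort_to_partition:
  fixes h :: "nat \<Rightarrow> nat"
  obtains a \<sigma> where "is_partition a" "\<sigma> permutes {..<n}" "\<forall>i<n. entry a (Suc (\<sigma> i)) = h i" "length a \<le> n"
    "\<forall>k\<le>n. (\<Sum>i<k. h i) \<le> (\<Sum>i<k. entry a (Suc i))" "sum_list a = (\<Sum>i<n. h i)"
proof -
  define xs where "xs = rev (sort (map h [0..<n]))"
  have len: "length xs = n" by (simp add: xs_def)
  have srt: "sorted_wrt (\<lambda>x y. y \<le> x) xs" unfolding xs_def sorted_wrt_rev by simp
  define a where "a = filter (\<lambda>x. 0 < x) xs"
  \<comment> \<open>The zeros stand at the end of a decreasing list, and \<open>entry\<close> is 0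
    beyond the end, so removing them changes no entry.\<close>
  have fe: "sorted_wrt (\<lambda>x y. y \<le> x) ys \<Longrightarrow> entry (filter (\<lambda>x. 0 < x) ys) (Suc i) = (if i < length ys then ys ! i else 0)" for ys :: "nat list" and i
  proof (induction ys arbitrary: i)
    case (Cons y ys)
    show ?case
    proof (cases "y > 0")
      case True
      have "sorted_wrt (\<lambda>x y. y \<le> x) ys" using Cons.prems by simp
      note IH = Cons.IH[OF this]
      show ?thesis
      proof (cases i)
        case (Suc i')
        have "entry (filter (\<lambda>x. 0 < x) (y # ys)) (Suc i) = entry (filter (\<lambda>x. 0 < x) ys) (Suc i')"
          using True Suc by (simp add: entry_Suc)
        then show ?thesis unfolding IH using Suc by simp
      qed (use True in \<open>simp add: entry_Suc\<close>)
    next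
      case False
      then have z: "\<forall>z\<in>set (y # ys). z = 0" using Cons.prems by auto
      then have "filter (\<lambda>x. 0 < x) (y # ys) = []" by (auto simp: filter_empty_conv)
      then have "entry (filter (\<lambda>x. 0 < x) (y # ys)) (Suc i) = 0" by (simp only: entry_Suc) simp
      moreover have "(if i < length (y # ys) then (y # ys) ! i else 0) = 0" using z nth_mem[of i "y # ys"] by metis
      ultimately show ?thesis by metis
    qed
  qed (simp add: entry_Suc)
  have ent: "entry a (Suc i) = (if i < n then xs ! i else 0)" for i using fe[OF srt] len by (simp add: a_def)
  have part: "is_partition a" unfolding is_partition_def is_composition_def
  proof
    have "\<forall>z\<in>set a. 0 < z" by (simp add: a_def)
    then show "a = [] \<or> last a \<noteq> 0" using last_in_set[of a] by (metis less_irrefl)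
    show "sorted_wrt (\<lambda>x y. y \<le> x) a" unfolding a_def by (rule sorted_wrt_filter[OF srt])
  qed
  have "image_mset h (mset_set {..<n}) = mset (map h [0..<n])" by (simp add: lessThan_atLeast0)
  also have "\<dots> = mset xs" by (simp add: xs_def)
  also have "\<dots> = mset (map ((!) xs) [0..<n])" using len by (metis map_nth)
  also have "\<dots> = image_mset ((!) xs) (mset_set {..<n})" by (simp add: lessThan_atLeast0)
  finally obtain \<sigma> where s: "\<sigma> permutes {..<n}" "\<forall>i\<in>{..<n}. h i = xs ! (\<sigma> i)" using image_mset_eq_implies_permutes[of "{..<n}" h "(!) xs"] by auto
  have s2: "entry a (Suc (\<sigma> i)) = h i" if "i < n" for i using s that permutes_in_image[OF s(1), of i] by (simp add: ent)
  have dom: "(\<Sum>i<k. h i) \<le> (\<Sum>i<k. entry a (Suc i))" if k: "k \<le> n" for k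
  proof -
    have inj: "inj_on \<sigma> {..<k}" using permutes_inj_on[OF s(1)] .
    have "(\<Sum>i<k. h i) = (\<Sum>i<k. entry a (Suc (\<sigma> i)))" using s2 k by (intro sum.cong) auto
    also have "\<dots> = (\<Sum>i\<in>\<sigma> ` {..<k}. entry a (Suc i))" by (simp add: sum.reindex[OF inj])
    also have "\<dots> \<le> (\<Sum>i<card (\<sigma> ` {..<k}). entry a (Suc i))" by (rule sum_top) (auto simp: entry_antimono[OF part])
    finally show ?thesis by (simp add: card_image[OF inj])
  qed
  have la: "length a \<le> n" unfolding a_def using len length_filter_le[of "\<lambda>x. 0 < x" xs] by simp
  have "(\<Sum>i<n. h i) = (\<Sum>i<n. entry a (Suc (\<sigma> i)))" using s2 by (intro sum.cong) auto
  also have "\<dots> = (\<Sum>i<n. entry a (Suc i))" using sum.permute[OF s(1), of "\<lambda>i. entry a (Suc i)"] by (simp add: comp_def)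
  finally have "sum_list a = (\<Sum>i<n. h i)" using sum_list_entry[OF la] by simp
  then show ?thesis using that[OF part s(1)] s2 la dom by simp
qed

lemma psum_cont:
  "k \<le> n \<Longrightarrow> psum (cont n \<alpha> \<beta>) k = (\<Sum>i<k. entry \<alpha> (Suc i))"
  "psum (cont n \<alpha> \<beta>) (n + k) = (\<Sum>i<n. entry \<alpha> (Suc i)) + (\<Sum>i<k. entry \<beta> (Suc i))"
proof -
  show "k \<le> n \<Longrightarrow> psum (cont n \<alpha> \<beta>) k = (\<Sum>i<k. entry \<alpha> (Suc i))" unfolding psum_def cont_def by (intro sum.cong) auto
  show "psum (cont n \<alpha> \<beta>) (n + k) = (\<Sum>i<n. entry \<alpha> (Suc i)) + (\<Sum>i<k. entry \<beta> (Suc i))"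
  proof (induction k)
    case 0
    have "(\<Sum>i<n. cont n \<alpha> \<beta> i) = (\<Sum>i<n. entry \<alpha> (Suc i))" by (rule sum.cong) (auto simp: cont_def)
    then show ?case by (simp add: psum_def)
  next
    case (Suc k)
    then show ?case by (simp add: psum_def cont_def)
  qed
qed

text \<open>Even and odd letters are sorted separately. This brings the larger contents met in the
  reduction back to pairs of partitions without lowering them.\<close>

lemma content_to_partitions:
  assumes tot: "psum c (2 * n) = n"
  obtains \<alpha> \<beta> where "is_partition \<alpha>" "is_partition \<beta>" "sum_list \<alpha> + sum_list \<beta> = n"
    "rep_iso (Sym n) (mono_rep n c :: 'a::field rep) (mono_rep n (cont n \<alpha> \<beta>))"
    "\<forall>k\<le>2*n. psum c k \<le> psum (cont n \<alpha> \<beta>) k"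
proof -
  obtain a \<sigma> where a: "is_partition a" "\<sigma> permutes {..<n}" "\<forall>i<n. entry a (Suc (\<sigma> i)) = c i" "length a \<le> n"
    "\<forall>k\<le>n. (\<Sum>i<k. c i) \<le> (\<Sum>i<k. entry a (Suc i))" "sum_list a = (\<Sum>i<n. c i)" by (rule sort_to_partition)
  obtain b \<tau> where b: "is_partition b" "\<tau> permutes {..<n}" "\<forall>i<n. entry b (Suc (\<tau> i)) = c (n + i)" "length b \<le> n"
    "\<forall>k\<le>n. (\<Sum>i<k. c (n + i)) \<le> (\<Sum>i<k. entry b (Suc i))" "sum_list b = (\<Sum>i<n. c (n + i))" by (rule sort_to_partition)
  have split: "psum c (n + k) = (\<Sum>i<n. c i) + (\<Sum>i<k. c (n + i))" for k
    by (induction k) (simp_all add: psum_def)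
  have sab: "sum_list a + sum_list b = n" using split[of n] tot a(6) b(6) by (simp add: mult_2)
  have dom: "psum c k \<le> psum (cont n a b) k" if k: "k \<le> 2*n" for k
  proof (cases "k \<le> n")
    case True
    then show ?thesis using a(5) by (simp add: psum_cont) (simp add: psum_def)
  next
    case False
    define l where "l = k - n"
    have l: "k = n + l" "l \<le> n" using False k by (auto simp: l_def)
    show ?thesis unfolding l(1) psum_cont split using a(5) b(5) l(2) by (intro add_mono) auto
  qed
  define f where "f k = (if k < n then \<sigma> k else n + \<tau> (k - n))" for k
  have lt: "\<sigma> k < n \<longleftrightarrow> k < n" "\<tau> k < n \<longleftrightarrow> k < n" for k using permutes_in_image[OF a(2), of k] permutes_in_image[OF b(2), of k] by auto
  have inj: "inj_on f {..<2*n}"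
  proof (rule inj_onI)
    fix x y assume f: "f x = f y"
    consider "x < n" "y < n" | "x < n" "\<not> y < n" | "\<not> x < n" "y < n" | "\<not> x < n" "\<not> y < n" by blast
    then show "x = y"
    proof cases
      case 1
      then show ?thesis using f injD[OF permutes_inj[OF a(2)], of x y] by (simp add: f_def)
    next
      case 2
      then show ?thesis using f lt(1)[of x] by (simp add: f_def)
    next
      case 3
      then show ?thesis using f lt(1)[of y] by (simp add: f_def)
    next
      case 4
      then have "x - n = y - n" using f injD[OF permutes_inj[OF b(2)], of "x - n" "y - n"] by (simp add: f_def)
      then show ?thesis using 4 by linarith
    qed
  qed
  have into: "f ` {..<2*n} \<subseteq> {..<2*n}" 
  proof (rule image_subsetI)
    fix x assume "x \<in> {..<2*n}"
    then show "f x \<in> {..<2*n}" using lt(1)[of x] lt(2)[of "x - n"] unfolding f_def by (auto split: if_splits)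
  qed
  have bij: "bij_betw f {..<2*n} {..<2*n}" unfolding bij_betw_def using inj endo_inj_surj[OF _ into inj] by simp
  have "rep_iso (Sym n) (mono_rep n c :: 'a rep) (mono_rep n (cont n a b))"
  proof (rule relabel_iso[OF bij])
    show "f k < n \<longleftrightarrow> k < n" if "k < 2*n" for k using lt by (auto simp: f_def)
    show "cont n a b (f k) = c k" if k: "k < 2*n" for k
    proof (cases "k < n")
      case True
      then show ?thesis using a(3) lt by (simp add: f_def cont_def)
    next
      case False
      then have "b = b" "k - n < n" "n + (k - n) = k" using k by auto
      then show ?thesis using b(3) False by (simp add: f_def cont_def)
    qed
  qed
  then show ?thesis using that[OF a(1) b(1) sab] dom by simp
qed

text \<open>The sums up to \<open>k \<le> n\<close> give the first family of inequalities and those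
  up to \<open>n + k\<close> the second. Both families are constant from \<open>k = n\<close> on, as
  no partition involved has more than \<open>n\<close> parts.\<close>

lemma dominates_psum:
  assumes "sum_list \<alpha> \<le> n" "sum_list l \<le> n" "sum_list \<beta> \<le> n" "sum_list \<nu> \<le> n"
    and part: "is_partition \<alpha>" "is_partition \<beta>" "is_partition l" "is_partition \<nu>"
    and dom: "\<forall>k\<le>2*n. psum (cont n \<alpha> \<beta>) k \<le> psum (cont n l \<nu>) k"
  shows "dominates (l, \<nu>) (\<alpha>, \<beta>)"
proof -
  have len: "length \<alpha> \<le> n" "length \<beta> \<le> n" "length l \<le> n" "length \<nu> \<le> n"
    using partition_length[OF part(1)] partition_length[OF part(2)] partition_length[OF part(3)] partition_length[OF part(4)] assms by linarith+
  have shift: "(\<Sum>i=1..k. entry a i) = (\<Sum>i<k. entry a (Suc i))" for a k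
    by (simp add: sum.atLeast1_atMost_eq)
  have trunc: "(\<Sum>i<k. entry a (Suc i)) = (\<Sum>i<min k n. entry a (Suc i))" if "length a \<le> n" for a k
    using that by (intro sum.mono_neutral_right) (auto simp: entry_Suc)
  have 1: "(\<Sum>i<k. entry \<alpha> (Suc i)) \<le> (\<Sum>i<k. entry l (Suc i))" for k
    using dom[rule_format, of "min k n"] trunc[OF len(1), of k] trunc[OF len(3), of k] by (simp add: psum_cont)
  have 2: "sum_list \<alpha> + (\<Sum>i<k. entry \<beta> (Suc i)) \<le> sum_list l + (\<Sum>i<k. entry \<nu> (Suc i))" for k
    using dom[rule_format, of "n + min k n"] trunc[OF len(2), of k] trunc[OF len(4), of k] sum_list_entry[OF len(1)] sum_list_entry[OF len(3)]
    by (simp add: psum_cont)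
  show ?thesis unfolding dominates_def fst_conv snd_conv shift by (intro allI impI conjI) (rule 1, rule 2)
qed

section \<open>Induced modules and relative projectivity\<close>

lemma perm_subgroupD:
  assumes "perm_subgroup H G"
  shows "h \<in> H \<Longrightarrow> h \<in> G" "id \<in> H" "a \<in> H \<Longrightarrow> b \<in> H \<Longrightarrow> a \<circ> b \<in> H" "a \<in> H \<Longrightarrow> pinv a \<in> H"
  using assms by (auto simp: perm_subgroup_def)

lemma Sym_cancel:
  assumes "g \<in> Sym n"
  shows "pinv g \<circ> (g \<circ> h) = h" "g \<circ> (pinv g \<circ> h) = h" "h \<circ> pinv g \<circ> g = h" "h \<circ> g \<circ> pinv g = h"
  using Sym_inv(1,2)[OF assms] by (metis comp_assoc id_comp comp_id)+

lemma transversal_exists: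
  assumes H: "perm_subgroup H (Sym n)"
  shows "\<exists>ts. left_transversal (Sym n) H ts"
proof -
  define coset where "coset g = (\<lambda>h. g \<circ> h) ` H" for g :: "nat \<Rightarrow> nat"
  have mem: "x \<in> coset g \<longleftrightarrow> pinv g \<circ> x \<in> H" if g: "g \<in> Sym n" for g x
  proof
    assume "x \<in> coset g"
    then show "pinv g \<circ> x \<in> H" using Sym_cancel(1)[OF g] by (auto simp: coset_def)
  next
    assume "pinv g \<circ> x \<in> H"
    then show "x \<in> coset g" using Sym_cancel(2)[OF g, of x] unfolding coset_def by (metis image_eqI)
  qed
  have sub: "coset g \<subseteq> Sym n" if "g \<in> Sym n" for g using Sym_closed(1)[OF that] perm_subgroupD(1)[OF H] by (auto simp: coset_def)
  have self: "g \<in> coset g" for g using perm_subgroupD(2)[OF H] unfolding coset_def by (metis comp_id image_eqI)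
  have eq: "coset x = coset g" if g: "g \<in> Sym n" and x: "x \<in> coset g" for x g
  proof -
    obtain h where h: "h \<in> H" "x = g \<circ> h" using x by (auto simp: coset_def)
    have hS: "h \<in> Sym n" using h perm_subgroupD(1)[OF H] by blast
    have "g \<circ> k \<in> coset x" if "k \<in> H" for k
    proof -
      have "g \<circ> k = x \<circ> (pinv h \<circ> k)" unfolding h(2) comp_assoc Sym_cancel(2)[OF hS] ..
      then show ?thesis using perm_subgroupD(3)[OF H perm_subgroupD(4)[OF H h(1)] that] by (auto simp: coset_def)
    qed
    moreover have "x \<circ> k \<in> coset g" if "k \<in> H" for k
      using perm_subgroupD(3)[OF H h(1) that] unfolding h(2) by (auto simp: coset_def comp_assoc)
    ultimately show ?thesis unfolding coset_def by blast
  qed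
  obtain cs where cs: "set cs = coset ` Sym n" "distinct cs" using finite_distinct_list[of "coset ` Sym n"] finite_Sym by blast
  define r where "r c = (SOME x. x \<in> c)" for c :: "(nat \<Rightarrow> nat) set"
  define ts where "ts = map r cs"
  have cs_i: "\<exists>g\<in>Sym n. cs ! i = coset g" if "i < length cs" for i using nth_mem[OF that] cs(1) by auto
  have r: "r c \<in> c" if c: "c \<in> set cs" for c
  proof -
    obtain g where "c = coset g" using c cs(1) by auto
    then show ?thesis unfolding r_def using someI[of "\<lambda>x. x \<in> coset g", OF self] by simp
  qed
  have ri: "ts ! i \<in> Sym n" "coset (ts ! i) = cs ! i" if i: "i < length cs" for i
  proof -
    obtain g where g: "g \<in> Sym n" "cs ! i = coset g" using cs_i[OF i] by blast
    have "ts ! i \<in> coset g" using r[OF nth_mem[OF i]] g(2) i by (simp add: ts_def)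
    then show "ts ! i \<in> Sym n" "coset (ts ! i) = cs ! i" using sub[OF g(1)] eq[OF g(1)] g(2) by auto
  qed
  have "left_transversal (Sym n) H ts" unfolding left_transversal_def
  proof (intro conjI ballI)
    show "set ts \<subseteq> Sym n" using ri(1) by (auto simp: in_set_conv_nth ts_def)
    fix g assume g: "g \<in> Sym n"
    have iff: "pinv (ts ! i) \<circ> g \<in> H \<longleftrightarrow> cs ! i = coset g" if i: "i < length cs" for i
      using mem[OF ri(1)[OF i], of g] ri(2)[OF i] eq[OF ri(1)[OF i], of g] self[of g] by metis
    obtain i where "i < length cs" "cs ! i = coset g" using g cs(1) by (metis imageI in_set_conv_nth)
    then have "\<exists>!i. i < length cs \<and> pinv (ts ! i) \<circ> g \<in> H"
      using iff cs(2) by (intro ex1I[of _ i]) (blast, metis nth_eq_iff_index_eq)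
    then show "\<exists>!i. i < length ts \<and> pinv (ts ! i) \<circ> g \<in> H" by (simp add: ts_def)
  qed
  then show ?thesis by blast
qed

section \<open>Block rows and block columns\<close>

definition colblk :: "nat \<Rightarrow> 'a::field mat \<Rightarrow> nat \<Rightarrow> 'a mat" where
  "colblk d A i = mat (dim_row A) d (\<lambda>(s,r). A $$ (s, i * d + r))"
definition rowblk :: "nat \<Rightarrow> 'a::field mat \<Rightarrow> nat \<Rightarrow> 'a mat" where
  "rowblk d A i = mat d (dim_col A) (\<lambda>(r,s). A $$ (i * d + r, s))"

lemma blk_dim [simp]: "dim_row (colblk d A i) = dim_row A" "dim_col (colblk d A i) = d"
  "dim_row (rowblk d A i) = d" "dim_col (rowblk d A i) = dim_col A"
  by (auto simp: colblk_def rowblk_def)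

lemma blk_index_less: "i < m \<Longrightarrow> r < d \<Longrightarrow> i * d + r < m * (d::nat)"
proof -
  assume *: "i < m" "r < d"
  have "i * d + r < Suc i * d" using * by simp
  also have "\<dots> \<le> m * d" using * by (intro mult_le_mono1) simp
  finally show ?thesis .
qed

lemma sum_lessThan_add: "(\<Sum>l<a + (d::nat). f l) = (\<Sum>l<a. f l) + (\<Sum>r<d. f (a + r))" for f :: "nat \<Rightarrow> 'b::comm_monoid_add"
  by (induction d) (simp_all add: add.assoc)

lemma sum_blocks: "(\<Sum>l<m * (d::nat). f l) = (\<Sum>i<m. \<Sum>r<d. f (i * d + r))" for f :: "nat \<Rightarrow> 'b::comm_monoid_add"
proof (induction m)
  case (Suc m)
  have "(\<Sum>l<Suc m * d. f l) = (\<Sum>l<m * d + d. f l)" by (simp add: add.commute)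
  also have "\<dots> = (\<Sum>l<m * d. f l) + (\<Sum>r<d. f (m * d + r))"
    by (rule sum_lessThan_add)
  finally show ?case using Suc by simp
qed simp

lemma mult_blocks:
  fixes A B :: "'a::field mat"
  assumes "dim_col A = m * d" "dim_row B = m * d" "s < dim_row A" "t < dim_col B"
  shows "(A * B) $$ (s,t) = (\<Sum>i<m. (colblk d A i * rowblk d B i) $$ (s,t))"
proof -
  have "(A * B) $$ (s,t) = (\<Sum>l<m * d. A $$ (s,l) * B $$ (l,t))"
    using assms by (simp add: scalar_prod_def lessThan_atLeast0)
  also have "\<dots> = (\<Sum>i<m. \<Sum>r<d. A $$ (s, i * d + r) * B $$ (i * d + r, t))" by (rule sum_blocks)
  also have "\<dots> = (\<Sum>i<m. (colblk d A i * rowblk d B i) $$ (s,t))"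
    using assms by (intro sum.cong) (auto simp: scalar_prod_def lessThan_atLeast0 colblk_def rowblk_def)
  finally show ?thesis .
qed

lemma colblk_mult:
  fixes A C :: "'a::field mat"
  assumes "dim_col C = dim_row A" "dim_col A = m * d" "i < m"
  shows "colblk d (C * A) i = C * colblk d A i"
  using assms blk_index_less[of i m _ d] by (intro eq_matI) (auto simp: colblk_def scalar_prod_def)

lemma rowblk_mult:
  fixes A C :: "'a::field mat"
  assumes "dim_row C = dim_col A" "dim_row A = m * d" "i < m"
  shows "rowblk d (A * C) i = rowblk d A i * C"
  using assms blk_index_less[of i m _ d] by (intro eq_matI) (auto simp: rowblk_def scalar_prod_def)

lemma eq_by_rowblk:
  fixes A B :: "'a::field mat"
  assumes "dim_row A = m * d" "dim_row B = m * d" "dim_col A = dim_col B" "\<And>i. i < m \<Longrightarrow> rowblk d A i = rowblk d B i"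
  shows "A = B"
proof (rule eq_matI)
  fix a s assume as: "a < dim_row B" "s < dim_col B"
  have d: "d > 0" using as assms(2) by (cases d) auto
  have a: "a div d < m" "a mod d < d" using as assms(2) d by (auto simp: less_mult_imp_div_less)
  have "rowblk d A (a div d) $$ (a mod d, s) = rowblk d B (a div d) $$ (a mod d, s)" using assms(4)[OF a(1)] by simp
  then show "A $$ (a,s) = B $$ (a,s)" using a as assms(3) by (simp add: rowblk_def)
qed (use assms in auto)

lemma eq_by_colblk:
  fixes A B :: "'a::field mat"
  assumes "dim_col A = m * d" "dim_col B = m * d" "dim_row A = dim_row B" "\<And>i. i < m \<Longrightarrow> colblk d A i = colblk d B i"
  shows "A = B"
proof (rule eq_matI)
  fix s a assume as: "s < dim_row B" "a < dim_col B"
  have d: "d > 0" using as assms(2) by (cases d) auto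
  have a: "a div d < m" "a mod d < d" using as assms(2) d by (auto simp: less_mult_imp_div_less)
  have "colblk d A (a div d) $$ (s, a mod d) = colblk d B (a div d) $$ (s, a mod d)" using assms(4)[OF a(1)] by simp
  then show "A $$ (s,a) = B $$ (s,a)" using a as assms(3) by (simp add: colblk_def)
qed (use assms in auto)

section \<open>Induced modules along a fixed transversal\<close>

locale induction_data =
  fixes n :: nat and H :: "(nat \<Rightarrow> nat) set" and M :: "'a::field rep"
  assumes H: "perm_subgroup H (Sym n)" and M: "is_rep H M"
begin

definition ts :: "(nat \<Rightarrow> nat) list" where "ts = (SOME ts. left_transversal (Sym n) H ts)"
abbreviation m :: nat where "m \<equiv> length ts"
abbreviation d :: nat where "d \<equiv> fst M"

lemma ts: "left_transversal (Sym n) H ts"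
  unfolding ts_def by (rule someI_ex[OF transversal_exists[OF H]])

lemma ts_Sym: "i < m \<Longrightarrow> ts ! i \<in> Sym n"
  using ts unfolding left_transversal_def by auto

lemma ts_ex1: "g \<in> Sym n \<Longrightarrow> \<exists>!i. i < m \<and> pinv (ts ! i) \<circ> g \<in> H"
  using ts unfolding left_transversal_def by auto

text \<open>The permutation of the cosets: \<open>cst g j\<close> is the index of the coset of
  \<open>g \<circ> ts ! j\<close>, and \<open>tr (cst g j) g j\<close> is the element of
  \<open>H\<close> that acts in the only nonzero block of block column \<open>j\<close>.\<close>

definition cst :: "(nat \<Rightarrow> nat) \<Rightarrow> nat \<Rightarrow> nat" where
  "cst g j = (THE i. i < m \<and> pinv (ts ! i) \<circ> (g \<circ> ts ! j) \<in> H)"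
definition tr :: "nat \<Rightarrow> (nat \<Rightarrow> nat) \<Rightarrow> nat \<Rightarrow> nat \<Rightarrow> nat" where
  "tr i g j = pinv (ts ! i) \<circ> g \<circ> ts ! j"

lemma cst_spec:
  assumes "g \<in> Sym n" "j < m"
  shows "cst g j < m" "tr (cst g j) g j \<in> H" "i < m \<Longrightarrow> tr i g j \<in> H \<Longrightarrow> i = cst g j"
proof -
  note ex = ts_ex1[OF Sym_closed(1)[OF assms(1) ts_Sym[OF assms(2)]]]
  show "cst g j < m" "tr (cst g j) g j \<in> H" using theI'[OF ex] unfolding cst_def tr_def comp_assoc by auto
  show "i < m \<Longrightarrow> tr i g j \<in> H \<Longrightarrow> i = cst g j" unfolding cst_def tr_def comp_assoc using the1_equality[OF ex, of i] by simp
qed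

lemma HSym: "h \<in> H \<Longrightarrow> h \<in> Sym n" using perm_subgroupD(1)[OF H] .

lemma tr_comp: "j < m \<Longrightarrow> tr i g j \<circ> tr j h k = tr i (g \<circ> h) k"
  unfolding tr_def using Sym_cancel(4)[OF ts_Sym, of j] by (metis comp_assoc)

lemma cst_comp:
  assumes "g \<in> Sym n" "h \<in> Sym n" "j < m"
  shows "cst (g \<circ> h) j = cst g (cst h j)"
proof -
  note 1 = cst_spec[OF assms(2,3)]
  note 2 = cst_spec[OF assms(1) 1(1)]
  have "tr (cst g (cst h j)) (g \<circ> h) j \<in> H" using perm_subgroupD(3)[OF H 2(2) 1(2)] tr_comp[OF 1(1)] by simp
  then show ?thesis using cst_spec(3)[OF Sym_closed(1)[OF assms(1,2)] assms(3) 2(1)] by simp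
qed

lemma cst_id: "j < m \<Longrightarrow> cst id j = j"
proof -
  assume j: "j < m"
  have "tr j id j \<in> H" using perm_subgroupD(2)[OF H] Sym_inv(2)[OF ts_Sym[OF j]] by (simp add: tr_def)
  from cst_spec(3)[OF Sym_closed(3) j j this] show ?thesis by (rule sym)
qed

lemma cst_inv: "g \<in> Sym n \<Longrightarrow> j < m \<Longrightarrow> cst g (cst (pinv g) j) = j" "g \<in> Sym n \<Longrightarrow> j < m \<Longrightarrow> cst (pinv g) (cst g j) = j"
  using cst_comp[of g "pinv g" j] cst_comp[of "pinv g" g j] cst_id by (simp_all add: Sym_closed Sym_inv)

lemma Ind_eq: "fst (Ind (Sym n) H M) = m * d"
  "snd (Ind (Sym n) H M) g = mat (m * d) (m * d) (\<lambda>(a,b). if tr (a div d) g (b div d) \<in> H then snd M (tr (a div d) g (b div d)) $$ (a mod d, b mod d) else 0)"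
  unfolding Ind_def ts_def[symmetric] Let_def tr_def by simp_all

lemma Ind_rowblk_colblk:
  assumes g: "g \<in> Sym n" and i: "i < m" and j: "j < m"
  shows "rowblk d (colblk d (snd (Ind (Sym n) H M) g) j) i = (if i = cst g j then snd M (tr i g j) else 0\<^sub>m d d)"
proof (rule eq_matI)
  fix r s assume "r < dim_row (if i = cst g j then snd M (tr i g j) else 0\<^sub>m d d)" "s < dim_col (if i = cst g j then snd M (tr i g j) else 0\<^sub>m d d)"
  then have rs: "r < d" "s < d" using cst_spec(2)[OF g j] is_repD(1,2)[OF M] by (auto split: if_splits)
  have dm: "(i * d + r) div d = i" "(i * d + r) mod d = r" "(j * d + s) div d = j" "(j * d + s) mod d = s" using rs by auto
  have mem: "tr i g j \<in> H \<longleftrightarrow> i = cst g j" using cst_spec(2)[OF g j] cst_spec(3)[OF g j i] by metis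
  show "rowblk d (colblk d (snd (Ind (Sym n) H M) g) j) i $$ (r,s) = (if i = cst g j then snd M (tr i g j) else 0\<^sub>m d d) $$ (r,s)"
    using rs blk_index_less[OF i rs(1)] blk_index_less[OF j rs(2)] by (simp add: rowblk_def colblk_def Ind_eq dm mem)
qed (use cst_spec(2)[OF g j] is_repD(1,2)[OF M] in auto)

lemma Ind_dim [simp]: "dim_row (snd (Ind (Sym n) H M) g) = m * d" "dim_col (snd (Ind (Sym n) H M) g) = m * d"
  by (simp_all add: Ind_eq)

lemma mult_Ind_colblk:
  assumes g: "g \<in> Sym n" and j: "j < m" and A: "dim_col A = m * d"
  shows "colblk d (A * snd (Ind (Sym n) H M) g) j = colblk d A (cst g j) * snd M (tr (cst g j) g j)"
proof (rule eq_matI)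
  note c = cst_spec[OF g j]
  have dM: "dim_row (snd M (tr (cst g j) g j)) = d" "dim_col (snd M (tr (cst g j) g j)) = d" using is_repD(1,2)[OF M c(2)] by auto
  fix s t assume "s < dim_row (colblk d A (cst g j) * snd M (tr (cst g j) g j))" "t < dim_col (colblk d A (cst g j) * snd M (tr (cst g j) g j))"
  then have st: "s < dim_row A" "t < d" using dM by auto
  have "colblk d (A * snd (Ind (Sym n) H M) g) j $$ (s,t) = (A * colblk d (snd (Ind (Sym n) H M) g) j) $$ (s,t)"
    using A j by (simp add: colblk_mult[of _ _ m])
  also have "\<dots> = (\<Sum>i<m. (colblk d A i * rowblk d (colblk d (snd (Ind (Sym n) H M) g) j) i) $$ (s,t))"
    using st A by (intro mult_blocks) auto
  also have "\<dots> = (\<Sum>i<m. if i = cst g j then (colblk d A (cst g j) * snd M (tr (cst g j) g j)) $$ (s,t) else 0)"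
    using st by (intro sum.cong) (auto simp: Ind_rowblk_colblk[OF g _ j] zero_mult_dim simp del: index_mult_mat(1))
  also have "\<dots> = (colblk d A (cst g j) * snd M (tr (cst g j) g j)) $$ (s,t)" using c(1) by simp
  finally show "colblk d (A * snd (Ind (Sym n) H M) g) j $$ (s,t) = (colblk d A (cst g j) * snd M (tr (cst g j) g j)) $$ (s,t)" .
qed (use cst_spec(1,2)[OF g j] is_repD(1,2)[OF M] in auto)

lemma Ind_mult_rowblk:
  assumes g: "g \<in> Sym n" and j: "j < m" and A: "dim_row A = m * d"
  shows "rowblk d (snd (Ind (Sym n) H M) g * A) (cst g j) = snd M (tr (cst g j) g j) * rowblk d A j"
proof (rule eq_matI)
  note c = cst_spec[OF g j]
  let ?I = "snd (Ind (Sym n) H M) g"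
  have dM: "dim_row (snd M (tr (cst g j) g j)) = d" "dim_col (snd M (tr (cst g j) g j)) = d" using is_repD(1,2)[OF M c(2)] by auto
  have swap: "colblk d (rowblk d ?I i) k = rowblk d (colblk d ?I k) i" if "i < m" "k < m" for i k
    using that blk_index_less[of i m _ d] blk_index_less[of k m _ d] by (intro eq_matI) (auto simp: colblk_def rowblk_def)
  have inj: "k = j" if "k < m" "cst g j = cst g k" for k using that cst_inv(2)[OF g] j by metis
  fix s t assume "s < dim_row (snd M (tr (cst g j) g j) * rowblk d A j)" "t < dim_col (snd M (tr (cst g j) g j) * rowblk d A j)"
  then have st: "s < d" "t < dim_col A" using dM by auto
  have "rowblk d (?I * A) (cst g j) $$ (s,t) = (rowblk d ?I (cst g j) * A) $$ (s,t)"
    using A c(1) by (simp add: rowblk_mult[of _ _ m])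
  also have "\<dots> = (\<Sum>k<m. (colblk d (rowblk d ?I (cst g j)) k * rowblk d A k) $$ (s,t))"
    using st A by (intro mult_blocks) auto
  also have "\<dots> = (\<Sum>k<m. if k = j then (snd M (tr (cst g j) g j) * rowblk d A j) $$ (s,t) else 0)"
    using st c(1) inj by (intro sum.cong) (auto simp: swap Ind_rowblk_colblk[OF g] zero_mult_dim simp del: index_mult_mat(1))
  also have "\<dots> = (snd M (tr (cst g j) g j) * rowblk d A j) $$ (s,t)" using j by simp
  finally show "rowblk d (?I * A) (cst g j) $$ (s,t) = (snd M (tr (cst g j) g j) * rowblk d A j) $$ (s,t)" .
qed (use cst_spec(1,2)[OF g j] is_repD(1,2)[OF M] in auto)

lemma is_rep_Ind: "is_rep (Sym n) (Ind (Sym n) H M)"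
  unfolding is_rep_def
proof (intro conjI ballI)
  fix g h assume g: "g \<in> Sym n" and h: "h \<in> Sym n"
  let ?I = "snd (Ind (Sym n) H M)"
  show "?I (g \<circ> h) = ?I g * ?I h"
  proof (rule eq_by_colblk[of _ m d])
    fix j assume j: "j < m"
    note ch = cst_spec[OF h j]
    note cg = cst_spec[OF g ch(1)]
    note gh = Sym_closed(1)[OF g h]
    show "colblk d (?I (g \<circ> h)) j = colblk d (?I g * ?I h) j"
    proof (rule eq_by_rowblk[of _ m d])
      fix i assume i: "i < m"
      have "rowblk d (colblk d (?I g * ?I h) j) i = rowblk d (colblk d (?I g) (cst h j) * snd M (tr (cst h j) h j)) i"
        by (simp add: mult_Ind_colblk[OF h j])
      also have "\<dots> = rowblk d (colblk d (?I g) (cst h j)) i * snd M (tr (cst h j) h j)"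
        using i is_repD(1)[OF M ch(2)] by (simp add: rowblk_mult[of _ _ m])
      also have "\<dots> = rowblk d (colblk d (?I (g \<circ> h)) j) i"
      proof (cases "i = cst g (cst h j)")
        case True
        then show ?thesis using is_repD(3)[OF M cg(2) ch(2)]
          by (simp add: Ind_rowblk_colblk[OF g cg(1) ch(1)] Ind_rowblk_colblk[OF gh cg(1) j] cst_comp[OF g h j] tr_comp[OF ch(1)])
      next
        case False
        then show ?thesis using is_repD(1,2)[OF M ch(2)]
          by (simp add: Ind_rowblk_colblk[OF g i ch(1)] Ind_rowblk_colblk[OF gh i j] cst_comp[OF g h j] zero_mult_dim)
      qed
      finally show "rowblk d (colblk d (?I (g \<circ> h)) j) i = rowblk d (colblk d (?I g * ?I h) j) i" ..
    qed auto
  qed auto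
next
  show "snd (Ind (Sym n) H M) id = 1\<^sub>m (fst (Ind (Sym n) H M))"
  proof (rule eq_by_colblk[of _ m d])
    fix j assume j: "j < m"
    show "colblk d (snd (Ind (Sym n) H M) id) j = colblk d (1\<^sub>m (fst (Ind (Sym n) H M))) j"
    proof (rule eq_by_rowblk[of _ m d])
      fix i assume i: "i < m"
      have tid: "tr j id j = id" using Sym_inv(2)[OF ts_Sym[OF j]] by (simp add: tr_def)
      have "i * d + r = j * d + s \<longleftrightarrow> i = j \<and> r = s" if "r < d" "s < d" for r s
      proof -
        have "(i * d + r) div d = i" "(i * d + r) mod d = r" "(j * d + s) div d = j" "(j * d + s) mod d = s" using that by auto
        then show ?thesis by metis
      qed
      then have e1: "rowblk d (colblk d (1\<^sub>m (fst (Ind (Sym n) H M))) j) i = (if i = j then 1\<^sub>m d else 0\<^sub>m d d)"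
        using i j blk_index_less[of i m _ d] blk_index_less[of j m _ d] by (intro eq_matI) (auto simp: rowblk_def colblk_def Ind_eq(1))
      have e2: "rowblk d (colblk d (snd (Ind (Sym n) H M) id) j) i = (if i = j then 1\<^sub>m d else 0\<^sub>m d d)"
        unfolding Ind_rowblk_colblk[OF Sym_closed(3) i j] cst_id[OF j] using tid is_repD(4)[OF M] by simp
      show "rowblk d (colblk d (snd (Ind (Sym n) H M) id) j) i = rowblk d (colblk d (1\<^sub>m (fst (Ind (Sym n) H M))) j) i"
        by (rule trans[OF e2 e1[symmetric]])
    qed (auto simp: Ind_eq(1))
  qed (auto simp: Ind_eq(1))
qed (auto simp: Ind_eq(1))

end

lemma is_rep_subgroup: "is_rep G M \<Longrightarrow> perm_subgroup H G \<Longrightarrow> is_rep H M"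
  unfolding is_rep_def perm_subgroup_def by blast

lemma rel_proj_iff_retract:
  assumes H: "perm_subgroup H (Sym n)" and rM: "is_rep (Sym n) M"
  shows "rel_proj (Sym n) H M \<longleftrightarrow> retract (Sym n) M (Ind (Sym n) H M)"
proof -
  interpret induction_data n H M using H is_rep_subgroup[OF rM H] by unfold_locales
  show ?thesis
  proof
    assume "rel_proj (Sym n) H M"
    then obtain C where C: "is_rep (Sym n) C" "rep_iso (Sym n) (Ind (Sym n) H M) (dsum M C)" unfolding rel_proj_def summand_def by auto
    have "retract (Sym n) (dsum M C) (Ind (Sym n) H M)"
      by (rule retract_iso[OF rep_iso_sym[OF C(2) is_rep_Ind is_rep_dsum[OF rM C(1)]] is_rep_dsum[OF rM C(1)] is_rep_Ind])
    then show "retract (Sym n) M (Ind (Sym n) H M)"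
      by (rule retract_trans[OF retract_dsum_left[OF rM C(1)] _ rM is_rep_dsum[OF rM C(1)] is_rep_Ind])
  next
    assume "retract (Sym n) M (Ind (Sym n) H M)"
    then obtain i p where "i \<in> rep_hom (Sym n) M (Ind (Sym n) H M)" "p \<in> rep_hom (Sym n) (Ind (Sym n) H M) M" "p * i = 1\<^sub>m (fst M)" by (rule retractE)
    then obtain Z where "is_rep (Sym n) Z" "rep_iso (Sym n) (Ind (Sym n) H M) (dsum M Z)" by (rule idempotent_complement[OF is_rep_Ind rM])
    then show "rel_proj (Sym n) H M" unfolding rel_proj_def summand_def by blast
  qed
qed

section \<open>Relative traces\<close>

context induction_data
begin

text \<open>Higman's criterion in the direction used for the upper bound: an
  \<open>H\<close>-endomorphism \<open>\<theta>\<close> whose relative trace is 1 splits the map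
  from the induced module back to \<open>M\<close>.\<close>

lemma trace_retract:
  fixes \<theta> :: "'a mat"
  assumes G: "is_rep (Sym n) M" and \<theta>: "dim_row \<theta> = d" "dim_col \<theta> = d"
    and com: "\<And>h. h \<in> H \<Longrightarrow> \<theta> * snd M h = snd M h * \<theta>"
    and tr1: "\<And>s t. s < d \<Longrightarrow> t < d \<Longrightarrow> (\<Sum>i<m. (snd M (ts ! i) * (\<theta> * snd M (pinv (ts ! i)))) $$ (s,t)) = 1\<^sub>m d $$ (s,t)"
  shows "retract (Sym n) M (Ind (Sym n) H M)"
proof -
  let ?I = "Ind (Sym n) H M"
  note D = is_repD(1,2)[OF G]
  \<comment> \<open>With \<open>t\<close> running over the transversal, \<open>\<iota>\<close> maps
    \<open>x\<close> to the tuple of \<open>\<theta>\<close> applied to \<open>t\<close> inverse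
    \<open>x\<close>, and \<open>\<pi>\<close> sums the results of applying \<open>t\<close> to the
    components; so \<open>\<pi> * \<iota>\<close> is the relative trace.\<close>
  define \<iota> where "\<iota> = mat (m * d) d (\<lambda>(a,s). (\<theta> * snd M (pinv (ts ! (a div d)))) $$ (a mod d, s))"
  define \<pi> where "\<pi> = mat d (m * d) (\<lambda>(s,a). snd M (ts ! (a div d)) $$ (s, a mod d))"
  have dims [simp]: "dim_row \<iota> = m * d" "dim_col \<iota> = d" "dim_row \<pi> = d" "dim_col \<pi> = m * d" by (auto simp: \<iota>_def \<pi>_def)
  have inv_ts: "pinv (ts ! i) \<in> Sym n" if "i < m" for i using Sym_closed(2)[OF ts_Sym[OF that]] .
  have ri: "rowblk d \<iota> i = \<theta> * snd M (pinv (ts ! i))" if i: "i < m" for i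
    using blk_index_less[of i m _ d] i \<theta> D(2)[OF inv_ts[OF i]] by (intro eq_matI) (auto simp: rowblk_def \<iota>_def)
  have ci: "colblk d \<pi> i = snd M (ts ! i)" if i: "i < m" for i
    using blk_index_less[of i m _ d] i D[OF ts_Sym[OF i]] by (intro eq_matI) (auto simp: colblk_def \<pi>_def)
  have "\<iota> \<in> rep_hom (Sym n) M ?I"
  proof -
    have "\<iota> * snd M g = snd ?I g * \<iota>" if g: "g \<in> Sym n" for g
    proof (rule eq_by_rowblk[of _ m d])
      fix i assume i: "i < m"
      define k where "k = cst (pinv g) i"
      have k: "k < m" "cst g k = i" unfolding k_def using cst_spec(1)[OF Sym_closed(2)[OF g] i] cst_inv(1)[OF g i] by auto
      have t: "tr i g k \<in> H" using cst_spec(2)[OF g k(1)] k(2) by simp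
      have "rowblk d (snd ?I g * \<iota>) i = snd M (tr i g k) * (\<theta> * snd M (pinv (ts ! k)))"
        using Ind_mult_rowblk[OF g k(1), of \<iota>] k by (simp add: ri)
      also have "\<dots> = \<theta> * (snd M (tr i g k) * snd M (pinv (ts ! k)))"
        using D[OF HSym[OF t]] D[OF inv_ts[OF k(1)]] \<theta> by (simp add: mult_assoc_dim[symmetric] com[OF t])
      also have "snd M (tr i g k) * snd M (pinv (ts ! k)) = snd M (tr i g k \<circ> pinv (ts ! k))"
        using is_repD(3)[OF G HSym[OF t] inv_ts[OF k(1)]] by simp
      also have "tr i g k \<circ> pinv (ts ! k) = pinv (ts ! i) \<circ> g"
        unfolding tr_def by (rule Sym_cancel(4)[OF ts_Sym[OF k(1)]])
      also have "snd M (pinv (ts ! i) \<circ> g) = snd M (pinv (ts ! i)) * snd M g"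
        by (rule is_repD(3)[OF G inv_ts[OF i] g])
      also have "\<theta> * (snd M (pinv (ts ! i)) * snd M g) = rowblk d (\<iota> * snd M g) i"
        using D[OF g] D[OF inv_ts[OF i]] \<theta> i by (simp add: rowblk_mult[of _ _ m] ri mult_assoc_dim)
      finally show "rowblk d (\<iota> * snd M g) i = rowblk d (snd ?I g * \<iota>) i" ..
    qed (use D[OF g] in auto)
    then show ?thesis by (auto simp: rep_hom_def Ind_eq(1))
  qed
  moreover have "\<pi> \<in> rep_hom (Sym n) ?I M"
  proof -
    have "\<pi> * snd ?I g = snd M g * \<pi>" if g: "g \<in> Sym n" for g
    proof (rule eq_by_colblk[of _ m d])
      fix j assume j: "j < m"
      note c = cst_spec[OF g j]
      have "colblk d (\<pi> * snd ?I g) j = snd M (ts ! cst g j) * snd M (tr (cst g j) g j)"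
        using mult_Ind_colblk[OF g j, of \<pi>] by (simp add: ci[OF c(1)])
      also have "\<dots> = snd M (ts ! cst g j \<circ> tr (cst g j) g j)" using is_repD(3)[OF G ts_Sym[OF c(1)] HSym[OF c(2)]] by simp
      also have "ts ! cst g j \<circ> tr (cst g j) g j = g \<circ> ts ! j" unfolding tr_def comp_assoc by (rule Sym_cancel(2)[OF ts_Sym[OF c(1)]])
      also have "snd M (g \<circ> ts ! j) = snd M g * snd M (ts ! j)" by (rule is_repD(3)[OF G g ts_Sym[OF j]])
      also have "\<dots> = colblk d (snd M g * \<pi>) j" using D[OF g] j by (simp add: colblk_mult[of _ _ m] ci)
      finally show "colblk d (\<pi> * snd ?I g) j = colblk d (snd M g * \<pi>) j" .
    qed (use D[OF g] in auto)
    then show ?thesis by (auto simp: rep_hom_def Ind_eq(1))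
  qed
  moreover have "\<pi> * \<iota> = 1\<^sub>m d"
  proof (rule eq_matI)
    fix s t assume "s < dim_row (1\<^sub>m d :: 'a mat)" "t < dim_col (1\<^sub>m d :: 'a mat)"
    then have st: "s < d" "t < d" by auto
    have "(\<pi> * \<iota>) $$ (s,t) = (\<Sum>i<m. (colblk d \<pi> i * rowblk d \<iota> i) $$ (s,t))" using st by (intro mult_blocks) auto
    also have "\<dots> = (\<Sum>i<m. (snd M (ts ! i) * (\<theta> * snd M (pinv (ts ! i)))) $$ (s,t))"
      by (intro sum.cong refl) (simp add: ri ci del: index_mult_mat(1))
    finally show "(\<pi> * \<iota>) $$ (s,t) = 1\<^sub>m d $$ (s,t)" using tr1[OF st] by simp
  qed auto
  ultimately show ?thesis by (rule retractI)
qed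

text \<open>A composite through the induced module is a sum over the cosets of a block column of
  \<open>A\<close> times a block row of \<open>B\<close>; conjugation by \<open>g\<close> permutes
  these terms as it permutes the cosets. This is used for the lower bound.\<close>

lemma trace_components:
  assumes G: "is_rep (Sym n) M" and N: "is_rep (Sym n) N"
    and A: "A \<in> rep_hom (Sym n) (Ind (Sym n) H M) N" and B: "B \<in> rep_hom (Sym n) N (Ind (Sym n) H M)"
    and g: "g \<in> Sym n" and k: "k < m"
  shows "snd N g * (colblk d A k * rowblk d B k) = (colblk d A (cst g k) * rowblk d B (cst g k)) * snd N g"
proof -
  note c = cst_spec[OF g k]
  note dA = rep_homD(1,2)[OF A, unfolded Ind_eq(1)] and dB = rep_homD(1,2)[OF B, unfolded Ind_eq(1)]
  note dN = is_repD(1,2)[OF N g] and dM = is_repD(1,2)[OF G HSym[OF c(2)]]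
  have 1: "snd N g * colblk d A k = colblk d A (cst g k) * snd M (tr (cst g k) g k)"
  proof -
    have "snd N g * colblk d A k = colblk d (snd N g * A) k" using dA dN k by (simp add: colblk_mult[of _ _ m])
    also have "snd N g * A = A * snd (Ind (Sym n) H M) g" using rep_homD(3)[OF A g] by simp
    also have "colblk d \<dots> k = colblk d A (cst g k) * snd M (tr (cst g k) g k)" by (rule mult_Ind_colblk[OF g k dA(2)])
    finally show ?thesis .
  qed
  have 2: "snd M (tr (cst g k) g k) * rowblk d B k = rowblk d B (cst g k) * snd N g"
  proof -
    have "snd M (tr (cst g k) g k) * rowblk d B k = rowblk d (snd (Ind (Sym n) H M) g * B) (cst g k)" by (rule Ind_mult_rowblk[OF g k dB(1), symmetric])
    also have "snd (Ind (Sym n) H M) g * B = B * snd N g" using rep_homD(3)[OF B g] by simp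
    also have "rowblk d (B * snd N g) (cst g k) = rowblk d B (cst g k) * snd N g" using dB dN c(1) by (simp add: rowblk_mult[of _ _ m])
    finally show ?thesis .
  qed
  have "snd N g * (colblk d A k * rowblk d B k) = (snd N g * colblk d A k) * rowblk d B k" using dN dA by (simp add: mult_assoc_dim)
  also have "\<dots> = colblk d A (cst g k) * (snd M (tr (cst g k) g k) * rowblk d B k)" unfolding 1 using dM by (simp add: mult_assoc_dim)
  also have "\<dots> = (colblk d A (cst g k) * rowblk d B (cst g k)) * snd N g" unfolding 2 using dB dN by (simp add: mult_assoc_dim)
  finally show ?thesis .
qed

end

section \<open>Orbit counting and Sylow subgroups\<close>

lemma orbit_card:
  fixes \<alpha> :: "(nat \<Rightarrow> nat) \<Rightarrow> 'x \<Rightarrow> 'x"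
  assumes Q: "perm_subgroup Q (Sym n)" and id: "\<alpha> id x = x"
    and comp: "\<And>q q'. q \<in> Q \<Longrightarrow> q' \<in> Q \<Longrightarrow> \<alpha> (q \<circ> q') x = \<alpha> q (\<alpha> q' x)"
    and comp': "\<And>q q'. q \<in> Q \<Longrightarrow> q' \<in> Q \<Longrightarrow> \<alpha> (pinv q' \<circ> q) x = x \<longleftrightarrow> \<alpha> q x = \<alpha> q' x"
  shows "card Q = card ((\<lambda>q. \<alpha> q x) ` Q) * card {q\<in>Q. \<alpha> q x = x}"
proof -
  have fin: "finite Q" using Q finite_Sym finite_subset unfolding perm_subgroup_def by blast
  have fib: "card {q\<in>Q. \<alpha> q x = y} = card {q\<in>Q. \<alpha> q x = x}" if y: "y \<in> (\<lambda>q. \<alpha> q x) ` Q" for y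
  proof -
    obtain q0 where q0: "q0 \<in> Q" "y = \<alpha> q0 x" using y by blast
    have q0S: "q0 \<in> Sym n" using perm_subgroupD(1)[OF Q q0(1)] .
    have "bij_betw (\<lambda>q. q0 \<circ> q) {q\<in>Q. \<alpha> q x = x} {q\<in>Q. \<alpha> q x = y}"
    proof (rule bij_betw_byWitness[where f'="\<lambda>q. pinv q0 \<circ> q"])
      show "\<forall>a\<in>{q \<in> Q. \<alpha> q x = x}. pinv q0 \<circ> (q0 \<circ> a) = a" using Sym_cancel(1)[OF q0S] by simp
      show "\<forall>a\<in>{q \<in> Q. \<alpha> q x = y}. q0 \<circ> (pinv q0 \<circ> a) = a" using Sym_cancel(2)[OF q0S] by simp
      show "(\<circ>) q0 ` {q \<in> Q. \<alpha> q x = x} \<subseteq> {q \<in> Q. \<alpha> q x = y}"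
        using perm_subgroupD(3)[OF Q q0(1)] comp[OF q0(1)] q0(2) by auto
      show "(\<circ>) (pinv q0) ` {q \<in> Q. \<alpha> q x = y} \<subseteq> {q \<in> Q. \<alpha> q x = x}"
        using perm_subgroupD(3)[OF Q perm_subgroupD(4)[OF Q q0(1)]] comp'[OF _ q0(1)] q0(2) by auto
    qed
    then show ?thesis by (rule bij_betw_same_card[symmetric])
  qed
  have "card Q = (\<Sum>y\<in>(\<lambda>q. \<alpha> q x) ` Q. card {q\<in>Q. \<alpha> q x = y})"
    using sum.image_gen[OF fin, of "\<lambda>_. 1 :: nat" "\<lambda>q. \<alpha> q x"] by simp
  also have "\<dots> = card ((\<lambda>q. \<alpha> q x) ` Q) * card {q\<in>Q. \<alpha> q x = x}" using fib by simp
  finally show ?thesis .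
qed

text \<open>Orbit sizes divide a power of \<open>p\<close>: an orbit with more than one point
  contributes a multiple of \<open>p\<close>, and a fixed point contributes 0. It is applied to
  words in \<open>kmul_BC\<close> and to cosets in \<open>lower_bound\<close>.\<close>

lemma sum_p_group:
  fixes \<alpha> :: "(nat \<Rightarrow> nat) \<Rightarrow> 'x \<Rightarrow> 'x" and f :: "'x \<Rightarrow> 'a::field"
  assumes Q: "perm_subgroup Q (Sym n)" and card: "card Q = p ^ e" and p: "prime p" "CHAR('a) = p"
    and fin: "finite X" and cl: "\<And>q x. q \<in> Q \<Longrightarrow> x \<in> X \<Longrightarrow> \<alpha> q x \<in> X" and id: "\<And>x. x \<in> X \<Longrightarrow> \<alpha> id x = x"
    and comp: "\<And>q q' x. q \<in> Q \<Longrightarrow> q' \<in> Q \<Longrightarrow> x \<in> X \<Longrightarrow> \<alpha> (q \<circ> q') x = \<alpha> q (\<alpha> q' x)"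
    and inv: "\<And>q x. q \<in> Q \<Longrightarrow> x \<in> X \<Longrightarrow> f (\<alpha> q x) = f x"
    and fixd: "\<And>x. x \<in> X \<Longrightarrow> (\<forall>q\<in>Q. \<alpha> q x = x) \<Longrightarrow> f x = 0"
  shows "(\<Sum>x\<in>X. f x) = 0"
  using fin cl id comp inv fixd
proof (induction "card X" arbitrary: X rule: less_induct)
  case less
  note cl = less.prems(2) and id = less.prems(3) and comp = less.prems(4)
  show ?case
  proof (cases "X = {}")
    case False
    then obtain x where x: "x \<in> X" by blast
    let ?O = "(\<lambda>q. \<alpha> q x) ` Q"
    have invc: "\<alpha> (pinv q) (\<alpha> q y) = y" if "q \<in> Q" "y \<in> X" for q y
      using comp[OF perm_subgroupD(4)[OF Q that(1)] that(1,2)] Sym_inv(2)[OF perm_subgroupD(1)[OF Q that(1)]] id[OF that(2)] by simp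
    have invc': "\<alpha> q (\<alpha> (pinv q) y) = y" if "q \<in> Q" "y \<in> X" for q y
      using comp[OF that(1) perm_subgroupD(4)[OF Q that(1)] that(2)] Sym_inv(1)[OF perm_subgroupD(1)[OF Q that(1)]] id[OF that(2)] by simp
    have sub: "?O \<subseteq> X" using cl x by blast
    have "card Q = card ?O * card {q\<in>Q. \<alpha> q x = x}"
    proof (rule orbit_card[where \<alpha>=\<alpha> and x=x, OF Q id[OF x]])
      show "\<And>q q'. q \<in> Q \<Longrightarrow> q' \<in> Q \<Longrightarrow> \<alpha> (q \<circ> q') x = \<alpha> q (\<alpha> q' x)" using comp x by blast
      fix q q' assume q: "q \<in> Q" "q' \<in> Q"
      have "\<alpha> (pinv q' \<circ> q) x = \<alpha> (pinv q') (\<alpha> q x)" using comp[OF perm_subgroupD(4)[OF Q q(2)] q(1) x] .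
      then show "\<alpha> (pinv q' \<circ> q) x = x \<longleftrightarrow> \<alpha> q x = \<alpha> q' x"
        using invc[OF q(2) x] invc'[OF q(2) cl[OF q(1) x]] by metis
    qed
    then have "card ?O dvd p ^ e" using card by (metis dvd_triv_left)
    then obtain j where j: "card ?O = p ^ j" using p(1) by (metis divides_primepow_nat)
    have sO: "sum f ?O = of_nat (card ?O) * f x"
    proof -
      have "sum f ?O = (\<Sum>y\<in>?O. f x)" by (rule sum.cong) (use less.prems(5)[OF _ x] in auto)
      then show ?thesis by simp
    qed
    have z: "sum f ?O = 0"
    proof (cases j)
      case 0
      then have "card ?O = 1" using j by simp
      then obtain y where y: "?O = {y}" by (rule card_1_singletonE)
      have "x \<in> ?O" using id[OF x] perm_subgroupD(2)[OF Q] by (metis image_eqI)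
      then have "\<forall>q\<in>Q. \<alpha> q x = x" using y by (metis imageI singletonD)
      then show ?thesis using less.prems(6)[OF x] sO by simp
    next
      case (Suc i)
      then have "of_nat (card ?O) = (0::'a)" using j p(2) by (simp add: of_nat_eq_0_iff_char_dvd)
      then show ?thesis using sO by simp
    qed
    have xO: "x \<in> ?O" using id[OF x] perm_subgroupD(2)[OF Q] by (metis image_eqI)
    have "card (X - ?O) < card X" using x xO less.prems(1) by (intro psubset_card_mono) auto
    moreover have "\<alpha> q y \<in> X - ?O" if "q \<in> Q" "y \<in> X - ?O" for q y
    proof
      show "\<alpha> q y \<in> X" using cl that by blast
      show "\<alpha> q y \<notin> ?O"
      proof
        assume "\<alpha> q y \<in> ?O"
        then obtain q' where q': "q' \<in> Q" "\<alpha> q y = \<alpha> q' x" by blast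
        then have "y = \<alpha> (pinv q) (\<alpha> q' x)" using invc[of q y] that by (metis Diff_iff)
        also have "\<dots> = \<alpha> (pinv q \<circ> q') x" using comp[OF perm_subgroupD(4)[OF Q that(1)] q'(1) x] by simp
        finally show False using that perm_subgroupD(3)[OF Q perm_subgroupD(4)[OF Q that(1)] q'(1)] by blast
      qed
    qed
    ultimately have "sum f (X - ?O) = 0"
      by (intro less.hyps) (use less.prems in auto)
    then show ?thesis using z sum.subset_diff[OF sub less.prems(1), of f] by simp
  qed simp
qed

hide_const (open) Sylow.sylow

text \<open>Permutations under composition as a group of HOL-Algebra, through which Lagrange's and
  Sylow's theorems become available.\<close>

definition pg :: "(nat \<Rightarrow> nat) set \<Rightarrow> (nat \<Rightarrow> nat) monoid" where
  "pg H = \<lparr>carrier = H, monoid.mult = (\<circ>), one = id\<rparr>"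

lemma pg_simps [simp]: "carrier (pg H) = H" "monoid.mult (pg H) = (\<circ>)" "one (pg H) = id"
  by (simp_all add: pg_def)

lemma group_pg:
  assumes "perm_subgroup H (Sym n)"
  shows "Group.group (pg H)"
proof (rule groupI)
  fix x assume x: "x \<in> carrier (pg H)"
  then show "\<exists>y\<in>carrier (pg H). y \<otimes>\<^bsub>pg H\<^esub> x = \<one>\<^bsub>pg H\<^esub>"
    using perm_subgroupD(4)[OF assms] Sym_inv(2)[OF perm_subgroupD(1)[OF assms]] by (intro bexI[of _ "pinv x"]) auto
qed (use perm_subgroupD[OF assms] in \<open>auto simp: comp_assoc\<close>)

lemma pg_inv:
  assumes H: "perm_subgroup H (Sym n)" and x: "x \<in> H"
  shows "m_inv (pg H) x = pinv x"
  by (rule group.inv_equality[OF group_pg[OF H]])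
    (use x perm_subgroupD(4)[OF H x] Sym_inv(2)[OF perm_subgroupD(1)[OF H x]] in auto)

lemma subgroup_pg_iff:
  assumes H: "perm_subgroup H (Sym n)"
  shows "subgroup A (pg H) \<longleftrightarrow> perm_subgroup A H"
proof
  assume A: "subgroup A (pg H)"
  have AH: "A \<subseteq> H" using subgroup.subset[OF A] by simp
  show "perm_subgroup A H" unfolding perm_subgroup_def
  proof (intro conjI ballI)
    fix a assume a: "a \<in> A"
    show "pinv a \<in> A" using subgroup.m_inv_closed[OF A a] pg_inv[OF H] a AH by auto
    fix b assume "b \<in> A"
    then show "a \<circ> b \<in> A" using subgroup.m_closed[OF A a] by simp
  qed (use AH subgroup.one_closed[OF A] in auto)
next
  assume A: "perm_subgroup A H"
  show "subgroup A (pg H)"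
  proof (rule subgroup.intro)
    show "\<And>x. x \<in> A \<Longrightarrow> inv\<^bsub>pg H\<^esub> x \<in> A" using perm_subgroupD(1,4)[OF A] pg_inv[OF H] by auto
  qed (use perm_subgroupD[OF A] in auto)
qed

lemma finite_perm_subgroup: "perm_subgroup H (Sym n) \<Longrightarrow> finite H"
  using finite_Sym finite_subset unfolding perm_subgroup_def by blast

lemma perm_subgroup_trans: "perm_subgroup A H \<Longrightarrow> perm_subgroup H G \<Longrightarrow> perm_subgroup A G"
  unfolding perm_subgroup_def by blast

lemma perm_lagrange:
  assumes H: "perm_subgroup H (Sym n)" and A: "perm_subgroup A H"
  shows "card A dvd card H"
proof -
  have "card (rcosets\<^bsub>pg H\<^esub> A) * card A = Coset.order (pg H)"
    by (rule group.lagrange[OF group_pg[OF H]]) (use A subgroup_pg_iff[OF H] in blast)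
  then show ?thesis unfolding Coset.order_def by (metis dvd_triv_right pg_simps(1))
qed

lemma sylow_exists:
  assumes H: "perm_subgroup H (Sym n)" and p: "prime p"
  shows "\<exists>P. sylow p P H"
proof -
  have pos: "card H > 0" using finite_perm_subgroup[OF H] perm_subgroupD(2)[OF H] by (auto simp: card_gt_0_iff)
  have nu: "\<not> is_unit p" using p by auto
  obtain m where m: "card H = p ^ multiplicity p (card H) * m" "\<not> p dvd m"
    using multiplicity_decompose'[of "card H" p] pos nu by (metis gr_implies_not0)
  let ?a = "multiplicity p (card H)"
  have "\<exists>P. subgroup P (pg H) \<and> card P = p ^ ?a"
    by (rule sylow_thm[OF p group_pg[OF H]]) (use m(1) finite_perm_subgroup[OF H] in \<open>auto simp: Coset.order_def\<close>)
  then obtain P where P: "subgroup P (pg H)" "card P = p ^ ?a" by blast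
  have "card H div card P = m" using m(1) P(2) p by (metis nonzero_mult_div_cancel_left power_not_zero prime_gt_0_nat less_irrefl)
  then show ?thesis unfolding Defs.sylow_def using P subgroup_pg_iff[OF H] m(2) by (intro exI[of _ P]) auto
qed

lemma point_orbit_card:
  assumes H: "perm_subgroup H (Sym n)"
  shows "card H = card ((\<lambda>h. h x) ` H) * card {h\<in>H. h x = x}"
proof (rule orbit_card[where \<alpha>="\<lambda>h y. h y" and x=x, OF H])
  fix q q' assume q: "q \<in> H" "q' \<in> H"
  have "inj q'" using SymD(3)[OF perm_subgroupD(1)[OF H q(2)]] .
  moreover have "q' (pinv q' y) = y" for y using SymD(4)[OF perm_subgroupD(1)[OF H q(2)]] by (simp add: surj_f_inv_f)
  ultimately show "(pinv q' \<circ> q) x = x \<longleftrightarrow> q x = q' x" by (metis comp_apply inv_f_f)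
qed auto

lemma point_stabilizer: "perm_subgroup H (Sym n) \<Longrightarrow> perm_subgroup {h\<in>H. h x = x} H"
proof -
  assume H: "perm_subgroup H (Sym n)"
  have "pinv h x = x" if "h \<in> H" "h x = x" for h
    using SymD(3)[OF perm_subgroupD(1)[OF H that(1)]] that(2) by (metis inv_f_f)
  then show ?thesis unfolding perm_subgroup_def using perm_subgroupD[OF H] by auto
qed

text \<open>By comparing point stabilisers, \<open>p ^ i\<close> divides the size of the orbit under
  \<open>P\<close> times the index of \<open>P\<close>, and that index is prime to \<open>p\<close>.
  It makes a Sylow subgroup of a Young subgroup transitive on blocks of \<open>p\<close>-power
  size.\<close>

lemma sylow_orbit:
  assumes H: "perm_subgroup H (Sym n)" and P: "sylow p P H" and p: "prime p" and O: "card ((\<lambda>h. h x) ` H) = p ^ i"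
  shows "(\<lambda>h. h x) ` P = (\<lambda>h. h x) ` H"
proof -
  have PH: "perm_subgroup P H" and ndvd: "\<not> p dvd (card H div card P)" using P by (auto simp: Defs.sylow_def)
  have PS: "perm_subgroup P (Sym n)" by (rule perm_subgroup_trans[OF PH H])
  let ?k = "card H div card P"
  have fin: "finite H" "finite P" using finite_perm_subgroup H PS by blast+
  have HP: "card H = card P * ?k" using perm_lagrange[OF H PH] by simp
  let ?Hx = "{h\<in>H. h x = x}" and ?Px = "{h\<in>P. h x = x}"
  have Hx: "perm_subgroup ?Hx (Sym n)" by (rule perm_subgroup_trans[OF point_stabilizer[OF H] H])
  have "perm_subgroup ?Px ?Hx"
    using point_stabilizer[OF PS, of x] PH unfolding perm_subgroup_def by blast
  from perm_lagrange[OF Hx this] obtain j where j: "card ?Hx = card ?Px * j" by (auto simp: dvd_def)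
  have Px: "card ?Px > 0" using perm_subgroupD(2)[OF PS] fin(2) by (auto simp: card_gt_0_iff)
  have "p ^ i * (card ?Px * j) = card ((\<lambda>h. h x) ` P) * card ?Px * ?k"
    using point_orbit_card[OF H, of x] point_orbit_card[OF PS, of x] HP O j by metis
  then have "card ?Px * (p ^ i * j) = card ?Px * (card ((\<lambda>h. h x) ` P) * ?k)" by (simp only: ac_simps)
  then have "p ^ i * j = card ((\<lambda>h. h x) ` P) * ?k" using Px by simp
  then have "p ^ i dvd card ((\<lambda>h. h x) ` P) * ?k" by (metis dvd_triv_left)
  moreover have "coprime (p ^ i) ?k" using p ndvd by (simp add: prime_imp_coprime)
  ultimately have "p ^ i dvd card ((\<lambda>h. h x) ` P)" by (simp add: coprime_dvd_mult_left_iff)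
  moreover have "card ((\<lambda>h. h x) ` P) > 0" using perm_subgroupD(2)[OF PS] fin(2) by (auto simp: card_gt_0_iff)
  ultimately have le: "p ^ i \<le> card ((\<lambda>h. h x) ` P)" by (rule dvd_imp_le)
  show ?thesis
    by (rule card_seteq) (use fin O le PH in \<open>auto simp: perm_subgroup_def\<close>)
qed

context induction_data
begin

text \<open>The elements carrying \<open>R0\<close> to \<open>U\<close> are as many as those fixing
  \<open>R0\<close>, and they form a disjoint union of left cosets of \<open>H\<close>, one for each
  index that is counted.\<close>

lemma transversal_count:
  assumes Q: "\<And>h. h \<in> H \<Longrightarrow> act h R0 = R0" and R0: "R0 \<in> wcont n c" and U: "U \<in> wcont n c"
  shows "card {i. i < m \<and> act (ts ! i) R0 = U} = card {g\<in>Sym n. act g R0 = R0} div card H"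
proof -
  obtain g0 where g0: "g0 \<in> Sym n" "act g0 R0 = U" using wcont_orbit[OF R0 U] by blast
  let ?S = "{g\<in>Sym n. act g R0 = R0}" and ?SU = "{g\<in>Sym n. act g R0 = U}" and ?I = "{i. i < m \<and> act (ts ! i) R0 = U}"
  have "bij_betw (\<lambda>g. g0 \<circ> g) ?S ?SU"
  proof (rule bij_betw_byWitness[where f'="\<lambda>g. pinv g0 \<circ> g"])
    show "\<forall>a\<in>?S. pinv g0 \<circ> (g0 \<circ> a) = a" using Sym_cancel(1)[OF g0(1)] by simp
    show "\<forall>a\<in>?SU. g0 \<circ> (pinv g0 \<circ> a) = a" using Sym_cancel(2)[OF g0(1)] by simp
    show "(\<circ>) g0 ` ?S \<subseteq> ?SU" using Sym_closed(1)[OF g0(1)] act_comp[OF g0(1)] g0(2) by auto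
    show "(\<circ>) (pinv g0) ` ?SU \<subseteq> ?S"
      using Sym_closed(1)[OF Sym_closed(2)[OF g0(1)]] act_comp[OF Sym_closed(2)[OF g0(1)]] act_inv(1)[OF g0(1)] g0(2) by auto
  qed
  then have cS: "card ?S = card ?SU" by (rule bij_betw_same_card)
  have finH: "finite H" by (rule finite_perm_subgroup[OF H])
  have "?SU = (\<Union>i\<in>?I. (\<lambda>h. ts ! i \<circ> h) ` H)"
  proof (rule Set.set_eqI, rule iffI)
    fix g assume g: "g \<in> ?SU"
    then obtain i where i: "i < m" "pinv (ts ! i) \<circ> g \<in> H" using ts_ex1[of g] by blast
    let ?h = "pinv (ts ! i) \<circ> g"
    have gi: "g = ts ! i \<circ> ?h" using Sym_cancel(2)[OF ts_Sym[OF i(1)], of g] by simp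
    have "act (ts ! i) R0 = act (ts ! i) (act ?h R0)" using Q[OF i(2)] by simp
    also have "\<dots> = act g R0" using act_comp[OF ts_Sym[OF i(1)] HSym[OF i(2)], of R0] gi by simp
    finally have "i \<in> ?I" using g i(1) by simp
    then show "g \<in> (\<Union>i\<in>?I. (\<lambda>h. ts ! i \<circ> h) ` H)" using gi i(2) by blast
  next
    fix g assume "g \<in> (\<Union>i\<in>?I. (\<lambda>h. ts ! i \<circ> h) ` H)"
    then obtain i h where ih: "i < m" "act (ts ! i) R0 = U" "h \<in> H" "g = ts ! i \<circ> h" by blast
    then show "g \<in> ?SU" using Sym_closed(1)[OF ts_Sym[OF ih(1)] HSym[OF ih(3)]] act_comp[OF ts_Sym[OF ih(1)] HSym[OF ih(3)]] Q by simp
  qed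
  moreover have "card (\<Union>i\<in>?I. (\<lambda>h. ts ! i \<circ> h) ` H) = (\<Sum>i\<in>?I. card ((\<lambda>h. ts ! i \<circ> h) ` H))"
  proof (rule card_UN_disjoint)
    show "\<forall>i\<in>?I. \<forall>j\<in>?I. i \<noteq> j \<longrightarrow> (\<lambda>h. ts ! i \<circ> h) ` H \<inter> (\<lambda>h. ts ! j \<circ> h) ` H = {}"
    proof (intro ballI impI, rule ccontr)
      fix i j assume ij: "i \<in> ?I" "j \<in> ?I" "i \<noteq> j" "(\<lambda>h. ts ! i \<circ> h) ` H \<inter> (\<lambda>h. ts ! j \<circ> h) ` H \<noteq> {}"
      then obtain h h' where h: "h \<in> H" "h' \<in> H" "ts ! i \<circ> h = ts ! j \<circ> h'" by blast
      have i: "i < m" "j < m" using ij by auto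
      have "pinv (ts ! i) \<circ> (ts ! i \<circ> h) \<in> H" unfolding Sym_cancel(1)[OF ts_Sym[OF i(1)]] by (rule h(1))
      moreover have "pinv (ts ! j) \<circ> (ts ! i \<circ> h) \<in> H" unfolding h(3) Sym_cancel(1)[OF ts_Sym[OF i(2)]] by (rule h(2))
      ultimately show False using ts_ex1[OF Sym_closed(1)[OF ts_Sym[OF i(1)] HSym[OF h(1)]]] i ij(3) by blast
    qed
  qed (use finH in auto)
  moreover have "card ((\<lambda>h. ts ! i \<circ> h) ` H) = card H" if "i \<in> ?I" for i
    by (rule card_image, rule inj_onI) (use that Sym_cancel(1)[OF ts_Sym, of i] in \<open>metis (mono_tags, lifting) mem_Collect_eq\<close>)
  ultimately have "card ?SU = card ?I * card H" by simp
  moreover have "card H > 0" using finH perm_subgroupD(2)[OF H] by (auto simp: card_gt_0_iff)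
  ultimately show ?thesis using cS by simp
qed

end

text \<open>The identity of \<open>Y\<close> is the sum over all words \<open>U\<close> of the maps
  \<open>A U * B U\<close> through the basis vector \<open>U\<close>. The group permutes these maps,
  so the sum is a relative trace from \<open>Q\<close> of the term at \<open>R0\<close>, once
  divided by the multiplicity with which each word is reached.\<close>

lemma stabilizer_rel_proj:
  fixes Y :: "'a::field rep"
  assumes Q: "perm_subgroup Q (Sym n)" and Y: "is_rep (Sym n) Y"
    and a: "a \<in> rep_hom (Sym n) (mono_rep n c) Y" and b: "b \<in> rep_hom (Sym n) Y (mono_rep n c)" and ab: "a * b = 1\<^sub>m (fst Y)"
    and R0: "R0 \<in> wcont n c" and fx: "\<And>q. q \<in> Q \<Longrightarrow> act q R0 = R0"
    and N: "of_nat (card {g\<in>Sym n. act g R0 = R0} div card Q) \<noteq> (0::'a)"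
  shows "rel_proj (Sym n) Q Y"
proof -
  interpret induction_data n Q Y using Q is_rep_subgroup[OF Y Q] by unfold_locales
  let ?X = "wcont n c" and ?w = "wenum n c"
  let ?N = "of_nat (card {g\<in>Sym n. act g R0 = R0} div card Q) :: 'a"
  note DY = is_repD(1,2)[OF Y] and da = rep_homD(1,2)[OF a] and db = rep_homD(1,2)[OF b]
  define ix where "ix = the_inv_into {0..<card ?X} ?w"
  have inj: "inj_on ?w {0..<card ?X}" using wenum_bij by (rule bij_betw_imp_inj_on)
  have ix: "ix U < card ?X" "?w (ix U) = U" if "U \<in> ?X" for U
    using that wenum_bij[of n c] the_inv_into_into[OF inj, of U "{0..<card ?X}"] f_the_inv_into_f_bij_betw[OF wenum_bij, of n c U]
    unfolding ix_def bij_betw_def by auto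
  have ixw: "ix (?w k) = k" if "k < card ?X" for k unfolding ix_def using that by (intro the_inv_into_f_f[OF inj]) simp
  define A where "A U = colblk 1 a (ix U)" for U
  define B where "B U = rowblk 1 b (ix U)" for U
  have dA [simp]: "dim_row (A U) = d" "dim_col (A U) = 1" "dim_row (B U) = 1" "dim_col (B U) = d" for U
    using da db by (auto simp: A_def B_def)
  have YA: "snd Y g * A U = of_int (eps n g U) \<cdot>\<^sub>m A (act g U)" if g: "g \<in> Sym n" and U: "U \<in> ?X" for g U
  proof (rule eq_matI)
    note gU = act_wcont[OF g U]
    fix s r assume "s < dim_row (of_int (eps n g U) \<cdot>\<^sub>m A (act g U))" "r < dim_col (of_int (eps n g U) \<cdot>\<^sub>m A (act g U))"
    then have s: "s < d" "r = 0" by auto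
    have "snd Y g * A U = colblk 1 (snd Y g * a) (ix U)" unfolding A_def using da DY[OF g] ix(1)[OF U] by (simp add: colblk_mult[of _ _ "card ?X"])
    also have "snd Y g * a = a * snd (mono_rep n c) g" using rep_homD(3)[OF a g] by simp
    finally have "(snd Y g * A U) $$ (s,r) = (a * snd (mono_rep n c) g) $$ (s, ix U)" using s da DY[OF g] by (simp add: colblk_def)
    also have "\<dots> = (\<Sum>l\<in>{0..<card ?X}. a $$ (s,l) * mono_kernel n g (?w l) U)"
      using s da ix[OF U] by (simp add: mono_rep_def scalar_prod_def) (simp add: kmat_def)
    also have "\<dots> = (\<Sum>l\<in>{0..<card ?X}. if l = ix (act g U) then of_int (eps n g U) * a $$ (s, ix (act g U)) else 0)"
      by (rule sum.cong) (use ix[OF gU] ixw in \<open>auto simp: mono_kernel_def\<close>)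
    also have "\<dots> = of_int (eps n g U) * a $$ (s, ix (act g U))" using ix(1)[OF gU] by simp
    finally show "(snd Y g * A U) $$ (s,r) = (of_int (eps n g U) \<cdot>\<^sub>m A (act g U)) $$ (s,r)" using s da by (simp add: A_def colblk_def)
  qed (use DY[OF g] in auto)
  have BY: "B U * snd Y (pinv g) = of_int (eps n g U) \<cdot>\<^sub>m B (act g U)" if g: "g \<in> Sym n" and U: "U \<in> ?X" for g U
  proof (rule eq_matI)
    note gU = act_wcont[OF g U] and gi = Sym_closed(2)[OF g]
    let ?gi = "pinv g"
    have e: "eps n ?gi (act g U) = eps n g U"
    proof -
      have "eps n ?gi (act g U) * eps n g U = 1" using eps_comp[OF gi g, of U] Sym_inv(2)[OF g] by simp
      then show ?thesis using eps_cases[of n g U] by auto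
    qed
    fix r t assume "r < dim_row (of_int (eps n g U) \<cdot>\<^sub>m B (act g U))" "t < dim_col (of_int (eps n g U) \<cdot>\<^sub>m B (act g U))"
    then have t: "t < d" "r = 0" by auto
    have "B U * snd Y ?gi = rowblk 1 (b * snd Y ?gi) (ix U)" unfolding B_def using db DY[OF gi] ix(1)[OF U] by (simp add: rowblk_mult[of _ _ "card ?X"])
    also have "b * snd Y ?gi = snd (mono_rep n c) ?gi * b" using rep_homD(3)[OF b gi] by simp
    finally have "(B U * snd Y ?gi) $$ (r,t) = (snd (mono_rep n c) ?gi * b) $$ (ix U, t)" using t db DY[OF gi] by (simp add: rowblk_def)
    also have "\<dots> = (\<Sum>l\<in>{0..<card ?X}. mono_kernel n ?gi U (?w l) * b $$ (l,t))"
      using t db ix[OF U] by (simp add: mono_rep_def scalar_prod_def) (simp add: kmat_def)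
    also have "\<dots> = (\<Sum>l\<in>{0..<card ?X}. if l = ix (act g U) then of_int (eps n g U) * b $$ (ix (act g U), t) else 0)"
    proof (rule sum.cong[OF refl])
      fix l assume l: "l \<in> {0..<card ?X}"
      have "act ?gi (?w l) = U \<longleftrightarrow> ?w l = act g U" using act_inv[OF g] by metis
      also have "\<dots> \<longleftrightarrow> l = ix (act g U)" using ix[OF gU] ixw l by (metis atLeastLessThan_iff)
      finally show "mono_kernel n ?gi U (?w l) * b $$ (l,t) = (if l = ix (act g U) then of_int (eps n g U) * b $$ (ix (act g U), t) else 0)"
        using e ix[OF gU] by (simp add: mono_kernel_def)
    qed
    also have "\<dots> = of_int (eps n g U) * b $$ (ix (act g U), t)" using ix(1)[OF gU] by simp
    finally show "(B U * snd Y ?gi) $$ (r,t) = (of_int (eps n g U) \<cdot>\<^sub>m B (act g U)) $$ (r,t)" using t db by (simp add: B_def rowblk_def)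
  qed (use DY[OF Sym_closed(2)[OF g]] in auto)
  \<comment> \<open>The sign of \<open>g\<close> at \<open>U\<close> comes once from the column and
    once from the row, so it squares to 1.\<close>
  have conj: "snd Y g * (A U * B U * snd Y (pinv g)) = A (act g U) * B (act g U)" if g: "g \<in> Sym n" and U: "U \<in> ?X" for g U
  proof -
    have "snd Y g * (A U * B U * snd Y (pinv g)) = (snd Y g * A U) * (B U * snd Y (pinv g))"
      using DY[OF g] DY[OF Sym_closed(2)[OF g]] by (simp add: mult_assoc_dim)
    also have "\<dots> = (of_int (eps n g U) * of_int (eps n g U)) \<cdot>\<^sub>m (A (act g U) * B (act g U))"
      unfolding YA[OF g U] BY[OF g U] by (simp add: smult_mult_dim) (rule eq_matI, auto)
    also have "\<dots> = A (act g U) * B (act g U)" unfolding eps_square_field by (rule eq_matI) auto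
    finally show ?thesis .
  qed
  define \<theta> where "\<theta> = inverse ?N \<cdot>\<^sub>m (A R0 * B R0)"
  have retr: "retract (Sym n) Y (Ind (Sym n) Q Y)"
  proof (rule trace_retract[OF Y])
    show dth: "dim_row \<theta> = d" "dim_col \<theta> = d" by (simp_all add: \<theta>_def)
    fix h assume h: "h \<in> Q"
    note hS = HSym[OF h]
    have "A R0 * B R0 * snd Y h = (snd Y h * (A R0 * B R0 * snd Y (pinv h))) * snd Y h"
      using conj[OF hS R0] fx[OF h] by simp
    also have "\<dots> = snd Y h * (A R0 * B R0 * (snd Y (pinv h) * snd Y h))"
      using DY[OF hS] DY[OF Sym_closed(2)[OF hS]] by (simp add: mult_assoc_dim)
    also have "snd Y (pinv h) * snd Y h = 1\<^sub>m d"
      using is_repD(3)[OF Y Sym_closed(2)[OF hS] hS] is_repD(4)[OF Y] Sym_inv(2)[OF hS] by simp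
    finally show "\<theta> * snd Y h = snd Y h * \<theta>" using DY[OF hS] by (simp add: \<theta>_def smult_mult_dim one_mult_dim)
  next
    fix s t assume st: "s < d" "t < d"
    have sm: "snd Y (ts ! i) * (\<theta> * snd Y (pinv (ts ! i))) = inverse ?N \<cdot>\<^sub>m (A (act (ts ! i) R0) * B (act (ts ! i) R0))" if i: "i < m" for i
    proof -
      have "snd Y (ts ! i) * (\<theta> * snd Y (pinv (ts ! i))) = inverse ?N \<cdot>\<^sub>m (snd Y (ts ! i) * (A R0 * B R0 * snd Y (pinv (ts ! i))))"
        using DY[OF ts_Sym[OF i]] DY[OF Sym_closed(2)[OF ts_Sym[OF i]]] by (simp add: \<theta>_def smult_mult_dim)
      then show ?thesis by (simp only: conj[OF ts_Sym[OF i] R0])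
    qed
    let ?f = "\<lambda>U. (A U * B U) $$ (s,t)"
    have "(\<Sum>i<m. (snd Y (ts ! i) * (\<theta> * snd Y (pinv (ts ! i)))) $$ (s,t)) = (\<Sum>i<m. inverse ?N * ?f (act (ts ! i) R0))"
      using st by (intro sum.cong) (simp_all add: sm del: index_mult_mat(1))
    also have "\<dots> = inverse ?N * (\<Sum>i<m. ?f (act (ts ! i) R0))" by (simp add: sum_distrib_left)
    also have "(\<Sum>i<m. ?f (act (ts ! i) R0)) = (\<Sum>U\<in>?X. \<Sum>i\<in>{i\<in>{..<m}. act (ts ! i) R0 = U}. ?f (act (ts ! i) R0))"
      by (rule sum.group[symmetric]) (auto simp: finite_wcont act_wcont[OF ts_Sym R0])
    also have "\<dots> = (\<Sum>U\<in>?X. ?N * ?f U)"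
    proof (rule sum.cong[OF refl])
      fix U assume U: "U \<in> ?X"
      have "(\<Sum>i\<in>{i\<in>{..<m}. act (ts ! i) R0 = U}. ?f (act (ts ! i) R0)) = (\<Sum>i\<in>{i\<in>{..<m}. act (ts ! i) R0 = U}. ?f U)" by (rule sum.cong) auto
      also have "\<dots> = of_nat (card {i. i < m \<and> act (ts ! i) R0 = U}) * ?f U" by simp
      finally show "(\<Sum>i\<in>{i\<in>{..<m}. act (ts ! i) R0 = U}. ?f (act (ts ! i) R0)) = ?N * ?f U"
        using transversal_count[OF fx R0 U] by simp
    qed
    also have "\<dots> = ?N * (\<Sum>U\<in>?X. ?f U)" by (simp add: sum_distrib_left)
    also have "(\<Sum>U\<in>?X. ?f U) = (\<Sum>k\<in>{0..<card ?X}. ?f (?w k))" by (rule sum.reindex_bij_betw[OF wenum_bij, symmetric])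
    also have "\<dots> = (\<Sum>k<card ?X. (colblk 1 a k * rowblk 1 b k) $$ (s,t))"
      by (rule sum.cong) (auto simp: A_def B_def ixw simp del: index_mult_mat(1))
    also have "\<dots> = (a * b) $$ (s,t)" by (rule mult_blocks[symmetric]) (use st da db in auto)
    finally show "(\<Sum>i<m. (snd Y (ts ! i) * (\<theta> * snd Y (pinv (ts ! i)))) $$ (s,t)) = 1\<^sub>m d $$ (s,t)"
      using N ab by simp
  qed
  then show ?thesis using rel_proj_iff_retract[OF Q Y] by simp
qed

section \<open>Young subgroups and signed permutation modules\<close>

lemma stabilizer_subgroup: "perm_subgroup {g\<in>Sym n. act g T = T} (Sym n)"
  unfolding perm_subgroup_def by (auto simp: Sym_closed act_comp) (metis act_inv(1))

lemma psum_mono: "k \<le> l \<Longrightarrow> psum c k \<le> psum c l"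
  unfolding psum_def by (intro sum_mono2) auto

lemma psum_cont_total:
  assumes "is_partition \<alpha>" "is_partition \<beta>" "sum_list \<alpha> + sum_list \<beta> = n"
  shows "psum (cont n \<alpha> \<beta>) (2 * n) = n" "psum (cont n \<alpha> \<beta>) n = sum_list \<alpha>" "length \<alpha> \<le> n" "length \<beta> \<le> n"
proof -
  show len: "length \<alpha> \<le> n" "length \<beta> \<le> n" using partition_length[OF assms(1)] partition_length[OF assms(2)] assms(3) by linarith+
  show "psum (cont n \<alpha> \<beta>) n = sum_list \<alpha>" using psum_cont(1)[of n n \<alpha> \<beta>] sum_list_entry[OF len(1)] by simp
  show "psum (cont n \<alpha> \<beta>) (2 * n) = n" using psum_cont(2)[of n \<alpha> \<beta> n] sum_list_entry[OF len(1)] sum_list_entry[OF len(2)] assms(3) by (simp add: mult_2)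
qed

section \<open>Young subgroups as groups preserving blocks\<close>

definition off :: "nat list \<Rightarrow> nat \<Rightarrow> nat" where "off a b = sum_list (take b a)"
definition blkof :: "nat list \<Rightarrow> nat \<Rightarrow> nat" where "blkof a x = (LEAST b. x \<le> off a (Suc b))"

lemma off_Suc: "b < length a \<Longrightarrow> off a (Suc b) = off a b + a ! b" by (simp add: off_def take_Suc_conv_app_nth)
lemma off_0 [simp]: "off a 0 = 0" by (simp add: off_def)
lemma off_mono: "b \<le> b' \<Longrightarrow> off a b \<le> off a b'"
proof -
  assume "b \<le> b'"
  then have "take b' a = take b a @ take (b' - b) (drop b a)" by (metis le_add_diff_inverse take_add)
  then show ?thesis by (simp add: off_def)
qed
lemma off_length: "length a \<le> b \<Longrightarrow> off a b = sum_list a" by (simp add: off_def)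

lemma blkof_unique:
  assumes "off a b < x" "x \<le> off a (Suc b)"
  shows "blkof a x = b"
  unfolding blkof_def
proof (rule Least_equality[where P="\<lambda>b. x \<le> off a (Suc b)", OF assms(2)])
  fix b' assume b': "x \<le> off a (Suc b')"
  show "b \<le> b'"
  proof (rule ccontr)
    assume "\<not> b \<le> b'"
    then have "off a (Suc b') \<le> off a b" by (intro off_mono) simp
    then show False using b' assms(1) by simp
  qed
qed

lemma blkof_bounds:
  assumes x: "x \<in> {1..sum_list a}"
  shows "blkof a x < length a" "off a (blkof a x) < x" "x \<le> off a (Suc (blkof a x))"
proof -
  have a: "a \<noteq> []" using x by auto
  then have ex: "x \<le> off a (Suc (length a - 1))" using x by (simp add: off_length)
  show le: "x \<le> off a (Suc (blkof a x))" unfolding blkof_def by (rule LeastI[where P="\<lambda>b. x \<le> off a (Suc b)", OF ex])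
  have "blkof a x \<le> length a - 1" unfolding blkof_def by (rule Least_le[where P="\<lambda>b. x \<le> off a (Suc b)", OF ex])
  then show "blkof a x < length a" using a by (cases a) auto
  show "off a (blkof a x) < x"
  proof (cases "blkof a x")
    case 0 then show ?thesis using x by simp
  next
    case (Suc b)
    then have "b < blkof a x" by simp
    then have "\<not> x \<le> off a (Suc b)" unfolding blkof_def by (rule not_less_Least)
    then show ?thesis using Suc by simp
  qed
qed

lemma blkof_iff: "x \<in> {1..sum_list a} \<Longrightarrow> blkof a x = b \<longleftrightarrow> off a b < x \<and> x \<le> off a (Suc b)"
  using blkof_bounds[of x a] blkof_unique[of a b x] by metis

lemma blkof_fibre: "b < length a \<Longrightarrow> {x\<in>{1..sum_list a}. blkof a x = b} = {off a b<..off a (Suc b)}"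
proof (intro Set.set_eqI iffI)
  fix x assume b: "b < length a"
  { assume "x \<in> {x\<in>{1..sum_list a}. blkof a x = b}"
    then show "x \<in> {off a b<..off a (Suc b)}" using blkof_iff[of x a b] by auto }
  assume "x \<in> {off a b<..off a (Suc b)}"
  then have x: "off a b < x" "x \<le> off a (Suc b)" by auto
  have "off a (Suc b) \<le> sum_list a" using off_mono[of "Suc b" "length a" a] b by (simp add: off_length)
  then show "x \<in> {x\<in>{1..sum_list a}. blkof a x = b}" using x blkof_unique[OF x] by auto
qed

lemma young_blkof: "young a = {g\<in>Sym (sum_list a). \<forall>x\<in>{1..sum_list a}. blkof a (g x) = blkof a x}"
proof (intro Set.set_eqI iffI)
  fix g assume g: "g \<in> young a"
  then have P: "g permutes {1..sum_list a}" by (simp add: young_def)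
  have "blkof a (g x) = blkof a x" if x: "x \<in> {1..sum_list a}" for x
    using g blkof_bounds[OF x] by (intro blkof_unique) (auto simp: young_def off_def)
  then show "g \<in> {g\<in>Sym (sum_list a). \<forall>x\<in>{1..sum_list a}. blkof a (g x) = blkof a x}" using P by (simp add: Sym_def)
next
  fix g assume g: "g \<in> {g\<in>Sym (sum_list a). \<forall>x\<in>{1..sum_list a}. blkof a (g x) = blkof a x}"
  then have P: "g permutes {1..sum_list a}" by (simp add: Sym_def)
  have "off a k < g x \<and> g x \<le> off a (Suc k)" if k: "k < length a" and x: "off a k < x" "x \<le> off a (Suc k)" for k x
  proof -
    have "x \<in> {x\<in>{1..sum_list a}. blkof a x = k}" unfolding blkof_fibre[OF k] using x by simp
    then have x': "x \<in> {1..sum_list a}" "blkof a x = k" by blast+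
    then have gx: "g x \<in> {1..sum_list a}" using permutes_in_image[OF P] by blast
    have "blkof a (g x) = k" using g x' by simp
    then show ?thesis using blkof_iff[OF gx] by blast
  qed
  then show "g \<in> young a" using P by (simp add: young_def off_def)
qed

lemma young_subgroup: "perm_subgroup (young a) (Sym (sum_list a))"
  unfolding perm_subgroup_def
proof (intro conjI ballI)
  show "young a \<subseteq> Sym (sum_list a)" by (auto simp: young_def Sym_def)
  show "id \<in> young a" using Sym_closed(3) by (simp add: young_blkof)
  fix g assume g: "g \<in> young a"
  then have gS: "g \<in> Sym (sum_list a)" and ge: "\<forall>x\<in>{1..sum_list a}. blkof a (g x) = blkof a x" unfolding young_blkof by blast+
  have mem: "h x \<in> {1..sum_list a}" if "h \<in> Sym (sum_list a)" "x \<in> {1..sum_list a}" for h x using permutes_in_image[OF SymD(1)[OF that(1)]] that(2) by blast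
  { fix x assume x: "x \<in> {1..sum_list a}"
    have "blkof a (g (pinv g x)) = blkof a (pinv g x)" using ge mem[OF Sym_closed(2)[OF gS] x] by blast
    then have "blkof a (pinv g x) = blkof a x" using permutes_inverses(1)[OF SymD(1)[OF gS]] by simp }
  then show "pinv g \<in> young a" unfolding young_blkof using Sym_closed(2)[OF gS] by blast
  fix h assume h: "h \<in> young a"
  then have hS: "h \<in> Sym (sum_list a)" and he: "\<forall>x\<in>{1..sum_list a}. blkof a (h x) = blkof a x" unfolding young_blkof by blast+
  have "\<forall>x\<in>{1..sum_list a}. blkof a ((g \<circ> h) x) = blkof a x"
  proof
    fix x assume x: "x \<in> {1..sum_list a}"
    have "blkof a (g (h x)) = blkof a (h x)" using ge mem[OF hS x] by blast
    then show "blkof a ((g \<circ> h) x) = blkof a x" using he x by simp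
  qed
  then show "g \<circ> h \<in> young a" unfolding young_blkof using Sym_closed(1)[OF gS hS] by blast
qed

lemma young_orbit:
  assumes x: "x \<in> {1..sum_list a}"
  shows "(\<lambda>g. g x) ` young a = {y\<in>{1..sum_list a}. blkof a y = blkof a x}"
proof
  show "(\<lambda>g. g x) ` young a \<subseteq> {y\<in>{1..sum_list a}. blkof a y = blkof a x}"
  proof
    fix y assume "y \<in> (\<lambda>g. g x) ` young a"
    then obtain g where g: "g \<in> Sym (sum_list a)" "\<forall>x\<in>{1..sum_list a}. blkof a (g x) = blkof a x" "y = g x" unfolding young_blkof by blast
    then show "y \<in> {y\<in>{1..sum_list a}. blkof a y = blkof a x}" using x permutes_in_image[OF SymD(1)[OF g(1)], of x] by blast
  qed
  show "{y\<in>{1..sum_list a}. blkof a y = blkof a x} \<subseteq> (\<lambda>g. g x) ` young a"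
  proof
    fix y assume "y \<in> {y\<in>{1..sum_list a}. blkof a y = blkof a x}"
    then have y: "y \<in> {1..sum_list a}" "blkof a y = blkof a x" by blast+
    let ?g = "swp x y"
    have "?g \<in> Sym (sum_list a)" unfolding Sym_def using permutes_swap_id[OF x y(1)] by simp
    moreover have "blkof a (?g z) = blkof a z" for z using y(2) by (simp add: Transposition.transpose_def)
    ultimately have "?g \<in> young a" unfolding young_blkof by simp
    then show "y \<in> (\<lambda>g. g x) ` young a" by (intro image_eqI[of _ _ ?g]) simp_all
  qed
qed

lemma card_block: "b < length a \<Longrightarrow> card {x\<in>{1..sum_list a}. blkof a x = b} = a ! b"
  unfolding blkof_fibre by (simp add: off_Suc)

text \<open>The word that writes a letter of its own on each block, even letters on the blocks of
  \<open>\<alpha>\<close> and odd ones on those of \<open>\<beta>\<close>; a permutation fixes it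
  exactly if it preserves the blocks.\<close>

lemma young_word:
  assumes part: "is_partition \<alpha>" "is_partition \<beta>" and tot: "sum_list \<alpha> + sum_list \<beta> = n"
  obtains T where "T \<in> wcont n (cont n \<alpha> \<beta>)" "young (\<alpha> @ \<beta>) = {g\<in>Sym n. act g T = T}" "odds n T = {x\<in>{1..n}. sum_list \<alpha> < x}"
proof -
  let ?a = "\<alpha> @ \<beta>"
  have sum: "sum_list ?a = n" using tot by simp
  note len = psum_cont_total(3,4)[OF part tot]
  note bounds = blkof_bounds[of _ ?a, unfolded sum]
  define f where "f k = (if k < length \<alpha> then k else n + (k - length \<alpha>))" for k
  define T where "T x = (if x \<in> {1..n} then f (blkof ?a x) else 0)" for x
  have Tx: "T x = f (blkof ?a x)" if "x \<in> {1..n}" for x using that by (simp add: T_def del: atLeastAtMost_iff)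
  have f_inj: "f k = f l \<longleftrightarrow> k = l" for k l using len(1) by (auto simp: f_def)
  have f_less: "f k < 2 * n" if "k < length ?a" for k using that len by (auto simp: f_def)
  have W: "T \<in> words n" unfolding words_def using f_less bounds(1) Tx by (simp add: T_def)
  have fibre: "card {x\<in>{1..n}. T x = f k} = ?a ! k" if "k < length ?a" for k
  proof -
    have "{x\<in>{1..n}. T x = f k} = {x\<in>{1..n}. blkof ?a x = k}" using Tx f_inj by auto
    then show ?thesis using card_block[OF that] by (simp only: sum)
  qed
  have empty: "card {x\<in>{1..n}. T x = k} = 0" if "\<And>l. l < length ?a \<Longrightarrow> f l \<noteq> k" for k
  proof -
    have "{x\<in>{1..n}. T x = k} = {}" using Tx bounds(1) that by auto
    then show ?thesis by (simp only: card.empty)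
  qed
  have "card {x\<in>{1..n}. T x = k} = cont n \<alpha> \<beta> k" for k
  proof (cases "k < n")
    case True
    show ?thesis
    proof (cases "k < length \<alpha>")
      case l: True
      then show ?thesis using fibre[of k] True by (simp add: f_def cont_def entry_Suc nth_append)
    next
      case False
      have "f l \<noteq> k" for l using True False by (auto simp: f_def)
      then show ?thesis using empty True False by (simp add: cont_def entry_Suc)
    qed
  next
    case False
    define j where "j = k - n"
    have k: "k = n + j" using False by (simp add: j_def)
    show ?thesis
    proof (cases "j < length \<beta>")
      case True
      have "f (length \<alpha> + j) = k" using k by (simp add: f_def)
      then show ?thesis using fibre[of "length \<alpha> + j"] True k by (simp add: cont_def entry_Suc nth_append)
    next
      case no: False
      have "f l \<noteq> k" if "l < length ?a" for l using that len(1) no k by (auto simp: f_def)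
      then show ?thesis using empty no k by (simp add: cont_def entry_Suc)
    qed
  qed
  then have T: "T \<in> wcont n (cont n \<alpha> \<beta>)" using W by (simp add: wcont_def)
  have "young ?a = {g\<in>Sym n. act g T = T}"
    unfolding young_blkof sum
  proof (rule Collect_cong, rule conj_cong[OF refl])
    fix g assume g: "g \<in> Sym n"
    have gx: "g x \<in> {1..n}" if "x \<in> {1..n}" for x using permutes_in_image[OF SymD(1)[OF g]] that by blast
    have "act g T = T \<longleftrightarrow> (\<forall>x\<in>{1..n}. T (g x) = T x)" using act_fix[OF g, of T] act_eqI[OF g W W] by blast
    then show "(\<forall>x\<in>{1..n}. blkof ?a (g x) = blkof ?a x) \<longleftrightarrow> act g T = T" using Tx gx f_inj by simp
  qed
  moreover have "odds n T = {x\<in>{1..n}. sum_list \<alpha> < x}"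
    unfolding odds_def
  proof (rule Collect_cong, rule conj_cong[OF refl])
    fix x assume x: "x \<in> {1..n}"
    let ?b = "blkof ?a x"
    have o: "off ?a (length \<alpha>) = sum_list \<alpha>" by (simp add: off_def)
    have "n \<le> T x \<longleftrightarrow> length \<alpha> \<le> ?b" using Tx[OF x] len(1) by (auto simp: f_def)
    also have "\<dots> \<longleftrightarrow> sum_list \<alpha> < x"
      using off_mono[of "length \<alpha>" ?b ?a] off_mono[of "Suc ?b" "length \<alpha>" ?a] bounds(2,3)[OF x] o by (cases "length \<alpha> \<le> ?b") auto
    finally show "n \<le> T x \<longleftrightarrow> sum_list \<alpha> < x" .
  qed
  ultimately show thesis by (rule that[OF T])
qed

text \<open>The basis vector of the coset of \<open>ts ! i\<close> corresponds to the word
  \<open>act (ts ! i) T\<close> with the sign \<open>eps n (ts ! i) T\<close>. These signs turn the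
  sign character of the Young subgroup into the signed action on words.\<close>

lemma signed_perm_module_iso:
  assumes part: "is_partition \<alpha>" "is_partition \<beta>" and tot: "sum_list \<alpha> + sum_list \<beta> = n"
  shows "is_rep (Sym n) (signed_perm_module n \<alpha> \<beta> :: 'a::field rep)"
    "rep_iso (Sym n) (signed_perm_module n \<alpha> \<beta> :: 'a rep) (mono_rep n (cont n \<alpha> \<beta>))"
proof -
  let ?c = "cont n \<alpha> \<beta>"
  obtain T where T: "T \<in> wcont n ?c" and Hdef0: "young (\<alpha> @ \<beta>) = {g\<in>Sym n. act g T = T}" and od: "odds n T = {x\<in>{1..n}. sum_list \<alpha> < x}"
    by (rule young_word[OF part tot])
  define H where "H = young (\<alpha> @ \<beta>)"
  have Hdef: "H = {g\<in>Sym n. act g T = T}" unfolding H_def by (rule Hdef0)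
  have HS: "perm_subgroup H (Sym n)" unfolding Hdef by (rule stabilizer_subgroup)
  define M :: "'a rep" where "M = (1, \<lambda>\<sigma>. mat 1 1 (\<lambda>_. of_int (sign (\<lambda>x. if sum_list \<alpha> < x then \<sigma> x else x))))"
  \<comment> \<open>The positions beyond \<open>sum_list \<alpha>\<close> are the odd positions of
    \<open>T\<close>, so both sides are the sign of \<open>h\<close> on the part that belongs to
    \<open>\<beta>\<close>.\<close>
  have sgn: "sign (\<lambda>x. if sum_list \<alpha> < x then h x else x) = eps n h T" if h: "h \<in> H" for h
  proof -
    have hS: "h \<in> Sym n" and hT: "act h T = T" using h Hdef by auto
    have "h x = x" if "x \<notin> {1..n}" for x using SymD(1)[OF hS] that by (auto simp: permutes_def)
    then have "(\<lambda>x. if sum_list \<alpha> < x then h x else x) = restr (odds n T) h"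
      unfolding restr_def od by (intro ext) (auto simp del: atLeastAtMost_iff)
    moreover have "h ` odds n T = odds n T" using odds_act[OF hS, of T] hT by simp
    ultimately show ?thesis unfolding eps_def using osgn_restr[OF finite_odds inj_on_subset[OF SymD(3)[OF hS] subset_UNIV]] by simp
  qed
  have Me: "snd M h = mat 1 1 (\<lambda>_. of_int (eps n h T))" if "h \<in> H" for h unfolding M_def using sgn[OF that] by simp
  have M1: "fst M = 1" by (simp add: M_def)
  have repM: "is_rep H M" unfolding is_rep_def
  proof (intro conjI ballI)
    fix g h assume g: "g \<in> H" and h: "h \<in> H"
    have gh: "g \<circ> h \<in> H" using perm_subgroupD(3)[OF HS g h] .
    have "eps n (g \<circ> h) T = eps n g T * eps n h T" using eps_comp[of g n h T] g h Hdef by simp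
    then show "snd M (g \<circ> h) = snd M g * snd M h" unfolding Me[OF gh] Me[OF g] Me[OF h] by (intro eq_matI) (auto simp: scalar_prod_def)
  next
    show "snd M id = 1\<^sub>m (fst M)" unfolding Me[OF perm_subgroupD(2)[OF HS]] M1 by (intro eq_matI) auto
  qed (auto simp: M_def)
  interpret induction_data n H M using HS repM by unfold_locales
  have eq: "signed_perm_module n \<alpha> \<beta> = Ind (Sym n) H M" unfolding signed_perm_module_def H_def M_def ..
  show "is_rep (Sym n) (signed_perm_module n \<alpha> \<beta> :: 'a rep)" unfolding eq by (rule is_rep_Ind)
  let ?X = "wcont n ?c" and ?w = "wenum n ?c"
  define U where "U i = act (ts ! i) T" for i
  have UX: "U i \<in> ?X" if "i < m" for i unfolding U_def by (rule act_wcont[OF ts_Sym[OF that] T])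
  have Uinj: "i = j" if ij: "i < m" "j < m" "U i = U j" for i j
  proof -
    have gS: "pinv (ts ! i) \<circ> ts ! j \<in> Sym n" using Sym_closed ts_Sym ij by blast
    have "act (pinv (ts ! i) \<circ> ts ! j) T = T"
      unfolding act_comp[OF Sym_closed(2)[OF ts_Sym[OF ij(1)]] ts_Sym[OF ij(2)]] using ij(3) act_inv(1)[OF ts_Sym[OF ij(1)]] unfolding U_def by metis
    then have "pinv (ts ! i) \<circ> ts ! j \<in> H" using gS Hdef by simp
    moreover have "pinv (ts ! j) \<circ> ts ! j \<in> H" using Sym_inv(2)[OF ts_Sym[OF ij(2)]] perm_subgroupD(2)[OF HS] by simp
    ultimately show ?thesis using ts_ex1[OF ts_Sym[OF ij(2)]] ij by blast
  qed
  have Usurj: "\<exists>i<m. U i = V" if V: "V \<in> ?X" for V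
  proof -
    obtain g where g: "g \<in> Sym n" "act g T = V" using wcont_orbit[OF T V] by blast
    obtain i where i: "i < m" "pinv (ts ! i) \<circ> g \<in> H" using ts_ex1[OF g(1)] by blast
    have "act (pinv (ts ! i)) V = T" using i(2) Hdef act_comp[OF Sym_closed(2)[OF ts_Sym[OF i(1)]] g(1), of T] g(2) by simp
    then have "U i = V" unfolding U_def using act_inv(2)[OF ts_Sym[OF i(1)]] by metis
    then show ?thesis using i by blast
  qed
  have bij: "bij_betw U {..<m} ?X"
  proof (rule bij_betw_imageI)
    show "inj_on U {..<m}" using Uinj by (auto intro!: inj_onI)
    show "U ` {..<m} = ?X" using UX Usurj by blast
  qed
  define e where "e i = (of_int (eps n (ts ! i) T) :: 'a)" for i
  have ee: "e i * e i = 1" for i unfolding e_def by (rule eps_square_field)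
  define A where "A = mat (card ?X) m (\<lambda>(u,i). if ?w u = U i then e i else 0)"
  define B where "B = mat m (card ?X) (\<lambda>(i,u). if ?w u = U i then e i else 0)"
  have dims [simp]: "dim_row A = card ?X" "dim_col A = m" "dim_row B = m" "dim_col B = card ?X" by (auto simp: A_def B_def)
  have If: "fst (Ind (Sym n) H M) = m" using Ind_eq(1) M1 by simp
  have AB: "A * B = 1\<^sub>m (card ?X)"
  proof (rule eq_matI)
    fix u v assume "u < dim_row (1\<^sub>m (card ?X) :: 'a mat)" "v < dim_col (1\<^sub>m (card ?X) :: 'a mat)"
    then have uv: "u < card ?X" "v < card ?X" by auto
    have "(A * B) $$ (u,v) = (\<Sum>i<m. (if ?w u = U i then e i else 0) * (if ?w v = U i then e i else 0))"
      using uv by (simp add: A_def B_def scalar_prod_def lessThan_atLeast0)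
    also have "\<dots> = (\<Sum>i<m. (\<lambda>V. if V = ?w u then (if ?w u = ?w v then 1 else 0) else 0) (U i))"
      using ee by (intro sum.cong) auto
    also have "\<dots> = (\<Sum>V\<in>?X. if V = ?w u then (if ?w u = ?w v then 1 else 0) else 0)" by (rule sum.reindex_bij_betw[OF bij])
    also have "\<dots> = (if ?w u = ?w v then 1 else 0)" using wenum_mem[OF uv(1)] finite_wcont by simp
    also have "\<dots> = 1\<^sub>m (card ?X) $$ (u,v)" using uv wenum_bij[of n ?c] by (auto simp: bij_betw_def dest: inj_onD)
    finally show "(A * B) $$ (u,v) = 1\<^sub>m (card ?X) $$ (u,v)" .
  qed auto
  have BA: "B * A = 1\<^sub>m m"
  proof (rule eq_matI)
    fix i j assume "i < dim_row (1\<^sub>m m :: 'a mat)" "j < dim_col (1\<^sub>m m :: 'a mat)"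
    then have ij: "i < m" "j < m" by auto
    have "(B * A) $$ (i,j) = (\<Sum>u\<in>{0..<card ?X}. (\<lambda>V. (if V = U i then e i else 0) * (if V = U j then e j else 0)) (?w u))"
      using ij by (simp add: A_def B_def scalar_prod_def)
    also have "\<dots> = (\<Sum>V\<in>?X. (if V = U i then e i else 0) * (if V = U j then e j else 0))" by (rule sum.reindex_bij_betw[OF wenum_bij])
    also have "\<dots> = (\<Sum>V\<in>?X. if V = U i then (if U i = U j then e i * e j else 0) else 0)" by (rule sum.cong) auto
    also have "\<dots> = (if U i = U j then e i * e j else 0)" using UX[OF ij(1)] finite_wcont by simp
    also have "\<dots> = 1\<^sub>m m $$ (i,j)" using ij Uinj[OF ij] ee by auto
    finally show "(B * A) $$ (i,j) = 1\<^sub>m m $$ (i,j)" .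
  qed auto
  have com: "A * snd (Ind (Sym n) H M) g = snd (mono_rep n ?c) g * A" if g: "g \<in> Sym n" for g
  proof (rule eq_matI)
    fix u j assume "u < dim_row (snd (mono_rep n ?c) g * A)" "j < dim_col (snd (mono_rep n ?c) g * A)"
    then have uj: "u < card ?X" "j < m" by (auto simp: mono_rep_def)
    let ?j = "cst g j" and ?t = "tr (cst g j) g j"
    note c = cst_spec[OF g uj(2)]
    have t: "?t \<in> Sym n" "act ?t T = T" using c(2) Hdef by auto
    have gt: "g \<circ> ts ! j = ts ! ?j \<circ> ?t" unfolding tr_def comp_assoc by (rule Sym_cancel(2)[OF ts_Sym[OF c(1)], symmetric])
    have Ug: "act g (U j) = U ?j"
      unfolding U_def act_comp[OF g ts_Sym[OF uj(2)], symmetric] gt act_comp[OF ts_Sym[OF c(1)] t(1)] t(2) ..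
    \<comment> \<open>Both sides are the sign of
      \<open>g \<circ> ts ! j = ts ! ?j \<circ> ?t\<close> at \<open>T\<close>, expanded by the
      cocycle identity in two ways.\<close>
    have eg: "eps n g (U j) * eps n (ts ! j) T = eps n (ts ! ?j) T * eps n ?t T"
      unfolding U_def eps_comp[OF g ts_Sym[OF uj(2)], symmetric] gt eps_comp[OF ts_Sym[OF c(1)] t(1)] t(2) ..
    have "(A * snd (Ind (Sym n) H M) g) $$ (u,j) = colblk 1 (A * snd (Ind (Sym n) H M) g) j $$ (u,0)" using uj by (simp add: colblk_def)
    also have "\<dots> = (colblk 1 A ?j * snd M ?t) $$ (u,0)"
      using mult_Ind_colblk[OF g uj(2), of A] M1 by simp
    also have "\<dots> = A $$ (u,?j) * of_int (eps n ?t T)" unfolding Me[OF c(2)] using uj by (simp add: colblk_def scalar_prod_def)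
    also have "\<dots> = (if ?w u = U ?j then of_int (eps n (ts ! ?j) T * eps n ?t T) else 0)" using uj c(1) by (simp add: A_def e_def)
    also have "\<dots> = (if ?w u = U ?j then of_int (eps n g (U j) * eps n (ts ! j) T) else 0)" by (simp only: eg)
    also have "\<dots> = (\<Sum>V\<in>?X. if V = U j then mono_kernel n g (?w u) V * e j else 0)" using UX[OF uj(2)] finite_wcont Ug by (auto simp: mono_kernel_def e_def)
    also have "\<dots> = (\<Sum>v\<in>{0..<card ?X}. (\<lambda>V. if V = U j then mono_kernel n g (?w u) V * e j else 0) (?w v))"
      by (rule sum.reindex_bij_betw[OF wenum_bij, symmetric])
    also have "\<dots> = (\<Sum>v\<in>{0..<card ?X}. mono_kernel n g (?w u) (?w v) * (if ?w v = U j then e j else 0))" by (rule sum.cong) auto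
    also have "\<dots> = (snd (mono_rep n ?c) g * A) $$ (u,j)" using uj by (simp add: mono_rep_def scalar_prod_def) (simp add: kmat_def A_def)
    finally show "(A * snd (Ind (Sym n) H M) g) $$ (u,j) = (snd (mono_rep n ?c) g * A) $$ (u,j)" .
  qed (auto simp: mono_rep_def Ind_eq M1)
  have A: "A \<in> rep_hom (Sym n) (Ind (Sym n) H M) (mono_rep n ?c)" unfolding rep_hom_def using com by (simp add: If)
  have "B \<in> rep_hom (Sym n) (mono_rep n ?c) (Ind (Sym n) H M)"
  proof -
    have "B * snd (mono_rep n ?c) g = snd (Ind (Sym n) H M) g * B" if g: "g \<in> Sym n" for g
    proof -
      have dd: "dim_row (snd (mono_rep n ?c :: 'a rep) g) = card ?X" "dim_col (snd (mono_rep n ?c :: 'a rep) g) = card ?X" by (simp_all add: mono_rep_def)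
      have di: "dim_row (snd (Ind (Sym n) H M) g) = m" "dim_col (snd (Ind (Sym n) H M) g) = m" using M1 by simp_all
      have "B * snd (mono_rep n ?c) g = B * (snd (mono_rep n ?c) g * (A * B))" using dd by (simp add: AB one_mult_dim)
      also have "\<dots> = B * (snd (mono_rep n ?c) g * A) * B" using dd by (simp add: mult_assoc_dim)
      also have "\<dots> = (B * A) * snd (Ind (Sym n) H M) g * B" unfolding com[OF g, symmetric] using di by (simp add: mult_assoc_dim M1)
      also have "\<dots> = snd (Ind (Sym n) H M) g * B" using di by (simp add: BA one_mult_dim M1)
      finally show ?thesis .
    qed
    then show ?thesis unfolding rep_hom_def by (simp add: If)
  qed
  then show "rep_iso (Sym n) (signed_perm_module n \<alpha> \<beta> :: 'a rep) (mono_rep n ?c)" unfolding eq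
    by (intro rep_isoI[OF is_rep_Ind is_rep_mono A]) (use AB BA If in auto)
qed

section \<open>Blocks and the character of the endomorphism ring\<close>

lemma kmul_mono_right:
  fixes K :: "_ \<Rightarrow> _ \<Rightarrow> 'a::field"
  assumes g: "g \<in> Sym n" and T: "T \<in> wcont n c"
  shows "kmul n c K (mono_kernel n g) U T = of_int (eps n g T) * K U (act g T)"
proof -
  have "kmul n c K (mono_kernel n g) U T = (\<Sum>S\<in>wcont n c. if S = act g T then of_int (eps n g T) * K U S else 0)"
    unfolding kmul_def mono_kernel_def by (rule sum.cong) auto
  then show ?thesis using act_wcont[OF g T] finite_wcont by (simp add: sum.delta)
qed

lemma kmul_mono_left:
  fixes K :: "_ \<Rightarrow> _ \<Rightarrow> 'a::field"
  assumes g: "g \<in> Sym n" and U: "U \<in> wcont n c"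
  shows "kmul n c (mono_kernel n g) K (act g U) T = of_int (eps n g U) * K U T"
proof -
  have "kmul n c (mono_kernel n g) K (act g U) T = (\<Sum>S\<in>wcont n c. if S = U then of_int (eps n g U) * K U T else 0)"
    unfolding kmul_def mono_kernel_def by (rule sum.cong) (auto simp: act_eq_iff[OF g])
  then show ?thesis using U finite_wcont by (simp add: sum.delta)
qed

text \<open>On permutations fixing the word, \<open>eps\<close> is a homomorphism to signs; if it
  took the value -1, multiplication by such an element would pair off the group, whose order is
  odd.\<close>

lemma eps_p_group:
  assumes Q: "perm_subgroup Q (Sym n)" and odd: "odd (card Q)" and fx: "\<And>q. q \<in> Q \<Longrightarrow> act q T = T" and q: "q \<in> Q"
  shows "eps n q T = 1"
proof (rule ccontr)
  assume "eps n q T \<noteq> 1"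
  then have m: "eps n q T = - 1" using eps_cases by blast
  have qS: "q \<in> Sym n" using perm_subgroupD(1)[OF Q q] .
  have fin: "finite Q" by (rule finite_perm_subgroup[OF Q])
  let ?A = "{r\<in>Q. eps n r T = 1}" and ?B = "{r\<in>Q. eps n r T = - 1}"
  have mul: "eps n (r \<circ> r') T = eps n r T * eps n r' T" if "r \<in> Q" "r' \<in> Q" for r r'
    using eps_comp[OF perm_subgroupD(1)[OF Q that(1)] perm_subgroupD(1)[OF Q that(2)], of T] fx[OF that(2)] by simp
  have qi: "pinv q \<in> Q" by (rule perm_subgroupD(4)[OF Q q])
  have mi: "eps n (pinv q) T = - 1"
  proof -
    have "eps n (pinv q \<circ> q) T = 1" using Sym_inv(2)[OF qS] by simp
    then show ?thesis using mul[OF qi q] m by simp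
  qed
  have "bij_betw (\<lambda>r. q \<circ> r) ?A ?B"
  proof (rule bij_betw_byWitness[where f'="\<lambda>r. pinv q \<circ> r"])
    show "\<forall>a\<in>?A. pinv q \<circ> (q \<circ> a) = a" using Sym_cancel(1)[OF qS] by simp
    show "\<forall>a\<in>?B. q \<circ> (pinv q \<circ> a) = a" using Sym_cancel(2)[OF qS] by simp
    show "(\<circ>) q ` ?A \<subseteq> ?B" using perm_subgroupD(3)[OF Q q] mul[OF q] m by auto
    show "(\<circ>) (pinv q) ` ?B \<subseteq> ?A" using perm_subgroupD(3)[OF Q qi] mul[OF qi] mi by auto
  qed
  then have "card ?A = card ?B" by (rule bij_betw_same_card)
  moreover have "Q = ?A \<union> ?B" using eps_cases by blast
  then have "card Q = card (?A \<union> ?B)" by simp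
  moreover have "card (?A \<union> ?B) = card ?A + card ?B" using fin by (intro card_Un_disjoint) auto
  ultimately show False using odd by simp
qed

lemma two_neq_zero:
  assumes "prime p" "odd p" "CHAR('a::field) = p"
  shows "(2::'a) \<noteq> 0"
proof
  assume "(2::'a) = 0"
  then have "of_nat 2 = (0::'a)" by simp
  then have "p dvd 2" using of_nat_eq_0_iff_char_dvd[where 'a='a, of 2] assms(3) by simp
  then show False using assms(1,2) by (metis primes_dvd_imp_eq two_is_prime_nat even_numeral dvd_refl)
qed

text \<open>Block \<open>b\<close> is an orbit of \<open>Q\<close> of size \<open>sz b\<close> and carries the letter \<open>t0 b\<close>; it stands for a box of a Young
  diagram with row \<open>t0 b\<close> (shifted by \<open>n\<close> in the odd case) and column \<open>col b\<close>.\<close>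
locale block_system =
  fixes n p e N :: nat and ty :: "'a::field itself" and Q :: "(nat \<Rightarrow> nat) set"
    and blk pos :: "nat \<Rightarrow> nat" and pt :: "nat \<Rightarrow> nat \<Rightarrow> nat" and sz t0 :: "nat \<Rightarrow> nat" and col :: "nat \<Rightarrow> 'c"
  assumes prime: "prime p" and odd_p: "odd p" and char: "CHAR('a) = p"
    and Q: "perm_subgroup Q (Sym n)" and card_Q: "card Q = p ^ e"
    and blk_less: "x \<in> {1..n} \<Longrightarrow> blk x < N" and pos_less: "x \<in> {1..n} \<Longrightarrow> pos x < sz (blk x)"
    and pt_mem: "b < N \<Longrightarrow> i < sz b \<Longrightarrow> pt b i \<in> {1..n}"
    and blk_pt: "b < N \<Longrightarrow> i < sz b \<Longrightarrow> blk (pt b i) = b" and pos_pt: "b < N \<Longrightarrow> i < sz b \<Longrightarrow> pos (pt b i) = i"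
    and pt_blk: "x \<in> {1..n} \<Longrightarrow> pt (blk x) (pos x) = x"
    and sz_odd: "b < N \<Longrightarrow> odd (sz b)"
    and orbits: "x \<in> {1..n} \<Longrightarrow> (\<lambda>q. q x) ` Q = {y\<in>{1..n}. blk y = blk x}"
    and t0_less: "b < N \<Longrightarrow> t0 b < 2 * n"
    and col_sz: "b < N \<Longrightarrow> b' < N \<Longrightarrow> col b = col b' \<Longrightarrow> sz b = sz b'"
    and col_par: "b < N \<Longrightarrow> b' < N \<Longrightarrow> col b = col b' \<Longrightarrow> n \<le> t0 b \<longleftrightarrow> n \<le> t0 b'"
    and col_inj: "b < N \<Longrightarrow> b' < N \<Longrightarrow> col b = col b' \<Longrightarrow> t0 b = t0 b' \<Longrightarrow> b = b'"
    and col_down: "b < N \<Longrightarrow> j \<le> t0 b \<Longrightarrow> (n \<le> j \<longleftrightarrow> n \<le> t0 b) \<Longrightarrow> \<exists>b'<N. col b' = col b \<and> t0 b' = j"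
    and odd_big: "b < N \<Longrightarrow> n \<le> t0 b \<Longrightarrow> 1 < sz b"
begin

definition W :: "(nat \<Rightarrow> nat) \<Rightarrow> nat \<Rightarrow> nat" where "W t = (\<lambda>x. if x \<in> {1..n} then t (blk x) else 0)"
definition con :: "(nat \<Rightarrow> nat) \<Rightarrow> bool" where "con T \<longleftrightarrow> (\<forall>x\<in>{1..n}. \<forall>y\<in>{1..n}. blk x = blk y \<longrightarrow> T x = T y)"
definition T0 :: "nat \<Rightarrow> nat" where "T0 = W t0"
definition c0 :: "nat \<Rightarrow> nat" where "c0 = content n T0"
definition BC :: "(nat \<Rightarrow> nat) \<Rightarrow> (nat \<Rightarrow> nat) set" where "BC c = {T\<in>wcont n c. con T}"
definition fil :: "(nat \<Rightarrow> nat) \<Rightarrow> nat \<Rightarrow> nat" where "fil T b = T (pt b 0)"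
definition hat :: "(nat \<Rightarrow> nat) \<Rightarrow> nat \<Rightarrow> nat" where "hat \<pi> = (\<lambda>x. if x \<in> {1..n} then pt (\<pi> (blk x)) (pos x) else x)"
definition szperm :: "(nat \<Rightarrow> nat) set" where "szperm = {\<pi>. \<pi> permutes {..<N} \<and> (\<forall>b<N. sz (\<pi> b) = sz b)}"
definition C :: "(nat \<Rightarrow> nat) set" where "C = {\<pi>. \<pi> permutes {..<N} \<and> (\<forall>b<N. col (\<pi> b) = col b)}"
definition ev :: "nat set" where "ev = {b. b < N \<and> t0 b < n}"
text \<open>The sign of the column antisymmetriser is counted on even blocks only. On odd blocks the
  module supplies it: exchanging two blocks with the same odd letter has \<open>eps\<close> equal to
  -1 because their size is odd. So \<open>chi\<close> times \<open>eps\<close> is -1 in both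
  cases.\<close>

definition chi :: "(nat \<Rightarrow> nat) \<Rightarrow> int" where "chi \<pi> = osgn ev \<pi>"

lemma two: "(2::'a) \<noteq> 0" by (rule two_neq_zero[OF prime odd_p char])

lemma sz_pos: "b < N \<Longrightarrow> 0 < sz b" using sz_odd[of b] by (auto intro: Nat.gr0I)

lemma BCD: "T \<in> BC c \<Longrightarrow> T \<in> wcont n c" "T \<in> BC c \<Longrightarrow> con T" "T \<in> BC c \<Longrightarrow> T \<in> words n"
  by (auto simp: BC_def wcont_words)

lemma finite_BC: "finite (BC c)" unfolding BC_def using finite_wcont[of n c] by auto

lemma W_fil: "T \<in> words n \<Longrightarrow> con T \<Longrightarrow> T = W (fil T)"
proof
  fix x assume T: "T \<in> words n" "con T"
  show "T x = W (fil T) x"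
  proof (cases "x \<in> {1..n}")
    case True
    have b: "blk x < N" "0 < sz (blk x)" using blk_less[OF True] sz_pos by auto
    then have "T x = T (pt (blk x) 0)" using T(2) True pt_mem[OF b] blk_pt[OF b] unfolding con_def by metis
    then show ?thesis using True by (simp add: W_def fil_def del: atLeastAtMost_iff)
  qed (use words_out[OF T(1)] in \<open>simp add: W_def del: atLeastAtMost_iff\<close>)
qed

lemma fil_W: "b < N \<Longrightarrow> fil (W t) b = t b"
  unfolding fil_def W_def using pt_mem[of b 0] blk_pt[of b 0] sz_pos[of b] by simp

lemma con_W: "con (W t)" unfolding con_def W_def by simp

lemma W_words: "(\<And>b. b < N \<Longrightarrow> t b < 2 * n) \<Longrightarrow> W t \<in> words n"
  unfolding words_def W_def using blk_less by auto

lemma W_eq_iff: "W t = W t' \<longleftrightarrow> (\<forall>b<N. t b = t' b)"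
proof
  assume "W t = W t'" then show "\<forall>b<N. t b = t' b" using fil_W by metis
next
  assume "\<forall>b<N. t b = t' b" then show "W t = W t'" unfolding W_def using blk_less by (intro ext) auto
qed

lemma T0_words: "T0 \<in> words n" unfolding T0_def by (rule W_words) (rule t0_less)
lemma T0_wcont: "T0 \<in> wcont n c0" unfolding c0_def by (rule wcont_content[OF T0_words])
lemma T0_BC: "T0 \<in> BC c0" using T0_wcont con_W[of t0] by (simp add: BC_def T0_def)

lemma fixed_iff_con: assumes "T \<in> words n" shows "(\<forall>q\<in>Q. act q T = T) \<longleftrightarrow> con T"
proof
  assume *: "\<forall>q\<in>Q. act q T = T"
  show "con T" unfolding con_def
  proof (intro ballI impI)
    fix x y assume x: "x \<in> {1..n}" "y \<in> {1..n}" "blk x = blk y"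
    then have "y \<in> (\<lambda>q. q x) ` Q" unfolding orbits[OF x(1)] by simp
    then obtain q where "q \<in> Q" "y = q x" by blast
    then show "T x = T y" using act_fix[OF perm_subgroupD(1)[OF Q]] * by metis
  qed
next
  assume con: "con T"
  show "\<forall>q\<in>Q. act q T = T"
  proof
    fix q assume q: "q \<in> Q"
    show "act q T = T"
    proof (rule act_eqI[OF perm_subgroupD(1)[OF Q q] assms assms])
      fix x assume x: "x \<in> {1..n}"
      have "q x \<in> {y\<in>{1..n}. blk y = blk x}" using orbits[OF x] q by blast
      then show "T (q x) = T x" using con x unfolding con_def by blast
    qed
  qed
qed

lemma act_Q: "T \<in> words n \<Longrightarrow> con T \<Longrightarrow> q \<in> Q \<Longrightarrow> act q T = T" using fixed_iff_con by blast

lemma eps_Q: "T \<in> words n \<Longrightarrow> con T \<Longrightarrow> q \<in> Q \<Longrightarrow> eps n q T = 1"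
  by (rule eps_p_group[OF Q]) (use card_Q odd_p act_Q in auto)

text \<open>Restriction to words that are constant on blocks is multiplicative: the other words form
  orbits under the \<open>p\<close>-group \<open>Q\<close> whose sizes are divisible by \<open>p\<close>.\<close>
lemma kmul_BC:
  fixes K L :: "_ \<Rightarrow> _ \<Rightarrow> 'a"
  assumes K: "kinv n c c' K" and L: "kinv n c' c'' L" and U: "U \<in> BC c" and T: "T \<in> BC c''"
  shows "kmul n c' K L U T = (\<Sum>S\<in>BC c'. K U S * L S T)"
proof -
  let ?f = "\<lambda>S. if con S then 0 else K U S * L S T"
  have "(\<Sum>S\<in>wcont n c'. ?f S) = 0"
  proof (rule sum_p_group[OF Q card_Q prime char finite_wcont, where \<alpha>=act])
    show "act q S \<in> wcont n c'" if "q \<in> Q" "S \<in> wcont n c'" for q S using act_wcont perm_subgroupD(1)[OF Q] that by blast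
    show "act (q \<circ> q') S = act q (act q' S)" if "q \<in> Q" "q' \<in> Q" for q q' S using act_comp perm_subgroupD(1)[OF Q] that by blast
    show "?f (act q S) = ?f S" if q: "q \<in> Q" and S: "S \<in> wcont n c'" for q S
    proof -
      have qS: "q \<in> Sym n" using perm_subgroupD(1)[OF Q q] .
      \<comment> \<open>\<open>q\<close> fixes \<open>U\<close> and \<open>T\<close> with sign 1, so
        \<open>K\<close> and \<open>L\<close> both pick up the sign of \<open>q\<close> at
        \<open>S\<close>, and it cancels in the product.\<close>
      have "K (act q U) (act q S) = of_int (eps n q U * eps n q S) * K U S" using K qS BCD(1)[OF U] S unfolding kinv_def by blast
      then have k: "K U (act q S) = of_int (eps n q S) * K U S" using act_Q[OF BCD(3,2)[OF U] q] eps_Q[OF BCD(3,2)[OF U] q] by simp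
      have "L (act q S) (act q T) = of_int (eps n q S * eps n q T) * L S T" using L qS BCD(1)[OF T] S unfolding kinv_def by blast
      then have l: "L (act q S) T = of_int (eps n q S) * L S T" using act_Q[OF BCD(3,2)[OF T] q] eps_Q[OF BCD(3,2)[OF T] q] by simp
      have "K U (act q S) * L (act q S) T = (of_int (eps n q S) * of_int (eps n q S)) * (K U S * L S T)" unfolding k l by (simp only: ac_simps)
      then have kl: "K U (act q S) * L (act q S) T = K U S * L S T" by (simp only: eps_square_field mult_1)
      have "con (act q S) \<longleftrightarrow> con S"
      proof -
        have S': "S \<in> words n" "act q S \<in> words n" using wcont_words[OF S] act_words[OF qS] by auto
        show ?thesis
        proof
          assume "con S" then show "con (act q S)" using act_Q[OF S'(1) _ q] by simp
        next
          assume "con (act q S)"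
          then have "act (pinv q) (act q S) = act q S" using act_Q[OF S'(2) _ perm_subgroupD(4)[OF Q q]] by simp
          then have "S = act q S" using act_inv(1)[OF qS] by simp
          then show "con S" using \<open>con (act q S)\<close> by simp
        qed
      qed
      then show ?thesis using kl by simp
    qed
    show "?f S = 0" if "S \<in> wcont n c'" "\<forall>q\<in>Q. act q S = S" for S using that fixed_iff_con[OF wcont_words] by simp
  qed simp
  moreover have "kmul n c' K L U T = (\<Sum>S\<in>wcont n c'. ?f S) + (\<Sum>S\<in>wcont n c'. if con S then K U S * L S T else 0)"
    unfolding kmul_def sum.distrib[symmetric] by (rule sum.cong) auto
  moreover have "(\<Sum>S\<in>wcont n c'. if con S then K U S * L S T else 0) = (\<Sum>S\<in>BC c'. K U S * L S T)"
    unfolding BC_def by (rule sum.inter_filter[OF finite_wcont, symmetric])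
  ultimately show ?thesis by simp
qed

section \<open>Permutations of blocks\<close>

lemma szpermD: "\<pi> \<in> szperm \<Longrightarrow> \<pi> permutes {..<N}" "\<pi> \<in> szperm \<Longrightarrow> b < N \<Longrightarrow> \<pi> b < N" "\<pi> \<in> szperm \<Longrightarrow> b < N \<Longrightarrow> sz (\<pi> b) = sz b"
proof -
  show 1: "\<pi> \<in> szperm \<Longrightarrow> \<pi> permutes {..<N}" and "\<pi> \<in> szperm \<Longrightarrow> b < N \<Longrightarrow> sz (\<pi> b) = sz b" by (auto simp: szperm_def)
  show "\<pi> b < N" if "\<pi> \<in> szperm" "b < N" using permutes_in_image[OF 1[OF that(1)], of b] that(2) by simp
qed

lemma C_szperm: "\<pi> \<in> C \<Longrightarrow> \<pi> \<in> szperm"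
proof -
  assume pi: "\<pi> \<in> C"
  have "sz (\<pi> b) = sz b" if "b < N" for b
    using col_sz[of "\<pi> b" b] pi that permutes_in_image[of \<pi> "{..<N}" b] unfolding C_def by auto
  then show ?thesis using pi by (auto simp: C_def szperm_def)
qed

lemma szperm_closed: "\<pi> \<in> szperm \<Longrightarrow> \<rho> \<in> szperm \<Longrightarrow> \<pi> \<circ> \<rho> \<in> szperm" "\<pi> \<in> szperm \<Longrightarrow> pinv \<pi> \<in> szperm" "id \<in> szperm"
proof -
  show "\<pi> \<circ> \<rho> \<in> szperm" if "\<pi> \<in> szperm" "\<rho> \<in> szperm"
    using permutes_compose[OF szpermD(1)[OF that(2)] szpermD(1)[OF that(1)]] szpermD(2,3)[OF that(2)] szpermD(3)[OF that(1)] by (simp add: szperm_def)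
  show "id \<in> szperm" by (simp add: szperm_def permutes_id)
  assume pi: "\<pi> \<in> szperm"
  note P = szpermD(1)[OF pi]
  have "sz (pinv \<pi> b) = sz b" if b: "b < N" for b
  proof -
    have "pinv \<pi> b < N" using permutes_in_image[OF permutes_inv[OF P], of b] b by simp
    from szpermD(3)[OF pi this] show ?thesis using permutes_inverses(1)[OF P] by simp
  qed
  then show "pinv \<pi> \<in> szperm" using permutes_inv[OF P] by (simp add: szperm_def)
qed

lemma C_closed: "\<pi> \<in> C \<Longrightarrow> \<rho> \<in> C \<Longrightarrow> \<pi> \<circ> \<rho> \<in> C" "\<pi> \<in> C \<Longrightarrow> pinv \<pi> \<in> C" "id \<in> C"
proof -
  show "\<pi> \<circ> \<rho> \<in> C" if "\<pi> \<in> C" "\<rho> \<in> C"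
  proof -
    have P: "\<pi> permutes {..<N}" "\<rho> permutes {..<N}" and e: "\<forall>b<N. col (\<pi> b) = col b" "\<forall>b<N. col (\<rho> b) = col b" using that by (auto simp: C_def)
    have "\<forall>b<N. \<rho> b < N" using szpermD(2)[OF C_szperm[OF that(2)]] by blast
    then show ?thesis using permutes_compose[OF P(2,1)] e by (simp add: C_def)
  qed
  show "id \<in> C" by (simp add: C_def permutes_id)
  assume pi: "\<pi> \<in> C"
  then have P: "\<pi> permutes {..<N}" by (simp add: C_def)
  have "col (pinv \<pi> b) = col b" if b: "b < N" for b
  proof -
    have "pinv \<pi> b < N" using permutes_in_image[OF permutes_inv[OF P], of b] b by simp
    then have "col (\<pi> (pinv \<pi> b)) = col (pinv \<pi> b)" using pi by (simp add: C_def)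
    then show ?thesis using permutes_inverses(1)[OF P] by simp
  qed
  then show "pinv \<pi> \<in> C" using permutes_inv[OF P] by (simp add: C_def)
qed

lemma hat_blk:
  assumes pi: "\<pi> \<in> szperm" and x: "x \<in> {1..n}"
  shows "hat \<pi> x \<in> {1..n}" "blk (hat \<pi> x) = \<pi> (blk x)" "pos (hat \<pi> x) = pos x"
proof -
  note b = szpermD(2)[OF pi blk_less[OF x]] 
  have i: "pos x < sz (\<pi> (blk x))" using szpermD(3)[OF pi blk_less[OF x]] pos_less[OF x] by simp
  have h: "hat \<pi> x = pt (\<pi> (blk x)) (pos x)" using x by (simp add: hat_def del: atLeastAtMost_iff)
  show "hat \<pi> x \<in> {1..n}" "blk (hat \<pi> x) = \<pi> (blk x)" "pos (hat \<pi> x) = pos x" unfolding h by (rule pt_mem[OF b i], rule blk_pt[OF b i], rule pos_pt[OF b i])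
qed

lemma hat_comp: "\<pi> \<in> szperm \<Longrightarrow> \<rho> \<in> szperm \<Longrightarrow> hat (\<pi> \<circ> \<rho>) = hat \<pi> \<circ> hat \<rho>"
proof
  fix x assume pi: "\<pi> \<in> szperm" "\<rho> \<in> szperm"
  show "hat (\<pi> \<circ> \<rho>) x = (hat \<pi> \<circ> hat \<rho>) x"
  proof (cases "x \<in> {1..n}")
    case True
    have "hat \<pi> (hat \<rho> x) = pt (\<pi> (blk (hat \<rho> x))) (pos (hat \<rho> x))" using hat_blk(1)[OF pi(2) True] by (simp add: hat_def[of \<pi>] del: atLeastAtMost_iff)
    then show ?thesis using True hat_blk(2,3)[OF pi(2) True] by (simp add: hat_def[of "\<pi> \<circ> \<rho>"] del: atLeastAtMost_iff)
  qed (simp add: hat_def del: atLeastAtMost_iff)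
qed

lemma hat_id: "hat id = id"
  unfolding hat_def using pt_blk by (intro ext) (simp del: atLeastAtMost_iff)

lemma hat_Sym: assumes pi: "\<pi> \<in> szperm" shows "hat \<pi> \<in> Sym n"
proof -
  let ?r = "pinv \<pi>"
  note P = szpermD(1)[OF pi]
  have "hat \<pi> \<circ> hat ?r = id" "hat ?r \<circ> hat \<pi> = id"
    unfolding hat_comp[OF pi szperm_closed(2)[OF pi], symmetric] hat_comp[OF szperm_closed(2)[OF pi] pi, symmetric]
    using permutes_inv_o[OF P] hat_id by simp_all
  then have "bij (hat \<pi>)" by (metis o_bij)
  moreover have "\<forall>x. x \<notin> {1..n} \<longrightarrow> hat \<pi> x = x" by (simp add: hat_def del: atLeastAtMost_iff)
  ultimately show ?thesis unfolding Sym_def permutes_def bij_iff by blast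
qed

lemma hat_act: assumes pi: "\<pi> \<in> szperm" and t: "\<And>b. b < N \<Longrightarrow> t b < 2 * n"
  shows "act (hat \<pi>) (W t) = W (t \<circ> pinv \<pi>)"
proof (rule act_eqI[OF hat_Sym[OF pi] W_words[OF t] W_words])
  note P = szpermD(1)[OF pi]
  show "(t \<circ> pinv \<pi>) b < 2 * n" if "b < N" for b using t szpermD(2)[OF szperm_closed(2)[OF pi] that] by simp
  fix x assume x: "x \<in> {1..n}"
  show "W (t \<circ> pinv \<pi>) (hat \<pi> x) = W t x"
    using hat_blk(1,2)[OF pi x] x permutes_inverses(2)[OF P] by (simp add: W_def del: atLeastAtMost_iff)
qed

lemma fil_less: "T \<in> words n \<Longrightarrow> b < N \<Longrightarrow> fil T b < 2 * n"
  unfolding fil_def by (rule words_lt) (simp_all only: pt_mem sz_pos)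

lemma hat_BC: assumes pi: "\<pi> \<in> szperm" and T: "T \<in> BC c" shows "act (hat \<pi>) T \<in> BC c" "b < N \<Longrightarrow> fil (act (hat \<pi>) T) b = fil T (pinv \<pi> b)"
proof -
  have eq: "act (hat \<pi>) T = W (fil T \<circ> pinv \<pi>)"
    using hat_act[OF pi, of "fil T"] W_fil[OF BCD(3,2)[OF T]] fil_less[OF BCD(3)[OF T]] by simp
  then show "act (hat \<pi>) T \<in> BC c" unfolding BC_def using act_wcont[OF hat_Sym[OF pi] BCD(1)[OF T]] con_W by simp
  show "b < N \<Longrightarrow> fil (act (hat \<pi>) T) b = fil T (pinv \<pi> b)" unfolding eq by (simp add: fil_W)
qed

lemma chi_cases: "chi \<pi> = 1 \<or> chi \<pi> = - 1" unfolding chi_def by (rule osgn_cases)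

lemma chi_comp: assumes "\<pi> \<in> C" "\<rho> \<in> C" shows "chi (\<pi> \<circ> \<rho>) = chi \<pi> * chi \<rho>"
proof -
  have P: "\<pi> permutes {..<N}" "\<rho> permutes {..<N}" using assms by (auto simp: C_def)
  have mem: "\<rho> b \<in> ev \<longleftrightarrow> b \<in> ev" if b: "b < N" for b
    using col_par[of "\<rho> b" b] b szpermD(2)[OF C_szperm[OF assms(2)] b] assms(2) unfolding ev_def C_def by auto
  have "\<rho> ` ev = ev"
  proof
    show "\<rho> ` ev \<subseteq> ev" using mem by (auto simp: ev_def)
    show "ev \<subseteq> \<rho> ` ev"
    proof
      fix b assume b: "b \<in> ev"
      let ?a = "pinv \<rho> b"
      have "?a < N" using szpermD(2)[OF szperm_closed(2)[OF C_szperm[OF assms(2)]]] b by (simp add: ev_def)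
      moreover have "\<rho> ?a = b" using permutes_inverses(1)[OF P(2)] .
      ultimately show "b \<in> \<rho> ` ev" using mem[of ?a] b by (metis image_eqI)
    qed
  qed
  then show ?thesis unfolding chi_def using osgn_comp[of \<rho> ev \<pi>] permutes_inj_on[OF P(1)] permutes_inj_on[OF P(2)] by simp
qed

lemma transpose_C: assumes "b < N" "b' < N" "col b = col b'" shows "swp b b' \<in> C"
proof -
  have "swp b b' permutes {..<N}" using assms(1,2) by (intro permutes_swap_id) auto
  moreover have "col (swp b b' a) = col a" for a using assms(3) by (simp add: Transposition.transpose_def)
  ultimately show ?thesis unfolding C_def by simp
qed

text \<open>The functions on block-constant words that transform like column antisymmetrisers. A transposition of
  two equal letters in one column forces such a function to vanish, which bounds the content of its support.\<close>
definition semi :: "(nat \<Rightarrow> nat) \<Rightarrow> ((nat \<Rightarrow> nat) \<Rightarrow> 'a) \<Rightarrow> bool" where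
  "semi c w \<longleftrightarrow> (\<forall>\<pi>\<in>C. \<forall>T\<in>BC c. w (act (hat \<pi>) T) = of_int (chi \<pi> * eps n (hat \<pi>) T) * w T) \<and>
     (\<forall>T\<in>BC c. w T \<noteq> 0 \<longrightarrow> (\<forall>b<N. 1 < sz b \<longrightarrow> (n \<le> fil T b \<longleftrightarrow> n \<le> t0 b)))"

lemma W_at_pt: "con T \<Longrightarrow> b < N \<Longrightarrow> i < sz b \<Longrightarrow> T (pt b i) = fil T b"
proof -
  assume T: "con T" and b: "b < N" "i < sz b"
  have b0: "0 < sz b" by (rule sz_pos[OF b(1)])
  have "blk (pt b i) = blk (pt b 0)" using blk_pt[OF b] blk_pt[OF b(1) b0] by simp
  then show "T (pt b i) = fil T b" unfolding fil_def using T pt_mem[OF b] pt_mem[OF b(1) b0] unfolding con_def by blast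
qed

end

lemma hom_kmat:
  assumes A: "(A :: 'a::field mat) \<in> rep_hom (Sym n) (mono_rep n c) (mono_rep n c')"
  obtains K where "A = kmat n c' c K" "kinv n c' c K"
proof -
  have "dim_row A = card (wcont n c')" "dim_col A = card (wcont n c)" using rep_homD[OF A] by auto
  then obtain K where K: "A = kmat n c' c K" by (rule kmat_surj)
  then have "kinv n c' c K" using A kmat_hom_iff by metis
  then show ?thesis using K that by blast
qed

context block_system begin

text \<open>\<open>h k\<close> exchanges the first \<open>k\<close> points of the two blocks and is
  a product of \<open>k\<close> transpositions of odd positions with equal letters, each of sign -1.
  The full exchange needs \<open>sz b\<close> of them, an odd number.\<close>

lemma hat_transpose_eps_odd:
  assumes b: "b < N" "b' < N" "b \<noteq> b'" "sz b = sz b'" and T: "T \<in> words n" "con T" and eq: "fil T b = fil T b'" and big: "n \<le> fil T b"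
  shows "eps n (hat (swp b b')) T = - 1"
proof -
  let ?t = "swp b b'"
  define h where "h k = (\<lambda>x. if x \<in> {1..n} \<and> pos x < k then hat ?t x else x)" for k
  have tp: "?t permutes {..<N}" using b(1,2) by (intro permutes_swap_id) auto
  have t: "?t \<in> szperm"
    unfolding szperm_def using tp b(4) by (simp add: Transposition.transpose_def)
  have fixd: "hat ?t x = x" if "x \<in> {1..n}" "blk x \<noteq> b" "blk x \<noteq> b'" for x
    using that pt_blk[OF that(1)] by (simp add: hat_def Transposition.transpose_def del: atLeastAtMost_iff)
  have step: "h (Suc k) = swp (pt b k) (pt b' k) \<circ> h k" if k: "k < sz b" for k
  proof
    fix x
    have k': "k < sz b'" using k b(4) by simp
    show "h (Suc k) x = (swp (pt b k) (pt b' k) \<circ> h k) x"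
    proof (cases "x \<in> {1..n}")
      case False
      then have "x \<noteq> pt b k" "x \<noteq> pt b' k" using pt_mem[OF b(1) k] pt_mem[OF b(2) k'] by blast+
      then show ?thesis using False by (simp add: h_def del: atLeastAtMost_iff)
    next
      case True
      consider "pos x < k" | "pos x = k" | "k < pos x" by linarith
      then show ?thesis
      proof cases
        case 1
        have "pos (hat ?t x) < k" using 1 hat_blk(3)[OF t True] by simp
        then have "hat ?t x \<noteq> pt b k" "hat ?t x \<noteq> pt b' k" using pos_pt[OF b(1) k] pos_pt[OF b(2) k'] by auto
        then show ?thesis using True 1 by (simp add: h_def del: atLeastAtMost_iff)
      next
        case 2
        have hx: "h k x = x" "h (Suc k) x = hat ?t x" using True 2 by (simp_all add: h_def del: atLeastAtMost_iff)
        have ht: "hat ?t x = pt (?t (blk x)) k" using True 2 by (simp add: hat_def del: atLeastAtMost_iff)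
        have x: "x = pt (blk x) k" using pt_blk[OF True] 2 by simp
        show ?thesis
        proof (cases "blk x = b \<or> blk x = b'")
          case True
          then show ?thesis
          proof
            assume e: "blk x = b"
            then have "x = pt b k" using x by simp
            then show ?thesis using hx ht e by simp
          next
            assume e: "blk x = b'"
            then have "x = pt b' k" using x by simp
            then show ?thesis using hx ht e by simp
          qed
        next
          case False
          then have "x \<noteq> pt b k" "x \<noteq> pt b' k" using blk_pt[OF b(1) k] blk_pt[OF b(2) k'] by auto
          then show ?thesis using fixd[OF True] False hx by simp
        qed
      next
        case 3
        then have "x \<noteq> pt b k" "x \<noteq> pt b' k" using pos_pt[OF b(1) k] pos_pt[OF b(2) k'] by auto
        then show ?thesis using 3 by (simp add: h_def del: atLeastAtMost_iff)
      qed
    qed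
  qed
  have ind: "h k \<in> Sym n \<and> act (h k) T = T \<and> eps n (h k) T = (- 1) ^ k" if "k \<le> sz b" for k
    using that
  proof (induct k)
    case 0
    have "h 0 = id" by (rule ext) (simp add: h_def)
    then show ?case using Sym_closed(3)[of n] act_id[of T] eps_id[of n T] by (simp only: power_0 simp_thms)
  next
    case (Suc k)
    then have k: "k < sz b" "k < sz b'" using b(4) by auto
    let ?s = "swp (pt b k) (pt b' k)"
    have IH: "h k \<in> Sym n" "act (h k) T = T" "eps n (h k) T = (- 1) ^ k" using Suc by auto
    have m: "pt b k \<in> {1..n}" "pt b' k \<in> {1..n}" by (rule pt_mem[OF b(1) k(1)], rule pt_mem[OF b(2) k(2)])
    have e: "T (pt b k) = T (pt b' k)" using W_at_pt[OF T(2) b(1) k(1)] W_at_pt[OF T(2) b(2) k(2)] eq by simp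
    have ne: "pt b k \<noteq> pt b' k" using blk_pt[OF b(1) k(1)] blk_pt[OF b(2) k(2)] b(3) by auto
    have s: "?s \<in> Sym n" "act ?s T = T" using act_transpose[OF m e] by auto
    have se: "eps n ?s T = - 1" using eps_transpose[OF m e ne] W_at_pt[OF T(2) b(1) k(1)] big by simp
    have "act (?s \<circ> h k) T = T" unfolding act_comp[OF s(1) IH(1)] IH(2) by (rule s(2))
    moreover have "eps n (?s \<circ> h k) T = (- 1) ^ Suc k" unfolding eps_comp[OF s(1) IH(1), of T] IH(2,3) se by simp
    ultimately show ?case unfolding step[OF k(1)] using Sym_closed(1)[OF s(1) IH(1)] by blast
  qed
  have "h (sz b) = hat ?t"
  proof
    fix x show "h (sz b) x = hat ?t x"
    proof (cases "x \<in> {1..n}")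
      case True
      show ?thesis
      proof (cases "blk x = b \<or> blk x = b'")
        case False
        then have "hat ?t x = x" using fixd[OF True] by blast
        then show ?thesis by (simp only: h_def if_cancel)
      next
        case b: True
        then have "pos x < sz b" using pos_less[OF True] \<open>sz b = sz b'\<close> by auto
        then show ?thesis using True by (simp only: h_def simp_thms if_True)
      qed
    qed (simp add: h_def hat_def del: atLeastAtMost_iff)
  qed
  then show ?thesis using ind[of "sz b"] sz_odd[OF b(1)] by simp
qed

text \<open>Every odd position lies outside the two blocks and is left in place.\<close>

lemma hat_transpose_eps_even:
  assumes T: "T \<in> words n" "con T" and b: "b < N" "b' < N" and small: "fil T b < n" "fil T b' < n"
  shows "eps n (hat (swp b b')) T = 1"
  unfolding eps_def
proof (rule osgn_id)
  fix x assume "x \<in> odds n T"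
  then have x: "x \<in> {1..n}" "n \<le> T x" by (auto simp: odds_def)
  have "T x = fil T (blk x)" using W_at_pt[OF T(2) blk_less[OF x(1)] pos_less[OF x(1)]] pt_blk[OF x(1)] by simp
  then have "blk x \<noteq> b" "blk x \<noteq> b'" using small x(2) by auto
  then show "hat (swp b b') x = x" using x(1) pt_blk[OF x(1)] by (simp add: hat_def Transposition.transpose_def del: atLeastAtMost_iff)
qed

lemma chi_transpose:
  assumes b: "b < N" "b' < N" "b \<noteq> b'" "col b = col b'"
  shows "chi (swp b b') = (if t0 b < n then - 1 else 1)"
proof (cases "t0 b < n")
  case True
  then have "b \<in> ev" "b' \<in> ev" using b col_par[OF b(1,2,4)] by (auto simp: ev_def)
  moreover have "finite ev" by (simp add: ev_def)
  ultimately show ?thesis unfolding chi_def using osgn_transpose[of ev b b'] b(3) True by simp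
next
  case False
  then have "b \<notin> ev" "b' \<notin> ev" using b col_par[OF b(1,2,4)] by (auto simp: ev_def)
  then have "chi (swp b b') = 1" unfolding chi_def by (intro osgn_id) (auto simp: Transposition.transpose_def)
  then show ?thesis using False by simp
qed

lemma hat_transpose_act:
  assumes b: "b < N" "b' < N" "sz b = sz b'" and T: "T \<in> words n" "con T" and eq: "fil T b = fil T b'"
  shows "act (hat (swp b b')) T = T"
proof -
  let ?t = "swp b b'"
  have tp: "?t permutes {..<N}" using b(1,2) by (intro permutes_swap_id) auto
  have t: "?t \<in> szperm" unfolding szperm_def using tp b(3) by (simp add: Transposition.transpose_def)
  have Tw: "T = W (fil T)" by (rule W_fil[OF T])
  have "pinv ?t = ?t" by (rule inv_unique_comp) simp_all
  then have "act (hat ?t) (W (fil T)) = W (fil T \<circ> ?t)" using hat_act[OF t fil_less[OF T(1)]] by simp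
  also have "\<dots> = W (fil T)" unfolding W_eq_iff using eq by (simp add: Transposition.transpose_def)
  finally show ?thesis using Tw by simp
qed

lemma semi_injective:
  assumes w: "semi c w" and T: "T \<in> BC c" and nz: "w T \<noteq> 0" and b: "b < N" "b' < N" "b \<noteq> b'" "col b = col b'"
    and eq: "fil T b = fil T b'" and par: "n \<le> fil T b \<longleftrightarrow> n \<le> t0 b"
  shows False
proof -
  let ?t = "swp b b'"
  note Tw = BCD(3,2)[OF T]
  note s = col_sz[OF b(1,2,4)]
  have "w (act (hat ?t) T) = of_int (chi ?t * eps n (hat ?t) T) * w T"
    using w T transpose_C[OF b(1,2,4)] unfolding semi_def by blast
  moreover have "act (hat ?t) T = T" by (rule hat_transpose_act[OF b(1,2) s Tw eq])
  moreover have "chi ?t * eps n (hat ?t) T = - 1"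
  proof (cases "t0 b < n")
    case True
    then have "eps n (hat ?t) T = 1" using hat_transpose_eps_even[OF Tw b(1,2)] eq par by simp
    then show ?thesis using chi_transpose[OF b] True by simp
  next
    case False
    then have "eps n (hat ?t) T = - 1" using hat_transpose_eps_odd[OF b(1,2,3) s Tw eq] par by simp
    then show ?thesis using chi_transpose[OF b] False by simp
  qed
  ultimately have "w T = - w T" by simp
  then have "w T + w T = 0" unfolding eq_neg_iff_add_eq_0 .
  then have "2 * w T = 0" by (simp only: mult_2)
  then show False using two nz by simp
qed

section \<open>Columns and the support of antisymmetric functions\<close>

definition colm :: "'c \<Rightarrow> nat set" where "colm y = {b. b < N \<and> col b = y}"

lemma finite_colm: "finite (colm y)" by (simp add: colm_def)

text \<open>The bound is trivial when \<open>t0\<close> is below \<open>k\<close> on the whole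
  column. Otherwise the letters below \<open>k\<close> in the column are distinct by
  \<open>semi_injective\<close>, and each of them also occurs as a letter of \<open>t0\<close> there
  by \<open>col_down\<close>. In an odd column \<open>odd_big\<close> and \<open>semi\<close> keep
  all letters odd; in an even one \<open>k \<le> n\<close> makes the letters below \<open>k\<close>
  even.\<close>

lemma semi_column_le:
  assumes w: "semi c w" and T: "T \<in> BC c" and nz: "w T \<noteq> 0"
  shows "card {b\<in>colm y. fil T b < k} \<le> card {b\<in>colm y. t0 b < k}"
proof (cases "{b\<in>colm y. fil T b < k} = {}")
  case True then show ?thesis unfolding True by simp
next
  case False
  then obtain a where a: "a < N" "col a = y" "fil T a < k" by (auto simp: colm_def)
  define base where "base = (if n \<le> t0 a then n else 0)"
  have parity: "n \<le> t0 b \<longleftrightarrow> n \<le> t0 a" if "b \<in> colm y" for b using that a col_par[of b a] by (auto simp: colm_def)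
  have odd_par: "n \<le> fil T b" if "b \<in> colm y" "n \<le> t0 a" for b
    using w T nz that parity[OF that(1)] odd_big[of b] unfolding semi_def colm_def by auto
  show ?thesis
  proof (cases "\<forall>b\<in>colm y. t0 b < k")
    case True
    then have "{b\<in>colm y. t0 b < k} = colm y" by blast
    then show ?thesis using card_mono[OF finite_colm, of "{b\<in>colm y. fil T b < k}" y] by auto
  next
    case False
    then obtain b1 where b1: "b1 \<in> colm y" "k \<le> t0 b1" by auto
    have kb: "k \<le> n" if "t0 a < n" using that parity[OF b1(1)] b1(2) by simp
    have inj: "inj_on (fil T) {b\<in>colm y. fil T b < k}"
    proof (rule inj_onI, rule ccontr)
      fix b b' assume A: "b \<in> {b\<in>colm y. fil T b < k}" "b' \<in> {b\<in>colm y. fil T b < k}" "fil T b = fil T b'" "b \<noteq> b'"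
      have "n \<le> fil T b \<longleftrightarrow> n \<le> t0 b"
      proof (cases "n \<le> t0 a")
        case True
        then show ?thesis using A(1) odd_par[of b] parity[of b] by auto
      next
        case False
        then have "fil T b < n" "t0 b < n" using A(1) kb parity[of b] by auto
        then show ?thesis by simp
      qed
      then show False using semi_injective[OF w T nz, of b b'] A by (auto simp: colm_def)
    qed
    have "fil T ` {b\<in>colm y. fil T b < k} \<subseteq> t0 ` {b\<in>colm y. t0 b < k}"
    proof
      fix j assume "j \<in> fil T ` {b\<in>colm y. fil T b < k}"
      then obtain b where b: "b \<in> colm y" "fil T b < k" "j = fil T b" by auto
      have "n \<le> j \<longleftrightarrow> n \<le> t0 b1"
      proof (cases "n \<le> t0 a")
        case True then show ?thesis using odd_par[OF b(1)] parity[OF b1(1)] b(3) by simp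
      next
        case False
        then have "j < n" "t0 b1 < n" using kb b parity[OF b1(1)] by auto
        then show ?thesis by simp
      qed
      moreover have "j \<le> t0 b1" using b b1(2) by simp
      ultimately obtain b2 where "b2 < N" "col b2 = col b1" "t0 b2 = j" using col_down[of b1 j] b1(1) unfolding colm_def by blast
      then show "j \<in> t0 ` {b\<in>colm y. t0 b < k}" using b b1(1) by (intro image_eqI[of _ _ b2]) (auto simp: colm_def)
    qed
    then have "card (fil T ` {b\<in>colm y. fil T b < k}) \<le> card (t0 ` {b\<in>colm y. t0 b < k})" by (intro card_mono) (simp_all add: finite_colm)
    also have "\<dots> \<le> card {b\<in>colm y. t0 b < k}" by (intro card_image_le) (simp add: finite_colm)
    finally show ?thesis using card_image[OF inj] by simp
  qed
qed

lemma psum_BC: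
  assumes T: "T \<in> BC c" and k: "k \<le> 2 * n"
  shows "psum c k = (\<Sum>b\<in>{b. b < N \<and> fil T b < k}. sz b)"
proof -
  have fin: "finite {b. b < N \<and> fil T b < k}" by simp
  have "{x\<in>{1..n}. T x < k} = (\<Union>b\<in>{b. b < N \<and> fil T b < k}. pt b ` {..<sz b})"
  proof (intro Set.set_eqI iffI)
    fix x assume "x \<in> {x\<in>{1..n}. T x < k}"
    then have x: "x \<in> {1..n}" "T x < k" by auto
    have "T x = fil T (blk x)" using W_at_pt[OF BCD(2)[OF T] blk_less[OF x(1)] pos_less[OF x(1)]] pt_blk[OF x(1)] by simp
    then have "blk x \<in> {b. b < N \<and> fil T b < k}" using x blk_less by auto
    moreover have "x \<in> pt (blk x) ` {..<sz (blk x)}" using pt_blk[OF x(1)] pos_less[OF x(1)] by (metis imageI lessThan_iff)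
    ultimately show "x \<in> (\<Union>b\<in>{b. b < N \<and> fil T b < k}. pt b ` {..<sz b})" by blast
  next
    fix x assume "x \<in> (\<Union>b\<in>{b. b < N \<and> fil T b < k}. pt b ` {..<sz b})"
    then obtain b i where b: "b < N" "fil T b < k" "i < sz b" "x = pt b i" by blast
    then show "x \<in> {x\<in>{1..n}. T x < k}" using pt_mem[OF b(1,3)] W_at_pt[OF BCD(2)[OF T] b(1,3)] by simp
  qed
  then have "psum c k = card (\<Union>b\<in>{b. b < N \<and> fil T b < k}. pt b ` {..<sz b})" using psum_card[OF BCD(1)[OF T] k] by simp
  also have "\<dots> = (\<Sum>b\<in>{b. b < N \<and> fil T b < k}. card (pt b ` {..<sz b}))"
  proof (rule card_UN_disjoint[OF fin])
    show "\<forall>i\<in>{b. b < N \<and> fil T b < k}. \<forall>j\<in>{b. b < N \<and> fil T b < k}. i \<noteq> j \<longrightarrow> pt i ` {..<sz i} \<inter> pt j ` {..<sz j} = {}"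
    proof (intro ballI impI, rule ccontr)
      fix i j assume ij: "i \<in> {b. b < N \<and> fil T b < k}" "j \<in> {b. b < N \<and> fil T b < k}" "i \<noteq> j" and "pt i ` {..<sz i} \<inter> pt j ` {..<sz j} \<noteq> {}"
      then obtain a b where "a < sz i" "b < sz j" "pt i a = pt j b" by blast
      then show False using blk_pt[of i a] blk_pt[of j b] ij by simp
    qed
  qed simp
  also have "\<dots> = (\<Sum>b\<in>{b. b < N \<and> fil T b < k}. sz b)"
  proof (rule sum.cong[OF refl])
    fix b assume "b \<in> {b. b < N \<and> fil T b < k}"
    then have "b < N" by simp
    then have "inj_on (pt b) {..<sz b}" by (intro inj_on_inverseI[where g=pos]) (simp add: pos_pt)
    then show "card (pt b ` {..<sz b}) = sz b" by (simp add: card_image)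
  qed
  finally show ?thesis .
qed

text \<open>The common size of the blocks in a column; the value 1 for an empty column keeps the
  weight positive without a case distinction.\<close>

definition csz :: "'c \<Rightarrow> nat" where "csz y = (if colm y = {} then 1 else sz (SOME b. b \<in> colm y))"

lemma csz: "b \<in> colm y \<Longrightarrow> csz y = sz b"
proof -
  assume b: "b \<in> colm y"
  then have "(SOME b. b \<in> colm y) \<in> colm y" by (rule someI)
  then show ?thesis using b col_sz[of "SOME b. b \<in> colm y" b] by (auto simp: csz_def colm_def)
qed

lemma csz_pos: "0 < csz y"
proof (cases "colm y = {}")
  case False
  then obtain b where "b \<in> colm y" by blast
  then show ?thesis using csz sz_pos by (auto simp: colm_def)
qed (simp add: csz_def)

lemma sum_columns: "(\<Sum>b\<in>{b. b < N \<and> P b}. sz b) = (\<Sum>y\<in>col ` {..<N}. csz y * card {b\<in>colm y. P b})"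
proof -
  have "(\<Sum>b\<in>{b. b < N \<and> P b}. sz b) = (\<Sum>y\<in>col ` {..<N}. \<Sum>b\<in>{b\<in>{b. b < N \<and> P b}. col b = y}. sz b)"
    by (rule sum.group[symmetric]) auto
  also have "\<dots> = (\<Sum>y\<in>col ` {..<N}. csz y * card {b\<in>colm y. P b})"
  proof (rule sum.cong[OF refl])
    fix y
    have "{b\<in>{b. b < N \<and> P b}. col b = y} = {b\<in>colm y. P b}" by (auto simp: colm_def)
    moreover have "(\<Sum>b\<in>{b\<in>colm y. P b}. sz b) = (\<Sum>b\<in>{b\<in>colm y. P b}. csz y)" by (rule sum.cong) (auto simp: csz)
    ultimately show "(\<Sum>b\<in>{b\<in>{b. b < N \<and> P b}. col b = y}. sz b) = csz y * card {b\<in>colm y. P b}" by simp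
  qed
  finally show ?thesis .
qed

lemma fil_T0: "b < N \<Longrightarrow> fil T0 b = t0 b" unfolding T0_def by (rule fil_W)

lemma psum_c0: "k \<le> 2 * n \<Longrightarrow> psum c0 k = (\<Sum>b\<in>{b. b < N \<and> t0 b < k}. sz b)"
proof -
  assume k: "k \<le> 2 * n"
  have "{b. b < N \<and> fil T0 b < k} = {b. b < N \<and> t0 b < k}" using fil_T0 by auto
  then show ?thesis using psum_BC[OF T0_BC k] by simp
qed

lemma semi_psum_le:
  assumes "semi c w" "T \<in> BC c" "w T \<noteq> 0" "k \<le> 2 * n"
  shows "psum c k \<le> psum c0 k"
  unfolding psum_BC[OF assms(2,4)] psum_c0[OF assms(4)] sum_columns
  by (rule sum_mono) (use semi_column_le[OF assms(1,2,3)] in simp)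

text \<open>The reason why \<open>phi\<close> vanishes on \<open>J\<close>: a homomorphism to a
  larger content sends the eigenvector to a function with this symmetry, which has no word left to
  live on.\<close>

lemma semi_above_zero: "semi c w \<Longrightarrow> above n c0 c \<Longrightarrow> T \<in> BC c \<Longrightarrow> w T = 0"
  using semi_psum_le unfolding above_def by (meson leD)

text \<open>For the content \<open>c0\<close> the weighted column bounds add up to an equality, and
  the weights are positive.\<close>

lemma semi_c0_column:
  assumes w: "semi c0 w" and T: "T \<in> BC c0" and nz: "w T \<noteq> 0" and k: "k \<le> 2 * n"
  shows "card {b\<in>colm y. fil T b < k} = card {b\<in>colm y. t0 b < k}"
proof (cases "y \<in> col ` {..<N}")
  case True
  have "(\<Sum>y\<in>col ` {..<N}. csz y * card {b\<in>colm y. fil T b < k}) = (\<Sum>y\<in>col ` {..<N}. csz y * card {b\<in>colm y. t0 b < k})"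
    using psum_BC[OF T k] psum_c0[OF k] by (simp only: sum_columns)
  then have "csz y * card {b\<in>colm y. fil T b < k} = csz y * card {b\<in>colm y. t0 b < k}"
    by (rule sum_mono_inv) (use semi_column_le[OF w T nz] True in auto)
  then show ?thesis using csz_pos[of y] by simp
next
  case False
  then have "colm y = {}" by (auto simp: colm_def)
  then show ?thesis by simp
qed

text \<open>Each column carries the letters of \<open>t0\<close> with the same multiplicities, so a
  permutation within the columns turns one filling into the other.\<close>

lemma semi_c0_orbit:
  assumes w: "semi c0 w" and T: "T \<in> BC c0" and nz: "w T \<noteq> 0"
  shows "\<exists>\<sigma>\<in>C. T = act (hat \<sigma>) T0"
proof -
  have lev: "card {b\<in>colm y. fil T b = j} = card {b\<in>colm y. t0 b = j}" for y j
  proof (cases "j < 2 * n")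
    case True
    have e: "card {b\<in>colm y. f b = j} = card {b\<in>colm y. f b < Suc j} - card {b\<in>colm y. f b < j}" for f :: "nat \<Rightarrow> nat"
    proof -
      have "{b\<in>colm y. f b = j} = {b\<in>colm y. f b < Suc j} - {b\<in>colm y. f b < j}" by auto
      moreover have "card \<dots> = card {b\<in>colm y. f b < Suc j} - card {b\<in>colm y. f b < j}" by (rule card_Diff_subset) (auto simp: finite_colm)
      ultimately show ?thesis by simp
    qed
    show ?thesis unfolding e using semi_c0_column[OF w T nz, of "Suc j" y] semi_c0_column[OF w T nz, of j y] True by simp
  next
    case False
    have e: "{b\<in>colm y. fil T b = j} = {}" "{b\<in>colm y. t0 b = j} = {}" using False fil_less[OF BCD(3)[OF T]] t0_less unfolding colm_def by fastforce+
    show ?thesis unfolding e ..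
  qed
  have "\<exists>g. g permutes {..<N} \<and> (\<forall>b\<in>{..<N}. (col (g b), fil T (g b)) = (col b, t0 b))"
  proof (rule permutes_of_cards[where f="\<lambda>b. (col b, fil T b)" and f'="\<lambda>b. (col b, t0 b)"])
    fix z :: "'c \<times> nat"
    have "{b\<in>{..<N}. (col b, f b) = z} = {b\<in>colm (fst z). f b = snd z}" for f :: "nat \<Rightarrow> nat" by (auto simp: colm_def)
    then show "card {b\<in>{..<N}. (col b, fil T b) = z} = card {b\<in>{..<N}. (col b, t0 b) = z}" by (simp only: lev)
  qed simp
  then obtain g where g: "g permutes {..<N}" "\<forall>b<N. col (g b) = col b \<and> fil T (g b) = t0 b" by auto
  have gC: "g \<in> C" using g by (simp add: C_def)
  have "T = W (fil T)" by (rule W_fil[OF BCD(3,2)[OF T]])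
  also have "\<dots> = W (t0 \<circ> pinv g)"
    unfolding W_eq_iff
  proof (intro allI impI)
    fix b assume b: "b < N"
    let ?a = "pinv g b"
    have "?a < N" using szpermD(2)[OF szperm_closed(2)[OF C_szperm[OF gC]] b] .
    then have "fil T (g ?a) = t0 ?a" using g(2) by blast
    then show "fil T b = (t0 \<circ> pinv g) b" using permutes_inverses(1)[OF g(1)] by simp
  qed
  also have "\<dots> = act (hat g) T0" unfolding T0_def by (rule hat_act[OF C_szperm[OF gC] t0_less, symmetric])
  finally show ?thesis using gC by blast
qed

lemma C_orbit_unique:
  assumes s: "\<sigma> \<in> C" "\<sigma>' \<in> C" and eq: "act (hat \<sigma>) T0 = act (hat \<sigma>') T0"
  shows "\<sigma> = \<sigma>'"
proof -
  have P: "\<sigma> permutes {..<N}" "\<sigma>' permutes {..<N}" using s by (auto simp: C_def)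
  have "W (t0 \<circ> pinv \<sigma>) = W (t0 \<circ> pinv \<sigma>')"
    using eq hat_act[OF C_szperm[OF s(1)], of t0] hat_act[OF C_szperm[OF s(2)], of t0] t0_less unfolding T0_def by simp
  then have e: "\<forall>b<N. t0 (pinv \<sigma> b) = t0 (pinv \<sigma>' b)" by (simp add: W_eq_iff)
  have "pinv \<sigma> b = pinv \<sigma>' b" for b
  proof (cases "b < N")
    case True
    have a: "pinv \<sigma> b < N" "pinv \<sigma>' b < N" using szpermD(2)[OF C_szperm[OF C_closed(2)] True] s by auto
    have "col (pinv \<sigma> b) = col b" "col (pinv \<sigma>' b) = col b" using C_closed(2)[OF s(1)] C_closed(2)[OF s(2)] True by (auto simp: C_def)
    then show ?thesis using col_inj[OF a] e True by simp
  next
    case False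
    then show ?thesis using permutes_not_in[OF permutes_inv[OF P(1)], of b] permutes_not_in[OF permutes_inv[OF P(2)], of b] by simp
  qed
  then have "pinv \<sigma> = pinv \<sigma>'" by blast
  then show ?thesis using permutes_inv_inv[OF P(1)] permutes_inv_inv[OF P(2)] by metis
qed

text \<open>The signed sum of the words \<open>act (hat \<sigma>) T0\<close> over the column
  permutations \<open>\<sigma>\<close>, an analogue of a polytabloid. By
  \<open>C_orbit_unique\<close> the permutation in the \<open>SOME\<close> is the only one.\<close>

definition v :: "(nat \<Rightarrow> nat) \<Rightarrow> 'a" where
  "v T = (if \<exists>\<sigma>\<in>C. T = act (hat \<sigma>) T0 then
     (let \<sigma> = (SOME \<sigma>. \<sigma> \<in> C \<and> T = act (hat \<sigma>) T0) in of_int (chi \<sigma> * eps n (hat \<sigma>) T0)) else 0)"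

lemma v_orbit: assumes s: "\<sigma> \<in> C" shows "v (act (hat \<sigma>) T0) = of_int (chi \<sigma> * eps n (hat \<sigma>) T0)"
proof -
  have "(SOME \<sigma>'. \<sigma>' \<in> C \<and> act (hat \<sigma>) T0 = act (hat \<sigma>') T0) = \<sigma>"
    by (rule some_equality) (use s C_orbit_unique in blast)+
  then show ?thesis unfolding v_def Let_def using s by auto
qed

lemma v_zero: "\<not> (\<exists>\<sigma>\<in>C. T = act (hat \<sigma>) T0) \<Longrightarrow> v T = 0" by (simp add: v_def)

lemma hat_comp_act: "\<pi> \<in> szperm \<Longrightarrow> \<sigma> \<in> szperm \<Longrightarrow> act (hat (\<pi> \<circ> \<sigma>)) T = act (hat \<pi>) (act (hat \<sigma>) T)"
  by (simp only: hat_comp act_comp[OF hat_Sym hat_Sym])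

lemma hat_comp_eps: "\<pi> \<in> szperm \<Longrightarrow> \<sigma> \<in> szperm \<Longrightarrow> eps n (hat (\<pi> \<circ> \<sigma>)) T = eps n (hat \<pi>) (act (hat \<sigma>) T) * eps n (hat \<sigma>) T"
  by (simp only: hat_comp eps_comp[OF hat_Sym hat_Sym])

lemma v_T0: "v T0 = 1"
proof -
  have "chi id = 1" unfolding chi_def by (rule osgn_id) simp
  then show ?thesis using v_orbit[OF C_closed(3)] by (simp add: hat_id)
qed

lemma v_semi: "semi c0 v"
  unfolding semi_def
proof (intro conjI ballI impI allI)
  fix \<pi> T assume pi: "\<pi> \<in> C" and T: "T \<in> BC c0"
  show "v (act (hat \<pi>) T) = of_int (chi \<pi> * eps n (hat \<pi>) T) * v T"
  proof (cases "\<exists>\<sigma>\<in>C. T = act (hat \<sigma>) T0")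
    case True
    then obtain \<sigma> where s: "\<sigma> \<in> C" "T = act (hat \<sigma>) T0" by blast
    note z = C_szperm[OF pi] C_szperm[OF s(1)]
    have "v (act (hat \<pi>) T) = v (act (hat (\<pi> \<circ> \<sigma>)) T0)" unfolding s(2) hat_comp_act[OF z] ..
    also have "\<dots> = of_int (chi (\<pi> \<circ> \<sigma>) * eps n (hat (\<pi> \<circ> \<sigma>)) T0)" by (rule v_orbit[OF C_closed(1)[OF pi s(1)]])
    also have "\<dots> = of_int (chi \<pi> * eps n (hat \<pi>) T) * of_int (chi \<sigma> * eps n (hat \<sigma>) T0)"
      unfolding chi_comp[OF pi s(1)] hat_comp_eps[OF z] s(2) by (simp only: of_int_mult ac_simps)
    finally show ?thesis using v_orbit[OF s(1)] s(2) by simp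
  next
    case False
    have "\<not> (\<exists>\<sigma>\<in>C. act (hat \<pi>) T = act (hat \<sigma>) T0)"
    proof
      assume "\<exists>\<sigma>\<in>C. act (hat \<pi>) T = act (hat \<sigma>) T0"
      then obtain \<sigma> where s: "\<sigma> \<in> C" "act (hat \<pi>) T = act (hat \<sigma>) T0" by blast
      let ?i = "pinv \<pi>"
      note i = C_closed(2)[OF pi]
      have "?i \<circ> \<pi> = id" using pi by (intro permutes_inv_o(2)[where S="{..<N}"]) (simp add: C_def)
      then have "T = act (hat (?i \<circ> \<pi>)) T" by (simp add: hat_id)
      also have "\<dots> = act (hat ?i) (act (hat \<sigma>) T0)" unfolding hat_comp_act[OF C_szperm[OF i] C_szperm[OF pi]] s(2) ..
      also have "\<dots> = act (hat (?i \<circ> \<sigma>)) T0" by (rule hat_comp_act[OF C_szperm[OF i] C_szperm[OF s(1)], symmetric])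
      finally show False using False C_closed(1)[OF i s(1)] by blast
    qed
    then show ?thesis using v_zero False by simp
  qed
next
  fix T b assume T: "T \<in> BC c0" "v T \<noteq> 0" and b: "b < N" "1 < sz b"
  then obtain \<sigma> where s: "\<sigma> \<in> C" "T = act (hat \<sigma>) T0" using v_zero by blast
  let ?a = "pinv \<sigma> b"
  have a: "?a < N" using szpermD(2)[OF C_szperm[OF C_closed(2)[OF s(1)]] b(1)] .
  have "fil T b = t0 ?a" unfolding s(2) using hat_BC(2)[OF C_szperm[OF s(1)] T0_BC b(1)] fil_T0[OF a] by simp
  moreover have "col ?a = col b" using C_closed(2)[OF s(1)] b(1) by (simp add: C_def)
  ultimately show "(n \<le> fil T b) = (n \<le> t0 b)" using col_par[OF a b(1)] by simp
qed

section \<open>The eigenvector and its eigenvalue\<close>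

definition app :: "((nat \<Rightarrow> nat) \<Rightarrow> (nat \<Rightarrow> nat) \<Rightarrow> 'a) \<Rightarrow> (nat \<Rightarrow> nat) \<Rightarrow> 'a" where
  "app K T = (\<Sum>S\<in>BC c0. K T S * v S)"

text \<open>The symmetry comes from that of the kernel and of \<open>v\<close>. The parity clause
  holds because two points of one block have the same pair of letters, so \<open>admissible\<close>
  forces equal parities.\<close>

lemma app_semi: assumes K: "kinv n c c0 K" shows "semi c (app K)"
  unfolding semi_def
proof (intro conjI ballI impI allI)
  fix \<pi> T assume pi: "\<pi> \<in> C" and T: "T \<in> BC c"
  note z = C_szperm[OF pi]
  note zi = szperm_closed(2)[OF z]
  have P: "\<pi> permutes {..<N}" by (rule szpermD(1)[OF z])
  let ?i = "pinv \<pi>"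
  have inv: "act (hat ?i) (act (hat \<pi>) S) = S" "act (hat \<pi>) (act (hat ?i) S) = S" for S
    unfolding hat_comp_act[OF zi z, symmetric] hat_comp_act[OF z zi, symmetric] permutes_inv_o[OF P] hat_id by simp_all
  have "app K (act (hat \<pi>) T) = (\<Sum>S\<in>BC c0. K (act (hat \<pi>) T) (act (hat \<pi>) S) * v (act (hat \<pi>) S))"
    unfolding app_def by (rule sum.reindex_bij_witness[where i="act (hat \<pi>)" and j="act (hat ?i)"]) (use inv hat_BC(1)[OF z] hat_BC(1)[OF zi] in auto)
  also have "\<dots> = (\<Sum>S\<in>BC c0. of_int (chi \<pi> * eps n (hat \<pi>) T) * (K T S * v S))"
  proof (rule sum.cong[OF refl])
    fix S assume S: "S \<in> BC c0"
    have k: "K (act (hat \<pi>) T) (act (hat \<pi>) S) = of_int (eps n (hat \<pi>) T * eps n (hat \<pi>) S) * K T S"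
      using K hat_Sym[OF z] BCD(1)[OF T] BCD(1)[OF S] unfolding kinv_def by blast
    have l: "v (act (hat \<pi>) S) = of_int (chi \<pi> * eps n (hat \<pi>) S) * v S" using v_semi pi S unfolding semi_def by blast
    have "K (act (hat \<pi>) T) (act (hat \<pi>) S) * v (act (hat \<pi>) S)
        = (of_int (eps n (hat \<pi>) S) * of_int (eps n (hat \<pi>) S)) * (of_int (chi \<pi> * eps n (hat \<pi>) T) * (K T S * v S))"
      unfolding k l by (simp only: of_int_mult ac_simps)
    then show "K (act (hat \<pi>) T) (act (hat \<pi>) S) * v (act (hat \<pi>) S) = of_int (chi \<pi> * eps n (hat \<pi>) T) * (K T S * v S)"
      by (simp only: eps_square_field mult_1)
  qed
  finally show "app K (act (hat \<pi>) T) = of_int (chi \<pi> * eps n (hat \<pi>) T) * app K T" unfolding app_def sum_distrib_left .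
next
  fix T b assume T: "T \<in> BC c" "app K T \<noteq> 0" and b: "b < N" "1 < sz b"
  then obtain S where S: "S \<in> BC c0" "K T S * v S \<noteq> 0" unfolding app_def by (meson sum.not_neutral_contains_not_neutral)
  have vS: "v S \<noteq> 0" and KS: "K T S \<noteq> 0" using S(2) by auto
  have par: "n \<le> fil S b \<longleftrightarrow> n \<le> t0 b" using v_semi S(1) vS b unfolding semi_def by blast
  have ad: "admissible n T S" using kinv_not_admissible[OF K BCD(1)[OF T(1)] BCD(1)[OF S(1)] _ two] KS by blast
  have b0: "0 < sz b" using b(2) by simp
  have m: "pt b 0 \<in> {1..n}" "pt b 1 \<in> {1..n}" "pt b 0 \<noteq> pt b 1"
    using pt_mem[OF b(1) b0] pt_mem[OF b] pos_pt[OF b(1) b0] pos_pt[OF b] by auto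
  have e: "T (pt b 0) = fil T b" "T (pt b 1) = fil T b" "S (pt b 0) = fil S b" "S (pt b 1) = fil S b"
    using W_at_pt[OF BCD(2)[OF T(1)] b(1)] W_at_pt[OF BCD(2)[OF S(1)] b(1)] b0 b(2) by auto
  have "n \<le> T (pt b 0) \<longleftrightarrow> n \<le> S (pt b 0)" using ad m e unfolding admissible_def by metis
  then show "(n \<le> fil T b) = (n \<le> t0 b)" using par e by simp
qed

text \<open>Functions with this symmetry on words of content \<open>c0\<close> are supported on one
  orbit of \<open>C\<close>, hence multiples of \<open>v\<close>. So \<open>v\<close> is an
  eigenvector.\<close>

lemma app_c0: assumes K: "kinv n c0 c0 K" and T: "T \<in> BC c0" shows "app K T = app K T0 * v T"
proof (cases "\<exists>\<sigma>\<in>C. T = act (hat \<sigma>) T0")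
  case True
  then obtain \<sigma> where s: "\<sigma> \<in> C" "T = act (hat \<sigma>) T0" by blast
  have "app K T = of_int (chi \<sigma> * eps n (hat \<sigma>) T0) * app K T0" using app_semi[OF K] s T0_BC unfolding semi_def by blast
  then show ?thesis using v_orbit[OF s(1)] s(2) by simp
next
  case False
  then show ?thesis using semi_c0_orbit[OF app_semi[OF K] T] v_zero[OF False] by auto
qed

lemma app_kmul:
  assumes K: "kinv n c c' K" and L: "kinv n c' c0 L" and U: "U \<in> BC c"
  shows "app (kmul n c' K L) U = (\<Sum>S\<in>BC c'. K U S * app L S)"
proof -
  have "app (kmul n c' K L) U = (\<Sum>T\<in>BC c0. \<Sum>S\<in>BC c'. K U S * (L S T * v T))"
    unfolding app_def by (rule sum.cong[OF refl]) (simp add: kmul_BC[OF K L U] sum_distrib_right mult.assoc)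
  also have "\<dots> = (\<Sum>S\<in>BC c'. \<Sum>T\<in>BC c0. K U S * (L S T * v T))" by (rule sum.swap)
  finally show ?thesis unfolding app_def sum_distrib_left .
qed

text \<open>The eigenvalue, read off at \<open>T0\<close> where \<open>v\<close> is 1. A matrix
  determines its kernel on words of content \<open>c0\<close>, so the \<open>SOME\<close> is
  harmless.\<close>

definition phi :: "'a mat \<Rightarrow> 'a" where "phi A = app (SOME K. A = kmat n c0 c0 K) T0"

lemma phi_kmat: "phi (kmat n c0 c0 K) = app K T0"
proof -
  let ?L = "SOME L. kmat n c0 c0 K = kmat n c0 c0 L"
  have "kmat n c0 c0 K = kmat n c0 c0 ?L" by (rule someI[of _ K]) simp
  then have "\<forall>U\<in>wcont n c0. \<forall>T\<in>wcont n c0. K U T = ?L U T" by (simp only: kmat_eq_iff)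
  then show ?thesis unfolding phi_def app_def using T0_wcont BCD(1) by (intro sum.cong) auto
qed

text \<open>Multiplicativity rests on \<open>app_kmul\<close>: on block-constant words a composite
  acts on \<open>v\<close> as one kernel after the other, and this is where \<open>kmul_BC\<close>
  enters.\<close>

lemma phi_character: "rep_character (Sym n) (mono_rep n c0) phi"
  unfolding rep_character_def
proof (intro conjI ballI)
  have "phi (kmat n c0 c0 (\<lambda>U T. if U = T then 1 else 0)) = 1"
    unfolding phi_kmat app_def using T0_BC finite_BC v_T0 by (simp add: if_distrib[of "\<lambda>x. x * _"] sum.delta' cong: if_cong)
  then show "phi (1\<^sub>m (fst (mono_rep n c0))) = 1" by (simp add: kmat_one)
  fix A B :: "'a mat" assume A: "A \<in> rep_hom (Sym n) (mono_rep n c0) (mono_rep n c0)" and B: "B \<in> rep_hom (Sym n) (mono_rep n c0) (mono_rep n c0)"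
  obtain K where K: "A = kmat n c0 c0 K" "kinv n c0 c0 K" by (rule hom_kmat[OF A])
  obtain L where L: "B = kmat n c0 c0 L" "kinv n c0 c0 L" by (rule hom_kmat[OF B])
  show "phi (A + B) = phi A + phi B" unfolding K L kmat_add phi_kmat app_def by (simp add: distrib_right sum.distrib)
  have "phi (A * B) = (\<Sum>S\<in>BC c0. K T0 S * (app L T0 * v S))"
    unfolding K L kmat_mult phi_kmat app_kmul[OF K(2) L(2) T0_BC] by (rule sum.cong[OF refl]) (simp add: app_c0[OF L(2)])
  also have "\<dots> = app K T0 * app L T0" unfolding app_def[of K] sum_distrib_right by (rule sum.cong) (simp_all add: ac_simps)
  finally show "phi (A * B) = phi A * phi B" unfolding K L phi_kmat .
qed

lemma phi_Jmat: "Jmat n c0 M \<Longrightarrow> phi M = 0"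
proof (induct rule: Jmat.induct)
  case Jmat_zero
  show ?case using character_zero[OF is_rep_mono phi_character] by simp
next
  case (Jmat_step c' A B M)
  obtain L where L: "A = kmat n c' c0 L" "kinv n c' c0 L" by (rule hom_kmat[OF Jmat_step(3)])
  obtain K where K: "B = kmat n c0 c' K" "kinv n c0 c' K" by (rule hom_kmat[OF Jmat_step(4)])
  have "phi (B * A) = 0" unfolding K L kmat_mult phi_kmat app_kmul[OF K(2) L(2) T0_BC]
    using semi_above_zero[OF app_semi[OF L(2)] Jmat_step(1)] by simp
  moreover have "B * A \<in> rep_hom (Sym n) (mono_rep n c0) (mono_rep n c0)" by (rule rep_hom_mult[OF is_rep_mono is_rep_mono is_rep_mono Jmat_step(3,4)])
  ultimately show ?case using phi_character Jmat_hom[OF Jmat_step(5)] Jmat_step(6) unfolding rep_character_def by simp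
qed

end

section \<open>Bounds for the vertex\<close>

context block_system begin

text \<open>\<open>i0 * p0\<close> factors through the module induced from \<open>R\<close>, so it
  is a sum of terms \<open>\<theta> k\<close> over the cosets of \<open>R\<close>, permuted by
  \<open>Q\<close>. The contribution of a term is constant along the orbits of \<open>Q\<close>, and
  no coset is fixed by \<open>Q\<close>; hence the sum vanishes in characteristic
  \<open>p\<close>.\<close>

lemma lower_bound:
  fixes Y :: "'a rep"
  assumes R: "perm_subgroup R Q" "R \<subset> Q" and Y: "is_rep (Sym n) Y" and rp: "rel_proj (Sym n) R Y"
    and i0: "i0 \<in> rep_hom (Sym n) Y (mono_rep n c0)" and p0: "p0 \<in> rep_hom (Sym n) (mono_rep n c0) Y"
  shows "phi (i0 * p0) = 0"
proof -
  have RS: "perm_subgroup R (Sym n)" by (rule perm_subgroup_trans[OF R(1) Q])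
  interpret I: induction_data n R Y by unfold_locales (use RS is_rep_subgroup[OF Y RS] in auto)
  let ?N = "mono_rep n c0 :: 'a rep"
  let ?I = "Ind (Sym n) R Y"
  have rI: "is_rep (Sym n) ?I" by (rule I.is_rep_Ind)
  have rN: "is_rep (Sym n) ?N" by (rule is_rep_mono)
  have "retract (Sym n) Y ?I" using rp rel_proj_iff_retract[OF RS Y] by blast
  then obtain i p where ip: "i \<in> rep_hom (Sym n) Y ?I" "p \<in> rep_hom (Sym n) ?I Y" "p * i = 1\<^sub>m (fst Y)" by (rule retractE)
  define A where "A = i0 * p"
  define B where "B = i * p0"
  have A: "A \<in> rep_hom (Sym n) ?I ?N" unfolding A_def by (rule rep_hom_mult[OF rI Y rN ip(2) i0])
  have B: "B \<in> rep_hom (Sym n) ?N ?I" unfolding B_def by (rule rep_hom_mult[OF rN Y rI p0 ip(1)])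
  have dims: "dim_row i0 = fst ?N" "dim_col i0 = fst Y" "dim_row p0 = fst Y" "dim_col p0 = fst ?N"
    "dim_row i = fst ?I" "dim_col i = fst Y" "dim_row p = fst Y" "dim_col p = fst ?I"
    using rep_homD[OF i0] rep_homD[OF p0] rep_homD[OF ip(1)] rep_homD[OF ip(2)] by auto
  have dA: "dim_row A = card (wcont n c0)" "dim_col A = I.m * I.d" "dim_row B = I.m * I.d" "dim_col B = card (wcont n c0)"
    using dims I.Ind_eq(1) by (simp_all add: A_def B_def)
  have AB: "A * B = i0 * p0"
  proof -
    have "A * B = i0 * (p * (i * p0))" unfolding A_def B_def by (rule mult_assoc_dim) (simp_all add: dims)
    also have "p * (i * p0) = (p * i) * p0" by (rule mult_assoc_dim[symmetric]) (simp_all add: dims)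
    also have "\<dots> = p0" unfolding ip(3) by (rule one_mult_dim) (simp add: dims)
    finally show ?thesis .
  qed
  define \<theta> where "\<theta> k = colblk I.d A k * rowblk I.d B k" for k
  define K where "K k = (SOME L. \<theta> k = kmat n c0 c0 L)" for k
  have K: "\<theta> k = kmat n c0 c0 (K k)" for k
  proof -
    have "dim_row (\<theta> k) = card (wcont n c0)" "dim_col (\<theta> k) = card (wcont n c0)" using dA by (simp_all add: \<theta>_def)
    then obtain L where "\<theta> k = kmat n c0 c0 L" by (rule kmat_surj)
    then show ?thesis unfolding K_def by (rule someI[where P="\<lambda>L. \<theta> k = kmat n c0 c0 L"])
  qed
  have "A * B = kmat n c0 c0 (\<lambda>U T. \<Sum>k<I.m. K k U T)"
  proof (rule eq_matI)
    fix s t assume st: "s < dim_row (kmat n c0 c0 (\<lambda>U T. \<Sum>k<I.m. K k U T))" "t < dim_col (kmat n c0 c0 (\<lambda>U T. \<Sum>k<I.m. K k U T))"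
    have "(A * B) $$ (s,t) = (\<Sum>k<I.m. \<theta> k $$ (s,t))" unfolding \<theta>_def by (rule mult_blocks) (use st dA in auto)
    also have "\<dots> = kmat n c0 c0 (\<lambda>U T. \<Sum>k<I.m. K k U T) $$ (s,t)" unfolding K using st by (simp add: kmat_def)
    finally show "(A * B) $$ (s,t) = kmat n c0 c0 (\<lambda>U T. \<Sum>k<I.m. K k U T) $$ (s,t)" .
  qed (use dA in simp_all)
  then have "phi (i0 * p0) = (\<Sum>S\<in>BC c0. \<Sum>k<I.m. K k T0 S * v S)" unfolding AB[symmetric] by (simp add: phi_kmat app_def sum_distrib_right)
  also have "\<dots> = (\<Sum>k<I.m. app (K k) T0)" unfolding app_def by (rule sum.swap)
  also have "\<dots> = 0"
  proof (rule sum_p_group[OF Q card_Q prime char, where \<alpha>=I.cst])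
    have QS: "q \<in> Sym n" if "q \<in> Q" for q using perm_subgroupD(1)[OF Q that] .
    show "finite {..<I.m}" by simp
    show "I.cst q k \<in> {..<I.m}" if "q \<in> Q" "k \<in> {..<I.m}" for q k using I.cst_spec(1)[OF QS[OF that(1)]] that(2) by simp
    show "I.cst id k = k" if "k \<in> {..<I.m}" for k using I.cst_id that by simp
    show "I.cst (q \<circ> q') k = I.cst q (I.cst q' k)" if "q \<in> Q" "q' \<in> Q" "k \<in> {..<I.m}" for q q' k
      using I.cst_comp[OF QS[OF that(1)] QS[OF that(2)]] that(3) by simp
    show "app (K (I.cst q k)) T0 = app (K k) T0" if q: "q \<in> Q" and k: "k \<in> {..<I.m}" for q k
      unfolding app_def
    proof (rule sum.cong[OF refl])
      fix S assume S: "S \<in> BC c0"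
      have "snd ?N q * \<theta> k = \<theta> (I.cst q k) * snd ?N q" unfolding \<theta>_def
        by (rule I.trace_components[OF Y rN A B QS[OF q]]) (use k in simp)
      then have "kmat n c0 c0 (kmul n c0 (mono_kernel n q) (K k)) = kmat n c0 c0 (kmul n c0 (K (I.cst q k)) (mono_kernel n q))"
        unfolding K by (simp add: mono_rep_def kmat_mult)
      then have "kmul n c0 (mono_kernel n q) (K k) T0 S = kmul n c0 (K (I.cst q k)) (mono_kernel n q) T0 S"
        using T0_wcont BCD(1)[OF S] by (simp add: kmat_eq_iff)
      moreover have "kmul n c0 (mono_kernel n q) (K k) T0 S = K k T0 S"
        using kmul_mono_left[OF QS[OF q] T0_wcont, of "K k" S] act_Q[OF T0_words BCD(2)[OF T0_BC] q] eps_Q[OF T0_words BCD(2)[OF T0_BC] q] by simp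
      moreover have "kmul n c0 (K (I.cst q k)) (mono_kernel n q) T0 S = K (I.cst q k) T0 S"
        using kmul_mono_right[OF QS[OF q] BCD(1)[OF S], of "K (I.cst q k)" T0] act_Q[OF BCD(3,2)[OF S] q] eps_Q[OF BCD(3,2)[OF S] q] by simp
      ultimately show "K (I.cst q k) T0 S * v S = K k T0 S * v S" by simp
    qed
    show "app (K k) T0 = 0" if k: "k \<in> {..<I.m}" and fx: "\<forall>q\<in>Q. I.cst q k = k" for k
    proof -
      have km: "k < I.m" using k by simp
      let ?t = "I.ts ! k"
      note t = I.ts_Sym[OF km]
      have mem: "I.tr k q k \<in> R" if "q \<in> Q" for q using I.cst_spec(2)[OF QS[OF that] km] fx that by simp
      \<comment> \<open>A fixed coset would conjugate \<open>Q\<close> into \<open>R\<close>, which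
        is smaller; the two comparisons of cardinalities below contradict each other, so the case is
        void.\<close>
      have "inj_on (\<lambda>q. I.tr k q k) Q"
      proof (rule inj_on_inverseI[where g="\<lambda>x. ?t \<circ> (x \<circ> pinv ?t)"])
        fix q assume "q \<in> Q"
        have "?t \<circ> (I.tr k q k \<circ> pinv ?t) = (?t \<circ> pinv ?t) \<circ> q \<circ> (?t \<circ> pinv ?t)" unfolding I.tr_def by (simp only: comp_assoc)
        then show "?t \<circ> (I.tr k q k \<circ> pinv ?t) = q" unfolding Sym_inv(1)[OF t] by simp
      qed
      then have "card Q = card ((\<lambda>q. I.tr k q k) ` Q)" by (rule card_image[symmetric])
      also have "\<dots> \<le> card R" using mem finite_perm_subgroup[OF RS] by (intro card_mono) auto
      finally have "card Q \<le> card R" .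
      moreover have "card R < card Q" by (rule psubset_card_mono[OF finite_perm_subgroup[OF Q] R(2)])
      ultimately show ?thesis by simp
    qed
  qed
  finally show ?thesis .
qed

section \<open>Reversal of the columns\<close>

definition hgt :: "nat \<Rightarrow> nat" where "hgt b = card (colm (col b))"
definition base :: "nat \<Rightarrow> nat" where "base b = (if n \<le> t0 b then n else 0)"
text \<open>The letters of \<open>t0\<close>, reversed within each column.\<close>
definition t1 :: "nat \<Rightarrow> nat" where "t1 b = base b + (hgt b - 1 - (t0 b - base b))"

lemma col_cong:
  assumes "b < N" "b' < N" "col b = col b'"
  shows "hgt b = hgt b'" "base b = base b'"
  using assms col_par[OF assms] by (simp_all add: hgt_def base_def)

text \<open>\<open>col_down\<close> closes the letters of a column downwards within their parity,
  and \<open>col_inj\<close> makes them distinct, so they fill an interval from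
  \<open>base b\<close> of length \<open>hgt b\<close>.\<close>

lemma column_letters:
  assumes b: "b < N"
  shows "t0 ` colm (col b) = {base b..<base b + hgt b}"
proof -
  let ?C = "colm (col b)"
  have bC: "b \<in> ?C" using b by (simp add: colm_def)
  have fin: "finite (t0 ` ?C)" "t0 ` ?C \<noteq> {}" using finite_colm bC by auto
  define M where "M = Max (t0 ` ?C)"
  have "M \<in> t0 ` ?C" unfolding M_def by (rule Max_in[OF fin])
  then obtain b1 where b1: "b1 < N" "col b1 = col b" "t0 b1 = M" by (auto simp: colm_def)
  have im: "t0 ` ?C = {base b..M}"
  proof
    show "t0 ` ?C \<subseteq> {base b..M}"
    proof
      fix j assume j: "j \<in> t0 ` ?C"
      then obtain b2 where b2: "b2 < N" "col b2 = col b" "j = t0 b2" by (auto simp: colm_def)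
      have "base b \<le> j" using col_cong(2)[OF b2(1) b b2(2)] b2(3) by (auto simp: base_def split: if_splits)
      then show "j \<in> {base b..M}" using Max_ge[OF fin(1) j] by (simp add: M_def)
    qed
    show "{base b..M} \<subseteq> t0 ` ?C"
    proof
      fix j assume j: "j \<in> {base b..M}"
      have "n \<le> j \<longleftrightarrow> n \<le> t0 b1" using j b1(3) col_cong(2)[OF b1(1) b b1(2)] by (auto simp: base_def split: if_splits)
      then obtain b2 where "b2 < N" "col b2 = col b1" "t0 b2 = j" using col_down[OF b1(1), of j] j b1(3) by auto
      then show "j \<in> t0 ` ?C" using b1(2) by (auto simp: colm_def)
    qed
  qed
  have "inj_on t0 ?C" by (rule inj_onI) (use col_inj in \<open>auto simp: colm_def\<close>)
  then have "hgt b = card {base b..M}" unfolding hgt_def im[symmetric] by (simp add: card_image)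
  moreover have "base b \<le> M" using im fin(2) by auto
  ultimately have "{base b..M} = {base b..<base b + hgt b}" by auto
  then show ?thesis using im by simp
qed

lemma letter_bounds: "b < N \<Longrightarrow> base b \<le> t0 b" "b < N \<Longrightarrow> t0 b < base b + hgt b"
proof -
  assume b: "b < N"
  then have "t0 b \<in> t0 ` colm (col b)" by (simp add: colm_def)
  then show "base b \<le> t0 b" "t0 b < base b + hgt b" unfolding column_letters[OF b] by auto
qed

definition rev0 :: "nat \<Rightarrow> nat" where
  "rev0 b = (if b < N then (THE b'. b' < N \<and> col b' = col b \<and> t0 b' = t1 b) else b)"

lemma rev0: assumes b: "b < N" shows "rev0 b < N" "col (rev0 b) = col b" "t0 (rev0 b) = t1 b"
proof -
  have "t1 b \<in> {base b..<base b + hgt b}" using letter_bounds[OF b] by (auto simp: t1_def)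
  then obtain b' where b': "b' < N" "col b' = col b" "t0 b' = t1 b" unfolding column_letters[OF b, symmetric] by (auto simp: colm_def)
  have "rev0 b = b'" unfolding rev0_def using b b' col_inj by (simp, intro the_equality) auto
  then show "rev0 b < N" "col (rev0 b) = col b" "t0 (rev0 b) = t1 b" using b' by auto
qed

lemma t1_rev0: assumes b: "b < N" shows "t1 (rev0 b) = t0 b"
proof -
  have "base (rev0 b) = base b" "hgt (rev0 b) = hgt b" using col_cong[OF rev0(1)[OF b] b rev0(2)[OF b]] by auto
  then show ?thesis using letter_bounds[OF b] unfolding t1_def[of "rev0 b"] rev0(3)[OF b] by (simp add: t1_def)
qed

lemma rev0_rev0: "rev0 (rev0 b) = b"
proof (cases "b < N")
  case True
  show ?thesis
    by (rule col_inj[OF rev0(1)[OF rev0(1)[OF True]] True]) (use rev0(2)[OF rev0(1)[OF True]] rev0(2)[OF True] rev0(3)[OF rev0(1)[OF True]] t1_rev0[OF True] in simp_all)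
qed (simp add: rev0_def)

lemma rev0_C: "rev0 \<in> C"
proof -
  have "rev0 permutes {..<N}"
  proof (rule bij_imp_permutes)
    show "bij_betw rev0 {..<N} {..<N}" by (rule bij_betw_byWitness[where f'=rev0]) (use rev0(1) rev0_rev0 in auto)
  qed (simp add: rev0_def)
  then show ?thesis using rev0(2) by (simp add: C_def)
qed

lemma sum_letters: "b < N \<Longrightarrow> int (t0 b) + int (t1 b) = 2 * int (base b) + int (hgt b) - 1"
  using letter_bounds[of b] by (simp add: t1_def)

text \<open>The sum of the squares of \<open>t0 (\<pi>\<^sup>-\<^sup>1 b) - t1 b\<close> is zero.\<close>
lemma letters_reversed:
  assumes pi: "\<pi> \<in> szperm" and a: "\<And>b. b < N \<Longrightarrow> t0 (\<pi> b) = t1 b"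
    and s: "\<sigma> \<in> C" and e: "\<And>b. b < N \<Longrightarrow> t0 (pinv \<pi> b) = t0 (pinv \<sigma> b)" and b: "b < N"
  shows "t0 (pinv \<pi> b) = t1 b"
proof -
  define r where "r b = int (t0 b)" for b
  define g where "g b = int (t1 b)" for b
  define f where "f b = int (t0 (pinv \<pi> b))" for b
  define H where "H b = 2 * int (base b) + int (hgt b) - 1" for b
  let ?S = "\<lambda>h :: nat \<Rightarrow> int. \<Sum>b<N. h b"
  have P: "\<pi> permutes {..<N}" "pinv \<pi> permutes {..<N}" using szpermD(1)[OF pi] permutes_inv by auto
  have Ps: "\<sigma> permutes {..<N}" using s by (simp add: C_def)
  have Pr: "rev0 permutes {..<N}" using rev0_C by (simp add: C_def)
  have rg: "r b + g b = H b" if "b < N" for b using sum_letters[OF that] by (simp add: r_def g_def H_def)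
  have ff: "?S (\<lambda>b. f b * f b) = ?S (\<lambda>b. r b * r b)"
    using sum.permute[OF P(2), of "\<lambda>b. r b * r b"] by (simp add: f_def r_def comp_def)
  have gg: "?S (\<lambda>b. g b * g b) = ?S (\<lambda>b. r b * r b)"
  proof -
    have "?S (\<lambda>b. r b * r b) = ?S (\<lambda>b. r (rev0 b) * r (rev0 b))" using sum.permute[OF Pr, of "\<lambda>b. r b * r b"] by (simp add: comp_def)
    also have "\<dots> = ?S (\<lambda>b. g b * g b)" by (rule sum.cong) (simp_all add: r_def g_def rev0(3))
    finally show ?thesis by simp
  qed
  have fr: "?S (\<lambda>b. f b * r b) = ?S (\<lambda>b. r b * g b)"
  proof -
    have "?S (\<lambda>b. f b * r b) = ?S (\<lambda>b. f (\<pi> b) * r (\<pi> b))" using sum.permute[OF P(1), of "\<lambda>b. f b * r b"] by (simp add: comp_def)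
    also have "\<dots> = ?S (\<lambda>b. r b * g b)" by (rule sum.cong) (simp_all add: f_def r_def g_def permutes_inverses(2)[OF P(1)] a)
    finally show ?thesis .
  qed
  \<comment> \<open>\<open>H = r + g\<close> is constant on columns, and \<open>f\<close> arises
    from \<open>r\<close> by the column permutation \<open>\<sigma>\<close>, so \<open>f\<close> and
    \<open>r\<close> have the same scalar product with \<open>H\<close>.\<close>
  have fH: "?S (\<lambda>b. f b * H b) = ?S (\<lambda>b. r b * H b)"
  proof -
    have "?S (\<lambda>b. f b * H b) = ?S (\<lambda>b. r (pinv \<sigma> b) * H b)" by (rule sum.cong) (simp_all add: f_def r_def e)
    also have "\<dots> = ?S (\<lambda>b. r (pinv \<sigma> (\<sigma> b)) * H (\<sigma> b))" using sum.permute[OF Ps, of "\<lambda>b. r (pinv \<sigma> b) * H b"] by (simp add: comp_def)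
    also have "\<dots> = ?S (\<lambda>b. r b * H b)"
    proof (rule sum.cong[OF refl])
      fix b assume "b \<in> {..<N}"
      then have b: "b < N" by simp
      have "\<sigma> b < N" "col (\<sigma> b) = col b" using szpermD(2)[OF C_szperm[OF s] b] s b by (auto simp: C_def)
      then have "H (\<sigma> b) = H b" using col_cong[of "\<sigma> b" b] b by (simp add: H_def)
      then show "r (pinv \<sigma> (\<sigma> b)) * H (\<sigma> b) = r b * H b" by (simp add: permutes_inverses(2)[OF Ps])
    qed
    finally show ?thesis .
  qed
  \<comment> \<open>\<open>g = H - r\<close> reduces the mixed sum to \<open>fH\<close> and
    \<open>fr\<close>, and \<open>r * H - r * g = r * r\<close>.\<close>
  have fg: "?S (\<lambda>b. f b * g b) = ?S (\<lambda>b. r b * r b)"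
  proof -
    have "?S (\<lambda>b. f b * g b) = ?S (\<lambda>b. f b * H b - f b * r b)"
    proof (rule sum.cong[OF refl])
      fix b assume "b \<in> {..<N}"
      then have "g b = H b - r b" using rg[of b] by simp
      then show "f b * g b = f b * H b - f b * r b" by (simp add: right_diff_distrib)
    qed
    also have "\<dots> = ?S (\<lambda>b. r b * H b - r b * g b)" unfolding sum_subtractf fH fr ..
    also have "\<dots> = ?S (\<lambda>b. r b * r b)"
    proof (rule sum.cong[OF refl])
      fix b assume "b \<in> {..<N}"
      then have "H b = r b + g b" using rg[of b] by simp
      then show "r b * H b - r b * g b = r b * r b" by (simp add: distrib_left)
    qed
    finally show ?thesis .
  qed
  have "?S (\<lambda>b. (f b - g b) * (f b - g b)) = ?S (\<lambda>b. f b * f b) - 2 * ?S (\<lambda>b. f b * g b) + ?S (\<lambda>b. g b * g b)"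
    by (simp add: algebra_simps sum.distrib sum_subtractf sum_distrib_left)
  then have "?S (\<lambda>b. (f b - g b) * (f b - g b)) = 0" unfolding ff fg gg by simp
  then have "(f b - g b) * (f b - g b) = 0" using b by (subst (asm) sum_nonneg_eq_0_iff) auto
  then show ?thesis by (simp add: f_def g_def)
qed

text \<open>\<open>t0\<close> and \<open>t1\<close> together fix the parity, the row of a box and
  the height of its column. For blocks coming from boxes, \<open>Z\<close> thus permutes, in each
  row of each diagram, the boxes whose columns have equal height.\<close>

definition Z :: "(nat \<Rightarrow> nat) set" where
  "Z = {z\<in>szperm. \<forall>b<N. t0 (z b) = t0 b \<and> t1 (z b) = t1 b}"

text \<open>The right-hand side says when a term of the sum in \<open>phi_K2K1\<close> is nonzero:
  the first condition for the kernel \<open>K2\<close>, the second for \<open>v\<close>. That they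
  leave only a translate of \<open>Z\<close> is the content of
  \<open>letters_reversed\<close>.\<close>

lemma Z_reverse_iff:
  assumes pi: "\<pi> \<in> szperm"
  shows "rev0 \<circ> \<pi> \<in> Z \<longleftrightarrow> (\<forall>b<N. t0 (\<pi> b) = t1 b) \<and> (\<exists>\<sigma>\<in>C. \<forall>b<N. t0 (pinv \<pi> b) = t0 (pinv \<sigma> b))"
    (is "?L \<longleftrightarrow> ?R")
proof
  note P = szpermD(1)[OF pi]
  note piN = szpermD(2)[OF pi]
  note invN = szpermD(2)[OF szperm_closed(2)[OF pi]]
  have inv_rev: "pinv rev0 = rev0" by (rule inv_equality) (simp_all add: rev0_rev0)
  show ?R if L: ?L
  proof (intro conjI bexI[of _ rev0] allI impI)
    fix b assume b: "b < N"
    have "t1 (rev0 (\<pi> b)) = t1 b" using L b by (simp add: Z_def)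
    then show "t0 (\<pi> b) = t1 b" using t1_rev0[OF piN[OF b]] by simp
    let ?a = "pinv \<pi> b"
    have "t0 (rev0 (\<pi> ?a)) = t0 ?a" using L invN[OF b] by (simp add: Z_def)
    then show "t0 ?a = t0 (pinv rev0 b)" unfolding inv_rev permutes_inverses(1)[OF P] by simp
  qed (rule rev0_C)
  show ?L if R: ?R
  proof -
    obtain \<sigma> where s: "\<sigma> \<in> C" "\<And>b. b < N \<Longrightarrow> t0 (pinv \<pi> b) = t0 (pinv \<sigma> b)" using R by blast
    have a: "t0 (\<pi> b) = t1 b" if "b < N" for b using R that by blast
    have "t0 (rev0 (\<pi> b)) = t0 b \<and> t1 (rev0 (\<pi> b)) = t1 b" if b: "b < N" for b
      using letters_reversed[OF pi a s piN[OF b]] rev0(3)[OF piN[OF b]] t1_rev0[OF piN[OF b]] a[OF b] permutes_inverses(2)[OF P] by simp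
    then show ?thesis unfolding Z_def using szperm_closed(1)[OF C_szperm[OF rev0_C] pi] by simp
  qed
qed

lemma finite_szperm: "finite szperm"
  by (rule finite_subset[of _ "{\<pi>. \<pi> permutes {..<N}}"]) (auto simp: szperm_def finite_permutations)

section \<open>The module whose words have a different letter on each block\<close>

lemma N_le: "N \<le> n"
proof -
  have "inj_on (\<lambda>b. pt b 0) {..<N}" by (rule inj_on_inverseI[where g=blk]) (simp add: blk_pt sz_pos)
  then have "card {..<N} \<le> card {1..n}" by (rule card_inj_on_le) (use pt_mem sz_pos in auto)
  then show ?thesis by simp
qed

text \<open>All blocks carry different letters, so the stabilizer of \<open>R0\<close> is the Young subgroup of the blocks.\<close>
definition r0 :: "nat \<Rightarrow> nat" where "r0 b = (if n \<le> t0 b then n + b else b)"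
definition R0 :: "nat \<Rightarrow> nat" where "R0 = W r0"
definition cR :: "nat \<Rightarrow> nat" where "cR = content n R0"
definition T1 :: "nat \<Rightarrow> nat" where "T1 = W t1"

lemma r0_less: "b < N \<Longrightarrow> r0 b < 2 * n" using N_le by (simp add: r0_def)
lemma r0_par: "b < N \<Longrightarrow> n \<le> r0 b \<longleftrightarrow> n \<le> t0 b" using N_le by (simp add: r0_def)
lemma r0_inj: "b < N \<Longrightarrow> b' < N \<Longrightarrow> r0 b = r0 b' \<Longrightarrow> b = b'" using N_le by (auto simp: r0_def split: if_splits)
lemma t1_less: "b < N \<Longrightarrow> t1 b < 2 * n" using t0_less[OF rev0(1)] rev0(3) by simp
lemma t1_par: "b < N \<Longrightarrow> n \<le> t1 b \<longleftrightarrow> n \<le> t0 b" using col_par[OF rev0(1) _ rev0(2)] rev0(3) by simp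
lemma R0_words: "R0 \<in> words n" unfolding R0_def by (rule W_words) (rule r0_less)
lemma R0_wcont: "R0 \<in> wcont n cR" unfolding cR_def by (rule wcont_content[OF R0_words])

lemma W_at: "x \<in> {1..n} \<Longrightarrow> W t x = t (blk x)" by (simp add: W_def del: atLeastAtMost_iff)

lemma eps_T1: "eps n g T1 = eps n g T0"
proof -
  have "odds n T1 = odds n T0" unfolding odds_def T1_def T0_def by (rule Collect_cong) (use W_at t1_par blk_less in auto)
  then show ?thesis by (simp add: eps_def)
qed

lemma stab_R0: "{g\<in>Sym n. act g R0 = R0} = {g\<in>Sym n. \<forall>x\<in>{1..n}. blk (g x) = blk x}"
proof (rule Collect_cong, rule conj_cong[OF refl])
  fix g assume g: "g \<in> Sym n"
  have gx: "g x \<in> {1..n}" if "x \<in> {1..n}" for x using permutes_in_image[OF SymD(1)[OF g], of x] that by blast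
  show "act g R0 = R0 \<longleftrightarrow> (\<forall>x\<in>{1..n}. blk (g x) = blk x)"
  proof
    assume e: "act g R0 = R0"
    show "\<forall>x\<in>{1..n}. blk (g x) = blk x"
    proof
      fix x assume x: "x \<in> {1..n}"
      have "r0 (blk (g x)) = r0 (blk x)" using act_fix[OF g e, of x] W_at[OF x] W_at[OF gx[OF x]] by (simp add: R0_def)
      then show "blk (g x) = blk x" using r0_inj[OF blk_less[OF gx[OF x]] blk_less[OF x]] by blast
    qed
  next
    assume e: "\<forall>x\<in>{1..n}. blk (g x) = blk x"
    show "act g R0 = R0"
      by (rule act_eqI[OF g R0_words R0_words]) (use e gx W_at in \<open>simp add: R0_def del: atLeastAtMost_iff\<close>)
  qed
qed

lemma stab_R0_W:
  assumes "g \<in> Sym n" "act g R0 = R0" and t: "\<And>b. b < N \<Longrightarrow> t b < 2 * n"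
  shows "act g (W t) = W t"
proof (rule act_eqI[OF assms(1) W_words[OF t] W_words[OF t]])
  fix x assume x: "x \<in> {1..n}"
  have "blk (g x) = blk x" using assms(1,2) stab_R0 x by blast
  moreover have "g x \<in> {1..n}" using permutes_in_image[OF SymD(1)[OF assms(1)], of x] x by blast
  ultimately show "W t (g x) = W t x" using x W_at by simp
qed

text \<open>\<open>g\<close> and \<open>hat \<pi>\<close> differ by an element of the stabiliser of
  \<open>R0\<close>, which preserves all blocks and thus fixes every block-constant word. So at a
  rearranged \<open>R0\<close> a row of \<open>K1\<close> and a column of \<open>K2\<close> have
  only one nonzero entry.\<close>

lemma R0_transporter:
  assumes g: "g \<in> Sym n" and pi: "\<pi> \<in> szperm" and e: "act g R0 = act (hat \<pi>) R0" and t: "\<And>b. b < N \<Longrightarrow> t b < 2 * n"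
  shows "act g (W t) = act (hat \<pi>) (W t)"
proof -
  note h = hat_Sym[OF pi]
  let ?s = "pinv (hat \<pi>) \<circ> g"
  have s: "?s \<in> Sym n" by (rule Sym_closed(1)[OF Sym_closed(2)[OF h] g])
  have "act ?s R0 = R0" unfolding act_comp[OF Sym_closed(2)[OF h] g] e by (rule act_inv(1)[OF h])
  then have "act ?s (W t) = W t" by (rule stab_R0_W[OF s _ t])
  then have "act (hat \<pi>) (act ?s (W t)) = act (hat \<pi>) (W t)" by simp
  then show ?thesis unfolding act_comp[OF Sym_closed(2)[OF h] g] act_inv(2)[OF h] .
qed

text \<open>The letter of block \<open>b\<close> occurs \<open>sz b\<close> times. In a
  block-constant word of this content each of the \<open>N\<close> letters sits on at least one of
  the \<open>N\<close> blocks, hence on exactly one, of the same size.\<close>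

lemma BC_R0:
  "BC cR = (\<lambda>\<pi>. act (hat \<pi>) R0) ` szperm" "inj_on (\<lambda>\<pi>. act (hat \<pi>) R0) szperm"
proof -
  have R0B: "R0 \<in> BC cR" unfolding BC_def using R0_wcont con_W[of r0] by (simp add: R0_def)
  show "inj_on (\<lambda>\<pi>. act (hat \<pi>) R0) szperm"
  proof (rule inj_onI)
    fix \<pi> \<rho> assume z: "\<pi> \<in> szperm" "\<rho> \<in> szperm" and e: "act (hat \<pi>) R0 = act (hat \<rho>) R0"
    note P = szpermD(1)[OF z(1)] szpermD(1)[OF z(2)]
    have "W (r0 \<circ> pinv \<pi>) = W (r0 \<circ> pinv \<rho>)"
      using e hat_act[OF z(1), of r0] hat_act[OF z(2), of r0] r0_less unfolding R0_def by simp
    then have e': "\<forall>b<N. r0 (pinv \<pi> b) = r0 (pinv \<rho> b)" by (simp add: W_eq_iff)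
    have "pinv \<pi> b = pinv \<rho> b" for b
    proof (cases "b < N")
      case True
      show ?thesis by (rule r0_inj[OF szpermD(2)[OF szperm_closed(2)[OF z(1)] True] szpermD(2)[OF szperm_closed(2)[OF z(2)] True]]) (use e' True in blast)
    next
      case False
      then show ?thesis using permutes_not_in[OF permutes_inv[OF P(1)], of b] permutes_not_in[OF permutes_inv[OF P(2)], of b] by simp
    qed
    then have "pinv \<pi> = pinv \<rho>" by blast
    then show "\<pi> = \<rho>" using permutes_inv_inv[OF P(1)] permutes_inv_inv[OF P(2)] by metis
  qed
  show "BC cR = (\<lambda>\<pi>. act (hat \<pi>) R0) ` szperm"
  proof
    show "(\<lambda>\<pi>. act (hat \<pi>) R0) ` szperm \<subseteq> BC cR" using hat_BC(1)[OF _ R0B] by blast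
    show "BC cR \<subseteq> (\<lambda>\<pi>. act (hat \<pi>) R0) ` szperm"
    proof
      fix S assume S: "S \<in> BC cR"
      have Sx: "S x = fil S (blk x)" if "x \<in> {1..n}" for x
        using W_at_pt[OF BCD(2)[OF S] blk_less[OF that] pos_less[OF that]] pt_blk[OF that] by simp
      have lev: "card {x\<in>{1..n}. S x = k} = card {x\<in>{1..n}. R0 x = k}" if "k < 2 * n" for k
        using BCD(1)[OF S] R0_wcont that unfolding wcont_def by auto
      have blk_set: "{x\<in>{1..n}. blk x = b} = pt b ` {..<sz b}" if "b < N" for b
      proof
        show "{x\<in>{1..n}. blk x = b} \<subseteq> pt b ` {..<sz b}"
        proof
          fix x assume "x \<in> {x\<in>{1..n}. blk x = b}"
          then have x: "x \<in> {1..n}" "blk x = b" by blast+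
          show "x \<in> pt b ` {..<sz b}" by (rule image_eqI[of _ _ "pos x"]) (use x pt_blk[OF x(1)] pos_less[OF x(1)] in auto)
        qed
        show "pt b ` {..<sz b} \<subseteq> {x\<in>{1..n}. blk x = b}" using pt_mem[OF that] blk_pt[OF that] by blast
      qed
      have blk_card: "card {x\<in>{1..n}. blk x = b} = sz b" if "b < N" for b
      proof -
        have "inj_on (pt b) {..<sz b}" by (rule inj_on_inverseI[where g=pos]) (simp add: pos_pt that)
        then show ?thesis unfolding blk_set[OF that] by (simp add: card_image)
      qed
      have R0lev: "{x\<in>{1..n}. R0 x = r0 b} = {x\<in>{1..n}. blk x = b}" if "b < N" for b
        by (rule Collect_cong, rule conj_cong[OF refl]) (use W_at r0_inj[OF blk_less that] in \<open>auto simp: R0_def simp del: atLeastAtMost_iff\<close>)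
      have ex: "\<exists>b'<N. fil S b' = r0 b" if b: "b < N" for b
      proof -
        have "card {x\<in>{1..n}. S x = r0 b} = sz b" using lev[OF r0_less[OF b]] R0lev[OF b] blk_card[OF b] by simp
        then have "{x\<in>{1..n}. S x = r0 b} \<noteq> {}" using sz_pos[OF b] by (metis card.empty less_irrefl)
        then obtain x where "x \<in> {1..n}" "S x = r0 b" by blast
        then show ?thesis using Sx blk_less by metis
      qed
      then obtain g where g: "\<And>b. b < N \<Longrightarrow> g b < N \<and> fil S (g b) = r0 b" by metis
      have ginj: "inj_on g {..<N}" by (rule inj_onI) (use g r0_inj in \<open>metis lessThan_iff\<close>)
      have gim: "g ` {..<N} = {..<N}" by (rule card_subset_eq) (use g ginj in \<open>auto simp: card_image\<close>)
      define \<pi> where "\<pi> b = (if b < N then g b else b)" for b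
      have P: "\<pi> permutes {..<N}"
      proof (rule bij_imp_permutes)
        have "bij_betw g {..<N} {..<N}" using ginj gim by (simp add: bij_betw_def)
        then show "bij_betw \<pi> {..<N} {..<N}" by (rule iffD1[OF bij_betw_cong, rotated]) (simp add: \<pi>_def)
      qed (simp add: \<pi>_def)
      have sz: "sz (\<pi> b) = sz b" if b: "b < N" for b
      proof -
        have "{x\<in>{1..n}. S x = r0 b} = {x\<in>{1..n}. blk x = g b}"
        proof (rule Collect_cong, rule conj_cong[OF refl])
          fix x assume x: "x \<in> {1..n}"
          obtain a where a: "a < N" "g a = blk x" using gim blk_less[OF x] by (metis imageE lessThan_iff)
          have "S x = r0 a" using Sx[OF x] g[OF a(1)] a(2) by simp
          then show "S x = r0 b \<longleftrightarrow> blk x = g b" using r0_inj[OF a(1) b] inj_onD[OF ginj, of a b] a b by auto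
        qed
        then have "sz (g b) = card {x\<in>{1..n}. S x = r0 b}" using blk_card[of "g b"] g[OF b] by simp
        also have "\<dots> = sz b" using lev[OF r0_less[OF b]] R0lev[OF b] blk_card[OF b] by simp
        finally show ?thesis using b by (simp add: \<pi>_def)
      qed
      have pi: "\<pi> \<in> szperm" using P sz by (simp add: szperm_def)
      have "S = W (fil S)" by (rule W_fil[OF BCD(3,2)[OF S]])
      also have "\<dots> = W (r0 \<circ> pinv \<pi>)" unfolding W_eq_iff
      proof (intro allI impI)
        fix b assume b: "b < N"
        let ?a = "pinv \<pi> b"
        have a: "?a < N" by (rule szpermD(2)[OF szperm_closed(2)[OF pi] b])
        have "\<pi> ?a = b" by (rule permutes_inverses(1)[OF P])
        then show "fil S b = (r0 \<circ> pinv \<pi>) b" using g[OF a] a by (simp add: \<pi>_def split: if_splits)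
      qed
      also have "\<dots> = act (hat \<pi>) R0" unfolding R0_def by (rule hat_act[OF pi, symmetric]) (rule r0_less)
      finally show "S \<in> (\<lambda>\<pi>. act (hat \<pi>) R0) ` szperm" using pi by blast
    qed
  qed
qed

lemma admissible_R0: "(\<And>b. b < N \<Longrightarrow> n \<le> t b \<longleftrightarrow> n \<le> t0 b) \<Longrightarrow> admissible n R0 (W t)" "(\<And>b. b < N \<Longrightarrow> n \<le> t b \<longleftrightarrow> n \<le> t0 b) \<Longrightarrow> admissible n (W t) R0"
  unfolding admissible_def using W_at blk_less r0_par by (auto simp: R0_def simp del: atLeastAtMost_iff)

lemma W_orbit_iff:
  assumes pi: "\<pi> \<in> szperm" and t: "\<And>b. b < N \<Longrightarrow> t b < 2 * n"
  shows "act (hat \<pi>) (W t) = W t' \<longleftrightarrow> (\<forall>b<N. t' (\<pi> b) = t b)"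
proof -
  note P = szpermD(1)[OF pi]
  have "act (hat \<pi>) (W t) = W t' \<longleftrightarrow> (\<forall>b<N. t (pinv \<pi> b) = t' b)" using hat_act[OF pi t] W_eq_iff[of "t \<circ> pinv \<pi>" t'] by simp
  also have "\<dots> \<longleftrightarrow> (\<forall>b<N. t' (\<pi> b) = t b)"
  proof
    assume A: "\<forall>b<N. t (pinv \<pi> b) = t' b"
    show "\<forall>b<N. t' (\<pi> b) = t b" using A szpermD(2)[OF pi] permutes_inverses(2)[OF P] by metis
  next
    assume A: "\<forall>b<N. t' (\<pi> b) = t b"
    show "\<forall>b<N. t (pinv \<pi> b) = t' b"
    proof (intro allI impI)
      fix b assume "b < N"
      then have "t' (\<pi> (pinv \<pi> b)) = t (pinv \<pi> b)" using A szpermD(2)[OF szperm_closed(2)[OF pi]] by blast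
      then show "t (pinv \<pi> b) = t' b" using permutes_inverses(1)[OF P] by simp
    qed
  qed
  finally show ?thesis .
qed

text \<open>\<open>K2\<close> is built on the reversed word \<open>T1\<close>. With
  \<open>T0\<close> in its place the value of \<open>phi\<close> on the composite would count all
  size-preserving block permutations that preserve \<open>t0\<close>, and their number may be
  divisible by \<open>p\<close>.\<close>

definition K1 :: "(nat \<Rightarrow> nat) \<Rightarrow> (nat \<Rightarrow> nat) \<Rightarrow> 'a" where "K1 = korb n R0 T0"
definition K2 :: "(nat \<Rightarrow> nat) \<Rightarrow> (nat \<Rightarrow> nat) \<Rightarrow> 'a" where "K2 = korb n T1 R0"

lemma K1_kinv: "kinv n cR c0 K1" unfolding K1_def T0_def by (rule korb_kinv[OF admissible_R0(1)]) simp
lemma K2_kinv: "kinv n c0 cR K2" unfolding K2_def T1_def by (rule korb_kinv[OF admissible_R0(2)]) (rule t1_par)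

lemma app_K1: assumes pi: "\<pi> \<in> szperm"
  shows "app K1 (act (hat \<pi>) R0) = of_int (eps n (hat \<pi>) R0 * eps n (hat \<pi>) T0) * v (act (hat \<pi>) T0)"
proof -
  note h = hat_Sym[OF pi]
  have val: "K1 (act (hat \<pi>) R0) S = (if S = act (hat \<pi>) T0 then of_int (eps n (hat \<pi>) R0 * eps n (hat \<pi>) T0) else 0)" for S
  proof (cases "S = act (hat \<pi>) T0")
    case True
    have "admissible n R0 T0" unfolding T0_def by (rule admissible_R0(1)) simp
    then show ?thesis using korb_value[OF _ h, of R0 T0, where 'a='a] True by (simp add: K1_def)
  next
    case False
    have "K1 (act (hat \<pi>) R0) S = 0"
    proof (rule ccontr)
      assume "K1 (act (hat \<pi>) R0) S \<noteq> 0"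
      then obtain g where g: "g \<in> Sym n" "act g R0 = act (hat \<pi>) R0" "act g T0 = S" unfolding K1_def using korb_nonzero by blast
      then show False using R0_transporter[OF g(1) pi g(2), of t0] t0_less False unfolding T0_def by simp
    qed
    then show ?thesis using False by simp
  qed
  show ?thesis unfolding app_def val using hat_BC(1)[OF pi T0_BC] finite_BC[of c0]
    by (simp add: if_distrib[of "\<lambda>x. x * _"] sum.delta' sum.delta cong: if_cong)
qed

lemma K2_value: assumes pi: "\<pi> \<in> szperm"
  shows "K2 T0 (act (hat \<pi>) R0) = (if \<forall>b<N. t0 (\<pi> b) = t1 b then of_int (eps n (hat \<pi>) T0 * eps n (hat \<pi>) R0) else 0)"
proof -
  note h = hat_Sym[OF pi]
  have iff: "act (hat \<pi>) T1 = T0 \<longleftrightarrow> (\<forall>b<N. t0 (\<pi> b) = t1 b)" unfolding T1_def T0_def by (rule W_orbit_iff[OF pi]) (rule t1_less)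
  show ?thesis
  proof (cases "act (hat \<pi>) T1 = T0")
    case True
    have "admissible n T1 R0" unfolding T1_def by (rule admissible_R0(2)) (rule t1_par)
    then have "K2 (act (hat \<pi>) T1) (act (hat \<pi>) R0) = of_int (eps n (hat \<pi>) T1 * eps n (hat \<pi>) R0)" unfolding K2_def by (rule korb_value[OF _ h])
    then show ?thesis using True iff by (simp add: eps_T1)
  next
    case False
    have "K2 T0 (act (hat \<pi>) R0) = 0"
    proof (rule ccontr)
      assume "K2 T0 (act (hat \<pi>) R0) \<noteq> 0"
      then obtain g where g: "g \<in> Sym n" "act g T1 = T0" "act g R0 = act (hat \<pi>) R0" unfolding K2_def using korb_nonzero by blast
      then show False using R0_transporter[OF g(1) pi g(3), of t1] t1_less False unfolding T1_def by simp
    qed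
    moreover have "\<not> (\<forall>b<N. t0 (\<pi> b) = t1 b)" using False iff by blast
    ultimately show ?thesis by (simp only: if_False)
  qed
qed

text \<open>The sum over the words of content \<open>cR\<close> becomes a sum over block
  permutations by \<open>BC_R0\<close>. The signs at \<open>R0\<close> and \<open>T0\<close> square
  away, and what remains of each nonzero term is the value of \<open>v\<close> at the word
  \<open>act (hat rev0) T0\<close>, the same for all.\<close>

lemma phi_K2K1: "app (kmul n cR K2 K1) T0 = of_int (chi rev0 * eps n (hat rev0) T0) * of_nat (card Z)"
proof -
  let ?k = "of_int (chi rev0 * eps n (hat rev0) T0) :: 'a"
  have "app (kmul n cR K2 K1) T0 = (\<Sum>S\<in>BC cR. K2 T0 S * app K1 S)" by (rule app_kmul[OF K2_kinv K1_kinv T0_BC])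
  also have "\<dots> = (\<Sum>\<pi>\<in>szperm. K2 T0 (act (hat \<pi>) R0) * app K1 (act (hat \<pi>) R0))" unfolding BC_R0(1) sum.reindex[OF BC_R0(2)] by simp
  also have "\<dots> = (\<Sum>\<pi>\<in>szperm. if rev0 \<circ> \<pi> \<in> Z then ?k else 0)"
  proof (rule sum.cong[OF refl])
    fix \<pi> assume pi: "\<pi> \<in> szperm"
    note h = hat_Sym[OF pi]
    show "K2 T0 (act (hat \<pi>) R0) * app K1 (act (hat \<pi>) R0) = (if rev0 \<circ> \<pi> \<in> Z then ?k else 0)"
    proof (cases "\<forall>b<N. t0 (\<pi> b) = t1 b")
      case False
      have "rev0 \<circ> \<pi> \<notin> Z" using False Z_reverse_iff[OF pi] by blast
      then show ?thesis using False by (simp only: K2_value[OF pi] if_False mult_zero_left)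
    next
      case True
      let ?r = "of_int (eps n (hat \<pi>) R0) :: 'a" and ?e = "of_int (eps n (hat \<pi>) T0) :: 'a"
      have "K2 T0 (act (hat \<pi>) R0) * app K1 (act (hat \<pi>) R0) = (?r * ?r) * (?e * ?e) * v (act (hat \<pi>) T0)"
        unfolding K2_value[OF pi] app_K1[OF pi] using True by (simp add: ac_simps)
      also have "\<dots> = v (act (hat \<pi>) T0)" by (simp only: eps_square_field mult_1)
      also have "\<dots> = (if rev0 \<circ> \<pi> \<in> Z then ?k else 0)"
      proof (cases "rev0 \<circ> \<pi> \<in> Z")
        case zZ: True
        let ?z = "rev0 \<circ> \<pi>"
        have z: "?z \<in> szperm" "\<forall>b<N. t0 (?z b) = t0 b" using zZ by (simp_all add: Z_def)
        have pz: "\<pi> = rev0 \<circ> ?z" using rev0_rev0 by (simp add: fun_eq_iff)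
        have "act (hat ?z) T0 = T0" unfolding T0_def by (subst W_orbit_iff[OF z(1)]) (use z(2) t0_less in auto)
        then have "act (hat \<pi>) T0 = act (hat rev0) T0" using hat_comp_act[OF C_szperm[OF rev0_C] z(1), of T0] pz by simp
        then show ?thesis using zZ v_orbit[OF rev0_C] by simp
      next
        case nZ: False
        have "\<not> (\<exists>\<sigma>\<in>C. act (hat \<pi>) T0 = act (hat \<sigma>) T0)"
        proof
          assume "\<exists>\<sigma>\<in>C. act (hat \<pi>) T0 = act (hat \<sigma>) T0"
          then obtain \<sigma> where s: "\<sigma> \<in> C" "act (hat \<pi>) T0 = act (hat \<sigma>) T0" by blast
          have "W (t0 \<circ> pinv \<pi>) = W (t0 \<circ> pinv \<sigma>)"
            using s(2) hat_act[OF pi, of t0] hat_act[OF C_szperm[OF s(1)], of t0] t0_less unfolding T0_def by simp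
          then have "\<forall>b<N. t0 (pinv \<pi> b) = t0 (pinv \<sigma> b)" by (simp add: W_eq_iff)
          then show False using nZ True s(1) unfolding Z_reverse_iff[OF pi] by blast
        qed
        then show ?thesis using nZ v_zero by simp
      qed
      finally show ?thesis .
    qed
  qed
  also have "\<dots> = (\<Sum>\<pi>\<in>{\<pi>\<in>szperm. rev0 \<circ> \<pi> \<in> Z}. ?k)" by (rule sum.inter_filter[OF finite_szperm, symmetric])
  also have "\<dots> = ?k * of_nat (card {\<pi>\<in>szperm. rev0 \<circ> \<pi> \<in> Z})" by simp
  also have "card {\<pi>\<in>szperm. rev0 \<circ> \<pi> \<in> Z} = card Z"
  proof (rule bij_betw_same_card)
    have cancel: "rev0 \<circ> (rev0 \<circ> \<pi>) = \<pi>" for \<pi> :: "nat \<Rightarrow> nat" using rev0_rev0 by (simp add: fun_eq_iff)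
    show "bij_betw (\<lambda>\<pi>. rev0 \<circ> \<pi>) {\<pi>\<in>szperm. rev0 \<circ> \<pi> \<in> Z} Z"
    proof (rule bij_betw_byWitness[where f'="\<lambda>\<pi>. rev0 \<circ> \<pi>"])
      have "rev0 \<circ> z \<in> szperm" if "z \<in> Z" for z using szperm_closed(1)[OF C_szperm[OF rev0_C]] that by (simp add: Z_def)
      then show "(\<lambda>\<pi>. rev0 \<circ> \<pi>) ` Z \<subseteq> {\<pi>\<in>szperm. rev0 \<circ> \<pi> \<in> Z}" by (auto simp only: image_subset_iff mem_Collect_eq cancel)
    qed (use cancel in auto)
  qed
  finally show ?thesis .
qed

lemma hat_inj: "\<pi> \<in> szperm \<Longrightarrow> \<rho> \<in> szperm \<Longrightarrow> hat \<pi> = hat \<rho> \<Longrightarrow> \<pi> = \<rho>"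
proof
  fix b assume z: "\<pi> \<in> szperm" "\<rho> \<in> szperm" and e: "hat \<pi> = hat \<rho>"
  show "\<pi> b = \<rho> b"
  proof (cases "b < N")
    case True
    note m = pt_mem[OF True sz_pos[OF True]]
    show ?thesis using hat_blk(2)[OF z(1) m] hat_blk(2)[OF z(2) m] e blk_pt[OF True sz_pos[OF True]] by simp
  next
    case False
    then show ?thesis using permutes_not_in[OF szpermD(1)[OF z(1)], of b] permutes_not_in[OF szpermD(1)[OF z(2)], of b] by simp
  qed
qed

lemma Z_closed: "z \<in> Z \<Longrightarrow> z' \<in> Z \<Longrightarrow> z \<circ> z' \<in> Z" "z \<in> Z \<Longrightarrow> pinv z \<in> Z" "id \<in> Z"
proof -
  show "id \<in> Z" using szperm_closed(3) by (simp add: Z_def)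
  show "z \<circ> z' \<in> Z" if "z \<in> Z" "z' \<in> Z" using that szperm_closed(1)[of z z'] szpermD(2)[of z'] by (simp add: Z_def)
  assume z: "z \<in> Z"
  then have zs: "z \<in> szperm" by (simp add: Z_def)
  have "t0 (pinv z b) = t0 b \<and> t1 (pinv z b) = t1 b" if b: "b < N" for b
  proof -
    have "pinv z b < N" by (rule szpermD(2)[OF szperm_closed(2)[OF zs] b])
    then have "t0 (z (pinv z b)) = t0 (pinv z b) \<and> t1 (z (pinv z b)) = t1 (pinv z b)" using z by (simp add: Z_def)
    then show ?thesis using permutes_inverses(1)[OF szpermD(1)[OF zs]] by simp
  qed
  then show "pinv z \<in> Z" using szperm_closed(2)[OF zs] by (simp add: Z_def)
qed

text \<open>A Sylow \<open>p\<close>-subgroup moves each point within a set of fewer than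
  \<open>p\<close> points, those at the same position of the blocks in one fibre. Its orbits have
  \<open>p\<close>-power size, so they are single points and the subgroup is trivial.\<close>

lemma Z_p_prime:
  assumes fiber: "\<And>b. b < N \<Longrightarrow> card {b'. b' < N \<and> sz b' = sz b \<and> t0 b' = t0 b \<and> t1 b' = t1 b} < p"
  shows "\<not> p dvd card Z"
proof -
  have Zs: "Z \<subseteq> szperm" by (auto simp: Z_def)
  have card: "card (hat ` Z) = card Z" by (rule card_image, rule inj_onI) (use hat_inj Zs in blast)
  have inv: "pinv (hat z) = hat (pinv z)" if "z \<in> Z" for z
  proof (rule inv_unique_comp)
    have zs: "z \<in> szperm" using that Zs by blast
    show "hat z \<circ> hat (pinv z) = id" unfolding hat_comp[OF zs szperm_closed(2)[OF zs], symmetric] permutes_inv_o(1)[OF szpermD(1)[OF zs]] by (rule hat_id)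
    show "hat (pinv z) \<circ> hat z = id" unfolding hat_comp[OF szperm_closed(2)[OF zs] zs, symmetric] permutes_inv_o(2)[OF szpermD(1)[OF zs]] by (rule hat_id)
  qed
  have H: "perm_subgroup (hat ` Z) (Sym n)"
    unfolding perm_subgroup_def
  proof (intro conjI ballI)
    show "hat ` Z \<subseteq> Sym n" using hat_Sym Zs by blast
    show "id \<in> hat ` Z" using Z_closed(3) hat_id by (metis imageI)
    fix a assume "a \<in> hat ` Z" then obtain z where z: "z \<in> Z" "a = hat z" by blast
    show "pinv a \<in> hat ` Z" unfolding z(2) inv[OF z(1)] using Z_closed(2)[OF z(1)] by blast
    fix b assume "b \<in> hat ` Z" then obtain y where y: "y \<in> Z" "b = hat y" by blast
    have "a \<circ> b = hat (z \<circ> y)" unfolding z y using hat_comp z(1) y(1) Zs by (metis subsetD)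
    then show "a \<circ> b \<in> hat ` Z" using Z_closed(1)[OF z(1) y(1)] by blast
  qed
  obtain P where P: "Defs.sylow p P (hat ` Z)" using sylow_exists[OF H prime] by blast
  have PH: "perm_subgroup P (hat ` Z)" and "\<exists>k. card P = p ^ k" and nd: "\<not> p dvd (card (hat ` Z) div card P)" using P by (auto simp: Defs.sylow_def)
  then obtain k where k: "card P = p ^ k" by blast
  have PS: "perm_subgroup P (Sym n)" by (rule perm_subgroup_trans[OF PH H])
  have triv: "h x = x" if h: "h \<in> P" and x: "x \<in> {1..n}" for h x
  proof -
    let ?F = "{b'. b' < N \<and> sz b' = sz (blk x) \<and> t0 b' = t0 (blk x) \<and> t1 b' = t1 (blk x)}"
    have "(\<lambda>h. h x) ` P \<subseteq> (\<lambda>b. pt b (pos x)) ` ?F"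
    proof
      fix y assume "y \<in> (\<lambda>h. h x) ` P"
      then obtain z where z: "z \<in> Z" "y = hat z x" using perm_subgroupD(1)[OF PH] by blast
      have "z (blk x) \<in> ?F" using z(1) blk_less[OF x] szpermD(2,3)[of z "blk x"] Zs by (auto simp: Z_def)
      then show "y \<in> (\<lambda>b. pt b (pos x)) ` ?F" using z(2) x by (intro image_eqI[of _ _ "z (blk x)"]) (simp_all add: hat_def del: atLeastAtMost_iff)
    qed
    then have "card ((\<lambda>h. h x) ` P) \<le> card ((\<lambda>b. pt b (pos x)) ` ?F)" by (intro card_mono) auto
    also have "\<dots> \<le> card ?F" by (rule card_image_le) simp
    also have "\<dots> < p" by (rule fiber[OF blk_less[OF x]])
    finally have lt: "card ((\<lambda>h. h x) ` P) < p" .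
    have "card ((\<lambda>h. h x) ` P) dvd p ^ k" using point_orbit_card[OF PS, of x] k by (metis dvd_triv_left)
    then obtain j where j: "card ((\<lambda>h. h x) ` P) = p ^ j" using divides_primepow_nat[OF prime] by blast
    have "j = 0"
    proof (rule ccontr)
      assume "j \<noteq> 0"
      then have "p ^ 1 \<le> p ^ j" using prime prime_gt_0_nat by (intro power_increasing) (auto simp: Suc_le_eq)
      then show False using lt j by simp
    qed
    then have "card ((\<lambda>h. h x) ` P) = 1" using j by simp
    then obtain y where y: "(\<lambda>h. h x) ` P = {y}" using card_1_singletonE by blast
    have "h x \<in> (\<lambda>h. h x) ` P" "id x \<in> (\<lambda>h. h x) ` P" using h perm_subgroupD(2)[OF PH] by blast+
    then show ?thesis unfolding y by simp
  qed
  have "P = {id}"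
  proof
    show "{id} \<subseteq> P" using perm_subgroupD(2)[OF PH] by simp
    show "P \<subseteq> {id}"
    proof
      fix h assume h: "h \<in> P"
      have "h x = x" for x
        by (cases "x \<in> {1..n}") (use triv[OF h] permutes_not_in[OF SymD(1)[OF perm_subgroupD(1)[OF PS h]]] in blast)+
      then show "h \<in> {id}" by (simp add: fun_eq_iff)
    qed
  qed
  then show ?thesis using nd card by simp
qed

text \<open>As \<open>phi\<close> does not vanish on \<open>K2\<close> after \<open>K1\<close>, the
  identity of \<open>Y\<close> factors through the module of content \<open>cR\<close>. There the
  stabiliser of \<open>R0\<close> is the Young subgroup of the blocks, in which \<open>Q\<close> has
  index prime to \<open>p\<close>, and \<open>stabilizer_rel_proj\<close> applies.\<close>

lemma upper_bound:
  fixes Y :: "'a rep"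
  assumes fiber: "\<And>b. b < N \<Longrightarrow> card {b'. b' < N \<and> sz b' = sz b \<and> t0 b' = t0 b \<and> t1 b' = t1 b} < p"
    and Qs: "Defs.sylow p Q {g\<in>Sym n. \<forall>x\<in>{1..n}. blk (g x) = blk x}"
    and Y: "indecomposable (Sym n) Y" and i0: "i0 \<in> rep_hom (Sym n) Y (mono_rep n c0)" and p0: "p0 \<in> rep_hom (Sym n) (mono_rep n c0) Y"
    and pi: "p0 * i0 = 1\<^sub>m (fst Y)" and ne: "phi (i0 * p0) \<noteq> 0"
  shows "rel_proj (Sym n) Q Y"
proof -
  note rY = indecomposable_rep(1)[OF Y]
  let ?M = "mono_rep n c0 :: 'a rep" and ?R = "mono_rep n cR :: 'a rep"
  let ?k1 = "kmat n cR c0 K1" and ?k2 = "kmat n c0 cR K2"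
  have k1: "?k1 \<in> rep_hom (Sym n) ?M ?R" and k2: "?k2 \<in> rep_hom (Sym n) ?R ?M" using K1_kinv K2_kinv by (simp_all add: kmat_hom_iff)
  let ?f = "?k2 * ?k1"
  have f: "?f \<in> rep_hom (Sym n) ?M ?M" by (rule rep_hom_mult[OF is_rep_mono is_rep_mono is_rep_mono k1 k2])
  have "chi rev0 * eps n (hat rev0) T0 = 1 \<or> chi rev0 * eps n (hat rev0) T0 = - 1" using chi_cases[of rev0] eps_cases[of n "hat rev0" T0] by auto
  moreover have "of_nat (card Z) \<noteq> (0::'a)" using Z_p_prime[OF fiber] char by (simp add: of_nat_eq_0_iff_char_dvd)
  ultimately have "phi ?f \<noteq> 0" unfolding kmat_mult phi_kmat phi_K2K1 by (auto simp del: of_int_mult)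
  then have "rep_unit (Sym n) Y (p0 * ?f * i0)" by (rule character_unit[OF is_rep_mono phi_character Y i0 p0 f pi ne])
  moreover have "p0 * ?f * i0 = (p0 * ?k2) * (?k1 * i0)"
  proof -
    have d: "dim_row i0 = card (wcont n c0)" "dim_col p0 = card (wcont n c0)" using rep_homD[OF i0] rep_homD[OF p0] by auto
    have "p0 * ?f = p0 * ?k2 * ?k1" by (rule mult_assoc_dim[symmetric]) (simp_all add: d)
    then have "p0 * ?f * i0 = p0 * ?k2 * ?k1 * i0" by simp
    also have "\<dots> = (p0 * ?k2) * (?k1 * i0)" by (rule mult_assoc_dim) (simp_all add: d)
    finally show ?thesis .
  qed
  ultimately have u: "rep_unit (Sym n) Y ((p0 * ?k2) * (?k1 * i0))" by simp
  have "retract (Sym n) Y ?R"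
    by (rule retract_unit[OF rY is_rep_mono rep_hom_mult[OF rY is_rep_mono is_rep_mono i0 k1] rep_hom_mult[OF is_rep_mono is_rep_mono rY k2 p0] u])
  then obtain b a where ab: "b \<in> rep_hom (Sym n) Y ?R" "a \<in> rep_hom (Sym n) ?R Y" "a * b = 1\<^sub>m (fst Y)" by (rule retractE)
  show ?thesis
  proof (rule stabilizer_rel_proj[OF Q rY ab(2,1,3) R0_wcont])
    show "act q R0 = R0" if "q \<in> Q" for q by (rule act_Q[OF R0_words _ that]) (simp add: R0_def con_W)
    show "of_nat (card {g\<in>Sym n. act g R0 = R0} div card Q) \<noteq> (0::'a)" unfolding stab_R0 using Qs char by (simp add: of_nat_eq_0_iff_char_dvd Defs.sylow_def)
  qed
qed

end

section \<open>Blocks from the boxes of p-adic expansions\<close>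

lemma entry_scale: "entry (scale q a) j = q * entry a j" by (cases j) (auto simp: entry_def scale_def)

lemma entry_pos: "0 < entry a (Suc j) \<Longrightarrow> j < length a" by (simp add: entry_Suc split: if_splits)

lemma sum_scale: "sum_list (scale q a) = q * sum_list a" by (simp add: scale_def sum_list_const_mult)

lemma scale_partition_iff: assumes q: "0 < q" shows "is_partition (scale q a) \<longleftrightarrow> is_partition a"
proof -
  have "is_composition (scale q a) \<longleftrightarrow> is_composition a" using q by (cases "a = []") (simp_all add: is_composition_def scale_def last_map)
  then show ?thesis using q by (simp add: is_partition_def scale_def sorted_wrt_map)
qed

text \<open>\<open>r\<close> bounds the exponents; the digits of \<open>mu\<close> stop one earlier
  because multiplication by \<open>p\<close> shifts them up by one. The parts of \<open>rho\<close>
  may come in any order, as they are matched with boxes by a bijection.\<close>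

locale cell_data =
  fixes n p :: nat and ty :: "'a::field itself" and lam mu rho :: "nat list" and r :: nat and l m :: "nat \<Rightarrow> nat list"
  assumes prime: "prime p" and odd_p: "odd p" and char: "CHAR('a) = p"
    and lam: "is_partition lam" and mu: "is_partition mu" and tot: "sum_list lam + p * sum_list mu = n"
    and l: "\<And>i. i \<le> r \<Longrightarrow> is_partition (l i)" and m: "\<And>i. i < r \<Longrightarrow> is_partition (m i)"
    and lam_exp: "\<And>j. entry lam j = (\<Sum>i<Suc r. p ^ i * entry (l i) j)"
    and mu_exp: "\<And>j. entry mu j = (\<Sum>i<r. p ^ i * entry (m i) j)"
    and rho_set: "set rho \<subseteq> {p ^ i | i. i \<le> r}"
    and rho_count: "\<And>i. i \<le> r \<Longrightarrow> count_list rho (p ^ i) = sum_list (l i) + (if i = 0 then 0 else sum_list (m (i - 1)))"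
begin

text \<open>Level \<open>i\<close> collects the boxes that become blocks of size
  \<open>p ^ i\<close>: those of \<open>l i\<close> as even ones and those of
  \<open>m (i - 1)\<close> as odd ones, since the odd rows are those of \<open>p\<close> times
  \<open>mu\<close>. The flag marks the odd diagram.\<close>

definition shape :: "nat \<Rightarrow> bool \<Rightarrow> nat list" where
  "shape i o' = (if o' then (if i = 0 then [] else m (i - 1)) else l i)"

lemma shape_partition: "i \<le> r \<Longrightarrow> is_partition (shape i o')"
  using l m by (auto simp: shape_def is_partition_def is_composition_def)

definition cells :: "(nat \<times> bool \<times> nat \<times> nat) set" where
  "cells = {(i, o', j, k). i \<le> r \<and> k < entry (shape i o') (Suc j)}"

definition rows :: "nat \<Rightarrow> bool \<Rightarrow> nat \<Rightarrow> (nat \<times> bool \<times> nat \<times> nat) set" where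
  "rows i o' j = (\<lambda>k. (i, o', j, k)) ` {..<entry (shape i o') (Suc j)}"

lemma p_gt1: "1 < p" using prime by (rule prime_gt_1_nat)

lemma level_cells:
  assumes i: "i \<le> r"
  shows "finite {c\<in>cells. fst c = i}" "card {c\<in>cells. fst c = i} = sum_list (shape i False) + sum_list (shape i True)"
proof -
  define D where "D o' = Sigma {..<length (shape i o')} (\<lambda>j. {..<entry (shape i o') (Suc j)})" for o'
  have cD: "card (D o') = sum_list (shape i o')" for o' unfolding D_def by (simp add: sum_list_entry[of "shape i o'" "length (shape i o')"])
  have fD: "finite (D o')" for o' by (simp add: D_def)
  have eq: "{c\<in>cells. fst c = i} = (\<lambda>(j,k). (i, False, j, k)) ` D False \<union> (\<lambda>(j,k). (i, True, j, k)) ` D True" (is "_ = ?A \<union> ?B")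
  proof (intro Set.set_eqI iffI)
    fix c assume "c \<in> {c\<in>cells. fst c = i}"
    then obtain o' j k where c: "c = (i, o', j, k)" "k < entry (shape i o') (Suc j)" by (auto simp: cells_def)
    then have "(j,k) \<in> D o'" by (auto simp: D_def entry_Suc split: if_splits)
    then show "c \<in> ?A \<union> ?B" using c(1) by (cases o') force+
  qed (use i in \<open>auto simp: cells_def D_def\<close>)
  show "finite {c\<in>cells. fst c = i}" unfolding eq using fD by simp
  have "card (?A \<union> ?B) = card ?A + card ?B" by (rule card_Un_disjoint) (use fD in auto)
  also have "card ?A = card (D False)" by (rule card_image) (auto simp: inj_on_def)
  also have "card ?B = card (D True)" by (rule card_image) (auto simp: inj_on_def)
  finally show "card {c\<in>cells. fst c = i} = sum_list (shape i False) + sum_list (shape i True)" unfolding eq cD .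
qed

lemma finite_cells: "finite cells"
proof -
  have "cells = (\<Union>i\<in>{..r}. {c\<in>cells. fst c = i})" by (auto simp: cells_def)
  then show ?thesis using level_cells(1) by (metis (no_types, lifting) atMost_iff finite_UN_I finite_atMost)
qed

lemma count_card: "count_list rho z = card {b\<in>{..<length rho}. rho ! b = z}"
  by (simp add: count_list_eq_length_filter length_filter_conv_card eq_commute[of z])

text \<open>The hypotheses on \<open>rho\<close> say that the parts equal to \<open>p ^ i\<close>
  are as many as the boxes of level \<open>i\<close>, and levels can be recovered from powers since
  \<open>p > 1\<close>.\<close>

lemma cell_bijection: "\<exists>h. bij_betw h {..<length rho} cells \<and> (\<forall>b<length rho. p ^ fst (h b) = rho ! b)"
proof -
  have "\<exists>h. bij_betw h {..<length rho} cells \<and> (\<forall>b\<in>{..<length rho}. p ^ fst (h b) = rho ! b)"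
  proof (rule bij_of_fibre_cards[OF _ finite_cells])
    fix z
    show "card {b\<in>{..<length rho}. rho ! b = z} = card {c\<in>cells. p ^ fst c = z}"
    proof (cases "\<exists>i\<le>r. z = p ^ i")
      case True
      then obtain i where i: "i \<le> r" "z = p ^ i" by blast
      have "{c\<in>cells. p ^ fst c = z} = {c\<in>cells. fst c = i}" using p_gt1 i(2) by auto
      then have "card {c\<in>cells. p ^ fst c = z} = sum_list (l i) + (if i = 0 then 0 else sum_list (m (i - 1)))" using level_cells(2)[OF i(1)] by (simp add: shape_def)
      then show ?thesis using rho_count[OF i(1)] i(2) by (simp add: count_card)
    next
      case False
      then have "{c\<in>cells. p ^ fst c = z} = {}" by (auto simp: cells_def)
      moreover have "{b\<in>{..<length rho}. rho ! b = z} = {}" using False rho_set by (auto dest!: nth_mem)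
      ultimately show ?thesis by (simp only: card.empty)
    qed
  qed simp
  then show ?thesis by auto
qed

definition cell :: "nat \<Rightarrow> nat \<times> bool \<times> nat \<times> nat" where
  "cell = (SOME h. bij_betw h {..<length rho} cells \<and> (\<forall>b<length rho. p ^ fst (h b) = rho ! b))"

lemma cell: "bij_betw cell {..<length rho} cells" "b < length rho \<Longrightarrow> p ^ fst (cell b) = rho ! b"
  using someI_ex[OF cell_bijection] unfolding cell_def by blast+

definition lev :: "nat \<Rightarrow> nat" where "lev b = fst (cell b)"
definition par :: "nat \<Rightarrow> bool" where "par b = fst (snd (cell b))"
definition row :: "nat \<Rightarrow> nat" where "row b = fst (snd (snd (cell b)))"
definition cln :: "nat \<Rightarrow> nat" where "cln b = snd (snd (snd (cell b)))"

lemma cell_eq: "cell b = (lev b, par b, row b, cln b)" by (simp add: lev_def par_def row_def cln_def)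

lemma cell_mem: assumes "b < length rho" shows "lev b \<le> r" "cln b < entry (shape (lev b) (par b)) (Suc (row b))"
proof -
  have "cell b \<in> cells" using bij_betwE[OF cell(1)] assms by blast
  then show "lev b \<le> r" "cln b < entry (shape (lev b) (par b)) (Suc (row b))" by (simp_all add: cells_def cell_eq)
qed

lemma cell_surj: "i \<le> r \<Longrightarrow> k < entry (shape i o') (Suc j) \<Longrightarrow> \<exists>b<length rho. lev b = i \<and> par b = o' \<and> row b = j \<and> cln b = k"
proof -
  assume "i \<le> r" "k < entry (shape i o') (Suc j)"
  then have "(i, o', j, k) \<in> cells" by (simp add: cells_def)
  then have "(i, o', j, k) \<in> cell ` {..<length rho}" using bij_betw_imp_surj_on[OF cell(1)] by simp
  then show ?thesis by (auto simp: cell_eq)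
qed

lemma cell_inj: "b < length rho \<Longrightarrow> b' < length rho \<Longrightarrow> lev b = lev b' \<Longrightarrow> par b = par b' \<Longrightarrow> row b = row b' \<Longrightarrow> cln b = cln b' \<Longrightarrow> b = b'"
  using inj_onD[OF bij_betw_imp_inj_on[OF cell(1)], of b b'] by (simp add: cell_eq)

lemma rho_nth: "b < length rho \<Longrightarrow> rho ! b = p ^ lev b" using cell(2)[of b] by (simp add: lev_def)

lemma weighted_sum:
  assumes S: "finite S" "S \<subseteq> cells"
  shows "(\<Sum>b\<in>{b. b < length rho \<and> cell b \<in> S}. rho ! b) = (\<Sum>c\<in>S. p ^ fst c)"
proof (rule sum.reindex_bij_betw[where h=cell and g="\<lambda>c. p ^ fst c" and T=S, THEN trans[rotated]])
  show "bij_betw cell {b. b < length rho \<and> cell b \<in> S} S"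
    unfolding bij_betw_def
  proof
    show "inj_on cell {b. b < length rho \<and> cell b \<in> S}" by (rule inj_on_subset[OF bij_betw_imp_inj_on[OF cell(1)]]) auto
    show "cell ` {b. b < length rho \<and> cell b \<in> S} = S"
    proof
      show "S \<subseteq> cell ` {b. b < length rho \<and> cell b \<in> S}"
      proof
        fix c assume c: "c \<in> S"
        then have "c \<in> cell ` {..<length rho}" using bij_betw_imp_surj_on[OF cell(1)] S(2) by blast
        then show "c \<in> cell ` {b. b < length rho \<and> cell b \<in> S}" using c by blast
      qed
    qed blast
  qed
  show "(\<Sum>b\<in>{b. b < length rho \<and> cell b \<in> S}. rho ! b) = (\<Sum>b\<in>{b. b < length rho \<and> cell b \<in> S}. p ^ fst (cell b))"
    by (rule sum.cong) (auto simp: cell(2))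
qed

text \<open>Each box of level \<open>i\<close> has weight \<open>p ^ i\<close>, so the row sums are
  the expansions of \<open>lam\<close> and \<open>scale p mu\<close>. This gives the word
  \<open>T0\<close> its content in \<open>block_content\<close>.\<close>

lemma row_weight:
  "(\<Sum>b\<in>{b. b < length rho \<and> par b = o' \<and> row b = j}. rho ! b) = (\<Sum>i\<le>r. p ^ i * entry (shape i o') (Suc j))"
proof -
  let ?S = "\<Union>i\<in>{..r}. rows i o' j"
  have fin: "finite (rows i o' j)" for i by (simp add: rows_def)
  have "{b. b < length rho \<and> par b = o' \<and> row b = j} = {b. b < length rho \<and> cell b \<in> ?S}"
    using cell_mem by (auto simp: rows_def cell_eq)
  moreover have "?S \<subseteq> cells" by (auto simp: rows_def cells_def)
  ultimately have "(\<Sum>b\<in>{b. b < length rho \<and> par b = o' \<and> row b = j}. rho ! b) = (\<Sum>c\<in>?S. p ^ fst c)" using weighted_sum[of ?S] fin by simp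
  also have "\<dots> = (\<Sum>i\<le>r. \<Sum>c\<in>rows i o' j. p ^ fst c)" by (rule sum.UNION_disjoint) (auto simp: fin rows_def)
  also have "\<dots> = (\<Sum>i\<le>r. p ^ i * entry (shape i o') (Suc j))"
  proof (rule sum.cong[OF refl])
    fix i
    have "(\<Sum>c\<in>rows i o' j. p ^ fst c) = (\<Sum>k<entry (shape i o') (Suc j). p ^ i)" unfolding rows_def by (subst sum.reindex) (auto simp: inj_on_def)
    then show "(\<Sum>c\<in>rows i o' j. p ^ fst c) = p ^ i * entry (shape i o') (Suc j)" by simp
  qed
  finally show ?thesis .
qed

lemma row_weight_even: "(\<Sum>b\<in>{b. b < length rho \<and> \<not> par b \<and> row b = j}. rho ! b) = entry lam (Suc j)"
  using row_weight[of False j] by (simp add: lam_exp shape_def lessThan_Suc_atMost)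

lemma row_weight_odd: "(\<Sum>b\<in>{b. b < length rho \<and> par b \<and> row b = j}. rho ! b) = entry (scale p mu) (Suc j)"
proof -
  have "(\<Sum>i\<le>r. p ^ i * entry (shape i True) (Suc j)) = (\<Sum>i<Suc r. p ^ i * entry (shape i True) (Suc j))" by (simp only: lessThan_Suc_atMost)
  also have "\<dots> = (\<Sum>i<r. p ^ Suc i * entry (m i) (Suc j))" unfolding sum.lessThan_Suc_shift by (simp add: shape_def entry_def)
  also have "\<dots> = p * entry mu (Suc j)" unfolding mu_exp sum_distrib_left by (simp add: mult.assoc)
  finally show ?thesis using row_weight[of True j] by (simp add: entry_scale)
qed

lemma rho_pos: "b < length rho \<Longrightarrow> 0 < rho ! b" using rho_nth[of b] p_gt1 by simp

lemma scale_partition: "is_partition (scale p mu)" using mu scale_partition_iff p_gt1 by simp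

lemma row_less_n: assumes b: "b < length rho" shows "row b < n"
proof (cases "par b")
  case True
  have "rho ! b \<le> (\<Sum>b\<in>{b'. b' < length rho \<and> par b' \<and> row b' = row b}. rho ! b)" by (rule member_le_sum) (use b True in auto)
  then have "0 < entry (scale p mu) (Suc (row b))" using rho_pos[OF b] row_weight_odd[of "row b"] by simp
  then have "row b < length (scale p mu)" by (rule entry_pos)
  also have "\<dots> \<le> n" using partition_length[OF scale_partition] tot by (simp add: sum_scale)
  finally show ?thesis .
next
  case False
  have "rho ! b \<le> (\<Sum>b\<in>{b'. b' < length rho \<and> \<not> par b' \<and> row b' = row b}. rho ! b)" by (rule member_le_sum) (use b False in auto)
  then have "0 < entry lam (Suc (row b))" using rho_pos[OF b] row_weight_even[of "row b"] by simp
  then have "row b < length lam" by (rule entry_pos)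
  also have "\<dots> \<le> n" using partition_length[OF lam] tot by simp
  finally show ?thesis .
qed

lemma sum_rho: "sum_list rho = n"
proof -
  have len: "length lam \<le> n" "length (scale p mu) \<le> n" using partition_length[OF lam] partition_length[OF scale_partition] tot by (simp_all add: sum_scale)
  have g: "(\<Sum>j<n. \<Sum>b\<in>{b\<in>A. row b = j}. rho ! b) = (\<Sum>b\<in>A. rho ! b)" if "A \<subseteq> {..<length rho}" for A
    by (rule sum.group) (use that row_less_n finite_subset[OF that] in auto)
  have "sum_list rho = (\<Sum>b<length rho. rho ! b)" by (simp add: sum_list_sum_nth atLeast0LessThan)
  also have "\<dots> = (\<Sum>b\<in>{b\<in>{..<length rho}. \<not> par b} \<union> {b\<in>{..<length rho}. par b}. rho ! b)" by (rule sum.cong) auto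
  also have "\<dots> = (\<Sum>b\<in>{b\<in>{..<length rho}. \<not> par b}. rho ! b) + (\<Sum>b\<in>{b\<in>{..<length rho}. par b}. rho ! b)" by (rule sum.union_disjoint) auto
  also have "\<dots> = (\<Sum>j<n. entry lam (Suc j)) + (\<Sum>j<n. entry (scale p mu) (Suc j))"
    unfolding g[of "{b\<in>{..<length rho}. \<not> par b}", OF Collect_restrict, symmetric] g[of "{b\<in>{..<length rho}. par b}", OF Collect_restrict, symmetric]
      row_weight_even[symmetric] row_weight_odd[symmetric] by (simp add: conj_assoc)
  also have "\<dots> = n" using sum_list_entry[OF len(1)] sum_list_entry[OF len(2)] tot by (simp add: sum_scale)
  finally show ?thesis .
qed

section \<open>The block system of the boxes\<close>

definition tz :: "nat \<Rightarrow> nat" where "tz b = (if par b then n + row b else row b)"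
text \<open>Level and parity in the label keep the columns of different diagrams apart.\<close>

definition cl :: "nat \<Rightarrow> nat \<times> bool \<times> nat" where "cl b = (lev b, par b, cln b)"

lemma tz_par: "b < length rho \<Longrightarrow> n \<le> tz b \<longleftrightarrow> par b" using row_less_n[of b] by (simp add: tz_def)

text \<open>The blocks are the orbits of the Sylow subgroup by \<open>sylow_orbit\<close>. Columns
  are closed downwards because the rows of a partition decrease, and odd blocks have more than one
  point because level 0 has no odd boxes.\<close>

lemma block_system:
  assumes P: "Defs.sylow p P (young rho)" and e: "card P = p ^ e"
  shows "block_system TYPE('a) n p e (length rho) P (blkof rho) (\<lambda>x. x - off rho (blkof rho x) - 1) (\<lambda>b i. off rho b + i + 1) ((!) rho) tz cl"
proof
  have yS: "perm_subgroup (young rho) (Sym n)" using young_subgroup[of rho] by (simp only: sum_rho)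
  have PH: "perm_subgroup P (young rho)" using P by (simp add: Defs.sylow_def)
  show "prime p" "odd p" "CHAR('a) = p" by (rule prime, rule odd_p, rule char)
  show "perm_subgroup P (Sym n)" by (rule perm_subgroup_trans[OF PH yS])
  show "card P = p ^ e" by (rule e)
  note bounds = blkof_bounds[of _ rho, unfolded sum_rho]
  show "blkof rho x < length rho" if "x \<in> {1..n}" for x by (rule bounds(1)[OF that])
  show "x - off rho (blkof rho x) - 1 < rho ! blkof rho x" if "x \<in> {1..n}" for x using bounds[OF that] by (simp add: off_Suc)
  show "off rho (blkof rho x) + (x - off rho (blkof rho x) - 1) + 1 = x" if "x \<in> {1..n}" for x using bounds[OF that] by simp
  have blk: "blkof rho (off rho b + i + 1) = b" if "b < length rho" "i < rho ! b" for b i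
    by (rule blkof_unique) (use that in \<open>auto simp: off_Suc\<close>)
  show "blkof rho (off rho b + i + 1) = b" if "b < length rho" "i < rho ! b" for b i by (rule blk[OF that])
  show "off rho b + i + 1 - off rho (blkof rho (off rho b + i + 1)) - 1 = i" if "b < length rho" "i < rho ! b" for b i unfolding blk[OF that] by simp
  show "off rho b + i + 1 \<in> {1..n}" if "b < length rho" "i < rho ! b" for b i
  proof -
    have "off rho (Suc b) \<le> off rho (length rho)" using that by (intro off_mono) simp
    then show ?thesis using that by (simp add: off_Suc off_length sum_rho)
  qed
  show "odd (rho ! b)" if "b < length rho" for b using rho_nth[OF that] odd_p by simp
  show "(\<lambda>q. q x) ` P = {y\<in>{1..n}. blkof rho y = blkof rho x}" if x: "x \<in> {1..n}" for x
  proof -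
    have orb: "(\<lambda>g. g x) ` young rho = {y\<in>{1..n}. blkof rho y = blkof rho x}" using young_orbit[of x rho] x by (simp only: sum_rho)
    have "card ((\<lambda>g. g x) ` young rho) = p ^ lev (blkof rho x)" unfolding orb using card_block[OF bounds(1)[OF x]] rho_nth[OF bounds(1)[OF x]] by (simp only: sum_rho)
    then show ?thesis using sylow_orbit[OF yS P prime] orb by simp
  qed
  show "tz b < 2 * n" if "b < length rho" for b using row_less_n[OF that] by (simp add: tz_def)
  show "rho ! b = rho ! b'" if "b < length rho" "b' < length rho" "cl b = cl b'" for b b' using that rho_nth by (simp add: cl_def)
  show "(n \<le> tz b) = (n \<le> tz b')" if "b < length rho" "b' < length rho" "cl b = cl b'" for b b' using that tz_par by (simp add: cl_def)
  show "b = b'" if "b < length rho" "b' < length rho" "cl b = cl b'" "tz b = tz b'" for b b'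
    using that cell_inj[OF that(1,2)] by (simp add: cl_def tz_def split: if_splits)
  show "\<exists>b'<length rho. cl b' = cl b \<and> tz b' = j" if b: "b < length rho" and j: "j \<le> tz b" "(n \<le> j) = (n \<le> tz b)" for b j
  proof -
    define j' where "j' = (if par b then j - n else j)"
    have "j' \<le> row b" using j tz_par[OF b] by (auto simp: j'_def tz_def)
    then have "entry (shape (lev b) (par b)) (Suc (row b)) \<le> entry (shape (lev b) (par b)) (Suc j')" by (rule entry_antimono[OF shape_partition[OF cell_mem(1)[OF b]]])
    then have "cln b < entry (shape (lev b) (par b)) (Suc j')" using cell_mem(2)[OF b] by simp
    then obtain b' where "b' < length rho" "lev b' = lev b" "par b' = par b" "row b' = j'" "cln b' = cln b" using cell_surj[OF cell_mem(1)[OF b]] by blast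
    then show ?thesis using j tz_par[OF b] by (intro exI[of _ b']) (auto simp: cl_def tz_def j'_def)
  qed
  show "1 < rho ! b" if b: "b < length rho" "n \<le> tz b" for b
  proof -
    have "par b" using b tz_par by blast
    then have "lev b \<noteq> 0" using cell_mem(2)[OF b(1)] by (cases "lev b = 0") (simp_all add: shape_def entry_def)
    then show ?thesis using rho_nth[OF b(1)] one_less_power[OF p_gt1, of "lev b"] by simp
  qed
qed

lemma block_content:
  assumes "block_system TYPE('a) n p e (length rho) P (blkof rho) (\<lambda>x. x - off rho (blkof rho x) - 1) (\<lambda>b i. off rho b + i + 1) ((!) rho) tz cl"
  shows "block_system.c0 n (blkof rho) tz = cont n lam (scale p mu)"
proof
  interpret B: block_system n p e "length rho" "TYPE('a)" P "blkof rho" "\<lambda>x. x - off rho (blkof rho x) - 1" "\<lambda>b i. off rho b + i + 1" "(!) rho" tz cl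
    by (rule assms)
  fix k
  let ?B = "{b. b < length rho \<and> tz b = k}" and ?A = "{x\<in>{1..n}. tz (blkof rho x) = k}"
  have "B.c0 k = card ?A" unfolding B.c0_def content_def B.T0_def by (rule arg_cong[where f=card], rule Collect_cong) (use B.W_at in auto)
  also have "\<dots> = (\<Sum>b\<in>?B. card {x\<in>?A. blkof rho x = b})"
    unfolding card_eq_sum by (rule sum.group[symmetric]) (use B.blk_less in auto)
  also have "\<dots> = (\<Sum>b\<in>?B. rho ! b)"
  proof (rule sum.cong[OF refl])
    fix b assume b: "b \<in> ?B"
    then have "{x\<in>?A. blkof rho x = b} = {x\<in>{1..n}. blkof rho x = b}" by auto
    then show "card {x\<in>?A. blkof rho x = b} = rho ! b" using card_block[of b rho] b by (simp only: sum_rho mem_Collect_eq)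
  qed
  also have "\<dots> = cont n lam (scale p mu) k"
  proof (cases "k < n")
    case True
    then have "?B = {b. b < length rho \<and> \<not> par b \<and> row b = k}" by (auto simp: tz_def split: if_splits)
    then show ?thesis using row_weight_even[of k] True by (simp add: cont_def)
  next
    case False
    then have "?B = {b. b < length rho \<and> par b \<and> row b = k - n}" using row_less_n by (force simp: tz_def split: if_splits)
    then show ?thesis using row_weight_odd[of "k - n"] False by (simp add: cont_def)
  qed
  finally show "B.c0 k = cont n lam (scale p mu) k" .
qed

text \<open>A fibre fixes the diagram, the row and the column height \<open>h\<close>. The columns
  of height \<open>h\<close> of a partition are counted by the difference of its parts
  \<open>h\<close> and \<open>h + 1\<close>, which is below \<open>p\<close> for a restricted
  partition.\<close>

lemma block_fibres:
  assumes "block_system TYPE('a) n p e (length rho) P (blkof rho) (\<lambda>x. x - off rho (blkof rho x) - 1) (\<lambda>b i. off rho b + i + 1) ((!) rho) tz cl"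
    and restr: "\<And>i. i \<le> r \<Longrightarrow> p_restricted p (l i)" "\<And>i. i < r \<Longrightarrow> p_restricted p (m i)" and b: "b < length rho"
  shows "card {b'. b' < length rho \<and> rho ! b' = rho ! b \<and> tz b' = tz b \<and>
      block_system.t1 n (length rho) tz cl b' = block_system.t1 n (length rho) tz cl b} < p"
proof -
  interpret B: block_system n p e "length rho" "TYPE('a)" P "blkof rho" "\<lambda>x. x - off rho (blkof rho x) - 1" "\<lambda>b i. off rho b + i + 1" "(!) rho" tz cl
    by (rule assms(1))
  let ?s = "shape (lev b) (par b)" and ?h = "B.hgt b"
  have base: "B.base b = (if par b then n else 0)" if "b < length rho" for b using tz_par[OF that] by (simp add: B.base_def)
  \<comment> \<open>The column of \<open>b\<close> reaches row \<open>hgt b - 1\<close> and no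
    further when rows are counted from 0, whereas \<open>entry\<close> counts from 1.\<close>
  have height: "entry (shape (lev b) (par b)) (Suc (B.hgt b)) \<le> cln b \<and> cln b < entry (shape (lev b) (par b)) (B.hgt b) \<and> 1 \<le> B.hgt b" if b: "b < length rho" for b
  proof (intro conjI)
    show h1: "1 \<le> B.hgt b" using B.letter_bounds[OF b] by simp
    then have "B.base b + (B.hgt b - 1) \<in> tz ` B.colm (cl b)" unfolding B.column_letters[OF b] by simp
    then obtain b2 where b2: "b2 < length rho" "cl b2 = cl b" "tz b2 = B.base b + (B.hgt b - 1)" by (auto simp: B.colm_def)
    then have "row b2 = B.hgt b - 1" "lev b2 = lev b" "par b2 = par b" "cln b2 = cln b" using base[OF b] by (auto simp: tz_def cl_def split: if_splits)
    then show "cln b < entry (shape (lev b) (par b)) (B.hgt b)" using cell_mem(2)[OF b2(1)] h1 by simp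
    show "entry (shape (lev b) (par b)) (Suc (B.hgt b)) \<le> cln b"
    proof (rule ccontr)
      assume "\<not> ?thesis"
      then obtain b3 where b3: "b3 < length rho" "lev b3 = lev b" "par b3 = par b" "row b3 = B.hgt b" "cln b3 = cln b"
        using cell_surj[OF cell_mem(1)[OF b], of "cln b" "par b" "B.hgt b"] by (auto simp: not_le)
      then have "B.base b + B.hgt b \<in> tz ` B.colm (cl b)" using base[OF b] by (intro image_eqI[of _ _ b3]) (auto simp: tz_def B.colm_def cl_def)
      then show False unfolding B.column_letters[OF b] by simp
    qed
  qed
  let ?F = "{b'. b' < length rho \<and> rho ! b' = rho ! b \<and> tz b' = tz b \<and> B.t1 b' = B.t1 b}"
  have F: "lev b' = lev b \<and> par b' = par b \<and> row b' = row b \<and> B.hgt b' = ?h" if "b' \<in> ?F" for b'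
  proof -
    have b': "b' < length rho" "rho ! b' = rho ! b" "tz b' = tz b" "B.t1 b' = B.t1 b" using that by auto
    have lv: "lev b' = lev b" using b'(2) rho_nth[OF b] rho_nth[OF b'(1)] p_gt1 by simp
    have pr: "par b' = par b" using tz_par[OF b] tz_par[OF b'(1)] b'(3) by simp
    have rw: "row b' = row b" using b'(3) pr by (simp add: tz_def split: if_splits)
    have bs: "B.base b' = B.base b" using base[OF b] base[OF b'(1)] pr by simp
    have "B.hgt b' = ?h" using b'(3,4) bs B.letter_bounds[OF b] B.letter_bounds[OF b'(1)] by (simp add: B.t1_def)
    then show ?thesis using lv pr rw by blast
  qed
  have "inj_on cln ?F" 
  proof (rule inj_onI)
    fix x y assume x: "x \<in> ?F" and y: "y \<in> ?F" and e: "cln x = cln y"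
    then have xy: "x < length rho" "y < length rho" by blast+
    show "x = y" by (rule cell_inj[OF xy]) (simp_all only: F[OF x] F[OF y] e)
  qed
  then have "card ?F = card (cln ` ?F)" by (rule card_image[symmetric])
  also have "\<dots> \<le> card {entry ?s (Suc ?h)..<entry ?s ?h}"
  proof (rule card_mono)
    show "cln ` ?F \<subseteq> {entry ?s (Suc ?h)..<entry ?s ?h}"
    proof
      fix k assume "k \<in> cln ` ?F"
      then obtain b' where b': "b' \<in> ?F" "k = cln b'" by blast
      then have "b' < length rho" by simp
      then show "k \<in> {entry ?s (Suc ?h)..<entry ?s ?h}" using height[of b'] F[OF b'(1)] b'(2) by simp
    qed
  qed simp
  also have "\<dots> = entry ?s ?h - entry ?s (?h + 1)" by simp
  also have "\<dots> < p"
  proof -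
    have "p_restricted p ?s \<or> ?s = []" using restr cell_mem(1)[OF b] by (auto simp: shape_def)
    then show ?thesis
    proof
      assume "p_restricted p ?s" then show ?thesis using height[OF b] unfolding p_restricted_def by blast
    next
      assume "?s = []" then show ?thesis using p_gt1 by (simp add: entry_def)
    qed
  qed
  finally show ?thesis .
qed

text \<open>The facts about \<open>\<phi>\<close> on which the final argument rests, stated in terms
  of \<open>lam\<close>, \<open>mu\<close> and \<open>rho\<close> so that the blocks remain hidden.
  Restrictedness is a premise of the last clause, so that the others serve arbitrary expansions as
  well.\<close>

lemma vertex_character:
  obtains P \<phi> where "Defs.sylow p P (young rho)" "perm_subgroup P (Sym n)"
    "rep_character (Sym n) (mono_rep n (cont n lam (scale p mu)) :: 'a rep) \<phi>"
    "\<forall>M. Jmat n (cont n lam (scale p mu)) M \<longrightarrow> \<phi> M = 0"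
    "\<forall>R Y i0 p0. perm_subgroup R P \<longrightarrow> R \<subset> P \<longrightarrow> is_rep (Sym n) Y \<longrightarrow> rel_proj (Sym n) R Y \<longrightarrow>
      i0 \<in> rep_hom (Sym n) Y (mono_rep n (cont n lam (scale p mu))) \<longrightarrow>
      p0 \<in> rep_hom (Sym n) (mono_rep n (cont n lam (scale p mu))) Y \<longrightarrow> \<phi> (i0 * p0) = 0"
    "(\<forall>i\<le>r. p_restricted p (l i)) \<longrightarrow> (\<forall>i<r. p_restricted p (m i)) \<longrightarrow>
      (\<forall>Y i0 p0. indecomposable (Sym n) Y \<longrightarrow> i0 \<in> rep_hom (Sym n) Y (mono_rep n (cont n lam (scale p mu))) \<longrightarrow>
        p0 \<in> rep_hom (Sym n) (mono_rep n (cont n lam (scale p mu))) Y \<longrightarrow> p0 * i0 = 1\<^sub>m (fst Y) \<longrightarrow>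
        \<phi> (i0 * p0) \<noteq> 0 \<longrightarrow> rel_proj (Sym n) P Y)"
proof -
  have yS: "perm_subgroup (young rho) (Sym n)" using young_subgroup[of rho] by (simp only: sum_rho)
  obtain P where P: "Defs.sylow p P (young rho)" using sylow_exists[OF yS prime] by blast
  then obtain e where e: "card P = p ^ e" by (auto simp: Defs.sylow_def)
  note bs = block_system[OF P e]
  interpret B: block_system n p e "length rho" "TYPE('a)" P "blkof rho" "\<lambda>x. x - off rho (blkof rho x) - 1" "\<lambda>b i. off rho b + i + 1" "(!) rho" tz cl
    by (rule bs)
  note c0 = block_content[OF bs]
  have y: "young rho = {g\<in>Sym n. \<forall>x\<in>{1..n}. blkof rho (g x) = blkof rho x}" using young_blkof[of rho] by (simp only: sum_rho)
  show thesis
  proof (rule that[of P B.phi]; (intro impI allI)?)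
    show "Defs.sylow p P (young rho)" by (rule P)
    show "perm_subgroup P (Sym n)" by (rule B.Q)
    show "rep_character (Sym n) (mono_rep n (cont n lam (scale p mu))) B.phi" using B.phi_character by (simp only: c0)
    show "B.phi M = 0" if "Jmat n (cont n lam (scale p mu)) M" for M using B.phi_Jmat that by (simp only: c0)
    show "B.phi (i0 * p0) = 0" if "perm_subgroup R P" "R \<subset> P" "is_rep (Sym n) Y" "rel_proj (Sym n) R Y"
      "i0 \<in> rep_hom (Sym n) Y (mono_rep n (cont n lam (scale p mu)))" "p0 \<in> rep_hom (Sym n) (mono_rep n (cont n lam (scale p mu))) Y" for R Y i0 p0
      by (rule B.lower_bound[OF that(1-4)]) (use that(5,6) in \<open>simp_all only: c0\<close>)
    show "rel_proj (Sym n) P Y" if "\<forall>i\<le>r. p_restricted p (l i)" "\<forall>i<r. p_restricted p (m i)" "indecomposable (Sym n) Y"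
      "i0 \<in> rep_hom (Sym n) Y (mono_rep n (cont n lam (scale p mu)))" "p0 \<in> rep_hom (Sym n) (mono_rep n (cont n lam (scale p mu))) Y"
      "p0 * i0 = 1\<^sub>m (fst Y)" "B.phi (i0 * p0) \<noteq> 0" for Y i0 p0
    proof (rule B.upper_bound[OF _ _ that(3) _ _ that(6,7)])
      show "card {b'. b' < length rho \<and> rho ! b' = rho ! b \<and> tz b' = tz b \<and> B.t1 b' = B.t1 b} < p" if "b < length rho" for b
        by (rule block_fibres[OF bs _ _ that]) (use \<open>\<forall>i\<le>r. p_restricted p (l i)\<close> \<open>\<forall>i<r. p_restricted p (m i)\<close> in auto)
      show "Defs.sylow p P {g\<in>Sym n. \<forall>x\<in>{1..n}. blkof rho (g x) = blkof rho x}" using P by (simp only: y)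
    qed (use that(4,5) in \<open>simp_all only: c0\<close>)
  qed
qed

end

section \<open>Signed Young modules\<close>

text \<open>\<open>mult\<close> chooses by \<open>SOME\<close>, so the two predicates on counts are
  shown to be equal.\<close>

lemma mult_iso:
  assumes iso: "rep_iso G M M'" and M: "is_rep G M" and M': "is_rep G M'"
  shows "mult G M N = mult G M' N"
proof -
  have iff: "rep_iso G M (dsum_list Ns) \<longleftrightarrow> rep_iso G M' (dsum_list Ns)" if "\<forall>X\<in>set Ns. indecomposable G X" for Ns
  proof -
    have D: "is_rep G (dsum_list Ns)" by (rule is_rep_dsum_list) (use that indecomposable_rep(1) in blast)
    show ?thesis using rep_iso_trans[OF iso _ M M' D] rep_iso_trans[OF rep_iso_sym[OF iso M M'] _ M' M D] by blast
  qed
  have "(\<exists>Ns. (\<forall>X\<in>set Ns. indecomposable G X) \<and> rep_iso G M (dsum_list Ns) \<and> k = length (filter (\<lambda>X. rep_iso G X N) Ns)) \<longleftrightarrow>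
    (\<exists>Ns. (\<forall>X\<in>set Ns. indecomposable G X) \<and> rep_iso G M' (dsum_list Ns) \<and> k = length (filter (\<lambda>X. rep_iso G X N) Ns))" for k
    by (rule ex_cong1, rule conj_cong[OF refl]) (simp only: iff)
  then show ?thesis unfolding mult_def by (simp only:)
qed

text \<open>A unit that is a sum of composites has a unit among them, since the endomorphism ring of
  \<open>X\<close> is local; that composite exhibits \<open>X\<close> as a retract of the module it
  passes through.\<close>

lemma Jmat_factor:
  assumes X: "indecomposable (Sym n) X" and i: "i \<in> rep_hom (Sym n) X (mono_rep n c)" and q: "q \<in> rep_hom (Sym n) (mono_rep n c) X"
    and J: "Jmat n c M" and u: "rep_unit (Sym n) X (q * M * i)"
  shows "\<exists>c'. above n c c' \<and> wcont n c' \<noteq> {} \<and> retract (Sym n) X (mono_rep n c')"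
  using J u
proof (induct rule: Jmat.induct)
  case Jmat_zero
  note rX = indecomposable_rep(1)[OF X]
  have d: "dim_col q = card (wcont n c)" "dim_row i = card (wcont n c)" "dim_row q = fst X" "dim_col i = fst X" using rep_homD[OF i] rep_homD[OF q] by auto
  have z: "q * 0\<^sub>m (card (wcont n c)) (card (wcont n c)) * i = 0\<^sub>m (fst X) (fst X)"
    by (simp add: zero_mult_dim d)
  obtain h where h: "h \<in> rep_hom (Sym n) X X" "h * (0\<^sub>m (fst X) (fst X)) = 1\<^sub>m (fst X)" using rep_unitE[OF Jmat_zero[unfolded z]] by metis
  have "h * 0\<^sub>m (fst X) (fst X) = 0\<^sub>m (fst X) (fst X)" using rep_homD(1,2)[OF h(1)] by (simp add: zero_mult_dim)
  then show ?case using h(2) zero_neq_one_mat[OF indecomposable_rep(2)[OF X], where 'a='a] by simp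
next
  case (Jmat_step c' A B M)
  note rX = indecomposable_rep(1)[OF X] and rm = is_rep_mono
  note d = rep_homD(1,2)[OF i] rep_homD(1,2)[OF q] rep_homD(1,2)[OF Jmat_step(3)] rep_homD(1,2)[OF Jmat_step(4)] Jmat_dim[OF Jmat_step(5)]
  have e: "q * (B * A + M) * i = (q * B) * (A * i) + q * M * i"
  proof -
    have "q * (B * A + M) * i = (q * (B * A) + q * M) * i" by (subst mult_add_dim) (simp_all add: d)
    also have "\<dots> = q * (B * A) * i + q * M * i" by (rule add_mult_dim) (simp_all add: d)
    also have "q * (B * A) * i = (q * B) * (A * i)" by (simp add: mult_assoc_dim d)
    finally show ?thesis .
  qed
  have a: "A * i \<in> rep_hom (Sym n) X (mono_rep n c')" by (rule rep_hom_mult[OF rX rm rm i Jmat_step(3)])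
  have b: "q * B \<in> rep_hom (Sym n) (mono_rep n c') X" by (rule rep_hom_mult[OF rm rm rX Jmat_step(4) q])
  have m: "q * M * i \<in> rep_hom (Sym n) X X" by (rule rep_hom_mult[OF rX rm rX i rep_hom_mult[OF rm rm rX Jmat_hom[OF Jmat_step(5)] q]])
  have "rep_unit (Sym n) X ((q * B) * (A * i)) \<or> rep_unit (Sym n) X (q * M * i)"
    by (rule rep_unit_add[OF X rep_hom_mult[OF rX rm rX a b] m]) (use Jmat_step(7) e in simp)
  then show ?case
  proof
    assume "rep_unit (Sym n) X ((q * B) * (A * i))"
    then show ?thesis using retract_unit[OF rX rm a b] Jmat_step(1,2) by blast
  qed (rule Jmat_step(6))
qed

text \<open>Equivalently, \<open>\<phi> (i q) \<noteq> 0\<close> for every character \<open>\<phi>\<close> that vanishes on \<open>J\<close>.\<close>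
definition top_summand :: "nat \<Rightarrow> (nat \<Rightarrow> nat) \<Rightarrow> 'a::field rep \<Rightarrow> bool" where
  "top_summand n c Y \<longleftrightarrow> indecomposable (Sym n) Y \<and> (\<exists>i\<in>rep_hom (Sym n) Y (mono_rep n c). \<exists>q\<in>rep_hom (Sym n) (mono_rep n c) Y.
     q * i = 1\<^sub>m (fst Y) \<and> \<not> Jmat n c (i * q))"

text \<open>Modulo \<open>J\<close> the endomorphism is a scalar, which is nonzero outside
  \<open>J\<close>; a nonzero scalar matrix is invertible, so a unital multiplicative
  \<open>\<phi>\<close> cannot vanish on it.\<close>

lemma character_not_Jmat:
  fixes A :: "'a::field mat"
  assumes two: "(2::'a) \<noteq> 0" and \<phi>: "rep_character (Sym n) (mono_rep n c) \<phi>" and J: "\<And>M. Jmat n c M \<Longrightarrow> \<phi> M = 0"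
    and A: "A \<in> rep_hom (Sym n) (mono_rep n c) (mono_rep n c)" and nJ: "\<not> Jmat n c A"
  shows "\<phi> A \<noteq> 0"
proof -
  let ?M = "mono_rep n c :: 'a rep" and ?d = "card (wcont n c)"
  have rM: "is_rep (Sym n) ?M" by (rule is_rep_mono)
  obtain a M where M: "Jmat n c M" "A = a \<cdot>\<^sub>m 1\<^sub>m ?d + M" using endomorphism_spanned[OF two A] by blast
  have a: "a \<noteq> 0"
  proof
    assume "a = 0"
    then have "A = M" using M(2) Jmat_dim[OF M(1)] by (intro eq_matI) auto
    then show False using nJ M(1) by simp
  qed
  have s: "k \<cdot>\<^sub>m 1\<^sub>m ?d \<in> rep_hom (Sym n) ?M ?M" for k using rep_hom_smult[OF rM rM rep_hom_one[OF rM]] by simp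
  have one: "\<phi> (1\<^sub>m ?d) = 1" using \<phi> by (simp add: rep_character_def)
  have "(a \<cdot>\<^sub>m 1\<^sub>m ?d) * (inverse a \<cdot>\<^sub>m 1\<^sub>m ?d) = (1\<^sub>m ?d :: 'a mat)"
    using a by (simp add: smult_mult_dim) (intro eq_matI, auto)
  then have "\<phi> (a \<cdot>\<^sub>m 1\<^sub>m ?d) * \<phi> (inverse a \<cdot>\<^sub>m 1\<^sub>m ?d) = 1" using \<phi> s one unfolding rep_character_def by metis
  then have "\<phi> (a \<cdot>\<^sub>m 1\<^sub>m ?d) \<noteq> 0" by auto
  moreover have "\<phi> A = \<phi> (a \<cdot>\<^sub>m 1\<^sub>m ?d) + \<phi> M" using \<phi> s Jmat_hom[OF M(1)] unfolding M(2) rep_character_def by blast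
  ultimately show ?thesis using J[OF M(1)] by simp
qed

lemma top_summand_exists:
  assumes \<phi>: "rep_character (Sym n) (mono_rep n c :: 'a::field rep) \<phi>" and J: "\<And>M. Jmat n c M \<Longrightarrow> \<phi> M = 0"
  shows "\<exists>Y :: 'a rep. top_summand n c Y"
proof -
  let ?M = "mono_rep n c :: 'a rep"
  obtain Ns where Ns: "\<forall>N\<in>set Ns. indecomposable (Sym n) N" "rep_iso (Sym n) ?M (dsum_list Ns)" using decomposition_exists[OF is_rep_mono] by blast
  obtain I P k0 where k0: "k0 < length Ns" and K: "\<forall>k<length Ns. I k \<in> rep_hom (Sym n) (Ns ! k) ?M \<and> P k \<in> rep_hom (Sym n) ?M (Ns ! k) \<and> P k * I k = 1\<^sub>m (fst (Ns ! k))
      \<and> \<phi> (I k * P k) = (if k = k0 then 1 else 0)"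
    by (rule character_component[OF is_rep_mono \<phi> Ns(2,1)])
  have "\<not> Jmat n c (I k0 * P k0)" using J[of "I k0 * P k0"] K k0 by auto
  then show ?thesis unfolding top_summand_def using K k0 Ns(1) nth_mem[OF k0] by blast
qed

text \<open>\<open>\<phi>\<close> is nonzero on both projections, so passing from \<open>X\<close>
  to \<open>Y\<close> and back inside the module is a unit of \<open>X\<close>. This allows a module
  chosen by \<open>SOME\<close> to be compared with any summand found later.\<close>

lemma top_summand_unique:
  fixes X Y :: "'a::field rep"
  assumes two: "(2::'a) \<noteq> 0" and \<phi>: "rep_character (Sym n) (mono_rep n c :: 'a rep) \<phi>" and J: "\<And>M. Jmat n c M \<Longrightarrow> \<phi> M = 0"
    and X: "top_summand n c X" and Y: "top_summand n c Y"
  shows "rep_iso (Sym n) X Y"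
proof -
  let ?M = "mono_rep n c :: 'a rep"
  obtain i q where i: "i \<in> rep_hom (Sym n) X ?M" "q \<in> rep_hom (Sym n) ?M X" "q * i = 1\<^sub>m (fst X)" "\<not> Jmat n c (i * q)" and iX: "indecomposable (Sym n) X" using X unfolding top_summand_def by blast
  obtain i' q' where i': "i' \<in> rep_hom (Sym n) Y ?M" "q' \<in> rep_hom (Sym n) ?M Y" "q' * i' = 1\<^sub>m (fst Y)" "\<not> Jmat n c (i' * q')" and iY: "indecomposable (Sym n) Y" using Y unfolding top_summand_def by blast
  note rX = indecomposable_rep(1)[OF iX] and rY = indecomposable_rep(1)[OF iY] and rM = is_rep_mono
  note d = rep_homD(1,2)[OF i(1)] rep_homD(1,2)[OF i(2)] rep_homD(1,2)[OF i'(1)] rep_homD(1,2)[OF i'(2)]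
  have e: "i * q \<in> rep_hom (Sym n) ?M ?M" "i' * q' \<in> rep_hom (Sym n) ?M ?M" by (rule rep_hom_mult[OF rM rX rM i(2,1)], rule rep_hom_mult[OF rM rY rM i'(2,1)])
  have ne: "\<phi> (i * q) \<noteq> 0" "\<phi> (i' * q') \<noteq> 0" using character_not_Jmat[OF two \<phi> J] e i(4) i'(4) by blast+
  have "rep_unit (Sym n) X (q * (i' * q') * i)" by (rule character_unit[OF rM \<phi> iX i(1,2) e(2) i(3) ne])
  moreover have "q * (i' * q') * i = (q * i') * (q' * i)" by (simp add: mult_assoc_dim d)
  ultimately have "rep_unit (Sym n) X ((q * i') * (q' * i))" by simp
  then have "retract (Sym n) X Y" by (rule retract_unit[OF rX rY rep_hom_mult[OF rX rM rY i(1) i'(2)] rep_hom_mult[OF rY rM rX i'(1) i(2)]])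
  then show ?thesis by (rule retract_indecomposable_iso[OF iX iY])
qed

lemma psum_total: assumes "wcont n c \<noteq> {}" shows "psum c (2 * n) = n"
proof -
  obtain T where T: "T \<in> wcont n c" using assms by blast
  have "{x\<in>{1..n}. T x < 2 * n} = {1..n}" using words_lt[OF wcont_words[OF T]] by blast
  then show ?thesis using psum_card[OF T, of "2 * n"] by simp
qed

lemma p_multiple_partition:
  assumes b: "is_partition \<beta>" and p: "0 < (p::nat)" and d: "\<forall>x\<in>set \<beta>. p dvd x"
  obtains mu where "is_partition mu" "\<beta> = scale p mu"
proof -
  let ?mu = "map (\<lambda>x. x div p) \<beta>"
  have "scale p ?mu = \<beta>" unfolding scale_def map_map by (rule map_idI) (use d in simp)
  then show ?thesis using that[of ?mu] b scale_partition_iff[OF p, of ?mu] by simp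
qed

text \<open>Uses the unrestricted expansions \<open>\<lambda>(0) = \<lambda>\<close> and \<open>\<mu>(0) = \<mu>\<close>.\<close>
lemma trivial_expansion:
  assumes p: "prime p" and "odd p" "CHAR('a::field) = p" "is_partition lam" "is_partition mu" "sum_list lam + p * sum_list mu = n"
  shows "\<exists>\<phi>. rep_character (Sym n) (mono_rep n (cont n lam (scale p mu)) :: 'a rep) \<phi> \<and> (\<forall>M. Jmat n (cont n lam (scale p mu)) M \<longrightarrow> \<phi> M = 0)"
proof -
  have p1: "1 < p" using p by (rule prime_gt_1_nat)
  interpret cell_data n p "TYPE('a)" lam mu "replicate (sum_list mu) p @ replicate (sum_list lam) 1" 1 "\<lambda>i. if i = 0 then lam else []" "\<lambda>i. mu"
  proof
    show "is_partition (if i = 0 then lam else [])" for i :: nat using assms by (simp add: is_partition_def is_composition_def)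
    show "entry lam j = (\<Sum>i<Suc 1. p ^ i * entry (if i = 0 then lam else []) j)" for j by (simp add: entry_def)
    show "set (replicate (sum_list mu) p @ replicate (sum_list lam) 1) \<subseteq> {p ^ i |i. i \<le> 1}"
      by (auto split: if_splits intro: exI[of _ 0] exI[of _ "1::nat"])
    have cr: "count_list (replicate k x) y = (if x = y then k else 0)" for k and x y :: nat by (induct k) auto
    show "count_list (replicate (sum_list mu) p @ replicate (sum_list lam) 1) (p ^ i) = sum_list (if i = 0 then lam else []) + (if i = 0 then 0 else sum_list mu)" if "i \<le> 1" for i
    proof (cases "i = 0")
      case False
      then have "i = 1" using that by simp
      then show ?thesis using p1 by (simp add: cr)
    qed (use p1 in \<open>simp add: cr\<close>)
  qed (use assms in \<open>simp_all\<close>)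
  show ?thesis by (rule vertex_character) blast
qed

text \<open>Induction upwards along dominance, measured by the distances of the partial sums from
  \<open>n\<close>. A summand whose projection lies in \<open>J\<close> is a retract of a module of
  larger content and is handled by the induction; any other is a top summand.\<close>

lemma summand_decomposition:
  fixes Y :: "nat list \<Rightarrow> nat list \<Rightarrow> 'a::field rep"
  assumes p: "prime p" "odd p" "CHAR('a) = p" and two: "(2::'a) \<noteq> 0"
    and Y: "\<And>lam mu. is_partition lam \<Longrightarrow> is_partition mu \<Longrightarrow> sum_list lam + p * sum_list mu = n \<Longrightarrow> top_summand n (cont n lam (scale p mu)) (Y lam mu)"
  shows "is_partition \<alpha> \<Longrightarrow> is_partition \<beta> \<Longrightarrow> sum_list \<alpha> + sum_list \<beta> = n \<Longrightarrow>
    \<exists>Ls. (\<forall>(lam, mu)\<in>set Ls. is_partition lam \<and> is_partition mu \<and> sum_list lam + p * sum_list mu = n \<and>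
        (\<forall>k\<le>2*n. psum (cont n \<alpha> \<beta>) k \<le> psum (cont n lam (scale p mu)) k)) \<and>
      rep_iso (Sym n) (mono_rep n (cont n \<alpha> \<beta>)) (dsum_list (map (\<lambda>(lam, mu). Y lam mu) Ls))"
proof (induct "\<Sum>k\<le>2*n. n - psum (cont n \<alpha> \<beta>) k" arbitrary: \<alpha> \<beta> rule: less_induct)
  case less
  let ?c = "cont n \<alpha> \<beta>"
  let ?M = "mono_rep n ?c :: 'a rep"
  let ?ok = "\<lambda>lam mu. is_partition lam \<and> is_partition mu \<and> sum_list lam + p * sum_list mu = n \<and>
        (\<forall>k\<le>2*n. psum (cont n \<alpha> \<beta>) k \<le> psum (cont n lam (scale p mu)) k)"
  have p0: "0 < p" using p(1) by (rule prime_gt_0_nat)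
  have indY: "indecomposable (Sym n) (Y lam mu)" if "?ok lam mu" for lam mu using Y that unfolding top_summand_def by blast
  have ne: "wcont n ?c \<noteq> {}" by (rule young_word[OF less(2-4)]) blast
  obtain Ns where Ns: "\<forall>N\<in>set Ns. indecomposable (Sym n) N" "rep_iso (Sym n) ?M (dsum_list Ns)" using decomposition_exists[OF is_rep_mono] by blast
  have rNs: "\<forall>N\<in>set Ns. is_rep (Sym n) N" using Ns(1) indecomposable_rep(1) by blast
  have claim: "\<exists>lm. ?ok (fst lm) (snd lm) \<and> rep_iso (Sym n) X (Y (fst lm) (snd lm))" if XN: "X \<in> set Ns" for X
  proof -
    have iX: "indecomposable (Sym n) X" using Ns(1) XN by blast
    note rX = indecomposable_rep(1)[OF iX] and rM = is_rep_mono
    obtain k where k: "k < length Ns" "X = Ns ! k" using XN by (metis in_set_conv_nth)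
    obtain i q where i: "i \<in> rep_hom (Sym n) X ?M" "q \<in> rep_hom (Sym n) ?M X" "q * i = 1\<^sub>m (fst X)"
      using dsum_list_maps[OF Ns(2) is_rep_mono rNs] k by blast
    have e: "i * q \<in> rep_hom (Sym n) ?M ?M" by (rule rep_hom_mult[OF rM rX rM i(2,1)])
    show ?thesis
    proof (cases "Jmat n ?c (i * q)")
      case True
      have "q * (i * q) * i = 1\<^sub>m (fst X)"
      proof -
        note d = rep_homD(1,2)[OF i(1)] rep_homD(1,2)[OF i(2)]
        have "q * (i * q) * i = (q * i) * (q * i)" by (simp add: mult_assoc_dim d)
        then show ?thesis unfolding i(3) by simp
      qed
      then have "rep_unit (Sym n) X (q * (i * q) * i)" using rep_hom_one[OF rX] unfolding rep_unit_def by (auto intro!: bexI[of _ "1\<^sub>m (fst X)"])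
      then obtain c' where c': "above n ?c c'" "wcont n c' \<noteq> {}" "retract (Sym n) X (mono_rep n c')" using Jmat_factor[OF iX i(1,2) True] by blast
      obtain \<alpha>' \<beta>' where ab: "is_partition \<alpha>'" "is_partition \<beta>'" "sum_list \<alpha>' + sum_list \<beta>' = n"
        "rep_iso (Sym n) (mono_rep n c' :: 'a rep) (mono_rep n (cont n \<alpha>' \<beta>'))" "\<forall>k\<le>2*n. psum c' k \<le> psum (cont n \<alpha>' \<beta>') k"
        by (rule content_to_partitions[OF psum_total[OF c'(2)], where 'a='a])
      let ?c' = "cont n \<alpha>' \<beta>'"
      have le: "\<forall>k\<le>2*n. psum ?c k \<le> psum ?c' k" using c'(1) ab(5) unfolding above_def by (meson le_trans)
      have bound: "psum ?c' k \<le> n" if "k \<le> 2 * n" for k using psum_mono[OF that, of ?c'] psum_cont_total(1)[OF ab(1-3)] by simp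
      obtain k1 where k1: "k1 \<le> 2 * n" "psum ?c k1 < psum c' k1" using c'(1) unfolding above_def by blast
      \<comment> \<open>The partial sums grow, one of them strictly; they are at most
        \<open>n\<close>, so truncated subtraction does not hide the strict growth.\<close>
      have lt: "(\<Sum>k\<le>2*n. n - psum ?c' k) < (\<Sum>k\<le>2*n. n - psum ?c k)"
      proof (rule sum_strict_mono_ex1)
        show "\<forall>k\<in>{..2*n}. n - psum ?c' k \<le> n - psum ?c k" using le by (simp add: diff_le_mono2)
        show "\<exists>k\<in>{..2*n}. n - psum ?c' k < n - psum ?c k"
          by (rule bexI[of _ k1]) (use k1 bound[OF k1(1)] ab(5) in \<open>auto intro!: diff_less_mono2 dest!: spec[of _ k1]\<close>)
      qed simp
      obtain Ls where Ls: "\<forall>(lam, mu)\<in>set Ls. is_partition lam \<and> is_partition mu \<and> sum_list lam + p * sum_list mu = n \<and>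
          (\<forall>k\<le>2*n. psum ?c' k \<le> psum (cont n lam (scale p mu)) k)"
        "rep_iso (Sym n) (mono_rep n ?c') (dsum_list (map (\<lambda>(lam, mu). Y lam mu) Ls))"
        using less(1)[OF lt ab(1-3)] by blast
      have ok: "?ok lam mu" if "(lam, mu) \<in> set Ls" for lam mu using Ls(1) that le by (fastforce intro: le_trans)
      have rY: "\<forall>N\<in>set (map (\<lambda>(lam, mu). Y lam mu) Ls). is_rep (Sym n) N"
      proof
        fix N assume "N \<in> set (map (\<lambda>(lam, mu). Y lam mu) Ls)"
        then obtain lam mu where lm: "(lam, mu) \<in> set Ls" "N = Y lam mu" by auto
        show "is_rep (Sym n) N" unfolding lm(2) by (rule indecomposable_rep(1)[OF indY[OF ok[OF lm(1)]]])
      qed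
      note rD = is_rep_dsum_list[OF rY]
      have "retract (Sym n) X (mono_rep n ?c')" by (rule retract_trans[OF c'(3) retract_iso[OF ab(4) rM rM] rX rM rM])
      then have "retract (Sym n) X (dsum_list (map (\<lambda>(lam, mu). Y lam mu) Ls))" by (rule retract_trans[OF _ retract_iso[OF Ls(2) rM rD] rX rM rD])
      then obtain N where "N \<in> set (map (\<lambda>(lam, mu). Y lam mu) Ls)" and rN: "retract (Sym n) X N" using retract_of_dsum_list[OF iX _ rY] by blast
      then obtain lam mu where lm: "(lam, mu) \<in> set Ls" "N = Y lam mu" by auto
      have "rep_iso (Sym n) X (Y lam mu)" using retract_indecomposable_iso[OF iX indY[OF ok[OF lm(1)]]] rN lm(2) by simp
      then show ?thesis using ok[OF lm(1)] by (intro exI[of _ "(lam, mu)"]) simp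
    next
      case nJ: False
      have "\<forall>x\<in>set \<beta>. p dvd x"
      proof (rule ccontr)
        assume "\<not> (\<forall>x\<in>set \<beta>. p dvd x)"
        then obtain j where j: "j < length \<beta>" "\<not> p dvd \<beta> ! j" by (metis in_set_conv_nth)
        have len: "length \<alpha> \<le> sum_list \<alpha>" "length \<beta> \<le> sum_list \<beta>" using partition_length less(2,3) by auto
        have "?c (n + j) = \<beta> ! j" using j(1) by (simp add: cont_def entry_Suc)
        then have "of_nat (?c (n + j)) \<noteq> (0::'a)" using j(2) p(3) by (simp add: of_nat_eq_0_iff_char_dvd)
        then have "Jmat n ?c (1\<^sub>m (card (wcont n ?c)) :: 'a mat)"
          by (intro identity_Jmat[OF ne, where a="length \<alpha>" and j="n + j"]) (use j(1) len less(4) in \<open>auto simp: cont_def entry_Suc\<close>)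
        moreover obtain a M where "Jmat n ?c M" "i * q = a \<cdot>\<^sub>m 1\<^sub>m (card (wcont n ?c)) + M" using endomorphism_spanned[OF two e] by blast
        ultimately show False using nJ Jmat_add[OF Jmat_smult] by metis
      qed
      then obtain mu where mu: "is_partition mu" "\<beta> = scale p mu" by (rule p_multiple_partition[OF less(3) p0])
      have tot: "sum_list \<alpha> + p * sum_list mu = n" using less(4) mu(2) by (simp add: sum_scale)
      obtain \<phi> where f: "rep_character (Sym n) ?M \<phi>" "\<forall>M. Jmat n ?c M \<longrightarrow> \<phi> M = 0"
        using trivial_expansion[OF p less(2) mu(1) tot] mu(2) by blast
      have "top_summand n ?c X" unfolding top_summand_def using iX i nJ by blast
      then have "rep_iso (Sym n) X (Y \<alpha> mu)" using top_summand_unique[OF two f(1), of X "Y \<alpha> mu"] f(2) Y[OF less(2) mu(1) tot] mu(2) by blast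
      then show ?thesis using less(2) mu tot by (intro exI[of _ "(\<alpha>, mu)"]) simp
    qed
  qed
  define sel where "sel X = (SOME lm. ?ok (fst lm) (snd lm) \<and> rep_iso (Sym n) X (Y (fst lm) (snd lm)))" for X
  have sel: "?ok (fst (sel X)) (snd (sel X)) \<and> rep_iso (Sym n) X (Y (fst (sel X)) (snd (sel X)))" if "X \<in> set Ns" for X
    unfolding sel_def by (rule someI_ex[OF claim[OF that]])
  let ?Ls = "map sel Ns"
  let ?Ys = "map (\<lambda>(lam, mu). Y lam mu) ?Ls"
  have ok: "?ok lam mu" if lm: "(lam, mu) \<in> set ?Ls" for lam mu
  proof -
    have "(lam, mu) \<in> sel ` set Ns" using lm by (simp only: set_map)
    then obtain X where X: "X \<in> set Ns" and e: "(lam, mu) = sel X" by (rule imageE)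
    show ?thesis using sel[OF X] unfolding e[symmetric] by simp
  qed
  have rY: "\<forall>N\<in>set ?Ys. is_rep (Sym n) N"
  proof
    fix N assume "N \<in> set ?Ys"
    then have "N \<in> (\<lambda>X. Y (fst (sel X)) (snd (sel X))) ` set Ns" by (simp add: case_prod_beta image_image)
    then obtain X where X: "X \<in> set Ns" "N = Y (fst (sel X)) (snd (sel X))" by blast
    show "is_rep (Sym n) N" unfolding X(2) by (rule indecomposable_rep(1)[OF indY[OF conjunct1[OF sel[OF X(1)]]]])
  qed
  have "list_all2 (rep_iso (Sym n)) Ns ?Ys" 
    unfolding list_all2_conv_all_nth using sel[OF nth_mem] by (simp add: case_prod_beta)
  then have "rep_iso (Sym n) (dsum_list Ns) (dsum_list ?Ys)" by (rule dsum_list_cong[OF _ rNs rY])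
  then have "rep_iso (Sym n) ?M (dsum_list ?Ys)" by (rule rep_iso_trans[OF Ns(2) _ is_rep_mono is_rep_dsum_list[OF rNs] is_rep_dsum_list[OF rY]])
  moreover have "\<forall>(lam, mu)\<in>set ?Ls. ?ok lam mu" using ok by blast
  ultimately show ?case by blast
qed

theorem theorem1p1:
  fixes p n :: nat
  assumes "prime p" and "odd p" and "CHAR('a::field) = p"
  shows "\<exists>Y :: nat list \<Rightarrow> nat list \<Rightarrow> 'a rep.
    (\<forall>lam mu. is_partition lam \<and> is_partition mu \<and> sum_list lam + p * sum_list mu = n \<longrightarrow>
        indecomposable (Sym n) (Y lam mu)
      \<and> mult (Sym n) (signed_perm_module n lam (scale p mu)) (Y lam mu) = 1
      \<and> (\<forall>r l m rho. padic_exp p lam (Suc r) l \<and> padic_exp p mu r m \<and> is_partition rho \<and>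
            set rho \<subseteq> {p ^ i | i. i \<le> r} \<and>
            (\<forall>i\<le>r. count_list rho (p ^ i) =
                       sum_list (l i) + (if i = 0 then 0 else sum_list (m (i - 1))))
          \<longrightarrow> (\<exists>P. sylow p P (young rho) \<and> vertex (Sym n) (Y lam mu) P)))
    \<and> (\<forall>\<alpha> \<beta>. is_partition \<alpha> \<and> is_partition \<beta> \<and> sum_list \<alpha> + sum_list \<beta> = n \<longrightarrow>
        (\<exists>Ls. (\<forall>(lam, mu) \<in> set Ls. is_partition lam \<and> is_partition mu \<and>
                  sum_list lam + p * sum_list mu = n \<and> dominates (lam, scale p mu) (\<alpha>, \<beta>)) \<and>
              rep_iso (Sym n) (signed_perm_module n \<alpha> \<beta>) (dsum_list (map (\<lambda>(lam, mu). Y lam mu) Ls))))"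
proof -
  have p0: "0 < p" using assms(1) by (rule prime_gt_0_nat)
  have two: "(2::'a) \<noteq> 0" by (rule two_neq_zero[OF assms])
  \<comment> \<open>\<open>Y lam mu\<close> is chosen by a property that involves no expansion, so
    the one module serves all expansions in (iii).\<close>
  define Y :: "nat list \<Rightarrow> nat list \<Rightarrow> 'a rep" where "Y lam mu = (SOME Y. top_summand n (cont n lam (scale p mu)) Y)" for lam mu
  have Y: "top_summand n (cont n lam (scale p mu)) (Y lam mu)" if A: "is_partition lam" "is_partition mu" "sum_list lam + p * sum_list mu = n" for lam mu
  proof -
    obtain \<phi> where "rep_character (Sym n) (mono_rep n (cont n lam (scale p mu)) :: 'a rep) \<phi>" "\<forall>M. Jmat n (cont n lam (scale p mu)) M \<longrightarrow> \<phi> M = 0"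
      using trivial_expansion[OF assms A] by blast
    then have "\<exists>Y :: 'a rep. top_summand n (cont n lam (scale p mu)) Y" using top_summand_exists by blast
    then show ?thesis unfolding Y_def by (rule someI_ex)
  qed
  show ?thesis
  proof (intro exI[of _ Y] conjI allI impI)
    fix lam mu assume lm: "is_partition lam \<and> is_partition mu \<and> sum_list lam + p * sum_list mu = n"
    let ?c = "cont n lam (scale p mu)"
    let ?M = "mono_rep n ?c :: 'a rep" and ?Y = "Y lam mu"
    have top: "top_summand n ?c ?Y" using Y lm by blast
    then show iY: "indecomposable (Sym n) ?Y" by (simp add: top_summand_def)
    obtain i q where i: "i \<in> rep_hom (Sym n) ?Y ?M" "q \<in> rep_hom (Sym n) ?M ?Y" "q * i = 1\<^sub>m (fst ?Y)" "\<not> Jmat n ?c (i * q)"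
      using top unfolding top_summand_def by blast
    note rY = indecomposable_rep(1)[OF iY]
    have e: "i * q \<in> rep_hom (Sym n) ?M ?M" by (rule rep_hom_mult[OF is_rep_mono rY is_rep_mono i(2,1)])
    have sp: "is_partition (scale p mu)" "sum_list lam + sum_list (scale p mu) = n" using lm p0 by (simp_all add: scale_partition_iff sum_scale)
    show "mult (Sym n) (signed_perm_module n lam (scale p mu)) ?Y = 1"
    proof -
      obtain \<phi> where f: "rep_character (Sym n) ?M \<phi>" "\<forall>M. Jmat n ?c M \<longrightarrow> \<phi> M = 0" using trivial_expansion[OF assms] lm by blast
      have "\<phi> (i * q) \<noteq> 0" using character_not_Jmat[OF two f(1) _ e i(4)] f(2) by blast
      then have "mult (Sym n) ?M ?Y = 1" by (rule character_mult_one[OF is_rep_mono f(1) iY i(1-3)])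
      then show ?thesis using mult_iso[OF signed_perm_module_iso(2,1) is_rep_mono] lm sp by metis
    qed
    fix r l m rho
    assume A: "padic_exp p lam (Suc r) l \<and> padic_exp p mu r m \<and> is_partition rho \<and>
            set rho \<subseteq> {p ^ i | i. i \<le> r} \<and>
            (\<forall>i\<le>r. count_list rho (p ^ i) = sum_list (l i) + (if i = 0 then 0 else sum_list (m (i - 1))))"
    have restr: "\<forall>i\<le>r. p_restricted p (l i)" "\<forall>i<r. p_restricted p (m i)" using A by (auto simp: padic_exp_def less_Suc_eq_le)
    \<comment> \<open>The expansion is now the restricted one and brings its own
      \<open>\<phi>\<close>; by \<open>character_not_Jmat\<close> it too is nonzero on the
      projection to \<open>Y lam mu\<close>.\<close>
    interpret cell_data n p "TYPE('a)" lam mu rho r l m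
    proof
      show "is_partition (l i)" if "i \<le> r" for i using restr(1) that by (simp add: p_restricted_def)
      show "is_partition (m i)" if "i < r" for i using restr(2) that by (simp add: p_restricted_def)
    qed (use assms lm A in \<open>auto simp: padic_exp_def\<close>)
    obtain P \<phi> where P: "Defs.sylow p P (young rho)" "perm_subgroup P (Sym n)" and f: "rep_character (Sym n) ?M \<phi>" "\<forall>M. Jmat n ?c M \<longrightarrow> \<phi> M = 0"
      and low: "\<forall>R Y i0 p0. perm_subgroup R P \<longrightarrow> R \<subset> P \<longrightarrow> is_rep (Sym n) Y \<longrightarrow> rel_proj (Sym n) R Y \<longrightarrow>
        i0 \<in> rep_hom (Sym n) Y ?M \<longrightarrow> p0 \<in> rep_hom (Sym n) ?M Y \<longrightarrow> \<phi> (i0 * p0) = 0"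
      and up: "(\<forall>i\<le>r. p_restricted p (l i)) \<longrightarrow> (\<forall>i<r. p_restricted p (m i)) \<longrightarrow>
       (\<forall>Y i0 p0. indecomposable (Sym n) Y \<longrightarrow> i0 \<in> rep_hom (Sym n) Y ?M \<longrightarrow>
          p0 \<in> rep_hom (Sym n) ?M Y \<longrightarrow> p0 * i0 = 1\<^sub>m (fst Y) \<longrightarrow> \<phi> (i0 * p0) \<noteq> 0 \<longrightarrow> rel_proj (Sym n) P Y)"
      by (rule vertex_character)
    have ne: "\<phi> (i * q) \<noteq> 0" using character_not_Jmat[OF two f(1) _ e i(4)] f(2) by blast
    have "rel_proj (Sym n) P ?Y" using up restr iY i(1-3) ne by blast
    moreover have "\<not> rel_proj (Sym n) R ?Y" if "perm_subgroup R P" "R \<subset> P" for R using low that rY i(1,2) ne by blast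
    ultimately have "vertex (Sym n) ?Y P" unfolding vertex_def using P(2) by blast
    then show "\<exists>P. Defs.sylow p P (young rho) \<and> vertex (Sym n) ?Y P" using P(1) by blast
  next
    fix \<alpha> \<beta> assume ab: "is_partition \<alpha> \<and> is_partition \<beta> \<and> sum_list \<alpha> + sum_list \<beta> = n"
    obtain Ls where Ls: "\<forall>(lam, mu)\<in>set Ls. is_partition lam \<and> is_partition mu \<and> sum_list lam + p * sum_list mu = n \<and>
        (\<forall>k\<le>2*n. psum (cont n \<alpha> \<beta>) k \<le> psum (cont n lam (scale p mu)) k)"
      "rep_iso (Sym n) (mono_rep n (cont n \<alpha> \<beta>)) (dsum_list (map (\<lambda>(lam, mu). Y lam mu) Ls))"
      using summand_decomposition[OF assms two Y] ab by blast
    have rY: "\<forall>N\<in>set (map (\<lambda>(lam, mu). Y lam mu) Ls). is_rep (Sym n) N"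
    proof
      fix N assume "N \<in> set (map (\<lambda>(lam, mu). Y lam mu) Ls)"
      then obtain lam mu where lm: "(lam, mu) \<in> set Ls" "N = Y lam mu" by auto
      have "is_partition lam" "is_partition mu" "sum_list lam + p * sum_list mu = n" using Ls(1) lm(1) by auto
      then have "top_summand n (cont n lam (scale p mu)) N" unfolding lm(2) by (rule Y)
      then show "is_rep (Sym n) N" by (simp add: top_summand_def indecomposable_def)
    qed
    have "rep_iso (Sym n) (signed_perm_module n \<alpha> \<beta>) (dsum_list (map (\<lambda>(lam, mu). Y lam mu) Ls))"
      by (rule rep_iso_trans[OF signed_perm_module_iso(2) Ls(2) signed_perm_module_iso(1) is_rep_mono is_rep_dsum_list[OF rY]]) (use ab in blast)+
    moreover have "dominates (lam, scale p mu) (\<alpha>, \<beta>)" if "(lam, mu) \<in> set Ls" for lam mu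
    proof (rule dominates_psum[of _ n])
      have A: "is_partition lam" "is_partition mu" "sum_list lam + p * sum_list mu = n" "\<forall>k\<le>2*n. psum (cont n \<alpha> \<beta>) k \<le> psum (cont n lam (scale p mu)) k"
        using Ls(1) that by auto
      then show "is_partition lam" "is_partition (scale p mu)" "sum_list lam \<le> n" "sum_list (scale p mu) \<le> n" "\<forall>k\<le>2*n. psum (cont n \<alpha> \<beta>) k \<le> psum (cont n lam (scale p mu)) k"
        using p0 by (simp_all add: scale_partition_iff sum_scale)
    qed (use ab in auto)
    ultimately show "\<exists>Ls. (\<forall>(lam, mu) \<in> set Ls. is_partition lam \<and> is_partition mu \<and>
                  sum_list lam + p * sum_list mu = n \<and> dominates (lam, scale p mu) (\<alpha>, \<beta>)) \<and>
              rep_iso (Sym n) (signed_perm_module n \<alpha> \<beta>) (dsum_list (map (\<lambda>(lam, mu). Y lam mu) Ls))"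
      using Ls(1) by (intro exI[of _ Ls]) auto
  qed
qed

end
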